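(* Let $R$ be a commutative ring with unit and let $(A,d,\mu)$ be a dg algebra over $R$ all of whose homology modules $H_i(A)$ are free $R$-modules. Let $\mu^*$ denote the induced multiplication on $H(A)$. (a) There exist a minimal $A_\infty$-algebra structure $(H(A),\{m_i\})$ on $H(A)$ with $m_1=0$ and $m_2=\mu^*$, and a weak equivalence of $A_\infty$-algebras $\{f_i\}:(H(A),\{m_i\})\to (A,\{d,\mu,0,0,\dots\})$ such that $f_1^*=\mathrm{id}_{H(A)}$, where $f_1^*:H(A)\to H(A)$ is the map induced in homology by the chain map $f_1:(H(A),0)\to(A,d)$. (b) Let $g:A\to A'$ be a map of dg algebras, where all $H_i(A')$ are also free, and let $(H(A),\{m_i\}),\{f_i\}$ and $(H(A'),\{m_i'\}),\{f_i'\}$ be as in (a) for $A$ and $A'$ respectively. Then there exists a morphism of $A_\infty$-algebras $\{g_i\}:(H(A),\{m_i\})\to(H(A'),\{m'_i\})$ with $g_1=g^*$ (the map induced by $g$ in homology) such that the two $A_\infty$-morphisms $g\circ\{f_i\}$ and $\{f'_i\}\circ\{g_i\}$ from $(H(A),\{m_i\})$ to $A'$ are homotopic as morphisms of $A_\infty$-algebras. (c) The structure is unique up to isomorphism: if $(H(A),\{m_i\})$ and $(H(A),\{m'_i\})$ are two minimal $A_\infty$-algebra structures on $H(A)$ which satisfy the conditions of (a), then there exists an isomorphism of $A_\infty$-algebras $\{g_i\}:(H(A),\{m_i\})\to(H(A),\{m'_i\})$ with $g_1=\mathrm{id}$.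
   Context: Tensor products are over $R$. Koszul sign rule: $(f\otimes g)(a\otimes b)=(-1)^{|g||a|}f(a)\otimes g(b)$. Graded modules are $\mathbb Z$-graded; homological and cohomological gradings are identified by $M^k=M_{-k}$. A dg algebra $(A,d,\mu)$ is a graded module with an associative degree $0$ multiplication and a differential ($d^2=0$, of homological degree $-1$, i.e. cohomological degree $+1$) satisfying $d(ab)=(da)b+(-1)^{|a|}a\,db$; no unit is required. Bar conventions. For a graded module $M$ let $(s^{-1}M)^k=M^{k+1}$, with $s^{-1}:M\to s^{-1}M$ the tautological map of degree $-1$, and let $T^c(s^{-1}M)=\bigoplus_{n\ge0}(s^{-1}M)^{\otimes n}$ with the deconcatenation coproduct. An $A_\infty$-algebra $(M,\{m_i\}_{i\ge1})$ is a graded module with maps $m_i:M^{\otimes i}\to M$ of cohomological degree $2-i$ such that, if $\beta_i:(s^{-1}M)^{\otimes i}\to s^{-1}M$ (degree $1$) is defined by $\beta_i\circ(s^{-1})^{\otimes i}=s^{-1}\circ m_i$, the coderivation $d_\beta=\sum \mathrm{id}^{\otimes r}\otimes\beta_j\otimes\mathrm{id}^{\otimes t}$ of $T^c(s^{-1}M)$ (with $d_\beta(1)=0$) satisfies $d_\beta^2=0$. The dg coalgebra $B(M,\{m_i\})=(T^c(s^{-1}M),d_\beta)$ is its bar construction. A dg algebra is the $A_\infty$-algebra with $m_1=d$, $m_2=\mu$, $m_{\ge3}=0$. The algebra is minimal if $m_1=0$. A morphism $\{f_i\}:(M,\{m_i\})\to(M',\{m_i'\})$ is a sequence $f_i:M^{\otimes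 i}\to M'$ of degree $1-i$ such that, with $\varphi_i\circ(s^{-1})^{\otimes i}=s^{-1}\circ f_i$, the coalgebra map $F=B(\{f_i\})=\sum_t\sum_{k_1,\dots,k_t\ge 1}\varphi_{k_1}\otimes\cdots\otimes\varphi_{k_t}$ (with $F(1)=1$) satisfies $d_{\beta'}F=Fd_\beta$. Composition is composition of the maps $F$; a dg algebra map $g$ is the morphism $\{g,0,0,\dots\}$; an isomorphism is an invertible morphism. Its first component is a chain map $f_1:(M,m_1)\to(M',m_1')$. The morphism is called a weak equivalence if $f_1$ induces an isomorphism $H(M,m_1)\to H(M',m'_1)$. Two morphisms $\{f_i\},\{g_i\}$ with associated maps $\varphi_i,\gamma_i$ and $F,G$ are homotopic if there are maps $h_i:M^{\otimes i}\to M'$ of degree $-i$ such that, with $\eta_i\circ(s^{-1})^{\otimes i}=s^{-1}\circ h_i$, the map $D=\sum\varphi_{k_1}\otimes\cdots\otimes\varphi_{k_{r}}\otimes\eta_{k_{r+1}}\otimes\gamma_{k_{r+2}}\otimes\cdots\otimes\gamma_{k_t}$ (sum over all $t\ge1$, $0\le r<t$, $k_j\ge1$, with $D(1)=0$) satisfies $F-G=d_{\beta'}D+Dd_\beta$. *)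

theory Defs
  imports "HOL-Algebra.Module" "HOL-Algebra.AbelCoset" "HOL-Library.Poly_Mapping"
begin

section \<open>Modules and graded modules\<close>

definition linear_map :: "('r, 'x) ring_scheme \<Rightarrow> ('r, 'a) module \<Rightarrow> ('r, 'b) module \<Rightarrow> ('a \<Rightarrow> 'b) \<Rightarrow> bool" where
  "linear_map R M N f \<longleftrightarrow>
     f \<in> carrier M \<rightarrow> carrier N \<and>
     (\<forall>x\<in>carrier M. \<forall>y\<in>carrier M. f (x \<oplus>\<^bsub>M\<^esub> y) = f x \<oplus>\<^bsub>N\<^esub> f y) \<and>
     (\<forall>r\<in>carrier R. \<forall>x\<in>carrier M. f (r \<odot>\<^bsub>M\<^esub> x) = r \<odot>\<^bsub>N\<^esub> f x)"

definition free_module :: "('r, 'x) ring_scheme \<Rightarrow> ('r, 'a) module \<Rightarrow> bool" where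
  "free_module R M \<longleftrightarrow> module R M \<and>
     (\<exists>B \<subseteq> carrier M.
        (\<forall>x\<in>carrier M. \<exists>F c. finite F \<and> F \<subseteq> B \<and> c \<in> F \<rightarrow> carrier R \<and>
            x = (\<Oplus>\<^bsub>M\<^esub>b\<in>F. c b \<odot>\<^bsub>M\<^esub> b)) \<and>
        (\<forall>F c. finite F \<and> F \<subseteq> B \<and> c \<in> F \<rightarrow> carrier R \<and>
            (\<Oplus>\<^bsub>M\<^esub>b\<in>F. c b \<odot>\<^bsub>M\<^esub> b) = \<zero>\<^bsub>M\<^esub> \<longrightarrow> (\<forall>b\<in>F. c b = \<zero>\<^bsub>R\<^esub>)))"

text \<open>A graded module is the family of its homogeneous components, indexed by cohomological
  degree; the component of homological degree \<open>i\<close> is \<open>M (- i)\<close>.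
  A homogeneous element is a pair of a degree and an element of that component.\<close>

definition graded_module :: "('r, 'x) ring_scheme \<Rightarrow> (int \<Rightarrow> ('r, 'a) module) \<Rightarrow> bool" where
  "graded_module R M \<longleftrightarrow> cring R \<and> (\<forall>k. module R (M k))"

type_synonym 'a word = "(int \<times> 'a) list"

definition words :: "(int \<Rightarrow> ('r, 'a) module) \<Rightarrow> 'a word set" where
  "words M = {w. \<forall>(k, x)\<in>set w. x \<in> carrier (M k)}"

definition wdeg :: "'a word \<Rightarrow> int" where
  "wdeg w = sum_list (map fst w)"

section \<open>Homology\<close>

definition cycles :: "(int \<Rightarrow> ('r, 'a) module) \<Rightarrow> (int \<Rightarrow> 'a \<Rightarrow> 'a) \<Rightarrow> int \<Rightarrow> 'a set" where
  "cycles M d k = {x \<in> carrier (M k). d k x = \<zero>\<^bsub>M (k + 1)\<^esub>}"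

definition boundaries :: "(int \<Rightarrow> ('r, 'a) module) \<Rightarrow> (int \<Rightarrow> 'a \<Rightarrow> 'a) \<Rightarrow> int \<Rightarrow> 'a set" where
  "boundaries M d k = d (k - 1) ` carrier (M (k - 1))"

definition hclass :: "(int \<Rightarrow> ('r, 'a) module) \<Rightarrow> (int \<Rightarrow> 'a \<Rightarrow> 'a) \<Rightarrow> int \<Rightarrow> 'a \<Rightarrow> 'a set" where
  "hclass M d k x = boundaries M d k +>\<^bsub>M k\<^esub> x"

text \<open>The quotient module of cycles by boundaries. The ring multiplication and unit are
  unused fields of the record type of modules.\<close>

definition homology :: "(int \<Rightarrow> ('r, 'a) module) \<Rightarrow> (int \<Rightarrow> 'a \<Rightarrow> 'a) \<Rightarrow> int \<Rightarrow> ('r, 'a set) module" where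
  "homology M d k =
     \<lparr>carrier = hclass M d k ` cycles M d k,
      monoid.mult = undefined, one = undefined,
      zero = boundaries M d k, add = set_add (M k),
      smult = (\<lambda>r X. boundaries M d k <+>\<^bsub>M k\<^esub> (\<lambda>x. r \<odot>\<^bsub>M k\<^esub> x) ` X)\<rparr>"

text \<open>For a chain map \<open>f\<close> the following sends the class of \<open>x\<close> to the class of \<open>f x\<close>.\<close>

definition induced_map ::
  "(int \<Rightarrow> ('r, 'b) module) \<Rightarrow> (int \<Rightarrow> 'b \<Rightarrow> 'b) \<Rightarrow> (int \<Rightarrow> 'a \<Rightarrow> 'b) \<Rightarrow> int \<Rightarrow> 'a set \<Rightarrow> 'b set" where
  "induced_map N dN f k X = boundaries N dN k <+>\<^bsub>N k\<^esub> f k ` X"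

section \<open>Differential graded algebras\<close>

record ('r, 'a) dga =
  dg_mod :: "int \<Rightarrow> ('r, 'a) module"
  dg_diff :: "int \<Rightarrow> 'a \<Rightarrow> 'a"
  dg_mult :: "int \<Rightarrow> int \<Rightarrow> 'a \<Rightarrow> 'a \<Rightarrow> 'a"

definition sgn_mod :: "('r, 'a) module \<Rightarrow> int \<Rightarrow> 'a \<Rightarrow> 'a" where
  "sgn_mod M e x = (if even e then x else \<ominus>\<^bsub>M\<^esub> x)"

definition dg_algebra :: "('r, 'x) ring_scheme \<Rightarrow> ('r, 'a) dga \<Rightarrow> bool" where
  "dg_algebra R A \<longleftrightarrow>
     (let M = dg_mod A; d = dg_diff A; \<mu> = dg_mult A in
       graded_module R M \<and>
       (\<forall>k. linear_map R (M k) (M (k + 1)) (d k)) \<and>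
       (\<forall>k. \<forall>x\<in>carrier (M k). d (k + 1) (d k x) = \<zero>\<^bsub>M (k + 2)\<^esub>) \<and>
       (\<forall>k l. \<forall>x\<in>carrier (M k). linear_map R (M l) (M (k + l)) (\<lambda>y. \<mu> k l x y)) \<and>
       (\<forall>k l. \<forall>y\<in>carrier (M l). linear_map R (M k) (M (k + l)) (\<lambda>x. \<mu> k l x y)) \<and>
       (\<forall>j k l. \<forall>x\<in>carrier (M j). \<forall>y\<in>carrier (M k). \<forall>z\<in>carrier (M l).
          \<mu> (j + k) l (\<mu> j k x y) z = \<mu> j (k + l) x (\<mu> k l y z)) \<and>
       (\<forall>k l. \<forall>x\<in>carrier (M k). \<forall>y\<in>carrier (M l).
          d (k + l) (\<mu> k l x y) =
            \<mu> (k + 1) l (d k x) y \<oplus>\<^bsub>M (k + l + 1)\<^esub>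
            sgn_mod (M (k + l + 1)) k (\<mu> k (l + 1) x (d l y))))"

definition dga_map :: "('r, 'x) ring_scheme \<Rightarrow> ('r, 'a) dga \<Rightarrow> ('r, 'b) dga \<Rightarrow> (int \<Rightarrow> 'a \<Rightarrow> 'b) \<Rightarrow> bool" where
  "dga_map R A A' g \<longleftrightarrow>
     (\<forall>k. linear_map R (dg_mod A k) (dg_mod A' k) (g k)) \<and>
     (\<forall>k. \<forall>x\<in>carrier (dg_mod A k). g (k + 1) (dg_diff A k x) = dg_diff A' k (g k x)) \<and>
     (\<forall>k l. \<forall>x\<in>carrier (dg_mod A k). \<forall>y\<in>carrier (dg_mod A l).
        g (k + l) (dg_mult A k l x y) = dg_mult A' k l (g k x) (g l y))"

abbreviation dga_homology :: "('r, 'a) dga \<Rightarrow> int \<Rightarrow> ('r, 'a set) module" where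
  "dga_homology A \<equiv> homology (dg_mod A) (dg_diff A)"

definition homology_mult :: "('r, 'a) dga \<Rightarrow> int \<Rightarrow> int \<Rightarrow> 'a set \<Rightarrow> 'a set \<Rightarrow> 'a set" where
  "homology_mult A k l X Y =
     boundaries (dg_mod A) (dg_diff A) (k + l) <+>\<^bsub>dg_mod A (k + l)\<^esub>
       {dg_mult A k l x y | x y. x \<in> X \<and> y \<in> Y}"

section \<open>Tensor powers\<close>

text \<open>A sequence of linear maps \<open>f\<^sub>i\<close> from the \<open>i\<close>-th tensor power of \<open>M\<close> to \<open>N\<close>, of degree \<open>c - i\<close>
  for all \<open>i \<ge> 1\<close>, is given by the corresponding multilinear maps on homogeneous elements. It is
  encoded as a single function on words, \<open>f\<^sub>i\<close> being its restriction to words of length \<open>i\<close>.\<close>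

definition graded_maps ::
  "('r, 'x) ring_scheme \<Rightarrow> (int \<Rightarrow> ('r, 'a) module) \<Rightarrow> (int \<Rightarrow> ('r, 'b) module) \<Rightarrow> int \<Rightarrow> ('a word \<Rightarrow> 'b) \<Rightarrow> bool" where
  "graded_maps R M N c f \<longleftrightarrow>
     (\<forall>w\<in>words M. w \<noteq> [] \<longrightarrow> f w \<in> carrier (N (wdeg w + c - int (length w)))) \<and>
     (\<forall>u\<in>words M. \<forall>v\<in>words M. \<forall>k. \<forall>x\<in>carrier (M k). \<forall>y\<in>carrier (M k).
        f (u @ [(k, x \<oplus>\<^bsub>M k\<^esub> y)] @ v) =
          f (u @ [(k, x)] @ v)
            \<oplus>\<^bsub>N (wdeg u + k + wdeg v + c - int (length u + 1 + length v))\<^esub>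
          f (u @ [(k, y)] @ v)) \<and>
     (\<forall>u\<in>words M. \<forall>v\<in>words M. \<forall>k. \<forall>r\<in>carrier R. \<forall>x\<in>carrier (M k).
        f (u @ [(k, r \<odot>\<^bsub>M k\<^esub> x)] @ v) =
          r \<odot>\<^bsub>N (wdeg u + k + wdeg v + c - int (length u + 1 + length v))\<^esub>
          f (u @ [(k, x)] @ v))"

text \<open>The direct sum over \<open>n \<ge> 0\<close> of the \<open>n\<close>-th tensor powers over \<open>R\<close> of \<open>P\<close> is the free abelian
  group on the symbols \<open>(r, [x\<^sub>1, \<dots>, x\<^sub>n])\<close>, which stand for \<open>r (x\<^sub>1 \<otimes> \<dots> \<otimes> x\<^sub>n)\<close>, modulo the
  subgroup \<open>tensor_rels\<close> generated by the relations of multilinearity and balancedness.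
  The symbols \<open>(r, [])\<close> span the summand \<open>R\<close> for \<open>n = 0\<close>.\<close>

type_synonym ('r, 'a) tensors = "('r \<times> 'a word) \<Rightarrow>\<^sub>0 int"

definition tensor_elems :: "('r, 'x) ring_scheme \<Rightarrow> (int \<Rightarrow> ('r, 'a) module) \<Rightarrow> ('r, 'a) tensors set" where
  "tensor_elems R P = {u. Poly_Mapping.keys u \<subseteq> carrier R \<times> words P}"

inductive_set tensor_rels :: "('r, 'x) ring_scheme \<Rightarrow> (int \<Rightarrow> ('r, 'a) module) \<Rightarrow> ('r, 'a) tensors set"
  for R :: "('r, 'x) ring_scheme" and P :: "int \<Rightarrow> ('r, 'a) module" where
  zero: "0 \<in> tensor_rels R P"
| diff: "\<lbrakk>u \<in> tensor_rels R P; v \<in> tensor_rels R P\<rbrakk> \<Longrightarrow> u - v \<in> tensor_rels R P"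
| coeff_add: "\<lbrakk>r \<in> carrier R; s \<in> carrier R; w \<in> words P\<rbrakk> \<Longrightarrow>
    frag_of (r \<oplus>\<^bsub>R\<^esub> s, w) - frag_of (r, w) - frag_of (s, w) \<in> tensor_rels R P"
| slot_add: "\<lbrakk>r \<in> carrier R; u \<in> words P; v \<in> words P; x \<in> carrier (P k); y \<in> carrier (P k)\<rbrakk> \<Longrightarrow>
    frag_of (r, u @ [(k, x \<oplus>\<^bsub>P k\<^esub> y)] @ v) - frag_of (r, u @ [(k, x)] @ v)
      - frag_of (r, u @ [(k, y)] @ v) \<in> tensor_rels R P"
| scalar: "\<lbrakk>r \<in> carrier R; s \<in> carrier R; u \<in> words P; v \<in> words P; x \<in> carrier (P k)\<rbrakk> \<Longrightarrow>
    frag_of (r, u @ [(k, s \<odot>\<^bsub>P k\<^esub> x)] @ v) - frag_of (r \<otimes>\<^bsub>R\<^esub> s, u @ [(k, x)] @ v)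
      \<in> tensor_rels R P"

definition tensor_eq ::
  "('r, 'x) ring_scheme \<Rightarrow> (int \<Rightarrow> ('r, 'a) module) \<Rightarrow> ('r, 'a) tensors \<Rightarrow> ('r, 'a) tensors \<Rightarrow> bool" where
  "tensor_eq R P u v \<longleftrightarrow> u - v \<in> tensor_rels R P"

section \<open>The bar construction\<close>

definition susp :: "(int \<Rightarrow> ('r, 'a) module) \<Rightarrow> int \<Rightarrow> ('r, 'a) module" where
  "susp M k = M (k + 1)"

definition desusp_word :: "'a word \<Rightarrow> 'a word" where
  "desusp_word w = map (\<lambda>(k, x). (k + 1, x)) w"

text \<open>By the Koszul rule, the \<open>n\<close>-th tensor power of \<open>s\<^sup>-\<^sup>1\<close> sends \<open>x\<^sub>1 \<otimes> \<dots> \<otimes> x\<^sub>n\<close> to the tensor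
  product of the \<open>s\<^sup>-\<^sup>1 x\<^sub>i\<close> times the power of \<open>-1\<close> whose exponent is the sum of the \<open>(n - i) |x\<^sub>i|\<close>.\<close>

fun susp_exp :: "'a word \<Rightarrow> int" where
  "susp_exp [] = 0"
| "susp_exp ((k, x) # w) = k * int (length w) + susp_exp w"

text \<open>If \<open>f\<close> has components of degree \<open>e + 1 - i\<close>, then \<open>bar_op N e f\<close> is the sequence of
  degree \<open>e\<close> maps \<open>b\<^sub>i\<close> from the tensor powers of \<open>s\<^sup>-\<^sup>1 M\<close> to \<open>s\<^sup>-\<^sup>1 N\<close> such that the composite
  of \<open>b\<^sub>i\<close> with the \<open>i\<close>-th tensor power of \<open>s\<^sup>-\<^sup>1\<close> is \<open>s\<^sup>-\<^sup>1 \<circ> f\<^sub>i\<close>.\<close>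

definition bar_op :: "(int \<Rightarrow> ('r, 'b) module) \<Rightarrow> int \<Rightarrow> ('a word \<Rightarrow> 'b) \<Rightarrow> 'a word \<Rightarrow> int \<times> 'b" where
  "bar_op N e f w =
     (wdeg w + e, sgn_mod (susp N (wdeg w + e)) (susp_exp (desusp_word w)) (f (desusp_word w)))"

definition koszul :: "int \<Rightarrow> int" where
  "koszul e = (if even e then 1 else - 1)"

definition splits :: "'a list \<Rightarrow> ('a list \<times> 'a list \<times> 'a list) set" where
  "splits w = {(u, v, t). u @ v @ t = w \<and> v \<noteq> []}"

definition blocks :: "'a list \<Rightarrow> 'a list list set" where
  "blocks w = {bs. concat bs = w \<and> [] \<notin> set bs}"

definition marked_blocks :: "'a list \<Rightarrow> ('a list list \<times> 'a list \<times> 'a list list) set" where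
  "marked_blocks w = {(ps, b, qs). ps @ [b] @ qs \<in> blocks w}"

lemma finite_splits: "finite (splits w)"
proof (rule finite_subset)
  have "finite {u. set u \<subseteq> set w \<and> length u \<le> length w}" (is "finite ?L")
    by (rule finite_lists_length_le) simp
  then show "finite (?L \<times> ?L \<times> ?L)" by blast
  show "splits w \<subseteq> ?L \<times> ?L \<times> ?L" by (auto simp: splits_def)
qed

lemma length_blocks: "bs \<in> blocks w \<Longrightarrow> length bs \<le> length w"
proof -
  have "[] \<notin> set bs \<Longrightarrow> length bs \<le> length (concat bs)"
    by (induction bs) (auto simp: Suc_le_eq add.commute intro: order.strict_trans1 dest: length_greater_0_conv[THEN iffD2])
  then show "bs \<in> blocks w \<Longrightarrow> length bs \<le> length w" by (auto simp: blocks_def)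
qed

lemma finite_blocks: "finite (blocks w)"
proof (rule finite_subset)
  have "finite {u. set u \<subseteq> set w \<and> length u \<le> length w}" (is "finite ?L")
    by (rule finite_lists_length_le) simp
  then show "finite {bs. set bs \<subseteq> ?L \<and> length bs \<le> length w}"
    by (rule finite_lists_length_le)
  have "length b \<le> length (concat bs)" if "b \<in> set bs" for b :: "'a list" and bs
    using that by (induction bs) auto
  then show "blocks w \<subseteq> {bs. set bs \<subseteq> ?L \<and> length bs \<le> length w}"
    using length_blocks by (fastforce simp: blocks_def)
qed

lemma finite_marked_blocks: "finite (marked_blocks w)"
proof (rule finite_subset)
  show "finite ((\<lambda>(bs, n). (take n bs, bs ! n, drop (Suc n) bs)) ` (blocks w \<times> {..length w}))"
    by (intro finite_imageI finite_cartesian_product finite_blocks) auto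
  show "marked_blocks w \<subseteq> (\<lambda>(bs, n). (take n bs, bs ! n, drop (Suc n) bs)) ` (blocks w \<times> {..length w})"
  proof
    fix p assume "p \<in> marked_blocks w"
    then obtain ps b qs where p: "p = (ps, b, qs)" "ps @ [b] @ qs \<in> blocks w"
      by (auto simp: marked_blocks_def)
    then have "length ps \<le> length w" using length_blocks[OF p(2)] by simp
    then show "p \<in> (\<lambda>(bs, n). (take n bs, bs ! n, drop (Suc n) bs)) ` (blocks w \<times> {..length w})"
      using p by (intro image_eqI[where x = "(ps @ [b] @ qs, length ps)"]) (auto simp: nth_append)
  qed
qed

text \<open>The coderivation \<open>d\<^sub>\<beta>\<close>, the coalgebra map \<open>F\<close> and the map \<open>D\<close>. The signs are the Koszul
  signs of moving \<open>\<beta>\<close>, of degree \<open>1\<close>, or \<open>\<eta>\<close>, of degree \<open>-1\<close>, past the preceding letters.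
  The empty word has no splitting and no marked decomposition, and only the empty decomposition
  into blocks, so that these maps send \<open>1\<close> to \<open>0\<close>, \<open>1\<close> and \<open>0\<close>, respectively.\<close>

definition bar_diff :: "(int \<Rightarrow> ('r, 'a) module) \<Rightarrow> ('a word \<Rightarrow> 'a) \<Rightarrow> ('r, 'a) tensors \<Rightarrow> ('r, 'a) tensors" where
  "bar_diff M m = frag_extend (\<lambda>(r, w). \<Sum>(u, v, t)\<in>splits w.
      frag_cmul (koszul (wdeg u)) (frag_of (r, u @ [bar_op M 1 m v] @ t)))"

definition bar_map :: "(int \<Rightarrow> ('r, 'b) module) \<Rightarrow> ('a word \<Rightarrow> 'b) \<Rightarrow> ('r, 'a) tensors \<Rightarrow> ('r, 'b) tensors" where
  "bar_map N f = frag_extend (\<lambda>(r, w). \<Sum>bs\<in>blocks w. frag_of (r, map (bar_op N 0 f) bs))"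

definition bar_homotopy ::
  "(int \<Rightarrow> ('r, 'b) module) \<Rightarrow> ('a word \<Rightarrow> 'b) \<Rightarrow> ('a word \<Rightarrow> 'b) \<Rightarrow> ('a word \<Rightarrow> 'b) \<Rightarrow>
   ('r, 'a) tensors \<Rightarrow> ('r, 'b) tensors" where
  "bar_homotopy N f h g = frag_extend (\<lambda>(r, w). \<Sum>(ps, b, qs)\<in>marked_blocks w.
      frag_cmul (koszul (wdeg (concat ps)))
        (frag_of (r, map (bar_op N 0 f) ps @ [bar_op N (- 1) h b] @ map (bar_op N 0 g) qs)))"

section \<open>A-infinity algebras\<close>

definition ainf_algebra :: "('r, 'x) ring_scheme \<Rightarrow> (int \<Rightarrow> ('r, 'a) module) \<Rightarrow> ('a word \<Rightarrow> 'a) \<Rightarrow> bool" where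
  "ainf_algebra R M m \<longleftrightarrow> graded_module R M \<and> graded_maps R M M 2 m \<and>
     (\<forall>u\<in>tensor_elems R (susp M). tensor_eq R (susp M) (bar_diff M m (bar_diff M m u)) 0)"

definition minimal_ainf_algebra ::
  "('r, 'x) ring_scheme \<Rightarrow> (int \<Rightarrow> ('r, 'a) module) \<Rightarrow> ('a word \<Rightarrow> 'a) \<Rightarrow> bool" where
  "minimal_ainf_algebra R M m \<longleftrightarrow> ainf_algebra R M m \<and>
     (\<forall>k. \<forall>x\<in>carrier (M k). m [(k, x)] = \<zero>\<^bsub>M (k + 1)\<^esub>)"

definition ainf_morphism ::
  "('r, 'x) ring_scheme \<Rightarrow> (int \<Rightarrow> ('r, 'a) module) \<Rightarrow> ('a word \<Rightarrow> 'a) \<Rightarrow>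
   (int \<Rightarrow> ('r, 'b) module) \<Rightarrow> ('b word \<Rightarrow> 'b) \<Rightarrow> ('a word \<Rightarrow> 'b) \<Rightarrow> bool" where
  "ainf_morphism R M m N n f \<longleftrightarrow> ainf_algebra R M m \<and> ainf_algebra R N n \<and>
     graded_maps R M N 1 f \<and>
     (\<forall>u\<in>tensor_elems R (susp M).
        tensor_eq R (susp N) (bar_diff N n (bar_map N f u)) (bar_map N f (bar_diff M m u)))"

text \<open>\<open>c\<close> is the composite of \<open>f\<close> from \<open>M\<close> to \<open>N\<close> and \<open>g\<close> from \<open>N\<close> to \<open>P\<close>.\<close>

definition ainf_composite ::
  "('r, 'x) ring_scheme \<Rightarrow> (int \<Rightarrow> ('r, 'a) module) \<Rightarrow> ('a word \<Rightarrow> 'a) \<Rightarrow>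
   (int \<Rightarrow> ('r, 'b) module) \<Rightarrow> ('b word \<Rightarrow> 'b) \<Rightarrow> (int \<Rightarrow> ('r, 'c) module) \<Rightarrow> ('c word \<Rightarrow> 'c) \<Rightarrow>
   ('b word \<Rightarrow> 'c) \<Rightarrow> ('a word \<Rightarrow> 'b) \<Rightarrow> ('a word \<Rightarrow> 'c) \<Rightarrow> bool" where
  "ainf_composite R M m N n P p g f c \<longleftrightarrow>
     ainf_morphism R M m N n f \<and> ainf_morphism R N n P p g \<and> ainf_morphism R M m P p c \<and>
     (\<forall>u\<in>tensor_elems R (susp M). tensor_eq R (susp P) (bar_map P c u) (bar_map P g (bar_map N f u)))"

definition ainf_isomorphism ::
  "('r, 'x) ring_scheme \<Rightarrow> (int \<Rightarrow> ('r, 'a) module) \<Rightarrow> ('a word \<Rightarrow> 'a) \<Rightarrow>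
   (int \<Rightarrow> ('r, 'b) module) \<Rightarrow> ('b word \<Rightarrow> 'b) \<Rightarrow> ('a word \<Rightarrow> 'b) \<Rightarrow> bool" where
  "ainf_isomorphism R M m N n g \<longleftrightarrow> ainf_morphism R M m N n g \<and>
     (\<exists>h. ainf_morphism R N n M m h \<and>
        (\<forall>u\<in>tensor_elems R (susp M). tensor_eq R (susp M) (bar_map M h (bar_map N g u)) u) \<and>
        (\<forall>u\<in>tensor_elems R (susp N). tensor_eq R (susp N) (bar_map N g (bar_map M h u)) u))"

definition ainf_homotopic ::
  "('r, 'x) ring_scheme \<Rightarrow> (int \<Rightarrow> ('r, 'a) module) \<Rightarrow> ('a word \<Rightarrow> 'a) \<Rightarrow>
   (int \<Rightarrow> ('r, 'b) module) \<Rightarrow> ('b word \<Rightarrow> 'b) \<Rightarrow> ('a word \<Rightarrow> 'b) \<Rightarrow> ('a word \<Rightarrow> 'b) \<Rightarrow> bool" where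
  "ainf_homotopic R M m N n f g \<longleftrightarrow> ainf_morphism R M m N n f \<and> ainf_morphism R M m N n g \<and>
     (\<exists>h. graded_maps R M N 0 h \<and>
        (\<forall>u\<in>tensor_elems R (susp M).
           tensor_eq R (susp N) (bar_map N f u - bar_map N g u)
             (bar_diff N n (bar_homotopy N f h g u) + bar_homotopy N f h g (bar_diff M m u))))"

definition arity_one :: "('a word \<Rightarrow> 'b) \<Rightarrow> int \<Rightarrow> 'a \<Rightarrow> 'b" where
  "arity_one f k x = f [(k, x)]"

text \<open>The map induced by \<open>f\<^sub>1\<close> is always linear, so it is an isomorphism once it is bijective
  in each degree.\<close>

definition ainf_weak_equivalence ::
  "('r, 'x) ring_scheme \<Rightarrow> (int \<Rightarrow> ('r, 'a) module) \<Rightarrow> ('a word \<Rightarrow> 'a) \<Rightarrow>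
   (int \<Rightarrow> ('r, 'b) module) \<Rightarrow> ('b word \<Rightarrow> 'b) \<Rightarrow> ('a word \<Rightarrow> 'b) \<Rightarrow> bool" where
  "ainf_weak_equivalence R M m N n f \<longleftrightarrow> ainf_morphism R M m N n f \<and>
     (\<forall>k. bij_betw (induced_map N (arity_one n) (arity_one f) k)
            (carrier (homology M (arity_one m) k)) (carrier (homology N (arity_one n) k)))"

fun dga_ops :: "('r, 'a) dga \<Rightarrow> 'a word \<Rightarrow> 'a" where
  "dga_ops A [(k, x)] = dg_diff A k x"
| "dga_ops A [(k, x), (l, y)] = dg_mult A k l x y"
| "dga_ops A w = \<zero>\<^bsub>dg_mod A (wdeg w + 2 - int (length w))\<^esub>"

fun strict_morphism :: "('r, 'b) dga \<Rightarrow> (int \<Rightarrow> 'a \<Rightarrow> 'b) \<Rightarrow> 'a word \<Rightarrow> 'b" where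
  "strict_morphism A' g [(k, x)] = g k x"
| "strict_morphism A' g w = \<zero>\<^bsub>dg_mod A' (wdeg w + 1 - int (length w))\<^esub>"

text \<open>The last condition says that \<open>f\<^sub>1\<close> induces the identity in homology, where a class \<open>X\<close> is
  identified with its class in the homology of the complex \<open>(H(A), m\<^sub>1)\<close> with \<open>m\<^sub>1 = 0\<close>.\<close>

definition minimal_model ::
  "('r, 'x) ring_scheme \<Rightarrow> ('r, 'a) dga \<Rightarrow> ('a set word \<Rightarrow> 'a set) \<Rightarrow> ('a set word \<Rightarrow> 'a) \<Rightarrow> bool" where
  "minimal_model R A m f \<longleftrightarrow>
     minimal_ainf_algebra R (dga_homology A) m \<and>
     (\<forall>k l. \<forall>X\<in>carrier (dga_homology A k). \<forall>Y\<in>carrier (dga_homology A l).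
        m [(k, X), (l, Y)] = homology_mult A k l X Y) \<and>
     ainf_weak_equivalence R (dga_homology A) m (dg_mod A) (dga_ops A) f \<and>
     (\<forall>k. \<forall>X\<in>carrier (dga_homology A k).
        induced_map (dg_mod A) (dg_diff A) (arity_one f) k
          (hclass (dga_homology A) (arity_one m) k X) = X)"

end

theory Submission
  imports Defs "HOL-Algebra.Free_Abelian_Groups"
begin

text \<open>Obstruction theory over word length. Maps out of the tensor coalgebra are treated as elements of
  the convolution ring: with \<open>ident\<close> the sum of the identities of the tensor powers and \<open>star \<phi>\<close> the
  geometric series \<open>1 + \<phi> + \<phi>\<^sup>2 + \<dots>\<close>, the coalgebra map of \<open>\<phi>\<close> is \<open>star \<phi>\<close>, the coderivation of \<open>\<beta>\<close> is
  \<open>\<plusminus>ident * \<beta> * ident\<close> and a homotopy is \<open>\<plusminus>star \<phi> * \<eta> * star \<gamma>\<close>, so that each equation between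
  them is equivalent to the equation between the projections to words of length one.

  If such an equation holds on words shorter than \<open>n\<close>, its failure on words of length \<open>n\<close> is a cycle
  of the target complex. Since the homology is free, words of basis elements can be assigned
  arbitrary values, so the class of that cycle defines the next \<open>m\<^sub>n\<close> (or \<open>g\<^sub>n\<close>), and a
  primitive of the rest defines the next \<open>f\<^sub>n\<close> (or \<open>h\<^sub>n\<close>). Uniqueness is the lifting of
  the identity of \<open>A\<close>: a morphism that is the identity on letters is inverted by a geometric series in
  \<open>ident - star \<gamma>\<close>, which shortens words.\<close>

section \<open>The convolution ring of operators on words\<close>

text \<open>Tensors over \<open>A\<close> have no normal form, because only the homology is free. So
  equality of tensors is kept apart from equality of operators: identities between composites, with
  all Koszul signs, are proved exactly in a ring with integer coefficients, the scalars of
  \<open>R\<close> being carried along, and everything else is a statement modulo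
  \<open>tensor_rels\<close>. Only words of length one allow a return from tensors to elements; this
  is why the data are letter-valued operators. The equation d^2 = 0 of the model is not solved
  separately. If E is the failure of the morphism equation and X that of d^2 = 0, then d E + f X = 0
  in leading order. Here d E is a boundary and f X represents the class X, so both vanish. The same
  device, with the failure of the homotopy equation in the place of E, shows that the lifted maps
  form a morphism. Minimality enters through the filtration: a structure that vanishes on letters
  has a coderivation that shortens words, so composing with it raises the order of an error term,
  and few linear terms remain.\<close>

instantiation list :: (type) monoid_add
begin
definition zero_list :: "'a list" where "zero_list = []"
definition plus_list :: "'a list \<Rightarrow> 'a list \<Rightarrow> 'a list" where "plus_list = append"
instance by standard (simp_all add: zero_list_def plus_list_def)
end

text \<open>With concatenation as the addition of lists, the product of \<open>poly_mapping\<close>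
  is the free associative one: \<open>'y sums\<close> is the tensor ring on the letters over the
  integers, and the empty word is its unit.\<close>

type_synonym 'y sums = "'y list \<Rightarrow>\<^sub>0 int"

lemma frag_of_mult: "frag_of (u :: 'a list) * frag_of v = frag_of (u @ v)"
  by (simp add: mult_single plus_list_def)

lemma one_sums: "(1 :: 'y sums) = frag_of []"
  by (simp add: single_one[symmetric] zero_list_def del: single_one)

lemma frag_of_Nil_mult [simp]: "frag_of [] * (a :: 'y sums) = a" "a * frag_of [] = a"
  by (simp_all flip: one_sums)

definition cuts :: "'a list \<Rightarrow> ('a list \<times> 'a list) set" where
  "cuts w = {(u, v). u @ v = w}"

lemma cuts_iff [simp]: "(u, v) \<in> cuts w \<longleftrightarrow> u @ v = w"
  by (simp add: cuts_def)

lemma cuts_eq_image: "cuts w = (\<lambda>i. (take i w, drop i w)) ` {..length w}"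
proof -
  have "(u, v) \<in> (\<lambda>i. (take i w, drop i w)) ` {..length w}" if "u @ v = w" for u v
    using that by (intro image_eqI[where x = "length u"]) auto
  then show ?thesis by (auto simp: cuts_def)
qed

lemma finite_cuts [simp]: "finite (cuts w)"
  by (simp add: cuts_eq_image)

lemma cuts_Nil [simp]: "cuts [] = {([], [])}"
  by (auto simp: cuts_def)

lemma sum_cuts_first:
  assumes "\<And>u v. u @ v = w \<Longrightarrow> u \<noteq> [] \<Longrightarrow> f (u, v) = 0"
  shows "sum f (cuts w) = f ([], w)"
proof -
  have "sum f (cuts w) = sum f {([], w)}"
  proof (rule sum.mono_neutral_right)
    show "\<forall>p\<in>cuts w - {([], w)}. f p = 0" using assms by (metis DiffE append_Nil cuts_iff insertI1 surj_pair)
  qed auto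
  then show ?thesis by simp
qed

text \<open>Coassociativity of deconcatenation: both sides enumerate the ways to cut
  \<open>w\<close> into three pieces. It makes the convolution of operators associative.\<close>

lemma cuts_assoc:
  fixes h :: "'a list \<Rightarrow> 'a list \<Rightarrow> 'a list \<Rightarrow> 'b :: comm_monoid_add"
  shows "(\<Sum>(u, v)\<in>cuts w. \<Sum>(v1, v2)\<in>cuts v. h u v1 v2) =
    (\<Sum>(t, v2)\<in>cuts w. \<Sum>(u, v1)\<in>cuts t. h u v1 v2)"
proof -
  have "(\<Sum>(u, v)\<in>cuts w. \<Sum>(v1, v2)\<in>cuts v. h u v1 v2) =
      (\<Sum>(p, q)\<in>Sigma (cuts w) (\<lambda>p. cuts (snd p)). h (fst p) (fst q) (snd q))"
    unfolding case_prod_unfold by (subst sum.Sigma) (auto simp: case_prod_unfold)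
  also have "\<dots> = (\<Sum>(p, q)\<in>Sigma (cuts w) (\<lambda>p. cuts (fst p)). h (fst q) (snd q) (snd p))"
    by (rule sum.reindex_bij_witness[where i = "\<lambda>((t, v2), (u, v1)). ((u, v1 @ v2), (v1, v2))"
          and j = "\<lambda>((u, v), (v1, v2)). ((u @ v1, v2), (u, v1))"]) (auto simp: cuts_def)
  also have "\<dots> = (\<Sum>(t, v2)\<in>cuts w. \<Sum>(u, v1)\<in>cuts t. h u v1 v2)"
    unfolding case_prod_unfold by (subst sum.Sigma) (auto simp: case_prod_unfold)
  finally show ?thesis .
qed

text \<open>An operator stands for a map from words to integer combinations of words; its product is the
  convolution of the deconcatenation coproduct with concatenation.\<close>

typedef ('x, 'y) oper = "UNIV :: ('x list \<Rightarrow> 'y sums) set"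
  morphisms app Op ..

lemma app_Op [simp]: "app (Op f) w = f w"
  by (simp add: Op_inverse)

lemma oper_eqI: "(\<And>w. app a w = app b w) \<Longrightarrow> a = b"
  by (metis app_inverse ext)

instantiation oper :: (type, type) ring_1
begin
definition zero_oper :: "('a, 'b) oper" where "0 = Op (\<lambda>w. 0)"
definition one_oper :: "('a, 'b) oper" where "1 = Op (\<lambda>w. if w = [] then 1 else 0)"
definition plus_oper :: "('a, 'b) oper \<Rightarrow> ('a, 'b) oper \<Rightarrow> ('a, 'b) oper" where
  "a + b = Op (\<lambda>w. app a w + app b w)"
definition minus_oper :: "('a, 'b) oper \<Rightarrow> ('a, 'b) oper \<Rightarrow> ('a, 'b) oper" where
  "a - b = Op (\<lambda>w. app a w - app b w)"
definition uminus_oper :: "('a, 'b) oper \<Rightarrow> ('a, 'b) oper" where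
  "- a = Op (\<lambda>w. - app a w)"
definition times_oper :: "('a, 'b) oper \<Rightarrow> ('a, 'b) oper \<Rightarrow> ('a, 'b) oper" where
  "a * b = Op (\<lambda>w. \<Sum>(u, v)\<in>cuts w. app a u * app b v)"

instance
proof
  fix a b c :: "('a, 'b) oper"
  show "a + b + c = a + (b + c)" by (rule oper_eqI) (simp add: plus_oper_def add.assoc)
  show "a + b = b + a" by (rule oper_eqI) (simp add: plus_oper_def add.commute)
  show "0 + a = a" by (rule oper_eqI) (simp add: plus_oper_def zero_oper_def)
  show "- a + a = 0" by (rule oper_eqI) (simp add: plus_oper_def zero_oper_def uminus_oper_def)
  show "a - b = a + - b" by (rule oper_eqI) (simp add: plus_oper_def minus_oper_def uminus_oper_def)
  show "a * b * c = a * (b * c)"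
  proof (rule oper_eqI)
    fix w
    have "app (a * b * c) w = (\<Sum>(t, v2)\<in>cuts w. \<Sum>(u, v1)\<in>cuts t. app a u * app b v1 * app c v2)"
      by (simp add: times_oper_def sum_distrib_right case_prod_unfold)
    also have "\<dots> = (\<Sum>(u, v)\<in>cuts w. \<Sum>(v1, v2)\<in>cuts v. app a u * app b v1 * app c v2)"
      by (rule cuts_assoc[symmetric])
    also have "\<dots> = app (a * (b * c)) w"
      by (simp add: times_oper_def sum_distrib_left case_prod_unfold mult.assoc)
    finally show "app (a * b * c) w = app (a * (b * c)) w" .
  qed
  show "1 * a = a"
  proof (rule oper_eqI)
    fix w
    have "app (1 * a) w = (\<Sum>p\<in>{([], w)}. app 1 (fst p) * app a (snd p))"
      unfolding times_oper_def app_Op case_prod_unfold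
      by (rule sum.mono_neutral_right) (auto simp: one_oper_def)
    then show "app (1 * a) w = app a w" by (simp add: one_oper_def)
  qed
  show "a * 1 = a"
  proof (rule oper_eqI)
    fix w
    have "app (a * 1) w = (\<Sum>p\<in>{(w, [])}. app a (fst p) * app 1 (snd p))"
      unfolding times_oper_def app_Op case_prod_unfold
      by (rule sum.mono_neutral_right) (auto simp: one_oper_def)
    then show "app (a * 1) w = app a w" by (simp add: one_oper_def)
  qed
  show "(a + b) * c = a * c + b * c"
    by (rule oper_eqI) (simp add: times_oper_def plus_oper_def distrib_right sum.distrib case_prod_unfold)
  show "a * (b + c) = a * b + a * c"
    by (rule oper_eqI) (simp add: times_oper_def plus_oper_def distrib_left sum.distrib case_prod_unfold)
  have "app (0 :: ('a, 'b) oper) [] \<noteq> app 1 []"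
    by (simp add: zero_oper_def one_oper_def)
  then show "(0 :: ('a, 'b) oper) \<noteq> 1" by metis
qed
end

lemma app_simps [simp]:
  "app 0 w = 0" "app 1 w = (if w = [] then 1 else 0)" "app (a + b) w = app a w + app b w"
  "app (a - b) w = app a w - app b w" "app (- a) w = - app a w"
  by (simp_all add: zero_oper_def one_oper_def plus_oper_def minus_oper_def uminus_oper_def)

lemma app_mult: "app (a * b) w = (\<Sum>(u, v)\<in>cuts w. app a u * app b v)"
  by (simp add: times_oper_def)

lemma app_mult_Nil [simp]: "app (a * b) [] = app a [] * app b []"
  by (simp add: app_mult)

definition ext :: "('x, 'y) oper \<Rightarrow> 'x sums \<Rightarrow> 'y sums" where
  "ext a = frag_extend (app a)"

lemma ext_simps [simp]:
  "ext a 0 = 0" "ext a (frag_of w) = app a w" "ext a (s + t) = ext a s + ext a t"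
  "ext a (s - t) = ext a s - ext a t" "ext a (- s) = - ext a s"
  by (simp_all add: ext_def frag_extend_add frag_extend_diff frag_extend_minus)

lemma ext_sum: "ext a (sum f I) = (\<Sum>i\<in>I. ext a (f i))"
  by (induction I rule: infinite_finite_induct) auto

lemma frag_induct_all [case_names zero one diff]:
  assumes "P 0" "\<And>w. P (frag_of w)" "\<And>s t. P s \<Longrightarrow> P t \<Longrightarrow> P (s - t)"
  shows "P (s :: 'b \<Rightarrow>\<^sub>0 int)"
  by (rule frag_induction[where S = UNIV]) (use assms in auto)

lemma ext_oper_simps [simp]:
  "ext 0 s = 0" "ext (a + b) s = ext a s + ext b s" "ext (a - b) s = ext a s - ext b s"
  "ext (- a) s = - ext a s"
  by (induction s rule: frag_induct_all) (auto simp: algebra_simps)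

definition ocomp :: "('y, 'z) oper \<Rightarrow> ('x, 'y) oper \<Rightarrow> ('x, 'z) oper" (infixl "\<bullet>" 75) where
  "a \<bullet> b = Op (\<lambda>w. ext a (app b w))"

lemma app_comp: "app (a \<bullet> b) w = ext a (app b w)"
  by (simp add: ocomp_def)

lemma ext_comp: "ext (a \<bullet> b) s = ext a (ext b s)"
  by (induction s rule: frag_induct_all) (auto simp: app_comp)

lemma comp_simps [simp]:
  "0 \<bullet> b = 0" "a \<bullet> 0 = 0" "(a + a') \<bullet> b = a \<bullet> b + a' \<bullet> b" "a \<bullet> (b + b') = a \<bullet> b + a \<bullet> b'"
  "(a - a') \<bullet> b = a \<bullet> b - a' \<bullet> b" "a \<bullet> (b - b') = a \<bullet> b - a \<bullet> b'"
  "(- a) \<bullet> b = - (a \<bullet> b)" "a \<bullet> (- b) = - (a \<bullet> b)"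
  by (rule oper_eqI, simp add: app_comp)+

lemma comp_assoc: "a \<bullet> b \<bullet> c = a \<bullet> (b \<bullet> c)"
  by (rule oper_eqI) (simp add: app_comp ext_comp)

definition ident :: "('x, 'x) oper" where
  "ident = Op frag_of"

lemma app_ident [simp]: "app ident w = frag_of w"
  by (simp add: ident_def)

lemma ext_ident [simp]: "ext ident s = s"
  by (induction s rule: frag_induct_all) auto

lemma comp_ident [simp]: "a \<bullet> ident = a" "ident \<bullet> a = a"
  by (rule oper_eqI, simp add: app_comp)+

text \<open>Letter-valued operators are the cogenerating data of the tensor coalgebra:
  coderivations, coalgebra maps and homotopies are determined by their projections to words of
  length one, and these have this form.\<close>

definition lv :: "('x, 'y) oper \<Rightarrow> bool" where
  "lv a \<longleftrightarrow> app a [] = 0 \<and> (\<forall>w. Poly_Mapping.keys (app a w) \<subseteq> range (\<lambda>x. [x]))"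

lemma lv_Nil [simp]: "lv a \<Longrightarrow> app a [] = 0"
  by (simp add: lv_def)

lemma keys_diff_subset: "Poly_Mapping.keys s \<subseteq> A \<Longrightarrow> Poly_Mapping.keys t \<subseteq> A \<Longrightarrow>
    Poly_Mapping.keys (s - t :: 'a \<Rightarrow>\<^sub>0 int) \<subseteq> A"
  using keys_diff[of s t] by blast

lemma keys_add_subset: "Poly_Mapping.keys s \<subseteq> A \<Longrightarrow> Poly_Mapping.keys t \<subseteq> A \<Longrightarrow>
    Poly_Mapping.keys (s + t :: 'a \<Rightarrow>\<^sub>0 int) \<subseteq> A"
  using keys_add[of s t] by blast

lemma keys_ext_subset:
  "(\<And>w. w \<in> Poly_Mapping.keys s \<Longrightarrow> Poly_Mapping.keys (app a w) \<subseteq> A) \<Longrightarrow> Poly_Mapping.keys (ext a s) \<subseteq> A"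
  unfolding ext_def using keys_frag_extend[of "app a" s] by blast

lemma lv_add: "lv a \<Longrightarrow> lv b \<Longrightarrow> lv (a + b)"
  and lv_diff: "lv a \<Longrightarrow> lv b \<Longrightarrow> lv (a - b)"
  and lv_uminus: "lv a \<Longrightarrow> lv (- a)"
  and lv_zero: "lv 0"
  by (simp_all add: lv_def keys_add_subset keys_diff_subset)

lemma lv_comp: "lv a \<Longrightarrow> ext a (app b []) = 0 \<Longrightarrow> lv (a \<bullet> b)"
  by (simp add: lv_def app_comp keys_ext_subset)

subsection \<open>Geometric series\<close>

text \<open>The sum over decompositions into blocks copies the formula of \<open>bar_map\<close>.
  That it is the geometric series, the inverse of \<open>1 - \<phi>\<close>, is expressed by the
  fixed point equation \<open>star_unfold\<close>.\<close>

definition star :: "('x, 'y) oper \<Rightarrow> ('x, 'y) oper" where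
  "star \<phi> = Op (\<lambda>w. \<Sum>bs\<in>blocks w. prod_list (map (app \<phi>) bs))"

lemma app_star: "app (star \<phi>) w = (\<Sum>bs\<in>blocks w. prod_list (map (app \<phi>) bs))"
  by (simp add: star_def)

lemma blocks_Nil [simp]: "blocks [] = {[]}"
  by (auto simp: blocks_def) (metis list.set_intros(1) neq_Nil_conv)

lemma star_Nil [simp]: "app (star \<phi>) [] = 1"
  by (simp add: app_star)

text \<open>Split off the first block of a decomposition. A cut with an empty first piece yields no
  block, and \<open>app \<phi> [] = 0\<close> removes it.\<close>

lemma star_unfold:
  assumes "app \<phi> [] = 0"
  shows "star \<phi> = 1 + \<phi> * star \<phi>"
proof (rule oper_eqI)
  fix w
  show "app (star \<phi>) w = app (1 + \<phi> * star \<phi>) w"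
  proof (cases "w = []")
    case True
    then show ?thesis using assms by simp
  next
    case False
    let ?f = "\<lambda>bs. prod_list (map (app \<phi>) bs)"
    have "app (\<phi> * star \<phi>) w = (\<Sum>p\<in>cuts w. \<Sum>bs\<in>blocks (snd p). app \<phi> (fst p) * ?f bs)"
      by (simp add: app_mult app_star sum_distrib_left case_prod_unfold)
    also have "\<dots> = (\<Sum>(p, bs)\<in>Sigma (cuts w) (\<lambda>p. blocks (snd p)). app \<phi> (fst p) * ?f bs)"
      by (rule sum.Sigma) (auto simp: finite_blocks)
    also have "\<dots> = (\<Sum>(p, bs)\<in>{(p, bs) \<in> Sigma (cuts w) (\<lambda>p. blocks (snd p)). fst p \<noteq> []}. app \<phi> (fst p) * ?f bs)"
      by (rule sum.mono_neutral_right) (auto simp: finite_blocks assms)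
    also have "\<dots> = (\<Sum>bs\<in>blocks w. ?f bs)"
    proof (rule sum.reindex_bij_witness[where i = "\<lambda>bs. ((hd bs, concat (tl bs)), tl bs)"
          and j = "\<lambda>(p, bs). fst p # bs"], goal_cases)
      case (4 bs)
      then obtain b bs' where "bs = b # bs'" using False by (cases bs) (auto simp: blocks_def)
      then show ?case using 4 by (auto simp: blocks_def cuts_def)
    next
      case (3 bs)
      then obtain b bs' where "bs = b # bs'" using False by (cases bs) (auto simp: blocks_def)
      then show ?case using 3 by (auto simp: blocks_def cuts_def)
    qed (auto simp: blocks_def cuts_def)
    finally show ?thesis using False by (simp add: app_star)
  qed
qed

text \<open>As \<open>\<phi>\<close> kills the empty word, the value of \<open>\<phi> * Z\<close> on
  a word involves \<open>Z\<close> on strictly shorter words only. Several identities below are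
  proved by checking that both sides solve one such equation.\<close>

lemma fixpoint_unique:
  assumes "app \<phi> [] = 0" "Z = \<phi> * Z"
  shows "Z = 0"
proof (rule oper_eqI)
  fix w
  show "app Z w = app 0 w"
  proof (induction w rule: length_induct)
    case (1 w)
    have "app Z w = (\<Sum>(u, v)\<in>cuts w. app \<phi> u * app Z v)"
      using assms(2) by (metis app_mult)
    also have "\<dots> = (\<Sum>(u, v)\<in>cuts w. 0)"
    proof (rule sum.cong)
      fix p assume "p \<in> cuts w"
      then obtain u v where p: "p = (u, v)" "w = u @ v" by (auto simp: cuts_def)
      show "(case p of (u, v) \<Rightarrow> app \<phi> u * app Z v) = (case p of (u, v) \<Rightarrow> 0)"
        using 1 assms(1) p by (cases "u = []") auto
    qed simp
    finally show ?case by simp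
  qed
qed

lemma star_unique:
  assumes "app \<phi> [] = 0" "F = 1 + \<phi> * F"
  shows "F = star \<phi>"
proof -
  have "F - star \<phi> = (1 + \<phi> * F) - (1 + \<phi> * star \<phi>)"
    using assms(2) star_unfold[OF assms(1)] by metis
  also have "\<dots> = \<phi> * (F - star \<phi>)" by (simp add: algebra_simps)
  finally have "F - star \<phi> = 0" by (rule fixpoint_unique[OF assms(1)])
  then show ?thesis by simp
qed

lemma star_unfold_right:
  assumes "app \<phi> [] = 0"
  shows "star \<phi> = 1 + star \<phi> * \<phi>"
proof -
  let ?F = "star \<phi>"
  have F: "\<phi> * ?F = ?F - 1" using star_unfold[OF assms] by (metis add_diff_cancel_left')
  \<comment> \<open>\<open>1 + ?F * \<phi>\<close> solves the left fixed point equation, whose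
    solution is unique.\<close>
  have "1 + \<phi> * (1 + ?F * \<phi>) = 1 + \<phi> + (\<phi> * ?F) * \<phi>" by (simp add: algebra_simps)
  also have "\<dots> = 1 + ?F * \<phi>" by (simp only: F) (simp add: algebra_simps)
  finally show ?thesis using star_unique[OF assms] by metis
qed

lemma star_mult:
  assumes "app \<phi> [] = 0"
  shows "\<phi> * star \<phi> = star \<phi> - 1" "star \<phi> * \<phi> = star \<phi> - 1"
  using star_unfold[OF assms] star_unfold_right[OF assms] by (metis add_diff_cancel_left')+

text \<open>Resolvent identity for the inverses of \<open>1 - \<phi>\<close> and
  \<open>1 - \<psi>\<close>. The outer factors are 1 on the empty word, so the leading term of the
  difference is \<open>\<psi> - \<phi>\<close> itself.\<close>

lemma star_diff:
  assumes "app \<phi> [] = 0" "app \<psi> [] = 0"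
  shows "star \<psi> - star \<phi> = star \<phi> * (\<psi> - \<phi>) * star \<psi>"
    (is "_ = ?F * _ * ?G")
proof -
  have "?F * (\<psi> - \<phi>) * ?G = ?F * (\<psi> * ?G) - (?F * \<phi>) * ?G" by (simp add: algebra_simps)
  also have "\<dots> = ?G - ?F" by (simp only: star_mult[OF assms(1)] star_mult[OF assms(2)]) (simp add: algebra_simps)
  finally show ?thesis by simp
qed

definition pr :: "('x, 'x) oper" where
  "pr = Op (\<lambda>w. if length w = 1 then frag_of w else 0)"

lemma app_pr: "app pr w = (if length w = 1 then frag_of w else 0)"
  by (simp add: pr_def)

lemma lv_pr: "lv pr"
  by (auto simp: lv_def app_pr length_Suc_conv)

lemma ident_eq_star: "ident = star pr"
proof (rule star_unique)
  show "ident = 1 + pr * (ident :: ('x, 'x) oper)"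
  proof (rule oper_eqI)
    fix w :: "'x list"
    show "app ident w = app (1 + pr * ident) w"
    proof (cases w)
      case Nil
      then show ?thesis by (simp add: app_pr one_sums)
    next
      case (Cons x w')
      have "app (pr * ident) w = (\<Sum>p\<in>{([x], w')}. app pr (fst p) * app ident (snd p))"
        unfolding app_mult case_prod_unfold using Cons
        by (intro sum.mono_neutral_right) (auto simp: app_pr length_Suc_conv)
      then show ?thesis using Cons by (simp add: app_pr frag_of_mult)
    qed
  qed
qed (simp add: app_pr)

subsection \<open>Composition and the coproduct\<close>

text \<open>A cut of a word beginning with \<open>x\<close> lies either before \<open>x\<close>, and
  then \<open>a\<close> sees the empty word, or after it, and then \<open>a\<close> acts through its
  translate, which inserts \<open>x\<close> in front.\<close>

lemma ext_mult_letter: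
  "ext (a * b) (frag_of [x] * t) = app a [] * ext b (frag_of [x] * t) + ext (Op (\<lambda>u. app a (x # u)) * b) t"
proof (induction t rule: frag_induct_all)
  case (one w)
  have "cuts (x # w) = insert ([], x # w) ((\<lambda>(u, v). (x # u, v)) ` cuts w)"
  proof (intro equalityI subsetI, goal_cases)
    case (1 p)
    then obtain u v where p: "p = (u, v)" "u @ v = x # w" by (auto simp: cuts_def)
    then show ?case by (cases u) force+
  qed auto
  moreover have "inj_on (\<lambda>(u, v). (x # u, v)) (cuts w)" by (auto simp: inj_on_def)
  moreover have "([], x # w) \<notin> (\<lambda>(u, v). (x # u, v)) ` cuts w" by auto
  ultimately show ?case
    by (simp add: frag_of_mult app_mult sum.reindex case_prod_unfold)
next
  case (diff s t)
  then show ?case by (simp add: algebra_simps)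
qed simp

lemma ext_shift: "ext (Op (\<lambda>u. app a (x # u))) t = ext a (frag_of [x] * t)"
  by (induction t rule: frag_induct_all) (auto simp: frag_of_mult right_diff_distrib)

text \<open>Hypothesis \<open>t\<close> ranges over all operators \<open>a\<close> because it is
  applied to the translates of the given one by the letters of \<open>s\<close>.\<close>

lemma ext_mult_lv:
  assumes s: "Poly_Mapping.keys s \<subseteq> range (\<lambda>x. [x])" and "finite I"
    and t: "\<And>a. ext (a * b) t = (\<Sum>i\<in>I. ext a (f i) * g i + ext a (f' i) * g' i)"
  shows "ext (a * b) (s * t) =
    app a [] * ext b (s * t) + (\<Sum>i\<in>I. ext a (s * f i) * g i + ext a (s * f' i) * g' i)"
  using s
proof (induction s rule: frag_induction)
  case (one w)
  then obtain x where "w = [x]" by blast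
  then show ?case using t by (simp add: ext_mult_letter ext_shift)
next
  case (diff s s')
  then show ?case by (simp add: algebra_simps sum_subtractf sum.distrib)
qed simp

text \<open>One step of an induction on word length that computes the precomposition of a
  convolution \<open>a * b\<close>: \<open>\<phi>\<close> has turned the first block into a letter,
  and the rest is a shorter word. Two pairs \<open>Y\<close>, \<open>Z\<close> are carried because
  the output of a homotopy can be cut in two ways.\<close>

lemma comp_mult_step:
  assumes "lv \<phi>"
    and IH: "\<And>a v. length v < length w \<Longrightarrow>
      ext (a * b) (app X v) = app ((a \<bullet> Y) * Z + (a \<bullet> Y') * Z') v"
  shows "ext (a * b) (app (\<phi> * X) w) =
    app a [] * ext b (app (\<phi> * X) w) + app ((a \<bullet> (\<phi> * Y)) * Z + (a \<bullet> (\<phi> * Y')) * Z') w"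
proof -
  have *: "ext (a * b) (app \<phi> u * app X v) = app a [] * ext b (app \<phi> u * app X v) +
      (\<Sum>(v1, v2)\<in>cuts v. ext a (app \<phi> u * app Y v1) * app Z v2 + ext a (app \<phi> u * app Y' v1) * app Z' v2)"
    if "(u, v) \<in> cuts w" for u v
  proof (cases "u = []")
    case True
    then show ?thesis using assms(1) by simp
  next
    case False
    then have v: "length v < length w" using that by (auto simp: cuts_def)
    show ?thesis
      unfolding case_prod_unfold
    proof (rule ext_mult_lv)
      show "Poly_Mapping.keys (app \<phi> u) \<subseteq> range (\<lambda>x. [x])" using assms(1) by (auto simp: lv_def)
      show "ext (a * b) (app X v) = (\<Sum>p\<in>cuts v. ext a (app Y (fst p)) * app Z (snd p) +
          ext a (app Y' (fst p)) * app Z' (snd p))" for a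
        by (subst IH[OF v]) (simp add: app_mult app_comp case_prod_unfold sum.distrib)
    qed simp
  qed
  have "ext (a * b) (app (\<phi> * X) w) = (\<Sum>(u, v)\<in>cuts w. ext (a * b) (app \<phi> u * app X v))"
    by (simp add: app_mult ext_sum case_prod_unfold)
  also have "\<dots> = (\<Sum>(u, v)\<in>cuts w. app a [] * ext b (app \<phi> u * app X v) +
      (\<Sum>(v1, v2)\<in>cuts v. ext a (app \<phi> u * app Y v1) * app Z v2 + ext a (app \<phi> u * app Y' v1) * app Z' v2))"
    by (rule sum.cong) (use * in auto)
  also have "\<dots> = app a [] * ext b (app (\<phi> * X) w) +
      (\<Sum>(u, v)\<in>cuts w. \<Sum>(v1, v2)\<in>cuts v. ext a (app \<phi> u * app Y v1) * app Z v2 + ext a (app \<phi> u * app Y' v1) * app Z' v2)"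
    by (simp add: app_mult ext_sum case_prod_unfold sum.distrib sum_distrib_left)
  also have "(\<Sum>(u, v)\<in>cuts w. \<Sum>(v1, v2)\<in>cuts v. ext a (app \<phi> u * app Y v1) * app Z v2 + ext a (app \<phi> u * app Y' v1) * app Z' v2)
     = (\<Sum>(t, v2)\<in>cuts w. \<Sum>(u, v1)\<in>cuts t. ext a (app \<phi> u * app Y v1) * app Z v2 + ext a (app \<phi> u * app Y' v1) * app Z' v2)"
    by (rule cuts_assoc)
  also have "\<dots> = app ((a \<bullet> (\<phi> * Y)) * Z + (a \<bullet> (\<phi> * Y')) * Z') w"
    by (simp add: app_mult app_comp ext_sum case_prod_unfold sum.distrib sum_distrib_right)
  finally show ?thesis .
qed

lemma comp_one_mult: "app ((a \<bullet> 1) * b) w = app a [] * app b w"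
  unfolding app_mult by (subst sum_cuts_first) (auto simp: app_comp one_sums)

text \<open>A coalgebra map respects deconcatenation, hence precomposition with it respects the dual
  product, which is convolution. The induction peels off the first block of the word.\<close>

lemma comp_mult_star:
  assumes "lv \<phi>"
  shows "(a * b) \<bullet> star \<phi> = (a \<bullet> star \<phi>) * (b \<bullet> star \<phi>)"
proof (rule oper_eqI)
  fix w
  let ?F = "star \<phi>"
  have F: "\<phi> * ?F = ?F - 1" using assms by (simp add: star_mult)
  show "app ((a * b) \<bullet> ?F) w = app ((a \<bullet> ?F) * (b \<bullet> ?F)) w"
  proof (induction w arbitrary: a rule: length_induct)
    case (1 w)
    show ?case
    proof (cases "w = []")
      case True
      then show ?thesis by (simp add: app_comp one_sums)
    next
      case False
      then have "app ((a * b) \<bullet> ?F) w = ext (a * b) (app (\<phi> * ?F) w)" by (simp add: F app_comp)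
      also have "\<dots> = app a [] * ext b (app (\<phi> * ?F) w) + app ((a \<bullet> (\<phi> * ?F)) * (b \<bullet> ?F) + (a \<bullet> (\<phi> * 0)) * 0) w"
        by (rule comp_mult_step[OF assms]) (use 1 in \<open>simp add: app_comp\<close>)
      also have "\<dots> = app ((a \<bullet> 1) * (b \<bullet> ?F) + (a \<bullet> (\<phi> * ?F)) * (b \<bullet> ?F)) w"
        using False by (simp add: comp_one_mult F app_comp)
      also have "\<dots> = app ((a \<bullet> ?F) * (b \<bullet> ?F)) w"
        by (simp add: F algebra_simps del: app_simps)
      finally show ?thesis .
    qed
  qed
qed

lemma ext_one_mult:
  assumes "Poly_Mapping.keys s \<subseteq> range (\<lambda>x. [x])"
  shows "ext 1 (s * t) = 0"
  using assms
proof (induction s rule: frag_induction)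
  case (one w)
  then obtain x where w: "w = [x]" by blast
  show ?case unfolding w by (induction t rule: frag_induct_all) (auto simp: frag_of_mult algebra_simps)
qed (auto simp: algebra_simps)

text \<open>Precomposition with \<open>star \<phi>\<close> is multiplicative and unital, so it turns
  the fixed point equation of \<open>star \<psi>\<close> into that of
  \<open>star (\<psi> \<bullet> star \<phi>)\<close>.\<close>

lemma comp_star:
  fixes \<phi> :: "('x, 'y) oper" and \<psi> :: "('y, 'z) oper"
  assumes "lv \<phi>" "lv \<psi>"
  shows "star \<psi> \<bullet> star \<phi> = star (\<psi> \<bullet> star \<phi>)"
proof (rule star_unique)
  show "app (\<psi> \<bullet> star \<phi>) [] = 0" using assms by (simp add: app_comp one_sums)
  have one: "(1 :: ('y, 'z) oper) \<bullet> star \<phi> = 1"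
  proof (rule oper_eqI)
    fix w
    have "app ((1 :: ('y, 'z) oper) \<bullet> star \<phi>) w = ext 1 (app (1 + \<phi> * star \<phi>) w)"
      using star_unfold assms(1) by (metis app_comp lv_Nil)
    moreover have "ext (1 :: ('y, 'z) oper) (app (\<phi> * star \<phi>) w) = 0"
      unfolding app_mult ext_sum case_prod_unfold
      by (intro sum.neutral ballI ext_one_mult) (use assms(1) in \<open>simp add: lv_def\<close>)
    ultimately have "app (1 \<bullet> star \<phi>) w = ext (1 :: ('y, 'z) oper) (app (1 :: ('x, 'y) oper) w)" by (simp only: ext_simps app_simps(3) add_0_right)
    then show "app ((1 :: ('y, 'z) oper) \<bullet> star \<phi>) w = app 1 w" by (cases "w = []") (simp_all add: one_sums)
  qed
  have "star \<psi> \<bullet> star \<phi> = (1 + \<psi> * star \<psi>) \<bullet> star \<phi>"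
    using star_unfold[of \<psi>] assms(2) by simp
  then show "star \<psi> \<bullet> star \<phi> = 1 + (\<psi> \<bullet> star \<phi>) * (star \<psi> \<bullet> star \<phi>)"
    by (simp add: comp_mult_star[OF assms(1)] one)
qed

subsection \<open>Signs and twisted derivations\<close>

text \<open>The Koszul sign of moving an odd operator past the input of \<open>a\<close>. It is
  multiplicative for convolution, which lets signs be handled inside the ring.\<close>

definition sg :: "(int \<times> 'a, 'y) oper \<Rightarrow> (int \<times> 'a, 'y) oper" where
  "sg a = Op (\<lambda>w. if even (wdeg w) then app a w else - app a w)"

lemma app_sg: "app (sg a) w = (if even (wdeg w) then app a w else - app a w)"
  by (simp add: sg_def)

lemma wdeg_simps [simp]: "wdeg [] = 0" "wdeg (x # w) = fst x + wdeg w" "wdeg (u @ v) = wdeg u + wdeg v"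
  by (simp_all add: wdeg_def)

lemma sg_simps [simp]:
  "sg 0 = 0" "sg 1 = 1" "sg (a + b) = sg a + sg b" "sg (a - b) = sg a - sg b" "sg (- a) = - sg a"
  "sg (sg a) = a"
  by (rule oper_eqI, simp add: app_sg)+

lemma sg_mult [simp]: "sg (a * b) = sg a * sg b"
proof (rule oper_eqI)
  fix w
  show "app (sg (a * b)) w = app (sg a * sg b) w"
    by (auto simp: app_sg app_mult sum_negf[symmetric] intro!: sum.cong)
qed

lemma comp_sg [simp]: "a \<bullet> sg b = sg (a \<bullet> b)"
  by (rule oper_eqI) (simp add: app_comp app_sg)

lemma lv_sg: "lv a \<Longrightarrow> lv (sg a)"
  by (simp add: lv_def app_sg)

text \<open>\<open>D\<close> is a coderivation along the pair \<open>star \<phi>\<close>,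
  \<open>star \<gamma>\<close>: its output can be cut before or after the letter produced by
  \<open>\<eta>\<close>. If the cut lies before it, the left piece comes from
  \<open>star \<phi>\<close> and has been passed by \<open>\<eta>\<close>, whence the
  \<open>sg\<close>.\<close>

lemma comp_mult_homotopy:
  assumes "lv \<phi>" "lv \<eta>" "lv \<gamma>"
  defines "D \<equiv> sg (star \<phi>) * \<eta> * star \<gamma>"
  shows "(a * b) \<bullet> D = sg (a \<bullet> star \<phi>) * (b \<bullet> D) + (a \<bullet> D) * (b \<bullet> star \<gamma>)"
proof (rule oper_eqI)
  fix w
  let ?F = "sg (star \<phi>)" and ?G = "star \<gamma>"
  have F: "sg \<phi> * ?F = ?F - 1"
    using assms(1) by (metis sg_mult sg_simps(2,4) star_mult(1) lv_Nil)
  have D: "D = sg \<phi> * D + \<eta> * ?G"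
    unfolding D_def mult.assoc[symmetric] by (simp add: F algebra_simps)
  have [simp]: "app D [] = 0" using assms(2) by (simp add: D_def)
  show "app ((a * b) \<bullet> D) w = app (sg (a \<bullet> star \<phi>) * (b \<bullet> D) + (a \<bullet> D) * (b \<bullet> star \<gamma>)) w"
  proof (induction w arbitrary: a rule: length_induct)
    case (1 w)
    have "app ((a * b) \<bullet> D) w = ext (a * b) (app (sg \<phi> * D) w) + ext (a * b) (app (\<eta> * ?G) w)"
      by (subst D) (simp add: app_comp)
    also have "ext (a * b) (app (sg \<phi> * D) w) = app a [] * ext b (app (sg \<phi> * D) w) +
        app ((a \<bullet> (sg \<phi> * ?F)) * (b \<bullet> D) + (a \<bullet> (sg \<phi> * D)) * (b \<bullet> ?G)) w"
      by (rule comp_mult_step) (use 1 assms(1) in \<open>auto simp: app_comp[symmetric] lv_sg simp del: app_simps\<close>)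
    also have "ext (a * b) (app (\<eta> * ?G) w) = app a [] * ext b (app (\<eta> * ?G) w) +
        app ((a \<bullet> (\<eta> * ?G)) * (b \<bullet> ?G) + (a \<bullet> (\<eta> * 0)) * 0) w"
      by (rule comp_mult_step)
        (use assms in \<open>auto simp: app_comp[symmetric] comp_mult_star[symmetric] simp del: app_simps\<close>)
    also have "app a [] * ext b (app (sg \<phi> * D) w) +
        app ((a \<bullet> (sg \<phi> * ?F)) * (b \<bullet> D) + (a \<bullet> (sg \<phi> * D)) * (b \<bullet> ?G)) w +
        (app a [] * ext b (app (\<eta> * ?G) w) + app ((a \<bullet> (\<eta> * ?G)) * (b \<bullet> ?G) + (a \<bullet> (\<eta> * 0)) * 0) w)
      = app a [] * ext b (app (sg \<phi> * D + \<eta> * ?G) w) +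
        app ((a \<bullet> (sg \<phi> * ?F)) * (b \<bullet> D) + (a \<bullet> (sg \<phi> * D + \<eta> * ?G)) * (b \<bullet> ?G)) w"
      by (simp add: algebra_simps)
    also have "\<dots> = app ((a \<bullet> 1) * (b \<bullet> D) + (a \<bullet> (sg \<phi> * ?F)) * (b \<bullet> D) + (a \<bullet> D) * (b \<bullet> ?G)) w"
      by (simp add: comp_one_mult app_comp[symmetric] flip: D)
    also have "\<dots> = app (sg (a \<bullet> star \<phi>) * (b \<bullet> D) + (a \<bullet> D) * (b \<bullet> star \<gamma>)) w"
      by (simp add: F algebra_simps del: app_simps)
    finally show ?case .
  qed
qed

section \<open>The maps of the bar construction as operators\<close>

definition tens :: "'r \<Rightarrow> (int \<times> 'a) sums \<Rightarrow> ('r, 'a) tensors" where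
  "tens r = frag_extend (\<lambda>w. frag_of (r, w))"

lemma tens_simps [simp]:
  "tens r 0 = 0" "tens r (frag_of w) = frag_of (r, w)" "tens r (s + t) = tens r s + tens r t"
  "tens r (s - t) = tens r s - tens r t" "tens r (- s) = - tens r s"
  by (simp_all add: tens_def frag_extend_add frag_extend_diff frag_extend_minus)

lemma tens_sum: "tens r (sum f I) = (\<Sum>i\<in>I. tens r (f i))"
  by (induction I rule: infinite_finite_induct) auto

text \<open>Operators see words only; the coefficient in \<open>R\<close> of a symbol is carried
  along unchanged. Linearity over \<open>R\<close> reappears as compatibility with the tensor
  relations.\<close>

definition rext :: "(int \<times> 'a, int \<times> 'b) oper \<Rightarrow> ('r, 'a) tensors \<Rightarrow> ('r, 'b) tensors" where
  "rext a = frag_extend (\<lambda>(r, w). tens r (app a w))"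

lemma rext_simps [simp]:
  "rext a 0 = 0" "rext a (frag_of (r, w)) = tens r (app a w)" "rext a (s + t) = rext a s + rext a t"
  "rext a (s - t) = rext a s - rext a t" "rext a (- s) = - rext a s"
  by (simp_all add: rext_def frag_extend_add frag_extend_diff frag_extend_minus)

lemma rext_tens [simp]: "rext a (tens r s) = tens r (ext a s)"
  by (induction s rule: frag_induct_all) auto

definition lop :: "('x list \<Rightarrow> 'y) \<Rightarrow> ('x, 'y) oper" where
  "lop \<beta> = Op (\<lambda>w. if w = [] then 0 else frag_of [\<beta> w])"

lemma app_lop: "app (lop \<beta>) w = (if w = [] then 0 else frag_of [\<beta> w])"
  by (simp add: lop_def)

lemma lv_lop [simp]: "lv (lop \<beta>)"
  by (auto simp: lv_def app_lop)

definition coder :: "(int \<times> 'a, int \<times> 'a) oper \<Rightarrow> (int \<times> 'a, int \<times> 'a) oper" where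
  "coder \<beta> = sg ident * \<beta> * ident"

definition htpy :: "(int \<times> 'a, 'y) oper \<Rightarrow> (int \<times> 'a, 'y) oper \<Rightarrow> (int \<times> 'a, 'y) oper \<Rightarrow> (int \<times> 'a, 'y) oper" where
  "htpy \<phi> \<eta> \<gamma> = sg (star \<phi>) * \<eta> * star \<gamma>"

text \<open>The identity is the coalgebra map of \<open>pr\<close>, so a coderivation is the special
  case of a coderivation along two coalgebra maps in which both are the identity. The composition
  rules for \<open>coder\<close> are obtained in this way.\<close>

lemma coder_eq_htpy: "coder \<beta> = htpy pr \<beta> pr"
  by (simp add: coder_def htpy_def flip: ident_eq_star)

lemma app_mult3:
  assumes "app b [] = 0"
  shows "app (a * b * c) w = (\<Sum>(u, v, t)\<in>splits w. app a u * app b v * app c t)"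
proof -
  have "app (a * b * c) w = (\<Sum>p\<in>cuts w. \<Sum>q\<in>cuts (fst p). app a (fst q) * app b (snd q) * app c (snd p))"
    by (simp add: app_mult sum_distrib_right case_prod_unfold)
  also have "\<dots> = (\<Sum>(p, q)\<in>Sigma (cuts w) (\<lambda>p. cuts (fst p)). app a (fst q) * app b (snd q) * app c (snd p))"
    by (rule sum.Sigma) auto
  also have "\<dots> = (\<Sum>(p, q)\<in>{(p, q)\<in>Sigma (cuts w) (\<lambda>p. cuts (fst p)). snd q \<noteq> []}.
      app a (fst q) * app b (snd q) * app c (snd p))"
    by (rule sum.mono_neutral_right) (use assms in auto)
  also have "\<dots> = (\<Sum>(u, v, t)\<in>splits w. app a u * app b v * app c t)"
    by (rule sum.reindex_bij_witness[where i = "\<lambda>(u, v, t). ((u @ v, t), (u, v))"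
          and j = "\<lambda>((s, t), (u, v)). (u, v, t)"]) (auto simp: splits_def)
  finally show ?thesis .
qed

lemma bar_diff_eq:
  fixes M :: "int \<Rightarrow> ('r, 'a) module"
  shows "bar_diff M m = rext (coder (lop (bar_op M 1 m)))"
proof -
  have "(\<Sum>(u, v, t)\<in>splits w. frag_cmul (koszul (wdeg u)) (frag_of (r, u @ [bar_op M 1 m v] @ t))) =
      tens r (app (coder (lop (bar_op M 1 m))) w)" for r :: 'r and w
  proof -
    have "app (coder (lop (bar_op M 1 m))) w =
        (\<Sum>(u, v, t)\<in>splits w. app (sg ident) u * app (lop (bar_op M 1 m)) v * app ident t)"
      unfolding coder_def by (rule app_mult3) simp
    then show ?thesis
      by (auto simp: tens_sum app_sg app_lop splits_def koszul_def frag_of_mult intro!: sum.cong)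
  qed
  then show ?thesis by (simp add: bar_diff_def rext_def)
qed

lemma prod_list_frag_of: "prod_list (map (\<lambda>b. frag_of [f b]) bs) = frag_of (map f bs)"
  by (induction bs) (auto simp: frag_of_mult one_sums)

lemma app_star_lop: "app (star (lop \<phi>)) w = (\<Sum>bs\<in>blocks w. frag_of (map \<phi> bs))"
proof -
  have "prod_list (map (app (lop \<phi>)) bs) = frag_of (map \<phi> bs)" if "bs \<in> blocks w" for bs
  proof -
    have "map (app (lop \<phi>)) bs = map (\<lambda>b. frag_of [\<phi> b]) bs"
      using that by (auto simp: blocks_def app_lop)
    then show ?thesis by (simp only: prod_list_frag_of)
  qed
  then show ?thesis by (simp add: app_star)
qed

lemma bar_map_eq: "bar_map N f = rext (star (lop (bar_op N 0 f)))"
  by (simp add: bar_map_def rext_def app_star_lop tens_sum)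

lemma bar_homotopy_eq:
  fixes N :: "int \<Rightarrow> ('r, 'b) module"
  shows "bar_homotopy N f h g = rext (htpy (lop (bar_op N 0 f)) (lop (bar_op N (- 1) h)) (lop (bar_op N 0 g)))"
proof -
  let ?\<phi> = "bar_op N 0 f" and ?\<eta> = "bar_op N (- 1) h" and ?\<gamma> = "bar_op N 0 g"
  let ?t = "\<lambda>ps b qs. map ?\<phi> ps @ [?\<eta> b] @ map ?\<gamma> qs"
  have "(\<Sum>(ps, b, qs)\<in>marked_blocks w. frag_cmul (koszul (wdeg (concat ps))) (frag_of (r, ?t ps b qs))) =
      tens r (app (htpy (lop ?\<phi>) (lop ?\<eta>) (lop ?\<gamma>)) w)" for r :: 'r and w
  proof -
    have "app (htpy (lop ?\<phi>) (lop ?\<eta>) (lop ?\<gamma>)) w =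
        (\<Sum>(u, v, t)\<in>splits w. app (sg (star (lop ?\<phi>))) u * app (lop ?\<eta>) v * app (star (lop ?\<gamma>)) t)"
      unfolding htpy_def by (rule app_mult3) simp
    also have "\<dots> = (\<Sum>(u, v, t)\<in>splits w. \<Sum>(ps, qs)\<in>blocks u \<times> blocks t.
        frag_cmul (koszul (wdeg u)) (frag_of (?t ps v qs)))"
      by (rule sum.cong) (auto simp: splits_def app_sg app_lop app_star_lop koszul_def sum_distrib_right
          sum_distrib_left sum_negf frag_of_mult sum.cartesian_product[symmetric] intro: sum.swap)
    also have "\<dots> = (\<Sum>(p, q)\<in>Sigma (splits w) (\<lambda>p. blocks (fst p) \<times> blocks (snd (snd p))).
        frag_cmul (koszul (wdeg (fst p))) (frag_of (?t (fst q) (fst (snd p)) (snd q))))"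
      unfolding case_prod_unfold
      by (subst sum.Sigma) (auto simp: case_prod_unfold finite_splits finite_blocks)
    also have "\<dots> = (\<Sum>(ps, b, qs)\<in>marked_blocks w. frag_cmul (koszul (wdeg (concat ps))) (frag_of (?t ps b qs)))"
      by (rule sum.reindex_bij_witness[where j = "\<lambda>((u, v, t), (ps, qs)). (ps, v, qs)"
            and i = "\<lambda>(ps, b, qs). ((concat ps, b, concat qs), (ps, qs))"])
        (auto simp: splits_def blocks_def marked_blocks_def)
    finally show ?thesis
      by (auto simp: tens_sum koszul_def intro!: sum.cong)
  qed
  then show ?thesis by (simp add: bar_homotopy_def rext_def)
qed

section \<open>Multilinear operators and the tensor relations\<close>

definition good :: "(int \<Rightarrow> ('r, 'a) module) \<Rightarrow> (int \<times> 'a) sums \<Rightarrow> bool" where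
  "good P s \<longleftrightarrow> Poly_Mapping.keys s \<subseteq> words P"

definition nul :: "('r, 'x) ring_scheme \<Rightarrow> (int \<Rightarrow> ('r, 'a) module) \<Rightarrow> (int \<times> 'a) sums \<Rightarrow> bool" where
  "nul R P s \<longleftrightarrow> (\<forall>r\<in>carrier R. tens r s \<in> tensor_rels R P)"

text \<open>Stands for \<open>s\<close> being \<open>c\<close> times \<open>t\<close> as tensors.
  Sums of words have integer coefficients, so \<open>c\<close> cannot multiply \<open>t\<close>
  directly and is moved into the coefficient of the symbol. Here and in \<open>nul\<close> every
  coefficient \<open>r\<close> is tested, since operators are applied to symbols with arbitrary
  coefficients.\<close>

definition rel :: "('r, 'x) ring_scheme \<Rightarrow> (int \<Rightarrow> ('r, 'a) module) \<Rightarrow> 'r \<Rightarrow> (int \<times> 'a) sums \<Rightarrow> (int \<times> 'a) sums \<Rightarrow> bool" where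
  "rel R P c s t \<longleftrightarrow> (\<forall>r\<in>carrier R. tens r s - tens (r \<otimes>\<^bsub>R\<^esub> c) t \<in> tensor_rels R P)"

text \<open>This is what \<open>rext a\<close> needs in order to descend to tensors
  (\<open>rext_rels\<close>). The values are sums of words, so multilinearity can only be asked for
  modulo the relations of the target.\<close>

definition mlin :: "('r, 'x) ring_scheme \<Rightarrow> (int \<Rightarrow> ('r, 'a) module) \<Rightarrow> (int \<Rightarrow> ('r, 'b) module) \<Rightarrow>
    (int \<times> 'a, int \<times> 'b) oper \<Rightarrow> bool" where
  "mlin R P Q a \<longleftrightarrow>
     (\<forall>w\<in>words P. good Q (app a w)) \<and>
     (\<forall>u\<in>words P. \<forall>v\<in>words P. \<forall>k. \<forall>x\<in>carrier (P k). \<forall>y\<in>carrier (P k).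
        nul R Q (app a (u @ [(k, x \<oplus>\<^bsub>P k\<^esub> y)] @ v) - app a (u @ [(k, x)] @ v) - app a (u @ [(k, y)] @ v))) \<and>
     (\<forall>u\<in>words P. \<forall>v\<in>words P. \<forall>k. \<forall>c\<in>carrier R. \<forall>x\<in>carrier (P k).
        rel R Q c (app a (u @ [(k, c \<odot>\<^bsub>P k\<^esub> x)] @ v)) (app a (u @ [(k, x)] @ v)))"

lemma words_simps [simp]:
  "[] \<in> words P" "(k, x) # w \<in> words P \<longleftrightarrow> x \<in> carrier (P k) \<and> w \<in> words P"
  "u @ v \<in> words P \<longleftrightarrow> u \<in> words P \<and> v \<in> words P"
  by (auto simp: words_def)

lemma good_simps [simp]: "good P 0" "good P (frag_of w) \<longleftrightarrow> w \<in> words P" "good P (1 :: (int \<times> 'a) sums)"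
  by (auto simp: good_def one_sums)

lemma good_add: "good P s \<Longrightarrow> good P t \<Longrightarrow> good P (s + t)"
  and good_diff: "good P s \<Longrightarrow> good P t \<Longrightarrow> good P (s - t)"
  and good_uminus: "good P s \<Longrightarrow> good P (- s)"
  by (auto simp: good_def keys_add_subset keys_diff_subset)

lemma good_sum: "(\<And>i. i \<in> I \<Longrightarrow> good P (f i)) \<Longrightarrow> good P (sum f I)"
  by (induction I rule: infinite_finite_induct) (auto intro: good_add)

lemma good_induct [consumes 1, case_names zero one diff]:
  assumes "good P s" "Q 0" "\<And>w. w \<in> words P \<Longrightarrow> Q (frag_of w)" "\<And>s t. Q s \<Longrightarrow> Q t \<Longrightarrow> Q (s - t)"
  shows "Q s"
  by (rule frag_induction[where S = "words P"]) (use assms in \<open>auto simp: good_def\<close>)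

lemma good_mult: "good P s \<Longrightarrow> good P t \<Longrightarrow> good P (s * t)"
proof (induction s rule: good_induct)
  case (one w)
  show ?case using \<open>good P t\<close>
    by (induction t rule: good_induct) (use one in \<open>auto simp: frag_of_mult right_diff_distrib good_diff\<close>)
qed (auto simp: left_diff_distrib good_diff)

lemma good_ext: "good P s \<Longrightarrow> (\<And>w. w \<in> words P \<Longrightarrow> good Q (app a w)) \<Longrightarrow> good Q (ext a s)"
  unfolding good_def by (rule keys_ext_subset) auto

lemma rels_zero [simp]: "0 \<in> tensor_rels R P"
  by (rule tensor_rels.zero)

lemma rels_uminus: "s \<in> tensor_rels R P \<Longrightarrow> - s \<in> tensor_rels R P"
  using tensor_rels.diff[OF tensor_rels.zero] by force

lemma rels_add: "s \<in> tensor_rels R P \<Longrightarrow> t \<in> tensor_rels R P \<Longrightarrow> s + t \<in> tensor_rels R P"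
  using tensor_rels.diff[OF _ rels_uminus] by force

lemma nul_zero [simp]: "nul R P 0"
  and nul_add: "nul R P s \<Longrightarrow> nul R P t \<Longrightarrow> nul R P (s + t)"
  and nul_diff: "nul R P s \<Longrightarrow> nul R P t \<Longrightarrow> nul R P (s - t)"
  and nul_uminus: "nul R P s \<Longrightarrow> nul R P (- s)"
  by (auto simp: nul_def rels_add tensor_rels.diff rels_uminus)

lemma nul_sum: "(\<And>i. i \<in> I \<Longrightarrow> nul R P (f i)) \<Longrightarrow> nul R P (sum f I)"
  by (induction I rule: infinite_finite_induct) (auto intro: nul_add)

lemma
  fixes P :: "int \<Rightarrow> ('r, 'a) module"
  shows rel_zero [simp]: "rel R P c 0 0"
  and rel_add: "rel R P c s t \<Longrightarrow> rel R P c s' t' \<Longrightarrow> rel R P c (s + s') (t + t')"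
  and rel_diff: "rel R P c s t \<Longrightarrow> rel R P c s' t' \<Longrightarrow> rel R P c (s - s') (t - t')"
  and rel_uminus: "rel R P c s t \<Longrightarrow> rel R P c (- s) (- t)"
proof -
  have *: "s + s' - (t + t') = (s - t) + (s' - t')" "s - s' - (t - t') = (s - t) - (s' - t')"
    "- s - (- t) = - (s - t)" for s s' t t' :: "('r, 'a) tensors"
    by (simp_all add: algebra_simps)
  show "rel R P c 0 0" by (simp add: rel_def)
  show "rel R P c s t \<Longrightarrow> rel R P c s' t' \<Longrightarrow> rel R P c (s + s') (t + t')"
    unfolding rel_def tens_simps * by (blast intro: rels_add)
  show "rel R P c s t \<Longrightarrow> rel R P c s' t' \<Longrightarrow> rel R P c (s - s') (t - t')"
    unfolding rel_def tens_simps by (metis *(2) tensor_rels.diff)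
  show "rel R P c s t \<Longrightarrow> rel R P c (- s) (- t)"
    unfolding rel_def tens_simps * by (blast intro: rels_uminus)
qed

lemma rel_sum: "(\<And>i. i \<in> I \<Longrightarrow> rel R P c (f i) (g i)) \<Longrightarrow> rel R P c (sum f I) (sum g I)"
  by (induction I rule: infinite_finite_induct) (auto intro: rel_add)

text \<open>Each generating relation concerns one slot or the coefficient, and it stays a generating
  relation when words are put around it. So the null sums form an ideal under concatenation.\<close>

lemma rels_translate:
  assumes "p \<in> words P" "q \<in> words P" "s \<in> tensor_rels R P"
  shows "frag_extend (\<lambda>(r, w). frag_of (r, p @ w @ q)) s \<in> tensor_rels R P"
  using assms(3)
proof induction
  case (slot_add r u v x k y)
  then show ?case
    using tensor_rels.slot_add[of r R "p @ u" P "v @ q" x k y] assms(1,2) by (simp add: frag_extend_diff)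
next
  case (scalar r s u v x k)
  then show ?case
    using tensor_rels.scalar[of r R s "p @ u" P "v @ q" x k] assms(1,2) by (simp add: frag_extend_diff)
next
  case (coeff_add r s w)
  then show ?case
    using tensor_rels.coeff_add[of r R s "p @ w @ q" P] assms(1,2) by (simp add: frag_extend_diff)
qed (auto simp: frag_extend_diff tensor_rels.diff)

lemma tens_translate: "tens r (frag_of p * s * frag_of q) = frag_extend (\<lambda>(r, w). frag_of (r, p @ w @ q)) (tens r s)"
  by (induction s rule: frag_induct_all) (auto simp: frag_of_mult frag_extend_diff left_diff_distrib right_diff_distrib)

lemma rel_mult_left: "good P p \<Longrightarrow> rel R P c s t \<Longrightarrow> rel R P c (p * s) (p * t)"
proof (induction p rule: good_induct)
  case (one w)
  have "tens r (frag_of w * s) - tens (r \<otimes>\<^bsub>R\<^esub> c) (frag_of w * t) \<in> tensor_rels R P" if "r \<in> carrier R" for r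
    using rels_translate[OF one(1) words_simps(1), of "tens r s - tens (r \<otimes>\<^bsub>R\<^esub> c) t" R] that \<open>rel R P c s t\<close>
    by (simp add: rel_def frag_extend_diff tens_translate[of _ w _ "[]", simplified])
  then show ?case by (simp add: rel_def)
qed (auto simp: left_diff_distrib rel_diff)

lemma rel_mult_right: "good P p \<Longrightarrow> rel R P c s t \<Longrightarrow> rel R P c (s * p) (t * p)"
proof (induction p rule: good_induct)
  case (one w)
  have "tens r (s * frag_of w) - tens (r \<otimes>\<^bsub>R\<^esub> c) (t * frag_of w) \<in> tensor_rels R P" if "r \<in> carrier R" for r
    using rels_translate[OF words_simps(1) one(1), of "tens r s - tens (r \<otimes>\<^bsub>R\<^esub> c) t" R] that \<open>rel R P c s t\<close>
    by (simp add: rel_def frag_extend_diff tens_translate[of _ "[]" _ w, simplified])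
  then show ?case by (simp add: rel_def)
qed (auto simp: right_diff_distrib rel_diff)

text \<open>Every cut lies on one side of the marked letter, so in each summand of a convolution
  only one factor contains it. This is why convolution preserves linearity in a slot.\<close>

lemma sum_cuts_slot:
  "sum f (cuts (u @ [z] @ v)) =
    (\<Sum>(u1, u2)\<in>cuts u. f (u1, u2 @ [z] @ v)) + (\<Sum>(v1, v2)\<in>cuts v. f (u @ [z] @ v1, v2))"
proof -
  let ?A = "(\<lambda>(u1, u2). (u1, u2 @ [z] @ v)) ` cuts u" and ?B = "(\<lambda>(v1, v2). (u @ [z] @ v1, v2)) ` cuts v"
  have "cuts (u @ [z] @ v) = ?A \<union> ?B"
  proof (intro equalityI subsetI)
    fix p assume "p \<in> cuts (u @ [z] @ v)"
    then obtain s t where p: "p = (s, t)" "s @ t = u @ [z] @ v" by (auto simp: cuts_def)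
    then obtain us where "s = u @ us \<and> us @ t = [z] @ v \<or> s @ us = u \<and> t = us @ [z] @ v"
      by (auto simp: append_eq_append_conv2)
    then show "p \<in> ?A \<union> ?B"
    proof (elim disjE conjE)
      assume a: "s = u @ us" "us @ t = [z] @ v"
      show ?thesis
      proof (cases us)
        case Nil
        then show ?thesis using a p by (auto intro!: image_eqI[where x = "(s, [])"])
      next
        case (Cons z' us')
        then show ?thesis using a p by (auto intro!: image_eqI[where x = "(us', t)"])
      qed
    next
      assume "s @ us = u" "t = us @ [z] @ v"
      then show ?thesis using p by (auto intro!: image_eqI[where x = "(s, us)"])
    qed
  qed auto
  moreover have "?A \<inter> ?B = {}"
    by auto
  moreover have "inj_on (\<lambda>(u1, u2). (u1, u2 @ [z] @ v)) (cuts u)" "inj_on (\<lambda>(v1, v2). (u @ [z] @ v1, v2)) (cuts v)"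
    by (auto simp: inj_on_def)
  ultimately show ?thesis
    by (simp add: sum.union_disjoint sum.reindex case_prod_unfold)
qed

lemma sum_cuts_slot':
  "(\<Sum>(s, t)\<in>cuts (u @ [z] @ v). h s t) =
    (\<Sum>(u1, u2)\<in>cuts u. h u1 (u2 @ [z] @ v)) + (\<Sum>(v1, v2)\<in>cuts v. h (u @ [z] @ v1) v2)"
  by (simp only: sum_cuts_slot prod.case)

context cring
begin

lemma nul_iff_rel: "nul R P s \<longleftrightarrow> rel R P \<one> s 0"
  by (auto simp: nul_def rel_def)

lemma nul_mult_left: "good P p \<Longrightarrow> nul R P s \<Longrightarrow> nul R P (p * s)"
  using rel_mult_left[of P p R \<one> s 0] by (simp add: nul_iff_rel)

lemma nul_mult_right: "good P p \<Longrightarrow> nul R P s \<Longrightarrow> nul R P (s * p)"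
  using rel_mult_right[of P p R \<one> s 0] by (simp add: nul_iff_rel)

lemma mlinI:
  assumes "\<And>w. w \<in> words P \<Longrightarrow> good Q (app a w)"
    and "\<And>u v k x y. u \<in> words P \<Longrightarrow> v \<in> words P \<Longrightarrow> x \<in> carrier (P k) \<Longrightarrow> y \<in> carrier (P k) \<Longrightarrow>
      nul R Q (app a (u @ [(k, x \<oplus>\<^bsub>P k\<^esub> y)] @ v) - app a (u @ [(k, x)] @ v) - app a (u @ [(k, y)] @ v))"
    and "\<And>u v k c x. u \<in> words P \<Longrightarrow> v \<in> words P \<Longrightarrow> c \<in> carrier R \<Longrightarrow> x \<in> carrier (P k) \<Longrightarrow>
      rel R Q c (app a (u @ [(k, c \<odot>\<^bsub>P k\<^esub> x)] @ v)) (app a (u @ [(k, x)] @ v))"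
  shows "mlin R P Q a"
  unfolding mlin_def using assms by blast

lemma mlinD:
  assumes "mlin R P Q a"
  shows "w \<in> words P \<Longrightarrow> good Q (app a w)"
    and "u \<in> words P \<Longrightarrow> v \<in> words P \<Longrightarrow> x \<in> carrier (P k) \<Longrightarrow> y \<in> carrier (P k) \<Longrightarrow>
      nul R Q (app a (u @ [(k, x \<oplus>\<^bsub>P k\<^esub> y)] @ v) - app a (u @ [(k, x)] @ v) - app a (u @ [(k, y)] @ v))"
    and "u \<in> words P \<Longrightarrow> v \<in> words P \<Longrightarrow> c \<in> carrier R \<Longrightarrow> x \<in> carrier (P k) \<Longrightarrow>
      rel R Q c (app a (u @ [(k, c \<odot>\<^bsub>P k\<^esub> x)] @ v)) (app a (u @ [(k, x)] @ v))"
  using assms unfolding mlin_def by blast+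

lemma mlin_zero: "mlin R P Q 0"
  by (rule mlinI) simp_all

lemma mlin_one: "mlin R P Q 1"
  by (rule mlinI) simp_all

lemma mlin_diff:
  assumes a: "mlin R P Q a" and b: "mlin R P Q b"
  shows "mlin R P Q (a - b)"
proof (rule mlinI)
  fix u v k x y assume *: "u \<in> words P" "v \<in> words P" "x \<in> carrier (P k)" "y \<in> carrier (P k)"
  show "nul R Q (app (a - b) (u @ [(k, x \<oplus>\<^bsub>P k\<^esub> y)] @ v) - app (a - b) (u @ [(k, x)] @ v) - app (a - b) (u @ [(k, y)] @ v))"
    using nul_diff[OF mlinD(2)[OF a *] mlinD(2)[OF b *]] by (simp add: algebra_simps)
qed (use mlinD[OF a] mlinD[OF b] in \<open>auto simp del: append.simps append_Cons intro: good_diff rel_diff\<close>)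

lemma mlin_uminus: "mlin R P Q a \<Longrightarrow> mlin R P Q (- a)"
  using mlin_diff[OF mlin_zero] by fastforce

lemma mlin_add: "mlin R P Q a \<Longrightarrow> mlin R P Q b \<Longrightarrow> mlin R P Q (a + b)"
  using mlin_diff[OF _ mlin_uminus] by fastforce

lemma mlin_sg: 
  assumes a: "mlin R P Q a"
  shows "mlin R P Q (sg a)"
proof (rule mlinI)
  fix u v k x y assume *: "u \<in> words P" "v \<in> words P" "x \<in> carrier (P k)" "y \<in> carrier (P k)"
  show "nul R Q (app (sg a) (u @ [(k, x \<oplus>\<^bsub>P k\<^esub> y)] @ v) - app (sg a) (u @ [(k, x)] @ v) - app (sg a) (u @ [(k, y)] @ v))"
    using mlinD(2)[OF a *] nul_uminus[OF mlinD(2)[OF a *]] by (auto simp: app_sg algebra_simps)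
next
  fix u v k c x assume *: "u \<in> words P" "v \<in> words P" "c \<in> carrier R" "x \<in> carrier (P k)"
  show "rel R Q c (app (sg a) (u @ [(k, c \<odot>\<^bsub>P k\<^esub> x)] @ v)) (app (sg a) (u @ [(k, x)] @ v))"
    using mlinD(3)[OF a *] rel_uminus[OF mlinD(3)[OF a *]] by (auto simp: app_sg)
qed (use mlinD(1)[OF a] in \<open>auto simp: app_sg good_uminus\<close>)

lemma mlin_mult:
  assumes a: "mlin R P Q a" and b: "mlin R P Q b"
  shows "mlin R P Q (a * b)"
proof (rule mlinI)
  fix w assume "w \<in> words P"
  then show "good Q (app (a * b) w)"
    unfolding app_mult by (intro good_sum) (auto intro!: good_mult mlinD(1)[OF a] mlinD(1)[OF b])
next
  fix u v k x y assume *: "u \<in> words P" "v \<in> words P" "x \<in> carrier (P k)" "y \<in> carrier (P k)"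
  let ?\<Delta> = "\<lambda>a u v. app a (u @ [(k, x \<oplus>\<^bsub>P k\<^esub> y)] @ v) - app a (u @ [(k, x)] @ v) - app a (u @ [(k, y)] @ v)"
  have "?\<Delta> (a * b) u v = (\<Sum>(u1, u2)\<in>cuts u. app a u1 * ?\<Delta> b u2 v) + (\<Sum>(v1, v2)\<in>cuts v. ?\<Delta> a u v1 * app b v2)"
    unfolding app_mult sum_cuts_slot' by (simp add: case_prod_unfold sum_subtractf right_diff_distrib left_diff_distrib)
  also have "nul R Q \<dots>"
    unfolding case_prod_unfold
    by (intro nul_add nul_sum nul_mult_left nul_mult_right mlinD[OF a] mlinD[OF b]) (use * in \<open>auto simp: cuts_def\<close>)
  finally show "nul R Q (?\<Delta> (a * b) u v)" .
next
  fix u v k c x assume *: "u \<in> words P" "v \<in> words P" "c \<in> carrier R" "x \<in> carrier (P k)"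
  show "rel R Q c (app (a * b) (u @ [(k, c \<odot>\<^bsub>P k\<^esub> x)] @ v)) (app (a * b) (u @ [(k, x)] @ v))"
    unfolding app_mult sum_cuts_slot'
    unfolding case_prod_unfold
    by (intro rel_add rel_sum rel_mult_left rel_mult_right mlinD[OF a] mlinD[OF b]) (use * in \<open>auto simp: cuts_def\<close>)
qed

lemma mlin_ident:
  assumes P: "\<And>k. module R (P k)"
  shows "mlin R P P ident"
proof (rule mlinI)
  fix u v k x y assume *: "u \<in> words P" "v \<in> words P" "x \<in> carrier (P k)" "y \<in> carrier (P k)"
  then show "nul R P (app ident (u @ [(k, x \<oplus>\<^bsub>P k\<^esub> y)] @ v) - app ident (u @ [(k, x)] @ v) - app ident (u @ [(k, y)] @ v))"
    using tensor_rels.slot_add[of _ R u P v x k y] by (simp add: nul_def)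
next
  fix u v k c x assume *: "u \<in> words P" "v \<in> words P" "c \<in> carrier R" "x \<in> carrier (P k)"
  then show "rel R P c (app ident (u @ [(k, c \<odot>\<^bsub>P k\<^esub> x)] @ v)) (app ident (u @ [(k, x)] @ v))"
    using tensor_rels.scalar[of _ R c u P v x k] by (simp add: rel_def)
qed simp

lemma mlin_power: "mlin R P Q a \<Longrightarrow> mlin R P Q (a ^ n)"
  by (induction n) (auto intro: mlin_one mlin_mult)

lemma mlin_sum: "(\<And>i. i \<in> I \<Longrightarrow> mlin R P Q (a i)) \<Longrightarrow> mlin R P Q (sum a I)"
  by (induction I rule: infinite_finite_induct) (auto intro: mlin_zero mlin_add)

end

lemma power_mult_vanish:
  assumes "app \<phi> [] = 0"
  shows "length w < n \<Longrightarrow> app (\<phi> ^ n * X) w = 0"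
proof (induction n arbitrary: w)
  case (Suc n)
  have "app \<phi> u * app (\<phi> ^ n * X) v = 0" if "u @ v = w" for u v
    using Suc assms that by (cases "u = []"; cases u) auto
  then have "(\<Sum>(u, v)\<in>cuts w. app \<phi> u * app (\<phi> ^ n * X) v) = 0"
    by (intro sum.neutral) auto
  then show ?case by (simp add: mult.assoc app_mult[of \<phi>])
qed simp

text \<open>A product of \<open>n\<close> factors that kill the empty word vanishes on words shorter
  than \<open>n\<close>. So on each single word \<open>star\<close> is a finite polynomial, and its
  closure properties reduce to those of sums and products.\<close>

lemma star_eq_sum_powers:
  assumes "app \<phi> [] = 0" "length w < n"
  shows "app (star \<phi>) w = app (\<Sum>i<n. \<phi> ^ i) w"
proof -
  have "star \<phi> = (\<Sum>i<n. \<phi> ^ i) + \<phi> ^ n * star \<phi>"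
  proof (induction n)
    case (Suc n)
    have "\<phi> ^ n * star \<phi> = \<phi> ^ n * (1 + \<phi> * star \<phi>)" using star_unfold[OF assms(1)] by simp
    also have "\<dots> = \<phi> ^ n + \<phi> ^ Suc n * star \<phi>" by (simp add: distrib_left power_commutes mult.assoc[symmetric])
    finally show ?case using Suc by (simp add: add.assoc)
  qed simp
  then show ?thesis using power_mult_vanish[OF assms, of "star \<phi>"] by (metis add.right_neutral app_simps(3))
qed

context cring
begin

lemma mlin_star:
  assumes a: "mlin R P Q \<phi>" and z: "app \<phi> [] = 0"
  shows "mlin R P Q (star \<phi>)"
proof (rule mlinI)
  note S = mlin_sum[where a = "\<lambda>i. \<phi> ^ i", OF mlin_power[OF a], where I = "{..<n}" for n]
  show "good Q (app (star \<phi>) w)" if "w \<in> words P" for w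
    using mlinD(1)[OF S that, of "Suc (length w)"] star_eq_sum_powers[OF z, of w "Suc (length w)"] by simp
  fix u v k x y assume *: "u \<in> words P" "v \<in> words P" "x \<in> carrier (P k)"
  have E: "app (star \<phi>) (u @ [z] @ v) = app (\<Sum>i<length u + length v + 2. \<phi> ^ i) (u @ [z] @ v)" for z
    by (rule star_eq_sum_powers[OF z]) simp
  show "nul R Q (app (star \<phi>) (u @ [(k, x \<oplus>\<^bsub>P k\<^esub> y)] @ v) - app (star \<phi>) (u @ [(k, x)] @ v) - app (star \<phi>) (u @ [(k, y)] @ v))"
    if "y \<in> carrier (P k)"
    unfolding E using mlinD(2)[OF S * that] .
  show "rel R Q c (app (star \<phi>) (u @ [(k, c \<odot>\<^bsub>P k\<^esub> x)] @ v)) (app (star \<phi>) (u @ [(k, x)] @ v))"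
    if "c \<in> carrier R" for c
    unfolding E using mlinD(3)[OF S *(1,2) that *(3)] .
qed

lemma rext_rels:
  assumes a: "mlin R P Q a" and "s \<in> tensor_rels R P"
  shows "rext a s \<in> tensor_rels R Q"
  using assms(2)
proof induction
  case (coeff_add r s w)
  have "tens (r \<oplus> s) X - tens r X - tens s X \<in> tensor_rels R Q" if "good Q X" for X
    using that
  proof (induction X rule: good_induct)
    case (one w)
    then show ?case using tensor_rels.coeff_add coeff_add by simp
  next
    case (diff X Y)
    then show ?case using tensor_rels.diff[OF diff] by (simp add: algebra_simps)
  qed simp
  then show ?case using mlinD(1)[OF a coeff_add(3)] by simp
next
  case (slot_add r u v x k y)
  then show ?case using mlinD(2)[OF a, of u v x k y] by (simp add: nul_def)
next
  case (scalar r s u v x k)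
  then show ?case using mlinD(3)[OF a, of u v s x k] by (simp add: rel_def)
qed (auto intro: tensor_rels.diff)

lemma rel_ext:
  assumes "mlin R P Q a" "rel R P c s t"
  shows "rel R Q c (ext a s) (ext a t)"
  unfolding rel_def
proof
  fix r assume "r \<in> carrier R"
  then show "tens r (ext a s) - tens (r \<otimes> c) (ext a t) \<in> tensor_rels R Q"
    using rext_rels[OF assms(1), of "tens r s - tens (r \<otimes> c) t"] assms(2) by (simp add: rel_def)
qed

lemma nul_ext: "mlin R P Q a \<Longrightarrow> nul R P s \<Longrightarrow> nul R Q (ext a s)"
  using rel_ext[of P Q a \<one> s 0] by (simp add: nul_iff_rel)

lemma mlin_comp:
  assumes a: "mlin R Q T a" and b: "mlin R P Q b"
  shows "mlin R P T (a \<bullet> b)"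
proof (rule mlinI)
  show "good T (app (a \<bullet> b) w)" if "w \<in> words P" for w
    unfolding app_comp by (rule good_ext[OF mlinD(1)[OF b that] mlinD(1)[OF a]])
  show "nul R T (app (a \<bullet> b) (u @ [(k, x \<oplus>\<^bsub>P k\<^esub> y)] @ v) - app (a \<bullet> b) (u @ [(k, x)] @ v) - app (a \<bullet> b) (u @ [(k, y)] @ v))"
    if "u \<in> words P" "v \<in> words P" "x \<in> carrier (P k)" "y \<in> carrier (P k)" for u v x k y
    using nul_ext[OF a mlinD(2)[OF b that]] by (simp add: app_comp)
  show "rel R T c (app (a \<bullet> b) (u @ [(k, c \<odot>\<^bsub>P k\<^esub> x)] @ v)) (app (a \<bullet> b) (u @ [(k, x)] @ v))"
    if "u \<in> words P" "v \<in> words P" "c \<in> carrier R" "x \<in> carrier (P k)" for u v c x k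
    using rel_ext[OF a mlinD(3)[OF b that]] by (simp add: app_comp)
qed

end

section \<open>Supports, degrees and signs\<close>

definition supp :: "('x list \<Rightarrow> 'y list \<Rightarrow> bool) \<Rightarrow> ('x, 'y) oper \<Rightarrow> bool" where
  "supp \<Phi> a \<longleftrightarrow> (\<forall>w. \<forall>v\<in>Poly_Mapping.keys (app a w). \<Phi> w v)"

lemma suppD: "supp \<Phi> a \<Longrightarrow> v \<in> Poly_Mapping.keys (app a w) \<Longrightarrow> \<Phi> w v"
  by (auto simp: supp_def)

lemma supp_zero: "supp \<Phi> 0"
  by (simp add: supp_def)

lemma supp_one: "\<Phi> [] [] \<Longrightarrow> supp \<Phi> 1"
  by (auto simp: supp_def one_sums)

lemma supp_diff: "supp \<Phi> a \<Longrightarrow> supp \<Phi> b \<Longrightarrow> supp \<Phi> (a - b)"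
  using keys_diff by (fastforce simp: supp_def)

lemma supp_uminus: "supp \<Phi> a \<Longrightarrow> supp \<Phi> (- a)"
  by (simp add: supp_def)

lemma supp_add: "supp \<Phi> a \<Longrightarrow> supp \<Phi> b \<Longrightarrow> supp \<Phi> (a + b)"
  using supp_diff[OF _ supp_uminus] by force

lemma supp_sg: "supp \<Phi> a \<Longrightarrow> supp \<Phi> (sg a)"
  by (simp add: supp_def app_sg)

lemma keys_mult_append: "v \<in> Poly_Mapping.keys (s * t :: 'y sums) \<Longrightarrow>
    \<exists>p\<in>Poly_Mapping.keys s. \<exists>q\<in>Poly_Mapping.keys t. v = p @ q"
  using keys_mult[of s t] unfolding plus_list_def by blast

lemma keys_sum_ex: "v \<in> Poly_Mapping.keys (sum f I) \<Longrightarrow> \<exists>i\<in>I. v \<in> Poly_Mapping.keys (f i :: 'y sums)"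
proof (induction I rule: infinite_finite_induct)
  case (insert i I)
  then show ?case using keys_add[of "f i" "sum f I"] by auto
qed auto

lemma keys_app_mult: "v \<in> Poly_Mapping.keys (app (a * b) w) \<Longrightarrow>
    \<exists>w1 w2 v1 v2. w = w1 @ w2 \<and> v = v1 @ v2 \<and> v1 \<in> Poly_Mapping.keys (app a w1) \<and> v2 \<in> Poly_Mapping.keys (app b w2)"
proof -
  assume "v \<in> Poly_Mapping.keys (app (a * b) w)"
  then obtain p where "p \<in> cuts w" "v \<in> Poly_Mapping.keys (app a (fst p) * app b (snd p))"
    unfolding app_mult case_prod_unfold by (blast dest: keys_sum_ex)
  then show ?thesis unfolding cuts_def by (auto dest!: keys_mult_append) blast
qed

lemma supp_mult:
  assumes "supp \<Phi> a" "supp \<Psi> b" "\<And>w1 v1 w2 v2. \<Phi> w1 v1 \<Longrightarrow> \<Psi> w2 v2 \<Longrightarrow> \<Xi> (w1 @ w2) (v1 @ v2)"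
  shows "supp \<Xi> (a * b)"
  using assms unfolding supp_def by (blast dest: keys_app_mult)

lemma supp_star:
  assumes "supp \<Phi> \<phi>" "app \<phi> [] = 0" "\<Phi> [] []"
    and "\<And>w1 v1 w2 v2. \<Phi> w1 v1 \<Longrightarrow> \<Phi> w2 v2 \<Longrightarrow> \<Phi> (w1 @ w2) (v1 @ v2)"
  shows "supp \<Phi> (star \<phi>)"
proof -
  have p: "supp \<Phi> (\<phi> ^ n)" for n
    by (induction n) (auto intro: supp_one supp_mult assms)
  have *: "supp \<Phi> (\<Sum>i<n. \<phi> ^ i)" for n
    by (induction n) (auto intro: supp_zero supp_add p)
  have "\<Phi> w v" if "v \<in> Poly_Mapping.keys (app (star \<phi>) w)" for w v
    using suppD[OF *] star_eq_sum_powers[OF assms(2) lessI] that by metis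
  then show ?thesis unfolding supp_def by blast
qed

lemma keys_ext_ex: "v \<in> Poly_Mapping.keys (ext a s) \<Longrightarrow> \<exists>u\<in>Poly_Mapping.keys s. v \<in> Poly_Mapping.keys (app a u)"
  using keys_frag_extend[of "app a" s] by (auto simp: ext_def)

lemma supp_comp:
  assumes "supp \<Phi> a" "supp \<Psi> b" "\<And>w v t. \<Psi> w v \<Longrightarrow> \<Phi> v t \<Longrightarrow> \<Xi> w t"
  shows "supp \<Xi> (a \<bullet> b)"
  using assms unfolding supp_def app_comp by (blast dest: keys_ext_ex)

definition hom :: "int \<Rightarrow> (int \<times> 'a, int \<times> 'b) oper \<Rightarrow> bool" where
  "hom e = supp (\<lambda>w v. wdeg v = wdeg w + e)"

lemma hom_zero [simp]: "hom e 0" and hom_one [simp]: "hom 0 1"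
  by (simp_all add: hom_def supp_zero supp_one)

lemma hom_ident [simp]: "hom 0 ident" and hom_pr [simp]: "hom 0 pr"
  by (simp_all add: hom_def supp_def app_pr)

lemma hom_diff: "hom e a \<Longrightarrow> hom e b \<Longrightarrow> hom e (a - b)"
  and hom_add: "hom e a \<Longrightarrow> hom e b \<Longrightarrow> hom e (a + b)"
  and hom_uminus: "hom e a \<Longrightarrow> hom e (- a)"
  and hom_sg: "hom e a \<Longrightarrow> hom e (sg a)"
  by (simp_all add: hom_def supp_diff supp_add supp_uminus supp_sg)

lemma hom_mult: "hom e a \<Longrightarrow> hom f b \<Longrightarrow> hom (e + f) (a * b)"
  unfolding hom_def by (erule supp_mult) auto

lemma hom_comp: "hom e a \<Longrightarrow> hom f b \<Longrightarrow> hom (e + f) (a \<bullet> b)"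
  unfolding hom_def by (erule supp_comp) auto

lemma hom_star: "hom 0 \<phi> \<Longrightarrow> app \<phi> [] = 0 \<Longrightarrow> hom 0 (star \<phi>)"
  unfolding hom_def by (erule supp_star) auto

lemma hom_coder: "hom e \<beta> \<Longrightarrow> hom e (coder \<beta>)"
  using hom_mult[OF hom_mult[OF hom_sg[OF hom_ident]] hom_ident] by (fastforce simp: coder_def)

lemma hom_htpy: "hom 0 \<phi> \<Longrightarrow> hom e \<eta> \<Longrightarrow> hom 0 \<gamma> \<Longrightarrow> lv \<phi> \<Longrightarrow> lv \<gamma> \<Longrightarrow> hom e (htpy \<phi> \<eta> \<gamma>)"
  using hom_mult[OF hom_mult[OF hom_sg[OF hom_star]] hom_star] by (fastforce simp: htpy_def)

text \<open>An operator of odd degree changes the parity that \<open>sg\<close> reads off its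
  argument.\<close>

lemma sg_comp:
  assumes "hom e b"
  shows "sg a \<bullet> b = (if even e then sg (a \<bullet> b) else - sg (a \<bullet> b))"
proof (rule oper_eqI)
  fix w
  have "ext (sg a) s = (if even n then ext a s else - ext a s)"
    if "Poly_Mapping.keys s \<subseteq> {v. wdeg v = n}" for s n
    using that by (induction s rule: frag_induction) (auto simp: app_sg)
  from this[of "app b w" "wdeg w + e"]
  show "app (sg a \<bullet> b) w = app (if even e then sg (a \<bullet> b) else - sg (a \<bullet> b)) w"
    using assms by (auto simp: app_comp app_sg hom_def supp_def subset_iff)
qed

definition low :: "nat \<Rightarrow> ('x, 'y) oper \<Rightarrow> bool" where
  "low j = supp (\<lambda>w v. length v + j \<le> length w)"

lemma low_ident [simp]: "low 0 ident"
  by (simp add: low_def supp_def)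

lemma low_sg: "low j a \<Longrightarrow> low j (sg a)"
  by (simp add: low_def supp_sg)

lemma low_mult: "low i a \<Longrightarrow> low j b \<Longrightarrow> low (i + j) (a * b)"
  unfolding low_def by (erule (1) supp_mult) auto

lemma low_lv: "lv a \<Longrightarrow> low 0 a"
  unfolding low_def supp_def lv_def
  by (metis (no_types, lifting) One_nat_def Suc_leI add.right_neutral empty_iff image_iff in_mono keys_zero
      length_greater_0_conv length_Cons list.size(3))

lemma low_star: "lv \<phi> \<Longrightarrow> low 0 (star \<phi>)"
  using low_lv[of \<phi>] unfolding low_def by (intro supp_star) auto

subsection \<open>Composites with coderivations, coalgebra maps and homotopies\<close>

lemma one_comp_mult: "lv \<phi> \<Longrightarrow> 1 \<bullet> (\<phi> * X) = 0"
proof (rule oper_eqI)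
  fix w assume "lv \<phi>"
  then show "app (1 \<bullet> (\<phi> * X)) w = app 0 w"
    unfolding app_comp app_mult ext_sum case_prod_unfold
    by (auto simp: lv_def intro!: sum.neutral ext_one_mult)
qed

lemma one_comp_one: "(1 :: ('y, 'z) oper) \<bullet> (1 :: ('x, 'y) oper) = 1"
  by (rule oper_eqI) (simp add: app_comp one_sums)

lemma one_comp_star: "lv \<phi> \<Longrightarrow> 1 \<bullet> star \<phi> = 1"
  using star_unfold[of \<phi>] one_comp_mult[of \<phi> "star \<phi>"] by (metis add.right_neutral comp_simps(4) lv_Nil one_comp_one)

lemma star_unfold_sg:
  assumes "lv \<phi>"
  shows "sg \<phi> * sg (star \<phi>) = sg (star \<phi>) - 1"
  using assms by (metis sg_mult sg_simps(2,4) star_mult(1) lv_Nil)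

lemma htpy_unfold:
  assumes "lv \<phi>"
  shows "htpy \<phi> \<eta> \<gamma> = sg \<phi> * htpy \<phi> \<eta> \<gamma> + \<eta> * star \<gamma>"
  unfolding htpy_def mult.assoc[symmetric] by (simp add: star_unfold_sg[OF assms] algebra_simps)

lemma one_comp_htpy: "lv \<phi> \<Longrightarrow> lv \<eta> \<Longrightarrow> 1 \<bullet> htpy \<phi> \<eta> \<gamma> = 0"
  by (subst htpy_unfold) (simp_all add: one_comp_mult lv_sg)

lemma ext_pr_mult:
  assumes "Poly_Mapping.keys s \<subseteq> range (\<lambda>x. [x])"
  shows "ext pr (s * t) = s * ext 1 t"
  using assms
proof (induction s rule: frag_induction)
  case (one w)
  then obtain x where w: "w = [x]" by blast
  show ?case unfolding w
    by (induction t rule: frag_induct_all) (auto simp: frag_of_mult app_pr algebra_simps one_sums)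
qed (auto simp: algebra_simps)

text \<open>The first letter of the output comes from \<open>\<phi>\<close>, so an output of length
  one forces \<open>X\<close> to contribute the empty word.\<close>

lemma pr_comp_mult: "lv \<phi> \<Longrightarrow> pr \<bullet> (\<phi> * X) = \<phi> * (1 \<bullet> X)"
proof (rule oper_eqI)
  fix w assume "lv \<phi>"
  then show "app (pr \<bullet> (\<phi> * X)) w = app (\<phi> * (1 \<bullet> X)) w"
    unfolding app_comp app_mult ext_sum case_prod_unfold
    by (auto simp: lv_def app_comp intro!: sum.cong ext_pr_mult)
qed

lemma pr_comp_star: "lv \<phi> \<Longrightarrow> pr \<bullet> star \<phi> = \<phi>"
proof -
  assume \<phi>: "lv \<phi>"
  have "pr \<bullet> 1 = 0" by (rule oper_eqI) (simp add: app_comp one_sums app_pr)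
  moreover have "pr \<bullet> star \<phi> = pr \<bullet> (1 + \<phi> * star \<phi>)" using star_unfold[of \<phi>] \<phi> by simp
  ultimately show ?thesis by (simp add: pr_comp_mult[OF \<phi>] one_comp_star[OF \<phi>])
qed

lemma pr_comp_htpy: "lv \<phi> \<Longrightarrow> lv \<eta> \<Longrightarrow> lv \<gamma> \<Longrightarrow> pr \<bullet> htpy \<phi> \<eta> \<gamma> = \<eta>"
  by (subst htpy_unfold) (simp_all add: pr_comp_mult lv_sg one_comp_htpy one_comp_star)

lemma comp_mult_htpy:
  assumes "lv \<phi>" "lv \<eta>" "lv \<gamma>"
  shows "(a * b) \<bullet> htpy \<phi> \<eta> \<gamma> =
    sg (a \<bullet> star \<phi>) * (b \<bullet> htpy \<phi> \<eta> \<gamma>) + (a \<bullet> htpy \<phi> \<eta> \<gamma>) * (b \<bullet> star \<gamma>)"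
  unfolding htpy_def by (rule comp_mult_homotopy[OF assms])

lemma comp_mult_coder:
  "lv \<beta> \<Longrightarrow> (a * b) \<bullet> coder \<beta> = sg a * (b \<bullet> coder \<beta>) + (a \<bullet> coder \<beta>) * b"
  unfolding coder_eq_htpy by (subst comp_mult_htpy) (simp_all add: lv_pr flip: ident_eq_star)

lemma one_comp_coder: "lv \<beta> \<Longrightarrow> 1 \<bullet> coder \<beta> = 0"
  unfolding coder_eq_htpy by (simp add: one_comp_htpy lv_pr)

lemma pr_comp_coder: "lv \<beta> \<Longrightarrow> pr \<bullet> coder \<beta> = \<beta>"
  unfolding coder_eq_htpy by (simp add: pr_comp_htpy lv_pr)

lemma coder_comp_star:
  assumes "lv \<phi>" "hom 0 \<phi>"
  shows "coder \<beta> \<bullet> star \<phi> = sg (star \<phi>) * (\<beta> \<bullet> star \<phi>) * star \<phi>"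
  unfolding coder_def using assms by (simp add: comp_mult_star sg_comp[OF hom_star])

text \<open>Both sides solve the fixed point equation for \<open>sg \<phi>\<close>. Together with
  \<open>coder_comp_star\<close> this brings both composites of the morphism equation into the form
  \<open>sg (star \<phi>) * _ * star \<phi>\<close>, so that the equation reduces to one between
  letter-valued middle factors.\<close>

lemma star_comp_coder:
  assumes "lv \<phi>" "lv \<beta>"
  shows "star \<phi> \<bullet> coder \<beta> = sg (star \<phi>) * (\<phi> \<bullet> coder \<beta>) * star \<phi>"
proof -
  let ?d = "coder \<beta>" and ?F = "star \<phi>"
  let ?Y = "sg ?F * (\<phi> \<bullet> ?d) * ?F"
  have "?F \<bullet> ?d = (1 + \<phi> * ?F) \<bullet> ?d" using star_unfold[of \<phi>] assms(1) by simp
  also have "\<dots> = sg \<phi> * (?F \<bullet> ?d) + (\<phi> \<bullet> ?d) * ?F"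
    by (simp add: comp_mult_coder[OF assms(2)] one_comp_coder[OF assms(2)])
  finally have 1: "?F \<bullet> ?d = sg \<phi> * (?F \<bullet> ?d) + (\<phi> \<bullet> ?d) * ?F" .
  have 2: "?Y = sg \<phi> * ?Y + (\<phi> \<bullet> ?d) * ?F"
    unfolding mult.assoc[symmetric] by (simp add: star_unfold_sg[OF assms(1)] algebra_simps)
  have "?F \<bullet> ?d - ?Y = sg \<phi> * (?F \<bullet> ?d) + (\<phi> \<bullet> ?d) * ?F - (sg \<phi> * ?Y + (\<phi> \<bullet> ?d) * ?F)"
    using 1 2 by metis
  also have "\<dots> = sg \<phi> * (?F \<bullet> ?d - ?Y)" by (simp add: algebra_simps)
  finally have "?F \<bullet> ?d - ?Y = 0"
    by (intro fixpoint_unique[of "sg \<phi>"]) (simp_all add: assms(1) lv_sg)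
  then show ?thesis by simp
qed

text \<open>The terms in which two copies of \<open>\<beta>\<close> act on disjoint parts of a word
  cancel in pairs, since \<open>\<beta>\<close> is odd. What remains is \<open>\<beta>\<close>
  applied to a block containing the letter that the other copy has produced.\<close>

lemma coder_comp_coder:
  assumes "lv \<beta>" "hom 1 \<beta>"
  shows "coder \<beta> \<bullet> coder \<beta> = ident * (\<beta> \<bullet> coder \<beta>) * ident"
proof -
  let ?d = "coder \<beta>"
  have "sg ident \<bullet> ?d = - sg ?d" using sg_comp[OF hom_coder[OF assms(2)], of ident] by simp
  then have "(sg ident * \<beta> * ident) \<bullet> ?d = (ident * (\<beta> \<bullet> ?d) - sg ?d * \<beta>) * ident + ident * sg \<beta> * ?d"
    by (simp add: comp_mult_coder[OF assms(1)])
  also have "\<dots> = ident * (\<beta> \<bullet> ?d) * ident"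
    by (simp add: coder_def algebra_simps)
  finally show ?thesis by (simp add: coder_def)
qed

text \<open>If \<open>p\<close> and \<open>q\<close> are morphisms, the last two summands vanish, and the sum on the left is
  determined by its projection.\<close>

lemma htpy_boundary:
  assumes lv: "lv p" "lv \<eta>" "lv q" "lv \<beta>" and hom: "hom 0 p" "hom (- 1) \<eta>" "hom 0 q" "hom 1 \<beta>"
  defines "D \<equiv> htpy p \<eta> q"
  shows "coder \<alpha> \<bullet> D + D \<bullet> coder \<beta> =
    star p * (\<alpha> \<bullet> D + \<eta> \<bullet> coder \<beta>) * star q
    + star p * sg (\<alpha> \<bullet> star p - p \<bullet> coder \<beta>) * D - sg D * (\<alpha> \<bullet> star q - q \<bullet> coder \<beta>) * star q"
proof -
  let ?P = "star p" and ?Q = "star q" and ?d = "coder \<beta>"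
  have homP: "hom 0 ?P" and homD: "hom (- 1) D" and homd: "hom 1 ?d"
    using hom lv by (simp_all add: D_def hom_star hom_htpy hom_coder)
  have D: "(a * b) \<bullet> D = sg (a \<bullet> ?P) * (b \<bullet> D) + (a \<bullet> D) * (b \<bullet> ?Q)" for a b :: "(int \<times> 'b, int \<times> 'c) oper"
    unfolding D_def by (rule comp_mult_htpy[OF lv(1-3)])
  have sP: "sg ident \<bullet> ?P = sg ?P" and sD: "sg ident \<bullet> D = - sg D"
    using sg_comp[OF homP, of ident] sg_comp[OF homD, of ident] by simp_all
  have 1: "coder \<alpha> \<bullet> D = ?P * sg (\<alpha> \<bullet> ?P) * D + (?P * (\<alpha> \<bullet> D) - sg D * (\<alpha> \<bullet> ?Q)) * ?Q"
    unfolding coder_def by (simp add: D sP sD comp_mult_star[OF lv(1)])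
  have sPd: "sg ?P \<bullet> ?d = - (?P * sg (p \<bullet> ?d) * sg ?P)"
    using sg_comp[OF homd, of ?P] star_comp_coder[OF lv(1,4)] by simp
  have 2: "D \<bullet> ?d = (?P * (\<eta> \<bullet> ?d) - ?P * sg (p \<bullet> ?d) * sg ?P * \<eta>) * ?Q + ?P * sg \<eta> * sg ?Q * (q \<bullet> ?d) * ?Q"
    unfolding D_def htpy_def
    by (simp add: comp_mult_coder[OF lv(4)] sPd star_comp_coder[OF lv(3,4)] algebra_simps)
  have 3: "D = sg ?P * \<eta> * ?Q" "sg D = ?P * sg \<eta> * sg ?Q" by (simp_all add: D_def htpy_def)
  show ?thesis
    unfolding 1 2 by (simp add: 3 algebra_simps)
qed

section \<open>The length filtration\<close>

text \<open>Order at least \<open>k\<close> in the length filtration, modulo the tensor relations.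
  Well-formedness is demanded on words of every length, so that products and composites stay
  meaningful; for \<open>k = 0\<close> this demand is all that is left.\<close>

definition Null :: "('r, 'x) ring_scheme \<Rightarrow> (int \<Rightarrow> ('r, 'a) module) \<Rightarrow> (int \<Rightarrow> ('r, 'b) module) \<Rightarrow> nat \<Rightarrow>
    (int \<times> 'a, int \<times> 'b) oper \<Rightarrow> bool" where
  "Null R P Q k a \<longleftrightarrow> (\<forall>w\<in>words P. good Q (app a w) \<and> (length w < k \<longrightarrow> nul R Q (app a w)))"

abbreviation Nul :: "('r, 'x) ring_scheme \<Rightarrow> (int \<Rightarrow> ('r, 'a) module) \<Rightarrow> (int \<Rightarrow> ('r, 'b) module) \<Rightarrow>
    (int \<times> 'a, int \<times> 'b) oper \<Rightarrow> bool" where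
  "Nul R P Q a \<equiv> \<forall>k. Null R P Q k a"

lemma NullD: "Null R P Q k a \<Longrightarrow> w \<in> words P \<Longrightarrow> good Q (app a w)"
  "Null R P Q k a \<Longrightarrow> w \<in> words P \<Longrightarrow> length w < k \<Longrightarrow> nul R Q (app a w)"
  by (auto simp: Null_def)

lemma Null_mono: "Null R P Q k a \<Longrightarrow> j \<le> k \<Longrightarrow> Null R P Q j a"
  by (auto simp: Null_def)

lemma NulI: "(\<And>w. w \<in> words P \<Longrightarrow> good Q (app a w)) \<Longrightarrow> (\<And>w. w \<in> words P \<Longrightarrow> nul R Q (app a w)) \<Longrightarrow> Nul R P Q a"
  by (auto simp: Null_def)

lemma NulD: "Nul R P Q a \<Longrightarrow> w \<in> words P \<Longrightarrow> nul R Q (app a w)"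
  by (meson NullD(2) lessI)

lemma Null_zero [simp]: "Null R P Q k 0"
  and Null_diff: "Null R P Q k a \<Longrightarrow> Null R P Q k b \<Longrightarrow> Null R P Q k (a - b)"
  and Null_add: "Null R P Q k a \<Longrightarrow> Null R P Q k b \<Longrightarrow> Null R P Q k (a + b)"
  and Null_uminus: "Null R P Q k a \<Longrightarrow> Null R P Q k (- a)"
  and Null_sg: "\<And>c. Null R P Q k c \<Longrightarrow> Null R P Q k (sg c)"
  by (simp_all add: Null_def good_diff good_add good_uminus nul_diff nul_add nul_uminus app_sg)

lemma Null_cancel: "Null R P Q k (a - b) \<Longrightarrow> Null R P Q k b \<Longrightarrow> Null R P Q k a"
  using Null_add by fastforce

definition fop :: "int \<Rightarrow> ('m word \<Rightarrow> 'n) \<Rightarrow> (int \<times> 'm, int \<times> 'n) oper" where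
  "fop e b = lop (\<lambda>w. (wdeg w + e, b w))"

lemma lv_fop [simp]: "lv (fop e b)"
  by (simp add: fop_def)

lemma app_fop: "app (fop e b) w = (if w = [] then 0 else frag_of [(wdeg w + e, b w)])"
  by (simp add: fop_def app_lop)

lemma hom_fop: "hom e (fop e b)"
  by (simp add: hom_def supp_def app_fop)

context cring
begin

lemma mlin_Null: "mlin R P Q a \<Longrightarrow> Null R P Q 0 a"
  by (simp add: Null_def mlinD(1))

text \<open>Every cut of a word shorter than \<open>i + j\<close> has a left piece shorter than
  \<open>i\<close> or a right piece shorter than \<open>j\<close>.\<close>

lemma Null_mult:
  assumes a: "Null R P Q i a" and b: "Null R P Q j b"
  shows "Null R P Q (i + j) (a * b)"
proof -
  have "good Q (app (a * b) w)" if "w \<in> words P" for w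
    unfolding app_mult using that
    by (auto intro!: good_sum good_mult NullD(1)[OF a] NullD(1)[OF b])
  moreover have "nul R Q (app (a * b) w)" if "w \<in> words P" "length w < i + j" for w
    unfolding app_mult
  proof (intro nul_sum, clarsimp simp: cuts_def)
    fix u v assume w: "w = u @ v"
    then have "length u < i \<or> length v < j" using that by auto
    then show "nul R Q (app a u * app b v)"
      using that w by (auto intro: nul_mult_left nul_mult_right NullD[OF a] NullD[OF b])
  qed
  ultimately show ?thesis by (simp add: Null_def)
qed

lemma Null_mult_left: "mlin R P Q a \<Longrightarrow> Null R P Q k b \<Longrightarrow> Null R P Q k (a * b)"
  using Null_mult[OF mlin_Null] by fastforce

lemma Null_mult_right: "mlin R P Q a \<Longrightarrow> Null R P Q k b \<Longrightarrow> Null R P Q k (b * a)"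
  using Null_mult[OF _ mlin_Null] by fastforce

lemma Null_comp_left:
  assumes a: "mlin R Q T a" and b: "Null R P Q k b"
  shows "Null R P T k (a \<bullet> b)"
  using NullD[OF b] by (auto simp: Null_def app_comp intro: nul_ext[OF a] good_ext mlinD(1)[OF a])

text \<open>On a word shorter than \<open>k + j\<close> the operator \<open>b\<close> produces only
  words shorter than \<open>k\<close>. This is how composing with a word-shortening operator gains
  order.\<close>

lemma Null_comp_low:
  assumes a: "Null R Q T k a" and b: "Null R P Q 0 b" "low j b"
  shows "Null R P T (k + j) (a \<bullet> b)"
proof -
  have "nul R T (ext a s)" if "good Q s" "Poly_Mapping.keys s \<subseteq> {v. length v < k}" for s
  proof -
    from that have "Poly_Mapping.keys s \<subseteq> {v \<in> words Q. length v < k}" by (auto simp: good_def)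
    then show ?thesis
      by (induction s rule: frag_induction) (auto intro: nul_diff NullD(2)[OF a])
  qed
  then show ?thesis
    using b by (fastforce simp: Null_def app_comp low_def supp_def intro: good_ext NullD(1)[OF a])
qed

lemma Nul_comp_right:
  assumes a: "Nul R Q T a" and b: "mlin R P Q b"
  shows "Nul R P T (a \<bullet> b)"
proof (rule NulI)
  fix w assume w: "w \<in> words P"
  show "good T (app (a \<bullet> b) w)" unfolding app_comp
    by (rule good_ext[OF mlinD(1)[OF b w]]) (use a in \<open>auto simp: Null_def\<close>)
  have "nul R T (ext a s)" if "good Q s" for s
    using that by (induction s rule: good_induct) (auto intro: nul_diff NulD[OF a])
  then show "nul R T (app (a \<bullet> b) w)" unfolding app_comp using mlinD(1)[OF b w] by blast
qed

definition gmod :: "(int \<Rightarrow> ('a, 'm) module) \<Rightarrow> bool" where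
  "gmod P \<longleftrightarrow> (\<forall>k. module R (P k))"

lemma gmodD: "gmod P \<Longrightarrow> module R (P k)"
  by (simp add: gmod_def)

lemma mlin_pr: "gmod P \<Longrightarrow> mlin R P P pr"
  using mlin_ident[of P]
  by (auto simp: gmod_def mlin_def app_pr)

lemma mlin_coder: "gmod P \<Longrightarrow> mlin R P P \<beta> \<Longrightarrow> mlin R P P (coder \<beta>)"
  unfolding coder_def by (intro mlin_mult mlin_sg mlin_ident gmodD)

lemma mlin_htpy: "mlin R P Q \<phi> \<Longrightarrow> mlin R P Q \<eta> \<Longrightarrow> mlin R P Q \<gamma> \<Longrightarrow> lv \<phi> \<Longrightarrow> lv \<gamma> \<Longrightarrow> mlin R P Q (htpy \<phi> \<eta> \<gamma>)"
  unfolding htpy_def by (intro mlin_mult mlin_sg mlin_star) auto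

lemma Null_star_diff:
  assumes "mlin R P Q \<phi>" "mlin R P Q \<psi>" "lv \<phi>" "lv \<psi>" "Null R P Q k (\<psi> - \<phi>)"
  shows "Null R P Q k (star \<psi> - star \<phi>)"
proof -
  have "Null R P Q (0 + k + 0) (star \<phi> * (\<psi> - \<phi>) * star \<psi>)"
    by (intro Null_mult mlin_Null mlin_star assms) (use assms in auto)
  then show ?thesis using assms by (simp add: star_diff)
qed

lemma Null_lv: "mlin R P Q a \<Longrightarrow> lv a \<Longrightarrow> Null R P Q 1 a"
  by (auto simp: Null_def mlinD(1))

lemma Null_star_minus_one:
  assumes "mlin R P Q \<phi>" "lv \<phi>"
  shows "Null R P Q 1 (star \<phi> - 1)"
  using assms mlin_star[OF assms(1)] by (auto simp: Null_def intro!: good_diff mlinD(1))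

text \<open>Both \<open>a - 1\<close> and \<open>b - 1\<close> have order 1 and so raise the order
  of \<open>c\<close> by one: factors that are 1 on the empty word do not affect the leading
  term.\<close>

lemma Null_sandwich:
  assumes a: "mlin R P Q a" "Null R P Q 1 (a - 1)" and b: "mlin R P Q b" "Null R P Q 1 (b - 1)"
    and c: "Null R P Q k c"
  shows "Null R P Q (Suc k) (a * c * b - c)"
proof -
  have "Null R P Q (Suc k) (a * c * b - c * b)"
    using Null_mult[OF Null_mult[OF a(2) c] mlin_Null[OF b(1)]] by (simp add: algebra_simps)
  moreover have "Null R P Q (Suc k) (c * b - c)"
    using Null_mult[OF c b(2)] by (simp add: algebra_simps)
  ultimately show ?thesis using Null_add by fastforce
qed

lemma Null_sg_ident_minus_one: "gmod P \<Longrightarrow> Null R P P 1 (sg ident - 1)"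
  and Null_ident_minus_one: "gmod P \<Longrightarrow> Null R P P 1 (ident - 1)"
  by (auto simp: Null_def app_sg one_sums intro!: good_diff good_uminus)

lemma Null_star_sandwich:
  assumes \<phi>: "mlin R P Q \<phi>" "lv \<phi>" and \<psi>: "mlin R P Q \<psi>" "lv \<psi>" and c: "Null R P Q k c"
  shows "Null R P Q (Suc k) (star \<phi> * c * star \<psi> - c)" "Null R P Q (Suc k) (sg (star \<phi>) * c * star \<psi> - c)"
proof -
  have "Null R P Q 1 (sg (star \<phi>) - 1)" using Null_sg[OF Null_star_minus_one[OF \<phi>]] by simp
  then show "Null R P Q (Suc k) (star \<phi> * c * star \<psi> - c)" "Null R P Q (Suc k) (sg (star \<phi>) * c * star \<psi> - c)"
    using assms by (intro Null_sandwich mlin_star mlin_sg Null_star_minus_one; simp)+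
qed

lemma Null_star_diff_leading:
  assumes \<phi>: "mlin R P Q \<phi>" "lv \<phi>" and \<psi>: "mlin R P Q \<psi>" "lv \<psi>" and k: "Null R P Q k (\<psi> - \<phi>)"
  shows "Null R P Q (Suc k) (star \<psi> - star \<phi> - (\<psi> - \<phi>))"
  using Null_star_sandwich(1)[OF \<phi> \<psi> k] \<phi>(2) \<psi>(2) by (simp add: star_diff)

lemma Null_coder_diff_leading:
  assumes "gmod P" "Null R P P k (\<beta>' - \<beta>)"
  shows "Null R P P (Suc k) (coder \<beta>' - coder \<beta> - (\<beta>' - \<beta>))"
proof -
  have "coder \<beta>' - coder \<beta> = sg ident * (\<beta>' - \<beta>) * ident" by (simp add: coder_def algebra_simps)
  then show ?thesis
    using assms by (simp only:) (intro Null_sandwich mlin_sg mlin_ident Null_sg_ident_minus_one Null_ident_minus_one gmodD)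
qed

text \<open>The differential of a minimal structure vanishes on letters only modulo the tensor relations.
  Removing it there altogether makes word length available as a filtration.\<close>

definition cutoff :: "('x, 'y) oper \<Rightarrow> ('x, 'y) oper" where
  "cutoff a = Op (\<lambda>w. if length w \<le> 1 then 0 else app a w)"

lemma app_cutoff: "app (cutoff a) w = (if length w \<le> 1 then 0 else app a w)"
  by (simp add: cutoff_def)

lemma mlin_cutoff: "mlin R P Q a \<Longrightarrow> mlin R P Q (cutoff a)"
  by (auto simp: mlin_def app_cutoff)

lemma lv_cutoff: "lv a \<Longrightarrow> lv (cutoff a)"
  by (auto simp: lv_def app_cutoff)

lemma low_cutoff: "lv a \<Longrightarrow> low 1 (cutoff a)"
  by (fastforce simp: low_def supp_def app_cutoff lv_def subset_iff)

lemma Nul_cutoff: "Null R P Q 2 a \<Longrightarrow> Nul R P Q (a - cutoff a)"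
  by (auto simp: Null_def app_cutoff numeral_2_eq_2 good_diff)

text \<open>Since \<open>\<beta>\<close> vanishes on letters, it merges at least two letters into
  one, and \<open>coder \<beta>\<close> shortens words modulo the relations. With
  \<open>cutoff \<beta>\<close> this holds exactly, and the two coderivations differ by a null
  operator.\<close>

lemma Null_comp_coder:
  assumes P: "gmod P" and a: "mlin R P Q a" "Null R P Q k a"
    and \<beta>: "mlin R P P \<beta>" "lv \<beta>" "Null R P P 2 \<beta>"
  shows "Null R P Q (Suc k) (a \<bullet> coder \<beta>)"
proof -
  have "low (0 + 1 + 0) (coder (cutoff \<beta>))"
    unfolding coder_def by (intro low_mult low_sg low_cutoff low_ident \<beta>)
  then have "Null R P Q (k + 1) (a \<bullet> coder (cutoff \<beta>))"
    by (intro Null_comp_low[OF a(2)] mlin_Null mlin_coder mlin_cutoff P \<beta>) simp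
  moreover have "Nul R P P (coder \<beta> - coder (cutoff \<beta>))"
  proof
    fix k
    have "coder \<beta> - coder (cutoff \<beta>) = sg ident * (\<beta> - cutoff \<beta>) * ident" by (simp add: coder_def algebra_simps)
    then show "Null R P P k (coder \<beta> - coder (cutoff \<beta>))"
      using Nul_cutoff[OF \<beta>(3)]
      by (simp only:) (intro Null_mult_left Null_mult_right mlin_sg mlin_ident gmodD P; simp)
  qed
  then have "Null R P Q (k + 1) (a \<bullet> coder \<beta> - a \<bullet> coder (cutoff \<beta>))"
    using Null_comp_left[OF a(1)] by (metis comp_simps(6))
  ultimately show ?thesis using Null_cancel by fastforce
qed

text \<open>A coalgebra map whose projection is the identity on letters differs from the identity
  only by merging letters, so \<open>star \<gamma> - ident\<close> shortens words.\<close>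

lemma Null_comp_unipotent:
  assumes P: "gmod P" and a: "mlin R P Q a" "Null R P Q k a"
    and \<gamma>: "mlin R P P \<gamma>" "lv \<gamma>" "Null R P P 2 (\<gamma> - pr)"
  shows "Null R P Q (Suc k) (a \<bullet> (star \<gamma> - ident))"
proof -
  \<comment> \<open>\<open>pr + ?c\<close> is \<open>\<gamma>\<close> with its values on letters
    replaced by the letters themselves.\<close>
  let ?c = "cutoff (\<gamma> - pr)"
  have c: "mlin R P P ?c" "lv ?c" "low 1 ?c"
    using \<gamma> by (auto intro!: mlin_cutoff mlin_diff mlin_pr P lv_cutoff lv_diff lv_pr low_cutoff[simplified])
  have \<psi>: "mlin R P P (pr + ?c)" "lv (pr + ?c)"
    using c by (auto intro: mlin_add mlin_pr P lv_add lv_pr)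
  have E: "star (pr + ?c) - ident = ident * ?c * star (pr + ?c)"
    using star_diff[OF lv_Nil[OF lv_pr] lv_Nil[OF \<psi>(2)]] by (simp add: ident_eq_star)
  have "low (0 + 1 + 0) (star (pr + ?c) - ident)"
    unfolding E by (intro low_mult low_ident c low_star \<psi>)
  then have "Null R P Q (k + 1) (a \<bullet> (star (pr + ?c) - ident))"
    by (intro Null_comp_low[OF a(2)] mlin_Null mlin_diff mlin_star \<psi>(1) mlin_ident gmodD P lv_Nil[OF \<psi>(2)]) simp
  moreover have "Null R P P (k + 1) (star \<gamma> - star (pr + ?c))"
    using Nul_cutoff[OF \<gamma>(3)] by (intro Null_star_diff \<psi> \<gamma>) (simp add: algebra_simps)
  then have "Null R P Q (k + 1) (a \<bullet> (star \<gamma> - ident) - a \<bullet> (star (pr + ?c) - ident))"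
    using Null_comp_left[OF a(1)] by fastforce
  ultimately show ?thesis using Null_cancel by fastforce
qed

section \<open>Families of multilinear maps\<close>

text \<open>Multilinearity as equations in the modules, in contrast to \<open>mlin\<close>.
  Solutions found as operators have to be brought back to this form to yield A-infinity data. The
  value on the empty word is left free, as \<open>fop\<close> ignores it.\<close>

definition fam :: "(int \<Rightarrow> ('a, 'm) module) \<Rightarrow> (int \<Rightarrow> ('a, 'n) module) \<Rightarrow> int \<Rightarrow> ('m word \<Rightarrow> 'n) \<Rightarrow> bool" where
  "fam P Q e b \<longleftrightarrow>
     (\<forall>w\<in>words P. w \<noteq> [] \<longrightarrow> b w \<in> carrier (Q (wdeg w + e))) \<and>
     (\<forall>u\<in>words P. \<forall>v\<in>words P. \<forall>k. \<forall>x\<in>carrier (P k). \<forall>y\<in>carrier (P k).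
        b (u @ [(k, x \<oplus>\<^bsub>P k\<^esub> y)] @ v) =
          b (u @ [(k, x)] @ v) \<oplus>\<^bsub>Q (wdeg u + k + wdeg v + e)\<^esub> b (u @ [(k, y)] @ v)) \<and>
     (\<forall>u\<in>words P. \<forall>v\<in>words P. \<forall>k. \<forall>c\<in>carrier R. \<forall>x\<in>carrier (P k).
        b (u @ [(k, c \<odot>\<^bsub>P k\<^esub> x)] @ v) = c \<odot>\<^bsub>Q (wdeg u + k + wdeg v + e)\<^esub> b (u @ [(k, x)] @ v))"

lemma famI:
  assumes "\<And>w. w \<in> words P \<Longrightarrow> w \<noteq> [] \<Longrightarrow> b w \<in> carrier (Q (wdeg w + e))"
    and "\<And>u v k x y. u \<in> words P \<Longrightarrow> v \<in> words P \<Longrightarrow> x \<in> carrier (P k) \<Longrightarrow> y \<in> carrier (P k) \<Longrightarrow>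
        b (u @ [(k, x \<oplus>\<^bsub>P k\<^esub> y)] @ v) =
          b (u @ [(k, x)] @ v) \<oplus>\<^bsub>Q (wdeg u + k + wdeg v + e)\<^esub> b (u @ [(k, y)] @ v)"
    and "\<And>u v k c x. u \<in> words P \<Longrightarrow> v \<in> words P \<Longrightarrow> c \<in> carrier R \<Longrightarrow> x \<in> carrier (P k) \<Longrightarrow>
        b (u @ [(k, c \<odot>\<^bsub>P k\<^esub> x)] @ v) = c \<odot>\<^bsub>Q (wdeg u + k + wdeg v + e)\<^esub> b (u @ [(k, x)] @ v)"
  shows "fam P Q e b"
  unfolding fam_def using assms by blast

lemma famD:
  assumes "fam P Q e b"
  shows "w \<in> words P \<Longrightarrow> w \<noteq> [] \<Longrightarrow> b w \<in> carrier (Q (wdeg w + e))"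
    and "u \<in> words P \<Longrightarrow> v \<in> words P \<Longrightarrow> x \<in> carrier (P k) \<Longrightarrow> y \<in> carrier (P k) \<Longrightarrow>
        b (u @ [(k, x \<oplus>\<^bsub>P k\<^esub> y)] @ v) =
          b (u @ [(k, x)] @ v) \<oplus>\<^bsub>Q (wdeg u + k + wdeg v + e)\<^esub> b (u @ [(k, y)] @ v)"
    and "u \<in> words P \<Longrightarrow> v \<in> words P \<Longrightarrow> c \<in> carrier R \<Longrightarrow> x \<in> carrier (P k) \<Longrightarrow>
        b (u @ [(k, c \<odot>\<^bsub>P k\<^esub> x)] @ v) = c \<odot>\<^bsub>Q (wdeg u + k + wdeg v + e)\<^esub> b (u @ [(k, x)] @ v)"
  using assms unfolding fam_def by blast+

lemma mlin_fop:
  assumes b: "fam P Q e b" and Q: "gmod Q"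
  shows "mlin R P Q (fop e b)"
proof (rule mlinI)
  show "good Q (app (fop e b) w)" if "w \<in> words P" for w
    using famD(1)[OF b that] by (simp add: app_fop)
next
  fix u v k x y assume *: "u \<in> words P" "v \<in> words P" "x \<in> carrier (P k)" "y \<in> carrier (P k)"
  let ?j = "wdeg u + k + wdeg v + e"
  have **: "b (u @ [(k, z)] @ v) \<in> carrier (Q ?j)" if "z \<in> carrier (P k)" for z
    using famD(1)[OF b, of "u @ [(k, z)] @ v"] that * by (simp add: algebra_simps)
  show "nul R Q (app (fop e b) (u @ [(k, x \<oplus>\<^bsub>P k\<^esub> y)] @ v) - app (fop e b) (u @ [(k, x)] @ v) - app (fop e b) (u @ [(k, y)] @ v))"
    using tensor_rels.slot_add[of _ R "[]" Q "[]" _ ?j, OF _ _ _ **[OF *(3)] **[OF *(4)]] famD(2)[OF b *]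
    by (simp add: nul_def app_fop algebra_simps)
next
  fix u v k c x assume *: "u \<in> words P" "v \<in> words P" "c \<in> carrier R" "x \<in> carrier (P k)"
  let ?j = "wdeg u + k + wdeg v + e"
  have **: "b (u @ [(k, x)] @ v) \<in> carrier (Q ?j)"
    using famD(1)[OF b, of "u @ [(k, x)] @ v"] * by (simp add: algebra_simps)
  show "rel R Q c (app (fop e b) (u @ [(k, c \<odot>\<^bsub>P k\<^esub> x)] @ v)) (app (fop e b) (u @ [(k, x)] @ v))"
    using tensor_rels.scalar[of _ R c "[]" Q "[]" _ ?j, OF _ *(3) _ _ **] famD(3)[OF b *]
    by (simp add: rel_def app_fop algebra_simps)
qed

text \<open>A letter represents the zero tensor only if it is zero: the symbols \<open>(r, [x])\<close> are
  evaluated to \<open>r x\<close>, and all other symbols to \<open>0\<close>.\<close>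

lemma letter_evaluation:
  assumes Q: "gmod Q"
  obtains ev where "\<And>s t. Poly_Mapping.keys s \<subseteq> carrier R \<times> words Q \<Longrightarrow> Poly_Mapping.keys t \<subseteq> carrier R \<times> words Q \<Longrightarrow>
      ev (s - t) = ev s \<ominus>\<^bsub>Q k\<^esub> ev t"
    and "\<And>r x. r \<in> carrier R \<Longrightarrow> x \<in> carrier (Q k) \<Longrightarrow> ev (frag_of (r, [(k, x)])) = r \<odot>\<^bsub>Q k\<^esub> x"
    and "\<And>s. s \<in> tensor_rels R Q \<Longrightarrow> ev s = \<zero>\<^bsub>Q k\<^esub>"
proof -
  interpret M: module R "Q k" by (rule gmodD[OF Q])
  have cancel: "x \<oplus>\<^bsub>Q k\<^esub> y \<ominus>\<^bsub>Q k\<^esub> x \<ominus>\<^bsub>Q k\<^esub> y = \<zero>\<^bsub>Q k\<^esub>"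
    if "x \<in> carrier (Q k)" "y \<in> carrier (Q k)" for x y
    using that M.a_comm[of x y] by (simp add: M.minus_eq M.a_assoc M.r_neg)
  define S where "S = carrier R \<times> words Q"
  define h where "h = (\<lambda>(r, w). case w of [(j, x)] \<Rightarrow> if j = k then r \<odot>\<^bsub>Q k\<^esub> x else \<zero>\<^bsub>Q k\<^esub> | _ \<Rightarrow> \<zero>\<^bsub>Q k\<^esub>)"
  have h_long: "h (r, u @ [(j, z)] @ v) = \<zero>\<^bsub>Q k\<^esub>" if "\<not> (u = [] \<and> v = [] \<and> j = k)" for r u v j z
    using that by (cases u) (auto simp: h_def split: list.split)
  have zz: "\<zero>\<^bsub>Q k\<^esub> \<ominus>\<^bsub>Q k\<^esub> \<zero>\<^bsub>Q k\<^esub> = \<zero>\<^bsub>Q k\<^esub>"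
    by (simp add: M.minus_eq)
  have "h ` S \<subseteq> carrier (add_monoid (Q k))"
    by (auto simp: h_def S_def split: list.split)
  then obtain ev where ev: "ev \<in> Group.hom (free_Abelian_group S) (add_monoid (Q k))" "\<And>x. x \<in> S \<Longrightarrow> ev (frag_of x) = h x"
    using comm_group.free_Abelian_group_universal[OF M.a_comm_group] by metis
  interpret ev: group_hom "free_Abelian_group S" "add_monoid (Q k)" ev
    by (intro group_hom.intro group_hom_axioms.intro ev group_free_Abelian_group comm_group.axioms(2) M.a_comm_group)
  have minus: "ev (s - t) = ev s \<ominus>\<^bsub>Q k\<^esub> ev t" if "Poly_Mapping.keys s \<subseteq> S" "Poly_Mapping.keys t \<subseteq> S" for s t
    using ev.hom_mult[of s "- t"] ev.hom_inv[of t] that by (simp add: a_minus_def a_inv_def)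
  have closed: "ev s \<in> carrier (Q k)" if "Poly_Mapping.keys s \<subseteq> S" for s
    using ev.hom_closed[of s] that by simp
  have kd: "Poly_Mapping.keys (s - t) \<subseteq> S" if "Poly_Mapping.keys s \<subseteq> S" "Poly_Mapping.keys t \<subseteq> S" for s t :: "('a, 'c) tensors"
    using keys_diff[of s t] that by blast
  have minus3: "ev (s - t - t') = ev s \<ominus>\<^bsub>Q k\<^esub> ev t \<ominus>\<^bsub>Q k\<^esub> ev t'"
    if "Poly_Mapping.keys s \<subseteq> S" "Poly_Mapping.keys t \<subseteq> S" "Poly_Mapping.keys t' \<subseteq> S" for s t t'
    using that by (simp add: minus kd)
  have rels: "Poly_Mapping.keys s \<subseteq> S \<and> ev s = \<zero>\<^bsub>Q k\<^esub>" if "s \<in> tensor_rels R Q" for s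
    using that
  proof induction
    case zero
    then show ?case using ev.hom_one by simp
  next
    case (diff s t)
    then show ?case using minus[of s t] kd[of s t] by (auto simp: M.minus_eq)
  next
    case (coeff_add r s w)
    then have S: "(r, w) \<in> S" "(s, w) \<in> S" "(r \<oplus> s, w) \<in> S" by (auto simp: S_def)
    have "h (r \<oplus> s, w) \<ominus>\<^bsub>Q k\<^esub> h (r, w) \<ominus>\<^bsub>Q k\<^esub> h (s, w) = \<zero>\<^bsub>Q k\<^esub>"
      using coeff_add
      by (auto simp: h_def M.smult_l_distr cancel zz split: list.split)
    then show ?case using S by (simp add: minus3 kd ev(2))
  next
    case (slot_add r u v x j y)
    interpret Pj: module R "Q j" by (rule gmodD[OF Q])
    have S: "(r, u @ [(j, z)] @ v) \<in> S" if "z \<in> carrier (Q j)" for z using slot_add that by (auto simp: S_def)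
    have "h (r, u @ [(j, x \<oplus>\<^bsub>Q j\<^esub> y)] @ v) \<ominus>\<^bsub>Q k\<^esub> h (r, u @ [(j, x)] @ v) \<ominus>\<^bsub>Q k\<^esub> h (r, u @ [(j, y)] @ v) = \<zero>\<^bsub>Q k\<^esub>"
      using slot_add h_long[of u v j]
      by (cases "u = [] \<and> v = [] \<and> j = k") (auto simp: h_def M.smult_r_distr cancel zz)
    then show ?case using slot_add S[OF slot_add(4)] S[OF slot_add(5)] S[OF Pj.a_closed[OF slot_add(4,5)]]
      by (simp add: minus3 kd ev(2) del: append_Cons append_Nil)
  next
    case (scalar r s u v x j)
    interpret Pj: module R "Q j" by (rule gmodD[OF Q])
    have S: "(r', u @ [(j, z)] @ v) \<in> S" if "z \<in> carrier (Q j)" "r' \<in> carrier R" for z r'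
      using scalar that by (auto simp: S_def)
    have "h (r, u @ [(j, s \<odot>\<^bsub>Q j\<^esub> x)] @ v) \<ominus>\<^bsub>Q k\<^esub> h (r \<otimes> s, u @ [(j, x)] @ v) = \<zero>\<^bsub>Q k\<^esub>"
      using scalar
      using h_long[of u v j]
      by (cases "u = [] \<and> v = [] \<and> j = k") (auto simp: h_def M.smult_assoc1 M.minus_eq M.r_neg)
    then show ?case using scalar S[OF Pj.smult_closed[OF scalar(2,5)]] S[OF scalar(5)]
      by (simp add: minus kd ev(2) del: append_Cons append_Nil)
  qed
  show ?thesis
  proof (rule that)
    show "ev (frag_of (r, [(k, x)])) = r \<odot>\<^bsub>Q k\<^esub> x" if "r \<in> carrier R" "x \<in> carrier (Q k)" for r x
      using that ev(2)[of "(r, [(k, x)])"] by (simp add: S_def h_def)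
  qed (use minus rels in \<open>auto simp: S_def\<close>)
qed

end

lemma (in abelian_group) minus_plus_cancel: "x \<in> carrier G \<Longrightarrow> y \<in> carrier G \<Longrightarrow> x \<ominus> y \<oplus> y = x"
  by (simp add: minus_eq a_assoc l_neg)

lemma (in abelian_group) eq_of_minus: "x \<ominus> y = \<zero> \<Longrightarrow> x \<in> carrier G \<Longrightarrow> y \<in> carrier G \<Longrightarrow> x = y"
  using minus_plus_cancel[of x y] by simp

context cring
begin

text \<open>Evaluating the relation at the coefficient \<open>\<one>\<close> returns an equation in
  the module. This is the passage from tensors of length one back to elements.\<close>

lemma letter_rel:
  assumes Q: "gmod Q" and c: "c \<in> carrier R" and x: "x \<in> carrier (Q k)" and y: "y \<in> carrier (Q k)"
    and rel: "rel R Q c (frag_of [(k, x)]) (frag_of [(k, y)])"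
  shows "x = c \<odot>\<^bsub>Q k\<^esub> y"
proof -
  interpret M: module R "Q k" by (rule gmodD[OF Q])
  obtain ev where ev:
      "\<And>s t. Poly_Mapping.keys s \<subseteq> carrier R \<times> words Q \<Longrightarrow> Poly_Mapping.keys t \<subseteq> carrier R \<times> words Q \<Longrightarrow>
        ev (s - t) = ev s \<ominus>\<^bsub>Q k\<^esub> ev t"
      "\<And>r x. r \<in> carrier R \<Longrightarrow> x \<in> carrier (Q k) \<Longrightarrow> ev (frag_of (r, [(k, x)])) = r \<odot>\<^bsub>Q k\<^esub> x"
      "\<And>s. s \<in> tensor_rels R Q \<Longrightarrow> ev s = \<zero>\<^bsub>Q k\<^esub>"
    by (rule letter_evaluation[OF Q, of k], rule that, assumption+)
  have "frag_of (\<one>, [(k, x)]) - frag_of (c, [(k, y)]) \<in> tensor_rels R Q"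
    using rel[unfolded rel_def, THEN bspec, OF one_closed] c by simp
  then have 0: "x \<ominus>\<^bsub>Q k\<^esub> c \<odot>\<^bsub>Q k\<^esub> y = \<zero>\<^bsub>Q k\<^esub>"
    using ev(1)[of "frag_of (\<one>, [(k, x)])" "frag_of (c, [(k, y)])"] ev(2)[of \<one> x] ev(2)[of c y] ev(3) c x y by simp
  then show ?thesis by (rule M.eq_of_minus[OF _ x M.smult_closed[OF c y]])
qed

lemma letter_eq:
  assumes Q: "gmod Q" and x: "x \<in> carrier (Q k)" and y: "y \<in> carrier (Q k)"
    and "nul R Q (frag_of [(k, x)] - frag_of [(k, y)])"
  shows "x = y"
proof -
  interpret M: module R "Q k" by (rule gmodD[OF Q])
  have "rel R Q \<one> (frag_of [(k, x)]) (frag_of [(k, y)])"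
    using assms(4) by (simp add: nul_def rel_def)
  then show ?thesis using letter_rel[OF Q one_closed x y] y by simp
qed

lemma letter_add:
  assumes "gmod Q" "x \<in> carrier (Q k)" "y \<in> carrier (Q k)"
  shows "nul R Q (frag_of [(k, x \<oplus>\<^bsub>Q k\<^esub> y)] - frag_of [(k, x)] - frag_of [(k, y)])"
  using tensor_rels.slot_add[of _ R "[]" Q "[]" x k y] assms by (simp add: nul_def)

lemma letter_zero:
  assumes Q: "gmod Q"
  shows "nul R Q (frag_of [(k, \<zero>\<^bsub>Q k\<^esub>)])"
proof -
  interpret M: module R "Q k" by (rule gmodD[OF Q])
  show ?thesis using nul_uminus[OF letter_add[OF Q, of "\<zero>\<^bsub>Q k\<^esub>" k "\<zero>\<^bsub>Q k\<^esub>"]] by simp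
qed

lemma letter_nul:
  assumes Q: "gmod Q" and x: "x \<in> carrier (Q k)"
  shows "nul R Q (frag_of [(k, x)]) \<longleftrightarrow> x = \<zero>\<^bsub>Q k\<^esub>"
proof
  interpret M: module R "Q k" by (rule gmodD[OF Q])
  assume "nul R Q (frag_of [(k, x)])"
  then have "nul R Q (frag_of [(k, x)] - frag_of [(k, \<zero>\<^bsub>Q k\<^esub>)])" by (intro nul_diff letter_zero Q)
  then show "x = \<zero>\<^bsub>Q k\<^esub>" by (rule letter_eq[OF Q x M.zero_closed])
qed (simp add: letter_zero[OF Q])

text \<open>The slot relation merges a sum of letters into a single letter, provided that all of
  them have the same degree and hence lie in one module.\<close>

lemma letter_represent:
  assumes Q: "gmod Q" and s: "good Q s" "Poly_Mapping.keys s \<subseteq> {[(k, x)] | x. True}"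
  shows "\<exists>x\<in>carrier (Q k). nul R Q (s - frag_of [(k, x)])"
proof -
  interpret M: module R "Q k" by (rule gmodD[OF Q])
  have "Poly_Mapping.keys s \<subseteq> {[(k, x)] | x. x \<in> carrier (Q k)}" using s by (fastforce simp: good_def)
  then show ?thesis
  proof (induction s rule: frag_induction)
    case zero
    then show ?case using nul_uminus[OF letter_zero[OF Q, of k]] by (intro bexI[of _ "\<zero>\<^bsub>Q k\<^esub>"]) auto
  next
    case (one w)
    then obtain x where "w = [(k, x)]" "x \<in> carrier (Q k)" by blast
    then show ?case by (intro bexI[of _ x]) auto
  next
    case (diff s t)
    then obtain x y where x: "x \<in> carrier (Q k)" "nul R Q (s - frag_of [(k, x)])"
      and y: "y \<in> carrier (Q k)" "nul R Q (t - frag_of [(k, y)])" by blast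
    have "x = (x \<ominus>\<^bsub>Q k\<^esub> y) \<oplus>\<^bsub>Q k\<^esub> y"
      using x y by (simp add: M.minus_eq M.a_assoc M.l_neg)
    then have "nul R Q (frag_of [(k, x)] - frag_of [(k, x \<ominus>\<^bsub>Q k\<^esub> y)] - frag_of [(k, y)])"
      using letter_add[OF Q, of "x \<ominus>\<^bsub>Q k\<^esub> y" k y] x y by simp
    from nul_add[OF nul_diff[OF x(2) y(2)] this] show ?case
      using x y by (intro bexI[of _ "x \<ominus>\<^bsub>Q k\<^esub> y"]) (auto simp: algebra_simps)
  qed
qed

lemma rel_of_nul: "c \<in> carrier R \<Longrightarrow> nul R P s \<Longrightarrow> nul R P t \<Longrightarrow> rel R P c s t"
  by (simp add: rel_def nul_def tensor_rels.diff)

text \<open>On each word the value is a sum of letters of one degree, hence equal to a single letter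
  modulo the relations. That letter is unique, which makes the chosen function multilinear although
  it is picked word by word.\<close>

lemma represent:
  assumes P: "gmod P" and Q: "gmod Q" and U: "mlin R P Q U" "lv U" "hom e U"
  obtains b where "fam P Q e b" "Nul R P Q (U - fop e b)"
proof -
  define b where "b = (\<lambda>w. SOME x. x \<in> carrier (Q (wdeg w + e)) \<and> nul R Q (app U w - frag_of [(wdeg w + e, x)]))"
  have b: "b w \<in> carrier (Q (wdeg w + e)) \<and> nul R Q (app U w - frag_of [(wdeg w + e, b w)])" if "w \<in> words P" for w
    unfolding b_def
  proof (rule someI_ex)
    have "Poly_Mapping.keys (app U w) \<subseteq> {[(wdeg w + e, x)] | x. True}"
    proof
      fix v assume v: "v \<in> Poly_Mapping.keys (app U w)"
      obtain z where "v = [z]" using U(2) v unfolding lv_def by blast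
      moreover have "wdeg v = wdeg w + e" using U(3) v unfolding hom_def supp_def by blast
      ultimately show "v \<in> {[(wdeg w + e, x)] | x. True}" by (cases z) auto
    qed
    from letter_represent[OF Q mlinD(1)[OF U(1) that] this]
    show "\<exists>x. x \<in> carrier (Q (wdeg w + e)) \<and> nul R Q (app U w - frag_of [(wdeg w + e, x)])" by blast
  qed
  have slot: "b (u @ [(k, x)] @ v) \<in> carrier (Q (wdeg u + k + wdeg v + e))"
    "nul R Q (app U (u @ [(k, x)] @ v) - frag_of [(wdeg u + k + wdeg v + e, b (u @ [(k, x)] @ v))])"
    if "u \<in> words P" "v \<in> words P" "x \<in> carrier (P k)" for u v k x
    using b[of "u @ [(k, x)] @ v"] that by (simp_all add: algebra_simps)
  have fam: "fam P Q e b"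
  proof (rule famI)
    show "b w \<in> carrier (Q (wdeg w + e))" if "w \<in> words P" for w using b[OF that] by blast
  next
    fix u v k x y assume *: "u \<in> words P" "v \<in> words P" "x \<in> carrier (P k)" "y \<in> carrier (P k)"
    let ?j = "wdeg u + k + wdeg v + e" and ?b = "\<lambda>z. b (u @ [(k, z)] @ v)" and ?U = "\<lambda>z. app U (u @ [(k, z)] @ v)"
    let ?z = "x \<oplus>\<^bsub>P k\<^esub> y"
    interpret M: module R "Q ?j" by (rule gmodD[OF Q])
    interpret Pk: module R "P k" by (rule gmodD[OF P])
    note s = slot[OF *(1,2)]
    have zc: "?z \<in> carrier (P k)" using * by (simp add: Pk.a_closed)
    have "nul R Q (?U ?z - ?U x - ?U y - (?U ?z - frag_of [(?j, ?b ?z)]) + (?U x - frag_of [(?j, ?b x)]) + (?U y - frag_of [(?j, ?b y)])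
        + (- (frag_of [(?j, ?b x \<oplus>\<^bsub>Q ?j\<^esub> ?b y)] - frag_of [(?j, ?b x)] - frag_of [(?j, ?b y)])))"
      by (intro nul_add nul_diff nul_uminus mlinD(2)[OF U(1) *] s letter_add Q * zc)
    then have "nul R Q (frag_of [(?j, ?b ?z)] - frag_of [(?j, ?b x \<oplus>\<^bsub>Q ?j\<^esub> ?b y)])" by (simp add: algebra_simps)
    then show "?b ?z = ?b x \<oplus>\<^bsub>Q ?j\<^esub> ?b y"
      by (rule letter_eq[OF Q, rotated 2]) (use s * zc in auto)
  next
    fix u v k c x assume *: "u \<in> words P" "v \<in> words P" "c \<in> carrier R" "x \<in> carrier (P k)"
    let ?j = "wdeg u + k + wdeg v + e" and ?b = "\<lambda>z. b (u @ [(k, z)] @ v)" and ?U = "\<lambda>z. app U (u @ [(k, z)] @ v)"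
    let ?z = "c \<odot>\<^bsub>P k\<^esub> x"
    interpret Pk: module R "P k" by (rule gmodD[OF P])
    note s = slot[OF *(1,2)]
    have zc: "?z \<in> carrier (P k)" using * by (simp add: Pk.smult_closed)
    have "rel R Q c (?U ?z - frag_of [(?j, ?b ?z)]) (?U x - frag_of [(?j, ?b x)])"
      using s zc * by (intro rel_of_nul)
    from rel_diff[OF mlinD(3)[OF U(1) *] this]
    have "rel R Q c (frag_of [(?j, ?b ?z)]) (frag_of [(?j, ?b x)])" by simp
    then show "?b ?z = c \<odot>\<^bsub>Q ?j\<^esub> ?b x"
      by (rule letter_rel[OF Q *(3), rotated 2]) (use s * zc in auto)
  qed
  have "Nul R P Q (U - fop e b)"
  proof (rule NulI)
    fix w assume w: "w \<in> words P"
    show "good Q (app (U - fop e b) w)"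
      using mlinD(1)[OF U(1) w] mlinD(1)[OF mlin_fop[OF fam Q] w] by (simp add: good_diff)
    show "nul R Q (app (U - fop e b) w)"
      using b[OF w] U(2) by (auto simp: app_fop)
  qed
  with fam show ?thesis by (rule that)
qed

end

section \<open>Lifting multilinear maps defined on free modules\<close>

lemma linear_mapD:
  assumes "linear_map R M N f"
  shows "x \<in> carrier M \<Longrightarrow> f x \<in> carrier N"
    and "x \<in> carrier M \<Longrightarrow> y \<in> carrier M \<Longrightarrow> f (x \<oplus>\<^bsub>M\<^esub> y) = f x \<oplus>\<^bsub>N\<^esub> f y"
    and "r \<in> carrier R \<Longrightarrow> x \<in> carrier M \<Longrightarrow> f (r \<odot>\<^bsub>M\<^esub> x) = r \<odot>\<^bsub>N\<^esub> f x"
  using assms by (auto simp: linear_map_def)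

lemma linear_mapI:
  assumes "\<And>x. x \<in> carrier M \<Longrightarrow> f x \<in> carrier N"
    and "\<And>x y. x \<in> carrier M \<Longrightarrow> y \<in> carrier M \<Longrightarrow> f (x \<oplus>\<^bsub>M\<^esub> y) = f x \<oplus>\<^bsub>N\<^esub> f y"
    and "\<And>r x. r \<in> carrier R \<Longrightarrow> x \<in> carrier M \<Longrightarrow> f (r \<odot>\<^bsub>M\<^esub> x) = r \<odot>\<^bsub>N\<^esub> f x"
  shows "linear_map R M N f"
  using assms by (auto simp: linear_map_def)

lemma linear_map_comp: "linear_map R M N f \<Longrightarrow> linear_map R N L g \<Longrightarrow> linear_map R M L (\<lambda>x. g (f x))"
  by (auto simp: linear_map_def Pi_iff)

context cring
begin

lemma linear_map_zero_const: "module R N \<Longrightarrow> linear_map R M N (\<lambda>x. \<zero>\<^bsub>N\<^esub>)"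
proof -
  assume "module R N"
  then interpret N: module R N .
  show ?thesis by (rule linear_mapI) simp_all
qed

lemma linear_map_add:
  assumes "module R N" "linear_map R M N f" "linear_map R M N g"
  shows "linear_map R M N (\<lambda>x. f x \<oplus>\<^bsub>N\<^esub> g x)"
proof -
  interpret N: module R N by fact
  show ?thesis
    using linear_mapD[OF assms(2)] linear_mapD[OF assms(3)]
    by (intro linear_mapI) (auto simp: N.a_ac N.smult_r_distr)
qed

lemma linear_map_smult:
  assumes "module R N" "linear_map R M N f" "c \<in> carrier R"
  shows "linear_map R M N (\<lambda>x. c \<odot>\<^bsub>N\<^esub> f x)"
proof -
  interpret N: module R N by fact
  show ?thesis
    using linear_mapD[OF assms(2)] assms(3)
    by (intro linear_mapI) (auto simp: N.smult_r_distr N.smult_assoc1[symmetric] m_comm)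
qed

lemma linear_map_zero:
  assumes "module R M" "module R N" "linear_map R M N f"
  shows "f \<zero>\<^bsub>M\<^esub> = \<zero>\<^bsub>N\<^esub>"
proof -
  interpret M: module R M by fact
  interpret N: module R N by fact
  show ?thesis using linear_mapD(3)[OF assms(3), of \<zero> "\<zero>\<^bsub>M\<^esub>"] linear_mapD(1)[OF assms(3), of "\<zero>\<^bsub>M\<^esub>"] by simp
qed

definition comb :: "('a, 'n) module \<Rightarrow> ('m \<Rightarrow> 'n) \<Rightarrow> 'm set \<Rightarrow> ('m \<Rightarrow> 'a) \<Rightarrow> 'n" where
  "comb N t F c = (\<Oplus>\<^bsub>N\<^esub>b\<in>F. c b \<odot>\<^bsub>N\<^esub> t b)"

lemma comb_extend:
  assumes N: "module R N" and "finite G" "F \<subseteq> G" "t \<in> G \<rightarrow> carrier N" "c \<in> F \<rightarrow> carrier R"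
  shows "comb N t G (\<lambda>b. if b \<in> F then c b else \<zero>) = comb N t F c"
proof -
  interpret N: module R N by fact
  show ?thesis
    unfolding comb_def using assms
    by (intro N.add.finprod_mono_neutral_cong_right) (auto simp: Pi_iff subset_iff)
qed

lemma comb_add:
  assumes N: "module R N" and "t \<in> F \<rightarrow> carrier N" "c \<in> F \<rightarrow> carrier R" "c' \<in> F \<rightarrow> carrier R"
  shows "comb N t F (\<lambda>b. c b \<oplus> c' b) = comb N t F c \<oplus>\<^bsub>N\<^esub> comb N t F c'"
proof -
  interpret N: module R N by fact
  have "comb N t F (\<lambda>b. c b \<oplus> c' b) = (\<Oplus>\<^bsub>N\<^esub>b\<in>F. c b \<odot>\<^bsub>N\<^esub> t b \<oplus>\<^bsub>N\<^esub> c' b \<odot>\<^bsub>N\<^esub> t b)"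
    unfolding comb_def using assms by (intro N.finsum_cong') (auto simp: N.smult_l_distr Pi_iff)
  then show ?thesis unfolding comb_def using assms by (simp add: N.finsum_addf Pi_iff)
qed

lemma comb_smult:
  assumes N: "module R N" and "t \<in> F \<rightarrow> carrier N" "c \<in> F \<rightarrow> carrier R" "r \<in> carrier R" "finite F"
  shows "comb N t F (\<lambda>b. r \<otimes> c b) = r \<odot>\<^bsub>N\<^esub> comb N t F c"
proof -
  interpret N: module R N by fact
  have "comb N t F (\<lambda>b. r \<otimes> c b) = (\<Oplus>\<^bsub>N\<^esub>b\<in>F. r \<odot>\<^bsub>N\<^esub> (c b \<odot>\<^bsub>N\<^esub> t b))"
    unfolding comb_def using assms by (intro N.finsum_cong') (auto simp: N.smult_assoc1 Pi_iff)
  then show ?thesis unfolding comb_def using assms by (subst N.finsum_smult_ldistr) (auto simp: Pi_iff)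
qed

lemma comb_closed: "module R N \<Longrightarrow> t \<in> F \<rightarrow> carrier N \<Longrightarrow> c \<in> F \<rightarrow> carrier R \<Longrightarrow> comb N t F c \<in> carrier N"
proof -
  assume N: "module R N" and "t \<in> F \<rightarrow> carrier N" "c \<in> F \<rightarrow> carrier R"
  interpret N: module R N by fact
  show ?thesis unfolding comb_def using \<open>t \<in> _\<close> \<open>c \<in> _\<close> by (auto simp: Pi_iff)
qed

lemma linear_map_comb:
  assumes N: "module R N" and L: "module R L" and f: "linear_map R N L f"
    and "finite F" "t \<in> F \<rightarrow> carrier N" "c \<in> F \<rightarrow> carrier R"
  shows "f (comb N t F c) = comb L (\<lambda>b. f (t b)) F c"
  using assms(4-6)
proof (induction F)
  interpret N: module R N by fact
  interpret L: module R L by fact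
  case empty
  then show ?case using linear_map_zero[OF N L f] by (simp add: comb_def)
next
  interpret N: module R N by fact
  interpret L: module R L by fact
  case (insert b F)
  then have "comb N t (insert b F) c = c b \<odot>\<^bsub>N\<^esub> t b \<oplus>\<^bsub>N\<^esub> comb N t F c"
    "comb L (\<lambda>b. f (t b)) (insert b F) c = c b \<odot>\<^bsub>L\<^esub> f (t b) \<oplus>\<^bsub>L\<^esub> comb L (\<lambda>b. f (t b)) F c"
    unfolding comb_def using linear_mapD(1)[OF f] by (subst N.finsum_insert L.finsum_insert; auto simp: Pi_iff)+
  moreover have "comb N t F c \<in> carrier N" using insert by (intro comb_closed N) auto
  ultimately show ?case using insert linear_mapD[OF f] by (auto simp: Pi_iff)
qed

text \<open>Universal property of a free module. The basis is fixed before the target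
  \<open>N\<close>, because one basis has to serve all the linear maps from which a multilinear map
  is built.\<close>

lemma basis_extension:
  fixes M :: "('a, 'm) module"
  assumes M: "free_module R M"
  obtains B where "B \<subseteq> carrier M"
    and "\<And>(N :: ('a, 'n) module) t. module R N \<Longrightarrow> t \<in> B \<rightarrow> carrier N \<Longrightarrow> \<exists>h. linear_map R M N h \<and> (\<forall>b\<in>B. h b = t b)"
    and "\<And>x. x \<in> carrier M \<Longrightarrow> \<exists>F c. finite F \<and> F \<subseteq> B \<and> c \<in> F \<rightarrow> carrier R \<and> x = comb M (\<lambda>b. b) F c"
proof -
  interpret M: module R M using M by (simp add: free_module_def)
  have M': "module R M" ..
  obtain B where B: "B \<subseteq> carrier M"
    and span: "\<forall>x\<in>carrier M. \<exists>F c. finite F \<and> F \<subseteq> B \<and> c \<in> F \<rightarrow> carrier R \<and> x = comb M (\<lambda>b. b) F c"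
    and indep: "\<forall>F c. finite F \<and> F \<subseteq> B \<and> c \<in> F \<rightarrow> carrier R \<and> comb M (\<lambda>b. b) F c = \<zero>\<^bsub>M\<^esub> \<longrightarrow> (\<forall>b\<in>F. c b = \<zero>)"
    using M unfolding free_module_def comb_def by auto
  \<comment> \<open>Two representations of one element are compared over the union of their
    supports, where independence forces equal coefficients.\<close>
  have well_defined: "comb N t F c = comb N t G c'"
    if N: "module R N" "t \<in> B \<rightarrow> carrier N" and F: "finite F" "F \<subseteq> B" "c \<in> F \<rightarrow> carrier R"
      and G: "finite G" "G \<subseteq> B" "c' \<in> G \<rightarrow> carrier R" and eq: "comb M (\<lambda>b. b) F c = comb M (\<lambda>b. b) G c'"
    for N :: "('a, 'n) module" and t F c G c'
  proof -
    let ?H = "F \<union> G"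
    let ?c = "\<lambda>b. if b \<in> F then c b else \<zero>" and ?c' = "\<lambda>b. if b \<in> G then c' b else \<zero>"
    have c: "?c \<in> ?H \<rightarrow> carrier R" "?c' \<in> ?H \<rightarrow> carrier R" using F G by auto
    have n: "(\<lambda>b. \<ominus> \<one> \<otimes> ?c' b) \<in> ?H \<rightarrow> carrier R" using G by (auto simp: Pi_iff)
    have id: "(\<lambda>b. b) \<in> ?H \<rightarrow> carrier M" using F G B by auto
    have e: "comb M (\<lambda>b. b) ?H ?c = comb M (\<lambda>b. b) F c" "comb M (\<lambda>b. b) ?H ?c' = comb M (\<lambda>b. b) G c'"
      using F G id by (intro comb_extend M'; auto)+
    have m: "comb M (\<lambda>b. b) ?H ?c \<in> carrier M" by (intro comb_closed M' id c)
    have "comb M (\<lambda>b. b) ?H (\<lambda>b. ?c b \<oplus> \<ominus> \<one> \<otimes> ?c' b) =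
        comb M (\<lambda>b. b) ?H ?c \<oplus>\<^bsub>M\<^esub> (\<ominus> \<one>) \<odot>\<^bsub>M\<^esub> comb M (\<lambda>b. b) ?H ?c'"
      using F G by (simp only: comb_add[OF M' id c(1) n]) (subst comb_smult[OF M' id c(2)]; simp)
    also have "\<dots> = \<zero>\<^bsub>M\<^esub>" using m eq e by (simp add: M.smult_l_minus M.r_neg)
    finally have 0: "?c b \<oplus> \<ominus> \<one> \<otimes> ?c' b = \<zero>" if "b \<in> ?H" for b
      using indep[rule_format, of ?H "\<lambda>b. ?c b \<oplus> \<ominus> \<one> \<otimes> ?c' b" b] F G c n that by (auto simp: Pi_iff)
    have "?c b = ?c' b" if "b \<in> ?H" for b
    proof -
      have r: "?c b \<in> carrier R" "?c' b \<in> carrier R" using c that by (simp_all only: Pi_iff)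
      then have "?c b \<ominus> ?c' b = \<zero>" using 0[OF that] by (simp only: l_minus one_closed l_one minus_eq)
      then show ?thesis using r by (rule eq_of_minus)
    qed
    then have "comb N t ?H ?c = comb N t ?H ?c'"
    proof -
      interpret N: module R N by fact
      assume eq: "\<And>b. b \<in> ?H \<Longrightarrow> ?c b = ?c' b"
      show ?thesis unfolding comb_def using F G N(2) c(2) eq
        by (intro N.finsum_cong') (auto simp: Pi_iff)
    qed
    moreover have "comb N t ?H ?c = comb N t F c" "comb N t ?H ?c' = comb N t G c'"
      using F G N by (intro comb_extend N; auto)+
    ultimately show ?thesis by simp
  qed
  have extend: "\<exists>h. linear_map R M N h \<and> (\<forall>b\<in>B. h b = t b)" if N: "module R N" and t: "t \<in> B \<rightarrow> carrier N"
    for N :: "('a, 'n) module" and t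
  proof -
    interpret N: module R N by fact
    obtain F c where F: "\<And>x. x \<in> carrier M \<Longrightarrow> finite (F x) \<and> F x \<subseteq> B \<and> c x \<in> F x \<rightarrow> carrier R \<and> comb M (\<lambda>b. b) (F x) (c x) = x"
      using span by metis
    define h where "h x = comb N t (F x) (c x)" for x
    have h: "h x = comb N t G c'" if "x = comb M (\<lambda>b. b) G c'" "finite G" "G \<subseteq> B" "c' \<in> G \<rightarrow> carrier R" for x G c'
    proof -
      have "x \<in> carrier M" using that B by (auto intro!: comb_closed M')
      then have x: "finite (F x)" "F x \<subseteq> B" "c x \<in> F x \<rightarrow> carrier R" "comb M (\<lambda>b. b) (F x) (c x) = x" using F by blast+
      show ?thesis unfolding h_def by (rule well_defined[OF N t]) (use x that in simp_all)
    qed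
    have "linear_map R M N h"
    proof (rule linear_mapI)
      show "h x \<in> carrier N" if "x \<in> carrier M" for x
        unfolding h_def using F[OF that] t by (intro comb_closed N) auto
      show "h (r \<odot>\<^bsub>M\<^esub> x) = r \<odot>\<^bsub>N\<^esub> h x" if "r \<in> carrier R" "x \<in> carrier M" for r x
      proof -
        have "r \<odot>\<^bsub>M\<^esub> x = comb M (\<lambda>b. b) (F x) (\<lambda>b. r \<otimes> c x b)"
          using F[OF that(2)] that B by (subst comb_smult[OF M']) auto
        then have "h (r \<odot>\<^bsub>M\<^esub> x) = comb N t (F x) (\<lambda>b. r \<otimes> c x b)"
          using F[OF that(2)] that by (intro h) auto
        then show ?thesis unfolding h_def using F[OF that(2)] that t by (subst (asm) comb_smult[OF N]) auto
      qed
      show "h (x \<oplus>\<^bsub>M\<^esub> y) = h x \<oplus>\<^bsub>N\<^esub> h y" if xy: "x \<in> carrier M" "y \<in> carrier M" for x y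
      proof -
        let ?H = "F x \<union> F y"
        let ?c = "\<lambda>b. if b \<in> F x then c x b else \<zero>" and ?c' = "\<lambda>b. if b \<in> F y then c y b else \<zero>"
        note Fx = F[OF xy(1)] and Fy = F[OF xy(2)]
        have c: "?c \<in> ?H \<rightarrow> carrier R" "?c' \<in> ?H \<rightarrow> carrier R" using Fx Fy by auto
        have id: "(\<lambda>b. b) \<in> ?H \<rightarrow> carrier M" and t': "t \<in> ?H \<rightarrow> carrier N" using Fx Fy B t by auto
        have "comb M (\<lambda>b. b) ?H ?c = x" "comb M (\<lambda>b. b) ?H ?c' = y"
          using Fx Fy id by (subst comb_extend[OF M']; auto)+
        then have "x \<oplus>\<^bsub>M\<^esub> y = comb M (\<lambda>b. b) ?H (\<lambda>b. ?c b \<oplus> ?c' b)"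
          by (subst comb_add[OF M' id c]) simp
        then have "h (x \<oplus>\<^bsub>M\<^esub> y) = comb N t ?H (\<lambda>b. ?c b \<oplus> ?c' b)"
          using Fx Fy c by (intro h) auto
        also have "\<dots> = comb N t ?H ?c \<oplus>\<^bsub>N\<^esub> comb N t ?H ?c'"
          by (rule comb_add[OF N t' c])
        moreover have "comb N t ?H ?c = h x" "comb N t ?H ?c' = h y"
          unfolding h_def using Fx Fy t' by (intro comb_extend N; auto)+
        ultimately show ?thesis by simp
      qed
    qed
    moreover have "h b = t b" if "b \<in> B" for b
    proof -
      have tb: "t b \<in> carrier N" "b \<in> carrier M" using that B t by auto
      then have "comb M (\<lambda>b. b) {b} (\<lambda>_. \<one>) = b" "comb N t {b} (\<lambda>_. \<one>) = t b"
        by (simp_all add: comb_def)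
      then show ?thesis using h[OF sym, of "{b}" "\<lambda>_. \<one>" b] that by simp
    qed
    ultimately show ?thesis by blast
  qed
  show ?thesis using B extend bspec[OF span] by (rule that)
qed

lemma linear_maps_agree:
  assumes M: "module R M" and N: "module R N" and f: "linear_map R M N f" and g: "linear_map R M N g"
    and B: "B \<subseteq> carrier M" and eq: "\<And>b. b \<in> B \<Longrightarrow> f b = g b"
    and x: "\<exists>F c. finite F \<and> F \<subseteq> B \<and> c \<in> F \<rightarrow> carrier R \<and> x = comb M (\<lambda>b. b) F c"
  shows "f x = g x"
proof -
  interpret N: module R N by fact
  obtain F c where F: "finite F" "F \<subseteq> B" "c \<in> F \<rightarrow> carrier R" "x = comb M (\<lambda>b. b) F c"
    using x by blast
  have id: "(\<lambda>b. b) \<in> F \<rightarrow> carrier M" using F B by auto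
  have "comb N f F c = comb N g F c"
    unfolding comb_def using F eq B linear_mapD(1)[OF g] by (intro N.finsum_cong') (auto simp: Pi_iff subset_iff)
  then show ?thesis unfolding F(4) using linear_map_comb[OF M N f F(1) id F(3)] linear_map_comb[OF M N g F(1) id F(3)] by simp
qed

text \<open>The value on \<open>p @ w\<close>, where \<open>p\<close> consists of basis elements, of the multilinear map that takes
  the values \<open>t\<close> on words of basis elements.\<close>

primrec expand :: "(int \<Rightarrow> 'm set) \<Rightarrow> (int \<Rightarrow> ('a, 'm) module) \<Rightarrow> (int \<Rightarrow> ('a, 'n) module) \<Rightarrow> int \<Rightarrow>
    ('m word \<Rightarrow> 'n) \<Rightarrow> 'm word \<Rightarrow> 'm word \<Rightarrow> 'n" where
  "expand B P Y e t p [] = t p"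
| "expand B P Y e t p (z # w) =
    (SOME h. linear_map R (P (fst z)) (Y (wdeg p + (fst z + wdeg w) + e)) h \<and>
      (\<forall>b\<in>B (fst z). h b = expand B P Y e t (p @ [(fst z, b)]) w)) (snd z)"

text \<open>Choose preimages under \<open>D\<close> of \<open>u\<close> on words of basis elements,
  extend them multilinearly by \<open>expand\<close>, and compare with \<open>u\<close> on basis
  words again. Preimages cannot be chosen on all words at once, since \<open>Y\<close> need not
  split over the image of \<open>D\<close>.\<close>

lemma multilinear_lift:
  fixes Y Q :: "int \<Rightarrow> ('a, 'n) module"
  assumes free: "\<And>k. free_module R (P k)" and Q: "gmod Q" and Y: "gmod Y"
    and D: "\<And>k. linear_map R (Y k) (Q k) (D k)" and u: "fam P Q e u"
    and im: "\<And>w. w \<in> words P \<Longrightarrow> length w = n \<Longrightarrow> u w \<in> D (wdeg w + e) ` carrier (Y (wdeg w + e))"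
    and n: "n > 0"
  obtains \<nu> where "fam P Y e \<nu>" "\<And>w. w \<in> words P \<Longrightarrow> length w = n \<Longrightarrow> D (wdeg w + e) (\<nu> w) = u w"
    "\<And>w. length w \<noteq> n \<Longrightarrow> \<nu> w = \<zero>\<^bsub>Y (wdeg w + e)\<^esub>"
proof -
  have modP: "module R (P k)" for k using free by (simp add: free_module_def)
  define basis where "basis k B \<longleftrightarrow> B \<subseteq> carrier (P k) \<and>
      (\<forall>N t. module R (N :: ('a, 'n) module) \<longrightarrow> t \<in> B \<rightarrow> carrier N \<longrightarrow> (\<exists>h. linear_map R (P k) N h \<and> (\<forall>b\<in>B. h b = t b))) \<and>
      (\<forall>x\<in>carrier (P k). \<exists>F c. finite F \<and> F \<subseteq> B \<and> c \<in> F \<rightarrow> carrier R \<and> x = comb (P k) (\<lambda>b. b) F c)" for k B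
  have "\<exists>B. basis k B" for k
  proof (rule basis_extension[where 'n = 'n, OF free[of k]], goal_cases)
    case (1 B)
    show ?case unfolding basis_def by (intro exI[of _ B] conjI allI impI ballI 1)
  qed
  then obtain B where basis: "basis k (B k)" for k by metis
  have B: "B k \<subseteq> carrier (P k)" for k
    using basis[of k] by (simp add: basis_def)
  have ext: "\<exists>h. linear_map R (P k) N h \<and> (\<forall>b\<in>B k. h b = t b)" if "module R N" "t \<in> B k \<rightarrow> carrier N"
    for k t and N :: "('a, 'n) module"
    using basis[of k] that unfolding basis_def by blast
  have unique: "f x = g x" if "module R N" "linear_map R (P k) N f" "linear_map R (P k) N g" "\<And>b. b \<in> B k \<Longrightarrow> f b = g b"
      "x \<in> carrier (P k)" for k f g x and N :: "('a, 'n) module"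
    using linear_maps_agree[OF modP that(1-3) B that(4)] basis[of k] that(5) unfolding basis_def by blast
  define bw where "bw p \<longleftrightarrow> (\<forall>(k, b)\<in>set p. b \<in> B k)" for p
  have bw_words: "bw p \<Longrightarrow> p \<in> words P" for p using B by (fastforce simp: bw_def words_def)
  have bw_snoc: "bw p \<Longrightarrow> b \<in> B k \<Longrightarrow> bw (p @ [(k, b)])" for p k b by (auto simp: bw_def)
  \<comment> \<open>A preimage on basis words of length \<open>n\<close>, and any element of the
    module on the others, so that \<open>E_closed\<close> holds for all lengths.\<close>
  define t where "t p = (SOME y. y \<in> carrier (Y (wdeg p + e)) \<and> (length p = n \<longrightarrow> D (wdeg p + e) y = u p))" for p
  have t: "t p \<in> carrier (Y (wdeg p + e)) \<and> (length p = n \<longrightarrow> D (wdeg p + e) (t p) = u p)" if "bw p" for p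
    unfolding t_def
  proof (rule someI_ex)
    interpret Yk: module R "Y (wdeg p + e)" by (rule gmodD[OF Y])
    show "\<exists>y. y \<in> carrier (Y (wdeg p + e)) \<and> (length p = n \<longrightarrow> D (wdeg p + e) y = u p)"
      using im[OF bw_words[OF that]] Yk.zero_closed by (cases "length p = n") force+
  qed
  let ?E = "expand B P Y e t"
  \<comment> \<open>The linear map in the first open slot, chosen so that at basis elements it
    continues with the expansion of the remaining word.\<close>
  define H where "H p k w = (SOME h. linear_map R (P k) (Y (wdeg p + (k + wdeg w) + e)) h \<and>
      (\<forall>b\<in>B k. h b = ?E (p @ [(k, b)]) w))" for p k w
  have E_Cons: "?E p ((k, x) # w) = H p k w x" for p k x w
    by (simp add: H_def)
  have H': "linear_map R (P k) (Y (wdeg p + (k + wdeg w) + e)) (H p k w) \<and> (\<forall>b\<in>B k. H p k w b = ?E (p @ [(k, b)]) w)"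
    if "\<And>b. b \<in> B k \<Longrightarrow> ?E (p @ [(k, b)]) w \<in> carrier (Y (wdeg (p @ [(k, b)]) + wdeg w + e))" for p k w
    unfolding H_def using that by (intro someI_ex[OF ext] gmodD Y) (auto simp: algebra_simps)
  have E_closed: "?E p w \<in> carrier (Y (wdeg p + wdeg w + e))" if "bw p" "w \<in> words P" for p w
    using that
  proof (induction w arbitrary: p)
    case Nil
    then show ?case using t by simp
  next
    case (Cons z w)
    obtain k x where z: "z = (k, x)" by (cases z)
    have "linear_map R (P k) (Y (wdeg p + (k + wdeg w) + e)) (H p k w)"
      using Cons z by (intro conjunct1[OF H'] Cons.IH bw_snoc) auto
    then show ?case unfolding z E_Cons using Cons z by (auto simp: add.assoc dest: linear_mapD(1))
  qed
  have H: "linear_map R (P k) (Y (wdeg p + (k + wdeg w) + e)) (H p k w)" "b \<in> B k \<Longrightarrow> H p k w b = ?E (p @ [(k, b)]) w"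
    if "bw p" "w \<in> words P" for p k w b
    using H'[OF E_closed[OF bw_snoc[OF that(1)] that(2)], of k] by blast+
  have u_slot: "linear_map R (P k) (Q (wdeg p + (k + wdeg w) + e)) (\<lambda>x. u (p @ (k, x) # w))"
    if "p \<in> words P" "w \<in> words P" for p k w
  proof (rule linear_mapI)
    show "u (p @ (k, x) # w) \<in> carrier (Q (wdeg p + (k + wdeg w) + e))" if "x \<in> carrier (P k)" for x
      using famD(1)[OF u, of "p @ (k, x) # w"] that \<open>p \<in> _\<close> \<open>w \<in> _\<close> by (simp add: add.assoc)
  qed (use famD(2,3)[OF u that] in \<open>simp_all add: add.assoc\<close>)
  have DE: "D (wdeg p + wdeg w + e) (?E p w) = u (p @ w)" if "bw p" "w \<in> words P" "length (p @ w) = n" for p w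
    using that
  proof (induction w arbitrary: p)
    case Nil
    then show ?case using t by simp
  next
    case (Cons z w)
    obtain k x where z: "z = (k, x)" by (cases z)
    let ?j = "wdeg p + (k + wdeg w) + e"
    have w: "w \<in> words P" "x \<in> carrier (P k)" using Cons z by auto
    have "D ?j (H p k w x) = u (p @ (k, x) # w)"
    proof (rule unique[OF gmodD[OF Q] _ _ _ w(2)])
      show "linear_map R (P k) (Q ?j) (\<lambda>x. D ?j (H p k w x))"
        by (rule linear_map_comp[OF H(1)[OF Cons.prems(1) w(1)] D])
      show "linear_map R (P k) (Q ?j) (\<lambda>x. u (p @ (k, x) # w))"
        by (rule u_slot[OF bw_words[OF Cons.prems(1)] w(1)])
      show "D ?j (H p k w b) = u (p @ (k, b) # w)" if "b \<in> B k" for b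
        using Cons.IH[OF bw_snoc[OF Cons.prems(1) that] w(1)] Cons.prems H(2)[OF Cons.prems(1) w(1) that]
        by (simp add: add.assoc)
    qed
    then show ?case by (simp add: z E_Cons add.assoc del: expand.simps)
  qed
  have E_add: "?E p (a @ (k, x \<oplus>\<^bsub>P k\<^esub> y) # v) =
      ?E p (a @ (k, x) # v) \<oplus>\<^bsub>Y (wdeg p + (wdeg a + (k + wdeg v)) + e)\<^esub> ?E p (a @ (k, y) # v)"
    if "bw p" "a \<in> words P" "v \<in> words P" "x \<in> carrier (P k)" "y \<in> carrier (P k)" for p a k x y v
    using that
  proof (induction a arbitrary: p)
    case Nil
    then show ?case using linear_mapD(2)[OF H(1)] by (simp add: E_Cons add.assoc del: expand.simps)
  next
    case (Cons z a)
    obtain l x0 where z: "z = (l, x0)" by (cases z)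
    let ?w = "\<lambda>z. a @ (k, z) # v"
    interpret Pk: module R "P k" using free[of k] by (simp add: free_module_def)
    have w: "?w (x \<oplus>\<^bsub>P k\<^esub> y) \<in> words P" "?w x \<in> words P" "?w y \<in> words P" "x0 \<in> carrier (P l)"
      using Cons z by auto
    let ?j = "wdeg p + (l + (wdeg a + (k + wdeg v))) + e"
    have wd: "wdeg (?w z) = wdeg a + (k + wdeg v)" for z by simp
    have lin: "linear_map R (P l) (Y ?j) (H p l (?w z))" if "?w z \<in> words P" for z
      using H(1)[OF Cons.prems(1) that, of l] by simp
    \<comment> \<open>Both sides are linear in the first open slot, so they are compared at basis
      elements only; there the head becomes part of the prefix and the induction hypothesis
      applies.\<close>
    have "H p l (?w (x \<oplus>\<^bsub>P k\<^esub> y)) x0 = H p l (?w x) x0 \<oplus>\<^bsub>Y ?j\<^esub> H p l (?w y) x0"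
    proof (rule unique[OF gmodD[OF Y] _ _ _ w(4)])
      show "linear_map R (P l) (Y ?j) (\<lambda>x0. H p l (?w x) x0 \<oplus>\<^bsub>Y ?j\<^esub> H p l (?w y) x0)"
        by (rule linear_map_add[OF gmodD[OF Y] lin[OF w(2)] lin[OF w(3)]])
      show "H p l (?w (x \<oplus>\<^bsub>P k\<^esub> y)) b = H p l (?w x) b \<oplus>\<^bsub>Y ?j\<^esub> H p l (?w y) b" if "b \<in> B l" for b
        using Cons.IH[OF bw_snoc[OF Cons.prems(1) that]] Cons.prems H(2)[OF Cons.prems(1) w(1) that]
          H(2)[OF Cons.prems(1) w(2) that] H(2)[OF Cons.prems(1) w(3) that]
        by (simp add: add.assoc z)
    qed (rule lin[OF w(1)])
    then show ?case by (simp add: z E_Cons add.assoc del: expand.simps)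
  qed
  have E_smult: "?E p (a @ (k, c \<odot>\<^bsub>P k\<^esub> x) # v) =
      c \<odot>\<^bsub>Y (wdeg p + (wdeg a + (k + wdeg v)) + e)\<^esub> ?E p (a @ (k, x) # v)"
    if "bw p" "a \<in> words P" "v \<in> words P" "x \<in> carrier (P k)" "c \<in> carrier R" for p a k x c v
    using that
  proof (induction a arbitrary: p)
    case Nil
    then show ?case using linear_mapD(3)[OF H(1)] by (simp add: E_Cons add.assoc del: expand.simps)
  next
    case (Cons z a)
    obtain l x0 where z: "z = (l, x0)" by (cases z)
    let ?w = "\<lambda>z. a @ (k, z) # v"
    interpret Pk: module R "P k" using free[of k] by (simp add: free_module_def)
    have w: "?w (c \<odot>\<^bsub>P k\<^esub> x) \<in> words P" "?w x \<in> words P" "x0 \<in> carrier (P l)"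
      using Cons z by auto
    let ?j = "wdeg p + (l + (wdeg a + (k + wdeg v))) + e"
    have lin: "linear_map R (P l) (Y ?j) (H p l (?w z))" if "?w z \<in> words P" for z
      using H(1)[OF Cons.prems(1) that, of l] by simp
    have "H p l (?w (c \<odot>\<^bsub>P k\<^esub> x)) x0 = c \<odot>\<^bsub>Y ?j\<^esub> H p l (?w x) x0"
    proof (rule unique[OF gmodD[OF Y] _ _ _ w(3)])
      show "linear_map R (P l) (Y ?j) (\<lambda>x0. c \<odot>\<^bsub>Y ?j\<^esub> H p l (?w x) x0)"
        by (rule linear_map_smult[OF gmodD[OF Y] lin[OF w(2)] Cons.prems(5)])
      show "H p l (?w (c \<odot>\<^bsub>P k\<^esub> x)) b = c \<odot>\<^bsub>Y ?j\<^esub> H p l (?w x) b" if "b \<in> B l" for b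
        using Cons.IH[OF bw_snoc[OF Cons.prems(1) that]] Cons.prems H(2)[OF Cons.prems(1) w(1) that]
          H(2)[OF Cons.prems(1) w(2) that]
        by (simp add: add.assoc z)
    qed (rule lin[OF w(1)])
    then show ?case by (simp add: z E_Cons add.assoc del: expand.simps)
  qed
  have bwN: "bw []" by (simp add: bw_def)
  define \<nu> where "\<nu> w = (if length w = n then ?E [] w else \<zero>\<^bsub>Y (wdeg w + e)\<^esub>)" for w
  have "fam P Y e \<nu>"
  proof (rule famI)
    fix w assume w: "w \<in> words P"
    interpret Yk: module R "Y (wdeg w + e)" by (rule gmodD[OF Y])
    show "\<nu> w \<in> carrier (Y (wdeg w + e))" using E_closed[OF bwN w] by (simp add: \<nu>_def)
  next
    fix a v k x y assume *: "a \<in> words P" "v \<in> words P" "x \<in> carrier (P k)" "y \<in> carrier (P k)"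
    interpret Yk: module R "Y (wdeg a + k + wdeg v + e)" by (rule gmodD[OF Y])
    show "\<nu> (a @ [(k, x \<oplus>\<^bsub>P k\<^esub> y)] @ v) = \<nu> (a @ [(k, x)] @ v) \<oplus>\<^bsub>Y (wdeg a + k + wdeg v + e)\<^esub> \<nu> (a @ [(k, y)] @ v)"
      using E_add[OF bwN *] Yk.l_zero[OF Yk.zero_closed] by (simp add: \<nu>_def add.assoc)
  next
    fix a v k c x assume *: "a \<in> words P" "v \<in> words P" "c \<in> carrier R" "x \<in> carrier (P k)"
    interpret Yk: module R "Y (wdeg a + k + wdeg v + e)" by (rule gmodD[OF Y])
    show "\<nu> (a @ [(k, c \<odot>\<^bsub>P k\<^esub> x)] @ v) = c \<odot>\<^bsub>Y (wdeg a + k + wdeg v + e)\<^esub> \<nu> (a @ [(k, x)] @ v)"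
      using E_smult[OF bwN *(1,2,4,3)] Yk.smult_r_null[OF *(3)] by (simp add: \<nu>_def add.assoc)
  qed
  moreover have "D (wdeg w + e) (\<nu> w) = u w" if "w \<in> words P" "length w = n" for w
    using DE[OF bwN that(1)] that by (simp add: \<nu>_def)
  moreover have "\<nu> w = \<zero>\<^bsub>Y (wdeg w + e)\<^esub>" if "length w \<noteq> n" for w
    using that by (simp add: \<nu>_def)
  ultimately show ?thesis by (rule that)
qed

end

section \<open>Obstruction theory\<close>

context cring
begin

definition op :: "(int \<Rightarrow> ('a, 'm) module) \<Rightarrow> (int \<Rightarrow> ('a, 'n) module) \<Rightarrow> int \<Rightarrow> (int \<times> 'm, int \<times> 'n) oper \<Rightarrow> bool" where
  "op P Q e a \<longleftrightarrow> mlin R P Q a \<and> lv a \<and> hom e a"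

lemma opD: "op P Q e a \<Longrightarrow> mlin R P Q a" "op P Q e a \<Longrightarrow> lv a" "op P Q e a \<Longrightarrow> hom e a"
  by (auto simp: op_def)

lemma op_fop: "fam P Q e b \<Longrightarrow> gmod Q \<Longrightarrow> op P Q e (fop e b)"
  by (simp add: op_def mlin_fop hom_fop)

lemma op_diff: "op P Q e a \<Longrightarrow> op P Q e b \<Longrightarrow> op P Q e (a - b)"
  and op_add: "op P Q e a \<Longrightarrow> op P Q e b \<Longrightarrow> op P Q e (a + b)"
  by (simp_all add: op_def mlin_diff lv_diff hom_diff mlin_add lv_add hom_add)

lemma op_comp_star:
  assumes a: "op Q T e a" and \<phi>: "op P Q 0 \<phi>"
  shows "op P T e (a \<bullet> star \<phi>)"
proof -
  have "hom (e + 0) (a \<bullet> star \<phi>)"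
    using \<phi> by (intro hom_comp hom_star opD(3)[OF a]) (auto simp: op_def)
  moreover have "mlin R P T (a \<bullet> star \<phi>)"
    using \<phi> by (intro mlin_comp[OF opD(1)[OF a]] mlin_star) (auto simp: op_def)
  moreover have "lv (a \<bullet> star \<phi>)"
    using opD(2)[OF a] by (intro lv_comp) (simp_all add: one_sums)
  ultimately show ?thesis by (simp add: op_def)
qed

lemma op_comp_coder:
  assumes a: "op P Q e a" and P: "gmod P" and \<beta>: "op P P f \<beta>"
  shows "op P Q (e + f) (a \<bullet> coder \<beta>)"
proof -
  have "app (coder \<beta>) [] = 0" using opD(2)[OF \<beta>] by (simp add: coder_def)
  then show ?thesis
    unfolding op_def by (intro conjI hom_comp hom_coder mlin_comp[OF opD(1)[OF a]] mlin_coder lv_comp opD[OF a] opD[OF \<beta>] P) simp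
qed

lemma op_comp_htpy:
  assumes a: "op Q T e a" and o: "op P Q 0 \<phi>" "op P Q f \<eta>" "op P Q 0 \<gamma>"
  shows "op P T (e + f) (a \<bullet> htpy \<phi> \<eta> \<gamma>)"
proof -
  have "app (htpy \<phi> \<eta> \<gamma>) [] = 0" using opD(2)[OF o(2)] by (simp add: htpy_def)
  then show ?thesis
    unfolding op_def by (intro conjI hom_comp hom_htpy mlin_comp[OF opD(1)[OF a]] mlin_htpy lv_comp
        opD[OF a] opD[OF o(1)] opD[OF o(2)] opD[OF o(3)]) simp
qed

lemma op_comp: "op Q T e a \<Longrightarrow> op P Q f b \<Longrightarrow> op P T (e + f) (a \<bullet> b)"
  unfolding op_def by (auto intro!: mlin_comp lv_comp hom_comp)

lemma op_represent:
  assumes "gmod P" "gmod Q" "op P Q e a"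
  obtains b where "fam P Q e b" "Nul R P Q (a - fop e b)"
  using represent[OF assms(1,2)] assms(3) unfolding op_def by blast

text \<open>The values of \<open>b\<close> consist of letters, and \<open>a\<close> is null on
  letters. For a minimal structure \<open>\<beta>\<close> this removes linear terms such as
  \<open>\<beta> \<bullet> (\<beta>' - \<beta>)\<close>.\<close>

lemma Nul_lv_comp_lv:
  assumes a: "Null R Q T 2 a" and b: "mlin R P Q b" "lv b"
  shows "Null R P T k (a \<bullet> b)"
proof -
  have "nul R T (app (a \<bullet> b) w) \<and> good T (app (a \<bullet> b) w)" if "w \<in> words P" for w
  proof -
    have "Poly_Mapping.keys (app b w) \<subseteq> {v \<in> words Q. length v < 2}"
      using mlinD(1)[OF b(1) that] b(2) unfolding good_def lv_def by fastforce
    moreover have "nul R T (ext a s) \<and> good T (ext a s)" if "Poly_Mapping.keys s \<subseteq> {v \<in> words Q. length v < 2}" for s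
      using that by (induction s rule: frag_induction) (auto intro: nul_diff good_diff NullD[OF a])
    ultimately show ?thesis unfolding app_comp by blast
  qed
  then show ?thesis by (simp add: Null_def)
qed

lemma Null_eq_on_letter:
  assumes Q: "gmod Q" and b: "fam P Q e b" and b': "fam P Q e b'" and "Null R P Q k (fop e b - fop e b')"
    and w: "w \<in> words P" "w \<noteq> []" "length w < k"
  shows "b w = b' w"
  using letter_eq[OF Q famD(1)[OF b w(1,2)] famD(1)[OF b' w(1,2)]] NullD(2)[OF assms(4) w(1,3)] w(2)
  by (simp add: app_fop)

lemma Null_fop_iff:
  assumes Q: "gmod Q" and b: "fam P Q e b"
  shows "Null R P Q k (fop e b) \<longleftrightarrow> (\<forall>w\<in>words P. w \<noteq> [] \<longrightarrow> length w < k \<longrightarrow> b w = \<zero>\<^bsub>Q (wdeg w + e)\<^esub>)"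
proof -
  have "nul R Q (app (fop e b) w) \<longleftrightarrow> (w \<noteq> [] \<longrightarrow> b w = \<zero>\<^bsub>Q (wdeg w + e)\<^esub>)" if "w \<in> words P" for w
    using letter_nul[OF Q famD(1)[OF b that]] by (simp add: app_fop)
  then show ?thesis using mlinD(1)[OF mlin_fop[OF b Q]] by (auto simp: Null_def)
qed

text \<open>Stage \<open>i\<close> differs from the next one only on words of length at least
  \<open>i + c\<close>, so on a fixed word the sequence is eventually constant.\<close>

lemma limit_family:
  assumes Q: "gmod Q" and b: "\<And>i. fam P Q e (b i)" and step: "\<And>i. Null R P Q (i + c) (fop e (b (Suc i)) - fop e (b i))"
    and c: "c > 0"
  obtains b' where "fam P Q e b'" "\<And>i. Null R P Q (i + c) (fop e b' - fop e (b i))"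
proof -
  have mono: "Null R P Q (i + c) (fop e (b (i + j)) - fop e (b i))" for i j
  proof (induction j)
    case (Suc j)
    from Null_add[OF Null_mono[OF step[of "i + j"]] Suc] show ?case by simp
  qed simp
  \<comment> \<open>On \<open>w\<close> the stage \<open>length w\<close> is already final, because
    \<open>c > 0\<close>.\<close>
  define b' where "b' w = b (length w) w" for w
  have fam: "fam P Q e b'"
    unfolding fam_def b'_def using b unfolding fam_def by simp
  have "Null R P Q (i + c) (fop e b' - fop e (b i))" for i
  proof -
    have "nul R Q (app (fop e b' - fop e (b i)) w)" if w: "w \<in> words P" "length w < i + c" for w
    proof -
      have "nul R Q (app (fop e (b (length w)) - fop e (b i)) w)"
      proof (cases "length w \<ge> i")
        case True
        then show ?thesis using NullD(2)[OF mono[of i "length w - i"] w(1)] w(2) by simp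
      next
        case False
        then show ?thesis using nul_uminus[OF NullD(2)[OF mono[of "length w" "i - length w"] w(1)]] c by simp
      qed
      then show ?thesis by (cases "w = []") (simp_all add: app_fop b'_def)
    qed
    then show ?thesis
      using mlinD(1)[OF mlin_diff[OF mlin_fop[OF fam Q] mlin_fop[OF b Q]]] by (simp add: Null_def)
  qed
  with fam show ?thesis by (rule that)
qed

end

text \<open>A complex \<open>(Q, d)\<close>, \<open>d\<close> being the first component of the \<open>A\<^sub>\<infinity>\<close>-structure \<open>bA\<close>, and its
  homology \<open>P\<close>; \<open>cl\<close> sends a cycle to its class.\<close>

locale hcomplex = cring R for R (structure) +
  fixes Q :: "int \<Rightarrow> ('a, 'n) module" and bA :: "'n word \<Rightarrow> 'n"
    and P :: "int \<Rightarrow> ('a, 'm) module" and cl :: "int \<Rightarrow> 'n \<Rightarrow> 'm"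
  assumes gQ: "gmod Q" and freeP: "\<And>k. free_module R (P k)"
    and fam_bA: "fam Q Q 1 bA" and bA_square: "Nul R Q Q (fop 1 bA \<bullet> coder (fop 1 bA))"
    and cl_closed: "\<And>k z. z \<in> carrier (Q k) \<Longrightarrow> bA [(k, z)] = \<zero>\<^bsub>Q (k + 1)\<^esub> \<Longrightarrow> cl k z \<in> carrier (P k)"
    and cl_add: "\<And>k y z. y \<in> carrier (Q k) \<Longrightarrow> bA [(k, y)] = \<zero>\<^bsub>Q (k + 1)\<^esub> \<Longrightarrow>
      z \<in> carrier (Q k) \<Longrightarrow> bA [(k, z)] = \<zero>\<^bsub>Q (k + 1)\<^esub> \<Longrightarrow> cl k (y \<oplus>\<^bsub>Q k\<^esub> z) = cl k y \<oplus>\<^bsub>P k\<^esub> cl k z"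
    and cl_smult: "\<And>k c z. c \<in> carrier R \<Longrightarrow> z \<in> carrier (Q k) \<Longrightarrow> bA [(k, z)] = \<zero>\<^bsub>Q (k + 1)\<^esub> \<Longrightarrow>
      cl k (c \<odot>\<^bsub>Q k\<^esub> z) = c \<odot>\<^bsub>P k\<^esub> cl k z"
    and cl_zero_iff: "\<And>k z. z \<in> carrier (Q k) \<Longrightarrow> bA [(k, z)] = \<zero>\<^bsub>Q (k + 1)\<^esub> \<Longrightarrow>
      cl k z = \<zero>\<^bsub>P k\<^esub> \<longleftrightarrow> (\<exists>y\<in>carrier (Q (k - 1)). z = bA [(k - 1, y)])"
    and cl_surj: "\<And>k x. x \<in> carrier (P k) \<Longrightarrow> \<exists>z\<in>carrier (Q k). bA [(k, z)] = \<zero>\<^bsub>Q (k + 1)\<^esub> \<and> cl k z = x"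
begin

abbreviation \<alpha> :: "(int \<times> 'n, int \<times> 'n) oper" where
  "\<alpha> \<equiv> fop 1 bA"

definition cycle :: "int \<Rightarrow> 'n \<Rightarrow> bool" where
  "cycle k z \<longleftrightarrow> z \<in> carrier (Q k) \<and> bA [(k, z)] = \<zero>\<^bsub>Q (k + 1)\<^esub>"

text \<open>On letters the map picks a cycle in each class; for the model this is the condition that
  \<open>f\<^sub>1\<close> induces the identity in homology.\<close>

definition representing :: "('m word \<Rightarrow> 'n) \<Rightarrow> bool" where
  "representing \<phi> \<longleftrightarrow> fam P Q 0 \<phi> \<and> (\<forall>k. \<forall>x\<in>carrier (P k). cycle k (\<phi> [(k, x)]) \<and> cl k (\<phi> [(k, x)]) = x)"

lemma gP: "gmod P"
  using freeP by (simp add: gmod_def free_module_def)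

lemma op_\<alpha>: "op Q Q 1 \<alpha>"
  by (rule op_fop[OF fam_bA gQ])

lemma diff_linear: "linear_map R (Q k) (Q (k + 1)) (\<lambda>x. bA [(k, x)])"
  using famD(1)[OF fam_bA, of "[(k, x)]" for x] famD(2)[OF fam_bA, of "[]" "[]"] famD(3)[OF fam_bA, of "[]" "[]"]
  by (intro linear_mapI) simp_all

lemma cl_boundary: "y \<in> carrier (Q (k - 1)) \<Longrightarrow> cycle k (bA [(k - 1, y)]) \<Longrightarrow> cl k (bA [(k - 1, y)]) = \<zero>\<^bsub>P k\<^esub>"
  using cl_zero_iff unfolding cycle_def by blast

text \<open>\<open>\<alpha> \<bullet> E\<close> takes boundaries as values, while
  \<open>fop 0 \<phi> \<bullet> X\<close> takes cycles representing the values of \<open>X\<close>.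
  If the sum vanishes, these cycles are boundaries, so their classes \<open>X\<close> are zero, and
  then the other summand vanishes too.\<close>

lemma separate:
  assumes S: "gmod S" and E: "op S Q e E" and X: "op S P (e + 1) X" and \<phi>: "representing \<phi>"
    and eq: "Null R S Q k (\<alpha> \<bullet> E + fop 0 \<phi> \<bullet> X)"
  shows "Null R S P k X" "Null R S Q k (\<alpha> \<bullet> E)"
proof -
  have \<phi>': "fam P Q 0 \<phi>" using \<phi> by (simp add: representing_def)
  note m = opD(1)[OF E] opD(1)[OF X] opD(1)[OF op_\<alpha>] mlin_fop[OF \<phi>' gQ]
  obtain b where b: "fam S Q e b" "Nul R S Q (E - fop e b)" using op_represent[OF S gQ E] .
  obtain x where x: "fam S P (e + 1) x" "Nul R S P (X - fop (e + 1) x)" using op_represent[OF S gP X] .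
  have "x w = \<zero>\<^bsub>P (wdeg w + (e + 1))\<^esub>" if w: "w \<in> words S" "w \<noteq> []" "length w < k" for w
  proof -
    let ?j = "wdeg w + e"
    interpret Qj: module R "Q ?j" by (rule gmodD[OF gQ])
    interpret Qj1: module R "Q (?j + 1)" by (rule gmodD[OF gQ])
    have bw: "b w \<in> carrier (Q ?j)" by (rule famD(1)[OF b(1) w(1,2)])
    have xw: "x w \<in> carrier (P (?j + 1))" using famD(1)[OF x(1) w(1,2)] by (simp add: add.assoc)
    have phix: "cycle (?j + 1) (\<phi> [(?j + 1, x w)])" "cl (?j + 1) (\<phi> [(?j + 1, x w)]) = x w"
      using \<phi> xw by (auto simp: representing_def)
    let ?z = "bA [(?j, b w)]" and ?p = "\<phi> [(?j + 1, x w)]"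
    have z: "?z \<in> carrier (Q (?j + 1))" using linear_mapD(1)[OF diff_linear bw] .
    have p: "?p \<in> carrier (Q (?j + 1))" using phix by (simp add: cycle_def)
    have "Null R S Q k ((\<alpha> \<bullet> E + fop 0 \<phi> \<bullet> X) - \<alpha> \<bullet> (E - fop e b) - fop 0 \<phi> \<bullet> (X - fop (e + 1) x))"
      by (rule Null_diff[OF Null_diff[OF eq Null_comp_left[OF m(3) spec[OF b(2)]]] Null_comp_left[OF m(4) spec[OF x(2)]]])
    then have "Null R S Q k (\<alpha> \<bullet> fop e b + fop 0 \<phi> \<bullet> fop (e + 1) x)" by (simp add: algebra_simps)
    from NullD(2)[OF this w(1,3)] have "nul R Q (frag_of [(?j + 1, ?z)] + frag_of [(?j + 1, ?p)])"
      using w by (simp add: app_comp app_fop add.assoc)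
    from nul_add[OF letter_add[OF gQ z p] this] have "nul R Q (frag_of [(?j + 1, ?z \<oplus>\<^bsub>Q (?j + 1)\<^esub> ?p)])"
      by (simp add: algebra_simps)
    then have "?z \<oplus>\<^bsub>Q (?j + 1)\<^esub> ?p = \<zero>\<^bsub>Q (?j + 1)\<^esub>"
      using letter_nul[OF gQ Qj1.a_closed[OF z p]] by simp
    then have "?p = \<ominus>\<^bsub>Q (?j + 1)\<^esub> ?z" using Qj1.minus_equality[of ?p ?z] Qj1.a_comm[OF z p] z p by simp
    \<comment> \<open>The minus sign is carried through the differential as a scalar, which exhibits
      \<open>?p\<close> as a boundary.\<close>
    also have "\<dots> = (\<ominus> \<one>) \<odot>\<^bsub>Q (?j + 1)\<^esub> ?z" using z by (simp add: Qj1.smult_l_minus)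
    also have "\<dots> = bA [(?j, (\<ominus> \<one>) \<odot>\<^bsub>Q ?j\<^esub> b w)]" using linear_mapD(3)[OF diff_linear _ bw] by simp
    finally have "?p = bA [(?j, (\<ominus> \<one>) \<odot>\<^bsub>Q ?j\<^esub> b w)]" .
    then have "cl (?j + 1) ?p = \<zero>\<^bsub>P (?j + 1)\<^esub>"
      using cl_boundary[of "(\<ominus> \<one>) \<odot>\<^bsub>Q ?j\<^esub> b w" "?j + 1"] phix(1) bw by simp
    then show ?thesis using phix(2) by (simp add: add.assoc)
  qed
  then have "Null R S P k (fop (e + 1) x)" by (simp add: Null_fop_iff[OF gP x(1)])
  then show X0: "Null R S P k X" using x(2) Null_cancel by blast
  have "Null R S Q k ((\<alpha> \<bullet> E + fop 0 \<phi> \<bullet> X) - fop 0 \<phi> \<bullet> X)"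
    by (intro Null_diff eq Null_comp_left[OF m(4)] X0)
  then show "Null R S Q k (\<alpha> \<bullet> E)" by simp
qed

text \<open>In length \<open>n\<close> the values of \<open>U\<close> are cycles. Their classes form
  \<open>\<omega>\<close>; after subtraction of the representatives of \<open>\<omega>\<close> only
  boundaries remain, and freeness of the source lets \<open>multilinear_lift\<close> choose
  primitives \<open>\<nu>\<close>.\<close>

lemma decompose:
  assumes freeS: "\<And>k. free_module R (S k)" and U: "op S Q e U" "Null R S Q n U" "Null R S Q (Suc n) (\<alpha> \<bullet> U)"
    and n: "n > 0" and \<phi>: "representing \<phi>"
  obtains \<omega> \<nu> where "fam S P e \<omega>" "fam S Q (e - 1) \<nu>" "Null R S P n (fop e \<omega>)" "Null R S Q n (fop (e - 1) \<nu>)"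
    "Null R S Q (Suc n) (U - fop 0 \<phi> \<bullet> fop e \<omega> - \<alpha> \<bullet> fop (e - 1) \<nu>)"
proof -
  have S: "gmod S" using freeS by (simp add: gmod_def free_module_def)
  have \<phi>': "fam P Q 0 \<phi>" using \<phi> by (simp add: representing_def)
  note m = opD(1)[OF U(1)] opD(1)[OF op_\<alpha>] mlin_fop[OF \<phi>' gQ]
  obtain b where b: "fam S Q e b" "Nul R S Q (U - fop e b)" using op_represent[OF S gQ U(1)] .
  have cyc: "cycle (wdeg w + e) (b w)" if w: "w \<in> words S" "length w = n" for w
  proof -
    have w0: "w \<noteq> []" using w n by auto
    have bw: "b w \<in> carrier (Q (wdeg w + e))" by (rule famD(1)[OF b(1) w(1) w0])
    have "Null R S Q (Suc n) (\<alpha> \<bullet> U - \<alpha> \<bullet> (U - fop e b))"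
      by (rule Null_diff[OF U(3) Null_comp_left[OF m(2) spec[OF b(2)]]])
    then have "Null R S Q (Suc n) (\<alpha> \<bullet> fop e b)" by simp
    from NullD(2)[OF this w(1)] show ?thesis
      using w w0 bw letter_nul[OF gQ linear_mapD(1)[OF diff_linear bw]]
      by (simp add: app_comp app_fop cycle_def add.assoc)
  qed
  define \<omega> where "\<omega> w = (if length w = n then cl (wdeg w + e) (b w) else \<zero>\<^bsub>P (wdeg w + e)\<^esub>)" for w
  have \<omega>: "fam S P e \<omega>"
  proof (rule famI)
    fix w assume w: "w \<in> words S"
    interpret Pj: module R "P (wdeg w + e)" by (rule gmodD[OF gP])
    show "\<omega> w \<in> carrier (P (wdeg w + e))"
      using cyc[OF w] cl_closed by (simp add: \<omega>_def cycle_def)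
  next
    fix u v k x y assume *: "u \<in> words S" "v \<in> words S" "x \<in> carrier (S k)" "y \<in> carrier (S k)"
    let ?j = "wdeg u + k + wdeg v + e"
    interpret Pj: module R "P ?j" by (rule gmodD[OF gP])
    have "cycle ?j (b (u @ [(k, z)] @ v))" if "z \<in> carrier (S k)" "length u + Suc (length v) = n" for z
      using cyc[of "u @ [(k, z)] @ v"] * that by (simp add: add.assoc)
    then show "\<omega> (u @ [(k, x \<oplus>\<^bsub>S k\<^esub> y)] @ v) = \<omega> (u @ [(k, x)] @ v) \<oplus>\<^bsub>P ?j\<^esub> \<omega> (u @ [(k, y)] @ v)"
      using cl_add[of _ ?j] famD(2)[OF b(1) *] * Pj.l_zero[OF Pj.zero_closed] by (simp add: \<omega>_def cycle_def add.assoc)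
  next
    fix u v k c x assume *: "u \<in> words S" "v \<in> words S" "c \<in> carrier R" "x \<in> carrier (S k)"
    let ?j = "wdeg u + k + wdeg v + e"
    interpret Pj: module R "P ?j" by (rule gmodD[OF gP])
    have "cycle ?j (b (u @ [(k, x)] @ v))" if "length u + Suc (length v) = n"
      using cyc[of "u @ [(k, x)] @ v"] * that by (simp add: add.assoc)
    then show "\<omega> (u @ [(k, c \<odot>\<^bsub>S k\<^esub> x)] @ v) = c \<odot>\<^bsub>P ?j\<^esub> \<omega> (u @ [(k, x)] @ v)"
      using cl_smult[of c _ ?j] famD(3)[OF b(1) *] * Pj.smult_r_null[OF *(3)] by (simp add: \<omega>_def cycle_def add.assoc)
  qed
  have \<omega>0: "Null R S P n (fop e \<omega>)" by (simp add: Null_fop_iff[OF gP \<omega>] \<omega>_def)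
  let ?V = "U - fop 0 \<phi> \<bullet> fop e \<omega>"
  have V: "op S Q e ?V"
    using op_comp[OF op_fop[OF \<phi>' gQ] op_fop[OF \<omega> gP]] by (intro op_diff U) simp
  obtain u where u: "fam S Q e u" "Nul R S Q (?V - fop e u)" using op_represent[OF S gQ V] .
  have im: "u w \<in> (\<lambda>y. bA [(wdeg w + e - 1, y)]) ` carrier (Q (wdeg w + e - 1))" if w: "w \<in> words S" "length w = n" for w
  proof -
    let ?j = "wdeg w + e"
    interpret Qj: module R "Q ?j" by (rule gmodD[OF gQ])
    interpret Qj1: module R "Q (?j + 1)" by (rule gmodD[OF gQ])
    interpret Pj: module R "P ?j" by (rule gmodD[OF gP])
    have w0: "w \<noteq> []" using w n by auto
    let ?p = "\<phi> [(?j, \<omega> w)]"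
    have \<omega>w: "\<omega> w \<in> carrier (P ?j)" "cl ?j (b w) = \<omega> w" using famD(1)[OF \<omega> w(1) w0] w(2) by (simp_all add: \<omega>_def)
    have p: "cycle ?j ?p" "cl ?j ?p = \<omega> w" using \<phi> \<omega>w by (auto simp: representing_def)
    have uw: "u w \<in> carrier (Q ?j)" by (rule famD(1)[OF u(1) w(1) w0])
    have c: "cycle ?j (b w)" by (rule cyc[OF w])
    have "Nul R S Q ((U - fop e b) - (?V - fop e u))" using Null_diff[OF spec[OF b(2)] spec[OF u(2)]] by blast
    from NulD[OF this w(1)] have "nul R Q (frag_of [(?j, ?p)] + frag_of [(?j, u w)] - frag_of [(?j, b w)])"
      using w0 by (simp add: app_comp app_fop algebra_simps)
    from nul_add[OF letter_add[OF gQ _ uw, of ?p] this]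
    have "nul R Q (frag_of [(?j, ?p \<oplus>\<^bsub>Q ?j\<^esub> u w)] - frag_of [(?j, b w)])"
      using p by (simp add: algebra_simps cycle_def)
    then have e: "?p \<oplus>\<^bsub>Q ?j\<^esub> u w = b w"
      by (rule letter_eq[OF gQ, rotated 2]) (use p c uw in \<open>simp_all add: cycle_def\<close>)
    have pc: "?p \<in> carrier (Q ?j)" "bA [(?j, ?p)] = \<zero>\<^bsub>Q (?j + 1)\<^esub>" using p by (auto simp: cycle_def)
    have "bA [(?j, u w)] = \<zero>\<^bsub>Q (?j + 1)\<^esub>"
      using linear_mapD(2)[OF diff_linear pc(1) uw] linear_mapD(1)[OF diff_linear uw] e c pc(2)
      by (simp add: cycle_def)
    then have cu: "cycle ?j (u w)" using uw by (simp add: cycle_def)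
    have "\<omega> w \<oplus>\<^bsub>P ?j\<^esub> cl ?j (u w) = \<omega> w"
      using cl_add[of ?p ?j "u w"] e p(2) \<omega>w(2) pc cu by (simp add: cycle_def)
    then have "cl ?j (u w) = \<zero>\<^bsub>P ?j\<^esub>"
      using \<omega>w(1) cl_closed[of "u w" ?j] cu by (simp add: cycle_def)
    then show ?thesis using cl_zero_iff[of "u w" ?j] cu by (auto simp: cycle_def)
  qed
  have D: "linear_map R (Q (k - 1)) (Q k) (\<lambda>y. bA [(k - 1, y)])" for k
    using diff_linear[of "k - 1"] by simp
  \<comment> \<open>Shifting the degree turns the differential into maps that preserve the index, as
    \<open>multilinear_lift\<close> expects.\<close>
  have Y: "gmod (\<lambda>k. Q (k - 1))" using gQ by (simp add: gmod_def)
  obtain \<nu> where \<nu>: "fam S (\<lambda>k. Q (k - 1)) e \<nu>"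
    "\<And>w. w \<in> words S \<Longrightarrow> length w = n \<Longrightarrow> bA [(wdeg w + e - 1, \<nu> w)] = u w"
    "\<And>w. length w \<noteq> n \<Longrightarrow> \<nu> w = \<zero>\<^bsub>Q (wdeg w + e - 1)\<^esub>"
    by (rule multilinear_lift[where D = "\<lambda>k y. bA [(k - 1, y)]", OF freeS gQ Y D u(1) im n]) blast+
  have \<nu>f: "fam S Q (e - 1) \<nu>"
    using \<nu>(1) unfolding fam_def by (simp add: add_diff_eq)
  have \<nu>0: "Null R S Q n (fop (e - 1) \<nu>)"
    using \<nu>(3) by (simp add: Null_fop_iff[OF gQ \<nu>f] add_diff_eq)
  have "Null R S Q (Suc n) (?V - \<alpha> \<bullet> fop (e - 1) \<nu>)"
    unfolding Null_def
  proof (intro ballI conjI impI)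
    fix w assume w: "w \<in> words S"
    have "mlin R S Q (?V - \<alpha> \<bullet> fop (e - 1) \<nu>)"
      by (rule mlin_diff[OF opD(1)[OF V] mlin_comp[OF m(2) mlin_fop[OF \<nu>f gQ]]])
    then show "good Q (app (?V - \<alpha> \<bullet> fop (e - 1) \<nu>) w)" using w by (rule mlinD(1))
    assume "length w < Suc n"
    then consider "length w < n" | "length w = n" by linarith
    then show "nul R Q (app (?V - \<alpha> \<bullet> fop (e - 1) \<nu>) w)"
    proof cases
      case 1
      have "Null R S Q n (?V - \<alpha> \<bullet> fop (e - 1) \<nu>)"
        by (intro Null_diff U Null_comp_left[OF m(3)] Null_comp_left[OF m(2)] \<omega>0 \<nu>0)
      then show ?thesis using NullD(2) w 1 by blast
    next
      case 2
      then have "app (\<alpha> \<bullet> fop (e - 1) \<nu>) w = app (fop e u) w"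
        using \<nu>(2)[OF w 2] n by (auto simp: app_comp app_fop algebra_simps)
      then show ?thesis using NulD[OF u(2) w] by simp
    qed
  qed
  with \<omega> \<nu>f \<omega>0 \<nu>0 show ?thesis by (rule that)
qed

end

section \<open>The square of a coderivation in leading order\<close>

context cring
begin

lemma Null_comp_coder_op:
  "gmod P \<Longrightarrow> mlin R P Q a \<Longrightarrow> Null R P Q k a \<Longrightarrow> op P P 1 \<beta> \<Longrightarrow> Null R P P 2 \<beta> \<Longrightarrow> Null R P Q (Suc k) (a \<bullet> coder \<beta>)"
  by (intro Null_comp_coder) (auto simp: op_def)

lemma square_leading:
  assumes P: "gmod P" and \<beta>: "op P P 1 \<beta>" and "Null R P P k (\<beta> \<bullet> coder \<beta>)"
  shows "Null R P P (Suc k) (coder \<beta> \<bullet> coder \<beta> - \<beta> \<bullet> coder \<beta>)"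
  unfolding coder_comp_coder[OF opD(2,3)[OF \<beta>]]
  by (intro Null_sandwich mlin_ident gmodD P Null_ident_minus_one assms)

lemma coder_square_null:
  assumes P: "gmod P" and \<beta>: "op P P 1 \<beta>" and "Nul R P P (\<beta> \<bullet> coder \<beta>)"
  shows "Nul R P P (coder \<beta> \<bullet> coder \<beta>)"
proof
  fix k
  show "Null R P P k (coder \<beta> \<bullet> coder \<beta>)"
    using assms(3) unfolding coder_comp_coder[OF opD(2,3)[OF \<beta>]]
    by (intro Null_mult_left Null_mult_right mlin_ident gmodD P) blast
qed

text \<open>Both linear terms of the change gain order:
  \<open>(\<beta>' - \<beta>) \<bullet> coder \<beta>'\<close> because the coderivation shortens
  words, and \<open>\<beta> \<bullet> (\<beta>' - \<beta>)\<close> because \<open>\<beta>\<close> is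
  null on letters. So a correction in length \<open>k\<close> does not disturb the square in length
  \<open>k\<close>.\<close>

lemma square_change:
  assumes P: "gmod P" and \<beta>: "op P P 1 \<beta>" "Null R P P 2 \<beta>" and \<beta>': "op P P 1 \<beta>'" "Null R P P 2 \<beta>'"
    and k: "Null R P P k (\<beta>' - \<beta>)"
  shows "Null R P P (Suc k) (\<beta>' \<bullet> coder \<beta>' - \<beta> \<bullet> coder \<beta>)"
proof -
  note o = op_diff[OF \<beta>'(1) \<beta>(1)]
  have "Null R P P (Suc k) ((\<beta>' - \<beta>) \<bullet> coder \<beta>' + \<beta> \<bullet> (coder \<beta>' - coder \<beta> - (\<beta>' - \<beta>)) + \<beta> \<bullet> (\<beta>' - \<beta>))"
    by (rule Null_add[OF Null_add[OF Null_comp_coder_op[OF P opD(1)[OF o] k \<beta>']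
        Null_comp_left[OF opD(1)[OF \<beta>(1)] Null_coder_diff_leading[OF P k]]] Nul_lv_comp_lv[OF \<beta>(2) opD(1,2)[OF o]]])
  then show ?thesis by (simp add: algebra_simps)
qed

end

section \<open>Construction of the minimal model by word length\<close>

context hcomplex
begin

definition defect :: "(int \<times> 'm, int \<times> 'm) oper \<Rightarrow> (int \<times> 'm, int \<times> 'n) oper \<Rightarrow> (int \<times> 'm, int \<times> 'n) oper" where
  "defect \<beta> \<phi> = \<alpha> \<bullet> star \<phi> - \<phi> \<bullet> coder \<beta>"

lemma op_defect: "op P P 1 \<beta> \<Longrightarrow> op P Q 0 \<phi> \<Longrightarrow> op P Q 1 (defect \<beta> \<phi>)"
  unfolding defect_def using op_diff[OF op_comp_star[OF op_\<alpha>] op_comp_coder[OF _ gP, of Q 0 _ 1, simplified]] .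

lemma alpha_square_comp: "mlin R S Q a \<Longrightarrow> Nul R S Q (\<alpha> \<bullet> (coder \<alpha> \<bullet> a))"
  using Nul_comp_right[OF bA_square] by (simp add: comp_assoc)

text \<open>Apply \<open>\<alpha>\<close> to the failure of \<open>star \<phi>\<close> to commute
  with the coderivations. Composites of \<open>\<alpha>\<close> with \<open>coder \<alpha>\<close>
  are null, the defect composed with \<open>coder \<beta>\<close> gains order, and the square of
  \<open>\<beta>\<close> enters through \<open>\<phi>\<close>. The result has the shape required by
  \<open>separate\<close>.\<close>

lemma defect_cycle:
  assumes \<beta>: "op P P 1 \<beta>" "Null R P P 2 \<beta>" and \<phi>: "op P Q 0 \<phi>"
    and n: "Null R P Q n (defect \<beta> \<phi>)" "Null R P P n (\<beta> \<bullet> coder \<beta>)"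
  shows "Null R P Q (Suc n) (\<alpha> \<bullet> defect \<beta> \<phi> + \<phi> \<bullet> (\<beta> \<bullet> coder \<beta>))"
proof -
  let ?E = "defect \<beta> \<phi>" and ?d = "coder \<beta>" and ?F = "star \<phi>"
  note m = opD(1)[OF \<beta>(1)] opD(1)[OF \<phi>] opD(1)[OF op_\<alpha>] opD(1)[OF op_defect[OF \<beta>(1) \<phi>]]
  note l = opD(2)[OF \<beta>(1)] opD(2)[OF \<phi>]
  have F: "mlin R P Q ?F" by (rule mlin_star[OF m(2) lv_Nil[OF l(2)]])
  have comm: "coder \<alpha> \<bullet> ?F = ?F \<bullet> ?d + sg ?F * ?E * ?F"
    unfolding defect_def coder_comp_star[OF l(2) opD(3)[OF \<phi>]] star_comp_coder[OF l(2,1)] by (simp add: algebra_simps)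
  have id: "\<alpha> \<bullet> ?E + \<phi> \<bullet> (\<beta> \<bullet> ?d) = \<alpha> \<bullet> (coder \<alpha> \<bullet> ?F) - \<alpha> \<bullet> (sg ?F * ?E * ?F - ?E)
      - ?E \<bullet> ?d - \<phi> \<bullet> (?d \<bullet> ?d - \<beta> \<bullet> ?d)"
    unfolding comm by (simp add: defect_def comp_assoc)
  show ?thesis
    unfolding id
    by (rule Null_diff[OF Null_diff[OF Null_diff[OF spec[OF alpha_square_comp[OF F]]
        Null_comp_left[OF m(3) Null_star_sandwich(2)[OF m(2) l(2) m(2) l(2) n(1)]]]
        Null_comp_coder_op[OF gP m(4) n(1) \<beta>]] Null_comp_left[OF m(2) square_leading[OF gP \<beta>(1) n(2)]]])
qed

text \<open>Linearisation of the defect: in leading order a change of \<open>\<phi>\<close> enters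
  through the differential of the target, and a change of \<open>\<beta>\<close> through the letters
  of \<open>\<phi>\<close>.\<close>

lemma defect_change:
  assumes \<beta>: "op P P 1 \<beta>" "Null R P P 2 \<beta>" and \<beta>': "op P P 1 \<beta>'" "Null R P P 2 \<beta>'"
    and \<phi>: "op P Q 0 \<phi>" and \<phi>': "op P Q 0 \<phi>'"
    and k: "Null R P P k (\<beta>' - \<beta>)" "Null R P Q k (\<phi>' - \<phi>)"
  shows "Null R P Q (Suc k) (defect \<beta>' \<phi>' - defect \<beta> \<phi> - (\<alpha> \<bullet> (\<phi>' - \<phi>) - \<phi> \<bullet> (\<beta>' - \<beta>)))"
    and "Null R P Q k (defect \<beta>' \<phi>' - defect \<beta> \<phi>)"
proof -
  note m = opD(1)[OF \<phi>] opD(1)[OF op_\<alpha>] opD(1)[OF op_diff[OF \<phi>' \<phi>]]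
  have id: "defect \<beta>' \<phi>' - defect \<beta> \<phi> - (\<alpha> \<bullet> (\<phi>' - \<phi>) - \<phi> \<bullet> (\<beta>' - \<beta>)) =
      \<alpha> \<bullet> (star \<phi>' - star \<phi> - (\<phi>' - \<phi>)) - (\<phi>' - \<phi>) \<bullet> coder \<beta>' - \<phi> \<bullet> (coder \<beta>' - coder \<beta> - (\<beta>' - \<beta>))"
    by (simp add: defect_def algebra_simps)
  show 1: "Null R P Q (Suc k) (defect \<beta>' \<phi>' - defect \<beta> \<phi> - (\<alpha> \<bullet> (\<phi>' - \<phi>) - \<phi> \<bullet> (\<beta>' - \<beta>)))"
    unfolding id
    by (rule Null_diff[OF Null_diff[OF Null_comp_left[OF m(2) Null_star_diff_leading[OF opD(1,2)[OF \<phi>] opD(1,2)[OF \<phi>'] k(2)]]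
        Null_comp_coder_op[OF gP m(3) k(2) \<beta>']] Null_comp_left[OF m(1) Null_coder_diff_leading[OF gP k(1)]]])
  have 2: "Null R P Q k (\<alpha> \<bullet> (\<phi>' - \<phi>) - \<phi> \<bullet> (\<beta>' - \<beta>))"
    by (rule Null_diff[OF Null_comp_left[OF m(2) k(2)] Null_comp_left[OF m(1) k(1)]])
  show "Null R P Q k (defect \<beta>' \<phi>' - defect \<beta> \<phi>)"
    by (rule Null_cancel[OF Null_mono[OF 1] 2]) simp
qed

definition partial_model :: "nat \<Rightarrow> ('m word \<Rightarrow> 'm) \<Rightarrow> ('m word \<Rightarrow> 'n) \<Rightarrow> bool" where
  "partial_model n b f \<longleftrightarrow> fam P P 1 b \<and> Null R P P 2 (fop 1 b) \<and> representing f \<and>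
     Null R P Q n (defect (fop 1 b) (fop 0 f)) \<and> Null R P P n (fop 1 b \<bullet> coder (fop 1 b))"

lemma representing_change:
  assumes f: "representing f" and f': "fam P Q 0 f'" and "Null R P Q 2 (fop 0 f' - fop 0 f)"
  shows "representing f'"
proof -
  have "f' [(k, x)] = f [(k, x)]" if "x \<in> carrier (P k)" for k x
    using Null_eq_on_letter[OF gQ f' _ assms(3), of "[(k, x)]"] f that by (simp add: representing_def)
  then show ?thesis using f f' by (simp add: representing_def)
qed

lemma fam_add_represent:
  assumes "gmod S" "gmod T" "fam S T e b" "fam S T e c"
  obtains b' where "fam S T e b'" "Nul R S T (fop e b' - fop e b - fop e c)"
proof -
  obtain b' where b': "fam S T e b'" "Nul R S T (fop e b + fop e c - fop e b')"
    using op_represent[OF assms(1,2) op_add[OF op_fop[OF assms(3,2)] op_fop[OF assms(4,2)]]] .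
  have "Nul R S T (fop e b' - fop e b - fop e c)"
    using Null_uminus[OF spec[OF b'(2)]] by (simp add: algebra_simps)
  with b'(1) show ?thesis by (rule that)
qed

text \<open>\<open>separate\<close> shows that the square is already null in length \<open>n\<close>
  and that the defect consists of cycles there. The class of the defect is absorbed by the structure
  and a primitive of the rest by the map; \<open>square_change\<close> keeps the square
  null.\<close>

lemma partial_model_step:
  assumes bf: "partial_model n b f" and n: "n \<ge> 2"
  obtains b' f' where "partial_model (Suc n) b' f'"
    "Null R P P n (fop 1 b' - fop 1 b)" "Null R P Q n (fop 0 f' - fop 0 f)"
proof -
  let ?\<beta> = "fop 1 b" and ?\<phi> = "fop 0 f"
  have b: "fam P P 1 b" and f: "representing f" "fam P Q 0 f" and b2: "Null R P P 2 ?\<beta>"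
    and E: "Null R P Q n (defect ?\<beta> ?\<phi>)" and X: "Null R P P n (?\<beta> \<bullet> coder ?\<beta>)"
    using bf by (auto simp: partial_model_def representing_def)
  note o = op_fop[OF b gP] op_fop[OF f(2) gQ]
  note oX = op_comp_coder[OF o(1) gP o(1)]
  have sep: "Null R P P (Suc n) (?\<beta> \<bullet> coder ?\<beta>)" "Null R P Q (Suc n) (\<alpha> \<bullet> defect ?\<beta> ?\<phi>)"
    by (rule separate[OF gP op_defect[OF o] oX f(1) defect_cycle[OF o(1) b2 o(2) E X]])+
  obtain \<omega> \<nu> where \<omega>: "fam P P 1 \<omega>" "Null R P P n (fop 1 \<omega>)" and \<nu>: "fam P Q (1 - 1) \<nu>" "Null R P Q n (fop (1 - 1) \<nu>)"
    and E': "Null R P Q (Suc n) (defect ?\<beta> ?\<phi> - ?\<phi> \<bullet> fop 1 \<omega> - \<alpha> \<bullet> fop (1 - 1) \<nu>)"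
  proof -
    have "n > 0" using n by simp
    from decompose[OF freeP op_defect[OF o] E sep(2) this f(1)] that show ?thesis by blast
  qed
  \<comment> \<open>The signs are dictated by \<open>defect_change\<close>: adding
    \<open>\<omega>\<close> to \<open>b\<close> and subtracting \<open>\<nu>\<close> from
    \<open>f\<close> each subtract the corresponding part from the defect.\<close>
  obtain b' where b': "fam P P 1 b'" "Nul R P P (fop 1 b' - ?\<beta> - fop 1 \<omega>)"
    using fam_add_represent[OF gP gP b \<omega>(1)] .
  have \<nu>0: "fam P Q 0 \<nu>" using \<nu>(1) by simp
  obtain f' where f': "fam P Q 0 f'" "Nul R P Q (?\<phi> - fop 0 \<nu> - fop 0 f')"
    using op_represent[OF gP gQ op_diff[OF o(2) op_fop[OF \<nu>0 gQ]]] .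
  have f'\<nu>: "Nul R P Q (fop 0 f' - ?\<phi> + fop 0 \<nu>)"
    using Null_uminus[OF spec[OF f'(2)]] by (simp add: algebra_simps)
  have db: "Null R P P n (fop 1 b' - ?\<beta>)" using Null_add[OF spec[OF b'(2)] \<omega>(2)] by simp
  have df: "Null R P Q n (fop 0 f' - ?\<phi>)" using Null_diff[OF spec[OF f'\<nu>] \<nu>(2)] by simp
  have b'2: "Null R P P 2 (fop 1 b')" using Null_add[OF Null_mono[OF db n] b2] by simp
  note o' = op_fop[OF b'(1) gP] op_fop[OF f'(1) gQ]
  have "Null R P Q (Suc n) (defect (fop 1 b') (fop 0 f'))"
  proof -
    let ?E = "defect ?\<beta> ?\<phi>" and ?E' = "defect (fop 1 b') (fop 0 f')"
    have "?E' = (?E' - ?E - (\<alpha> \<bullet> (fop 0 f' - ?\<phi>) - ?\<phi> \<bullet> (fop 1 b' - ?\<beta>)))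
        + \<alpha> \<bullet> (fop 0 f' - ?\<phi> + fop 0 \<nu>) - ?\<phi> \<bullet> (fop 1 b' - ?\<beta> - fop 1 \<omega>)
        + (?E - ?\<phi> \<bullet> fop 1 \<omega> - \<alpha> \<bullet> fop (1 - 1) \<nu>)"
      by (simp add: algebra_simps)
    also have "Null R P Q (Suc n) \<dots>"
      by (rule Null_add[OF Null_diff[OF Null_add[OF defect_change(1)[OF o(1) b2 o'(1) b'2 o(2) o'(2) db df]
          Null_comp_left[OF opD(1)[OF op_\<alpha>] spec[OF f'\<nu>]]] Null_comp_left[OF opD(1)[OF o(2)] spec[OF b'(2)]]] E'])
    finally show ?thesis .
  qed
  moreover have "Null R P P (Suc n) (fop 1 b' \<bullet> coder (fop 1 b'))"
    by (rule Null_cancel[OF square_change[OF gP o(1) b2 o'(1) b'2 db] sep(1)])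
  ultimately have "partial_model (Suc n) b' f'"
    using b' b'2 representing_change[OF f(1) f'(1) Null_mono[OF df n]] by (simp add: partial_model_def)
  with db df show ?thesis using that by blast
qed

lemma star_zero: "star 0 = 1"
  using star_unfold[of 0] by simp

lemma comp_one: "lv a \<Longrightarrow> a \<bullet> 1 = 0"
  by (rule oper_eqI) (simp add: app_comp one_sums)

lemma Null_star_leading:
  assumes "mlin R S T \<phi>" "lv \<phi>"
  shows "Null R S T 2 (star \<phi> - 1 - \<phi>)"
  using Null_star_diff_leading[OF mlin_zero lv_zero assms, of 1] Null_lv[OF assms]
  by (simp add: star_zero numeral_2_eq_2)

lemma fam_zero:
  fixes S :: "int \<Rightarrow> ('a, 'c) module"
  assumes "gmod T"
  shows "fam S T e (\<lambda>w. \<zero>\<^bsub>T (wdeg w + e)\<^esub>)"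
proof (rule famI)
  fix w :: "'c word"
  interpret Tj: module R "T (wdeg w + e)" by (rule gmodD[OF assms])
  show "\<zero>\<^bsub>T (wdeg w + e)\<^esub> \<in> carrier (T (wdeg w + e))" by simp
next
  fix u v :: "'c word" and k x y
  interpret Tj: module R "T (wdeg u + k + wdeg v + e)" by (rule gmodD[OF assms])
  show "\<zero>\<^bsub>T (wdeg (u @ [(k, x \<oplus>\<^bsub>S k\<^esub> y)] @ v) + e)\<^esub> = \<zero>\<^bsub>T (wdeg (u @ [(k, x)] @ v) + e)\<^esub>
      \<oplus>\<^bsub>T (wdeg u + k + wdeg v + e)\<^esub> \<zero>\<^bsub>T (wdeg (u @ [(k, y)] @ v) + e)\<^esub>"
    using Tj.l_zero[OF Tj.zero_closed] by (simp add: add.assoc)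
next
  fix u v :: "'c word" and k c x assume c: "c \<in> carrier R"
  interpret Tj: module R "T (wdeg u + k + wdeg v + e)" by (rule gmodD[OF assms])
  show "\<zero>\<^bsub>T (wdeg (u @ [(k, c \<odot>\<^bsub>S k\<^esub> x)] @ v) + e)\<^esub> =
      c \<odot>\<^bsub>T (wdeg u + k + wdeg v + e)\<^esub> \<zero>\<^bsub>T (wdeg (u @ [(k, x)] @ v) + e)\<^esub>"
    using Tj.smult_r_null[OF c] by (simp add: add.assoc)
qed

lemma Nul_fam_zero: "gmod T \<Longrightarrow> Null R S T k (fop e (\<lambda>w. \<zero>\<^bsub>T (wdeg w + e)\<^esub>))"
  by (simp add: Null_fop_iff[OF _ fam_zero])

text \<open>Freeness of the homology splits the projection from cycles to classes: choose cycles for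
  a basis and extend linearly. This is the linear part of the model map.\<close>

lemma linear_section: "\<exists>h. linear_map R (P k) (Q k) h \<and> (\<forall>x\<in>carrier (P k). cycle k (h x) \<and> cl k (h x) = x)"
proof (rule basis_extension[where 'n = 'n, OF freeP[of k]], goal_cases)
  case (1 B)
  interpret Qk: module R "Q k" by (rule gmodD[OF gQ])
  interpret Pk: module R "P k" by (rule gmodD[OF gP])
  define t where "t b = (SOME z. cycle k z \<and> cl k z = b)" for b
  have t: "cycle k (t b) \<and> cl k (t b) = b" if "b \<in> B" for b
    unfolding t_def by (rule someI_ex) (use cl_surj[of b k] 1(1) that in \<open>auto simp: cycle_def\<close>)
  obtain h where h: "linear_map R (P k) (Q k) h" "\<And>b. b \<in> B \<Longrightarrow> h b = t b"
    using 1(2)[of "Q k" t] t gmodD[OF gQ] by (auto simp: cycle_def)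
  have cyc: "cycle k (h x)" if x: "x \<in> carrier (P k)" for x
  proof -
    have "bA [(k, h x)] = \<zero>\<^bsub>Q (k + 1)\<^esub>"
    proof (rule linear_maps_agree[OF gmodD[OF gP] gmodD[OF gQ] _ _ 1(1) _ 1(3)[OF x]])
      show "linear_map R (P k) (Q (k + 1)) (\<lambda>x. bA [(k, h x)])"
        by (rule linear_map_comp[OF h(1) diff_linear])
      show "linear_map R (P k) (Q (k + 1)) (\<lambda>x. \<zero>\<^bsub>Q (k + 1)\<^esub>)"
        by (rule linear_map_zero_const[OF gmodD[OF gQ]])
    qed (use t h(2) in \<open>simp add: cycle_def\<close>)
    then show ?thesis using linear_mapD(1)[OF h(1) x] by (simp add: cycle_def)
  qed
  have "cl k (h x) = x" if x: "x \<in> carrier (P k)" for x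
  proof (rule linear_maps_agree[OF gmodD[OF gP] gmodD[OF gP] _ _ 1(1) _ 1(3)[OF x]])
    show "linear_map R (P k) (P k) (\<lambda>x. cl k (h x))"
      using cyc cl_closed cl_add cl_smult linear_mapD[OF h(1)] by (intro linear_mapI) (auto simp: cycle_def)
    show "linear_map R (P k) (P k) (\<lambda>x. x)" by (rule linear_mapI) auto
  qed (use t h(2) in simp)
  with h(1) cyc show ?case by blast
qed

text \<open>The zero structure will do. In particular the binary operation is not prescribed; the
  first step produces it as a class, and \<open>minimal_modelI\<close> identifies it later with the
  product of homology.\<close>

lemma partial_model_start: "\<exists>b f. partial_model 2 b f"
proof -
  obtain h where h: "\<And>k. linear_map R (P k) (Q k) (h k)" "\<And>k x. x \<in> carrier (P k) \<Longrightarrow> cycle k (h k x) \<and> cl k (h k x) = x"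
    using linear_section by metis
  define f where "f w = (if length w = 1 then h (fst (hd w)) (snd (hd w)) else \<zero>\<^bsub>Q (wdeg w + 0)\<^esub>)" for w
  have f1: "f [(k, x)] = h k x" for k x by (simp add: f_def)
  have f: "fam P Q 0 f"
  proof (rule famI)
    fix w assume w: "w \<in> words P" "w \<noteq> []"
    then show "f w \<in> carrier (Q (wdeg w + 0))"
      using linear_mapD(1)[OF h(1)] famD(1)[OF fam_zero[OF gQ] w, of 0] by (cases w) (auto simp: f_def)
  next
    fix u v k x y assume *: "u \<in> words P" "v \<in> words P" "x \<in> carrier (P k)" "y \<in> carrier (P k)"
    show "f (u @ [(k, x \<oplus>\<^bsub>P k\<^esub> y)] @ v) = f (u @ [(k, x)] @ v) \<oplus>\<^bsub>Q (wdeg u + k + wdeg v + 0)\<^esub> f (u @ [(k, y)] @ v)"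
      using linear_mapD(2)[OF h(1) *(3,4)] famD(2)[OF fam_zero[OF gQ] *, of 0] by (auto simp: f_def)
  next
    fix u v k c x assume *: "u \<in> words P" "v \<in> words P" "c \<in> carrier R" "x \<in> carrier (P k)"
    show "f (u @ [(k, c \<odot>\<^bsub>P k\<^esub> x)] @ v) = c \<odot>\<^bsub>Q (wdeg u + k + wdeg v + 0)\<^esub> f (u @ [(k, x)] @ v)"
      using linear_mapD(3)[OF h(1) *(3,4)] famD(3)[OF fam_zero[OF gQ] *, of 0] by (auto simp: f_def)
  qed
  have rep: "representing f" using f h(2) by (simp add: representing_def f1)
  define b where "b = (\<lambda>w :: 'm word. \<zero>\<^bsub>P (wdeg w + 1)\<^esub>)"
  have b: "fam P P 1 b" "Nul R P P (fop 1 b)" unfolding b_def using fam_zero[OF gP] Nul_fam_zero[OF gP] by blast+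
  note o = op_fop[OF b(1) gP] op_fop[OF f gQ]
  have "Null R P Q 2 (\<alpha> \<bullet> fop 0 f)"
    unfolding Null_def
  proof (intro ballI conjI impI)
    fix w assume w: "w \<in> words P"
    show "good Q (app (\<alpha> \<bullet> fop 0 f) w)" by (rule mlinD(1)[OF mlin_comp[OF opD(1)[OF op_\<alpha>] opD(1)[OF o(2)]] w])
    assume "length w < 2"
    then consider "w = []" | z where "w = [z]" by (cases w) auto
    then show "nul R Q (app (\<alpha> \<bullet> fop 0 f) w)"
    proof cases
      case 2
      then show ?thesis
        using w h(2)[of "snd z" "fst z"] letter_zero[OF gQ, of "fst z + 1"]
        by (cases z) (simp add: app_comp app_fop f1 cycle_def)
    qed (simp add: app_comp app_fop)
  qed
  from Null_add[OF Null_comp_left[OF opD(1)[OF op_\<alpha>] Null_star_leading[OF opD(1,2)[OF o(2)]]] this]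
  have 1: "Null R P Q 2 (\<alpha> \<bullet> star (fop 0 f))" by (simp add: comp_one)
  have "Null R P Q (Suc 1) (fop 0 f \<bullet> coder (fop 1 b))"
    using b(2) by (intro Null_comp_coder_op gP opD(1)[OF o(2)] o(1) Null_lv) auto
  with 1 have "Null R P Q 2 (defect (fop 1 b) (fop 0 f))"
    unfolding defect_def by (intro Null_diff) (simp_all add: numeral_2_eq_2)
  moreover have "Nul R P P (fop 1 b \<bullet> coder (fop 1 b))"
    by (rule Nul_comp_right[OF b(2) mlin_coder[OF gP opD(1)[OF o(1)]]])
  ultimately have "partial_model 2 b f" using b rep by (simp add: partial_model_def)
  then show ?thesis by blast
qed

theorem model_exists:
  obtains b f where "fam P P 1 b" "Null R P P 2 (fop 1 b)" "representing f"
    "Nul R P Q (\<alpha> \<bullet> star (fop 0 f) - fop 0 f \<bullet> coder (fop 1 b))" "Nul R P P (fop 1 b \<bullet> coder (fop 1 b))"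
proof -
  \<comment> \<open>Stage \<open>i\<close> is correct on words shorter than \<open>i + 2\<close>,
    and passing to the next stage leaves these words alone.\<close>
  have "\<exists>s. \<forall>i. partial_model (i + 2) (fst (s i)) (snd (s i)) \<and>
      (Null R P P (i + 2) (fop 1 (fst (s (Suc i))) - fop 1 (fst (s i))) \<and>
      Null R P Q (i + 2) (fop 0 (snd (s (Suc i))) - fop 0 (snd (s i))))"
  proof (rule dependent_nat_choice)
    show "\<exists>s. partial_model (0 + 2) (fst s) (snd s)"
      using partial_model_start by (metis add_0 fst_conv snd_conv)
  next
    fix s i assume "partial_model (i + 2) (fst s) (snd s)"
    then obtain b f where "partial_model (Suc (i + 2)) b f" "Null R P P (i + 2) (fop 1 b - fop 1 (fst s))"
      "Null R P Q (i + 2) (fop 0 f - fop 0 (snd s))"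
      by (rule partial_model_step) simp
    then show "\<exists>s'. partial_model (Suc i + 2) (fst s') (snd s') \<and>
      (Null R P P (i + 2) (fop 1 (fst s') - fop 1 (fst s)) \<and> Null R P Q (i + 2) (fop 0 (snd s') - fop 0 (snd s)))"
      by (intro exI[of _ "(b, f)"]) simp
  qed
  then obtain s where s: "\<And>i. partial_model (i + 2) (fst (s i)) (snd (s i))"
    "\<And>i. Null R P P (i + 2) (fop 1 (fst (s (Suc i))) - fop 1 (fst (s i)))"
    "\<And>i. Null R P Q (i + 2) (fop 0 (snd (s (Suc i))) - fop 0 (snd (s i)))" by blast
  define bs where "bs i = fst (s i)" for i
  define fs where "fs i = snd (s i)" for i
  have bf: "fam P P 1 (bs i)" "Null R P P 2 (fop 1 (bs i))" "representing (fs i)" "fam P Q 0 (fs i)"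
    "Null R P Q (i + 2) (defect (fop 1 (bs i)) (fop 0 (fs i)))" "Null R P P (i + 2) (fop 1 (bs i) \<bullet> coder (fop 1 (bs i)))" for i
    using s(1)[of i] by (auto simp: partial_model_def representing_def bs_def fs_def)
  obtain b where b: "fam P P 1 b" "\<And>i. Null R P P (i + 2) (fop 1 b - fop 1 (bs i))"
    by (rule limit_family[OF gP bf(1) s(2)[folded bs_def]], simp, rule that)
  obtain f where f: "fam P Q 0 f" "\<And>i. Null R P Q (i + 2) (fop 0 f - fop 0 (fs i))"
    by (rule limit_family[OF gQ bf(4) s(3)[folded fs_def]], simp, rule that)
  have b2: "Null R P P 2 (fop 1 b)" using Null_cancel[OF b(2)[of 0, unfolded add_0] bf(2)] .
  have rep: "representing f" by (rule representing_change[OF bf(3) f(1) f(2)[of 0, unfolded add_0]])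
  note o = op_fop[OF b(1) gP] op_fop[OF f(1) gQ] and os = op_fop[OF bf(1) gP] op_fop[OF bf(4) gQ]
  \<comment> \<open>The limit differs from stage \<open>i\<close> only in order
    \<open>i + 2\<close>, so its defect does as well, and \<open>i\<close> is arbitrary.\<close>
  have "Null R P Q i (defect (fop 1 b) (fop 0 f))" for i
    by (rule Null_mono[OF Null_cancel[OF defect_change(2)[OF os(1) bf(2) o(1) b2 os(2) o(2) b(2) f(2)] bf(5)[of i]]]) simp
  moreover have "Null R P P i (fop 1 b \<bullet> coder (fop 1 b))" for i
    by (rule Null_mono[OF Null_cancel[OF Null_mono[OF square_change[OF gP os(1) bf(2) o(1) b2 b(2)]] bf(6)[of i]]]) simp_all
  ultimately show ?thesis using b(1) b2 rep by (intro that[of b f]) (simp_all add: defect_def)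
qed

end

text \<open>A source \<open>(S, \<sigma>)\<close> over which morphisms are lifted through a model \<open>(P, \<beta>) \<rightarrow> (Q, \<alpha>)\<close>.\<close>

locale lifting_problem = hcomplex R Q bA P cl
  for R :: "('a, 'x) ring_scheme" (structure) and Q :: "int \<Rightarrow> ('a, 'n) module" and bA
    and P :: "int \<Rightarrow> ('a, 'm) module" and cl +
  fixes S :: "int \<Rightarrow> ('a, 's) module" and \<sigma> :: "(int \<times> 's, int \<times> 's) oper"
    and \<beta> :: "(int \<times> 'm, int \<times> 'm) oper" and f :: "'m word \<Rightarrow> 'n" and p :: "(int \<times> 's, int \<times> 'n) oper"
  assumes freeS: "\<And>k. free_module R (S k)"
    and \<sigma>: "op S S 1 \<sigma>" "Null R S S 2 \<sigma>" "Nul R S S (\<sigma> \<bullet> coder \<sigma>)"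
    and \<beta>: "op P P 1 \<beta>" "Null R P P 2 \<beta>"
    and f: "representing f" and f_mor: "Nul R P Q (\<alpha> \<bullet> star (fop 0 f) - fop 0 f \<bullet> coder \<beta>)"
    and p: "op S Q 0 p" and p_mor: "Nul R S Q (\<alpha> \<bullet> star p - p \<bullet> coder \<sigma>)"
begin

abbreviation \<phi> :: "(int \<times> 'm, int \<times> 'n) oper" where
  "\<phi> \<equiv> fop 0 f"

lemma gS: "gmod S"
  using freeS by (simp add: gmod_def free_module_def)

lemma op_\<phi>: "op P Q 0 \<phi>"
  using f gQ by (simp add: representing_def op_fop)

section \<open>Lifting a morphism together with a homotopy\<close>

definition mor_defect :: "(int \<times> 's, int \<times> 'm) oper \<Rightarrow> (int \<times> 's, int \<times> 'm) oper" where
  "mor_defect \<gamma> = \<beta> \<bullet> star \<gamma> - \<gamma> \<bullet> coder \<sigma>"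

abbreviation through :: "(int \<times> 's, int \<times> 'm) oper \<Rightarrow> (int \<times> 's, int \<times> 'n) oper" where
  "through \<gamma> \<equiv> \<phi> \<bullet> star \<gamma>"

text \<open>Projection to letters of F - G - dD - Dd, where F comes from \<open>p\<close>, G is the
  composite of the lift with \<open>\<phi>\<close>, and D is the homotopy.\<close>

definition htpy_defect :: "(int \<times> 's, int \<times> 'm) oper \<Rightarrow> (int \<times> 's, int \<times> 'n) oper \<Rightarrow> (int \<times> 's, int \<times> 'n) oper" where
  "htpy_defect \<gamma> \<eta> = p - through \<gamma> - \<alpha> \<bullet> htpy p \<eta> (through \<gamma>) - \<eta> \<bullet> coder \<sigma>"

lemma op_through: "op S P 0 \<gamma> \<Longrightarrow> op S Q 0 (through \<gamma>)"
  by (rule op_comp_star[OF op_\<phi>])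

lemma op_mor_defect: "op S P 0 \<gamma> \<Longrightarrow> op S P 1 (mor_defect \<gamma>)"
  unfolding mor_defect_def using op_diff[OF op_comp_star[OF \<beta>(1)] op_comp_coder[OF _ gS \<sigma>(1), of P 0, simplified]] .

lemma op_htpy_defect: "op S P 0 \<gamma> \<Longrightarrow> op S Q (- 1) \<eta> \<Longrightarrow> op S Q 0 (htpy_defect \<gamma> \<eta>)"
  unfolding htpy_defect_def
  using op_diff[OF op_diff[OF op_diff[OF p op_through] op_comp_htpy[OF op_\<alpha> p _ op_through, of "- 1", simplified]]
      op_comp_coder[OF _ gS \<sigma>(1), of Q "- 1", simplified]] .

text \<open>As \<open>\<phi>\<close> is a morphism, the composite fails to be one only through the
  failure of \<open>\<gamma>\<close>, which \<open>\<phi>\<close> transports in leading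
  order.\<close>

lemma through_defect:
  assumes \<gamma>: "op S P 0 \<gamma>" and n: "Null R S P n (mor_defect \<gamma>)"
  shows "Null R S Q (Suc n) (\<alpha> \<bullet> star (through \<gamma>) - through \<gamma> \<bullet> coder \<sigma> - \<phi> \<bullet> mor_defect \<gamma>)"
proof -
  let ?\<Gamma> = "star \<gamma>" and ?X = "mor_defect \<gamma>"
  note l = opD(2)[OF \<gamma>] opD(2)[OF \<sigma>(1)]
  have \<Gamma>: "mlin R S P ?\<Gamma>" by (rule mlin_star[OF opD(1)[OF \<gamma>] lv_Nil[OF l(1)]])
  have "coder \<beta> \<bullet> ?\<Gamma> - ?\<Gamma> \<bullet> coder \<sigma> = sg ?\<Gamma> * ?X * ?\<Gamma>"
    unfolding mor_defect_def coder_comp_star[OF l(1) opD(3)[OF \<gamma>]] star_comp_coder[OF l] by (simp add: algebra_simps)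
  then have comm: "\<phi> \<bullet> (coder \<beta> \<bullet> ?\<Gamma>) = \<phi> \<bullet> (?\<Gamma> \<bullet> coder \<sigma>) + \<phi> \<bullet> (sg ?\<Gamma> * ?X * ?\<Gamma>)"
    by (metis comp_simps(4) diff_add_cancel add.commute)
  have "\<alpha> \<bullet> star (through \<gamma>) - through \<gamma> \<bullet> coder \<sigma> - \<phi> \<bullet> ?X =
      (\<alpha> \<bullet> star \<phi> - \<phi> \<bullet> coder \<beta>) \<bullet> ?\<Gamma> + \<phi> \<bullet> (sg ?\<Gamma> * ?X * ?\<Gamma> - ?X)"
    using comm by (simp add: comp_star[OF l(1) opD(2)[OF op_\<phi>], symmetric] comp_assoc algebra_simps)
  then show ?thesis
    using Null_add[OF spec[OF Nul_comp_right[OF f_mor \<Gamma>]]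
        Null_comp_left[OF opD(1)[OF op_\<phi>] Null_star_sandwich(2)[OF opD(1,2)[OF \<gamma>] opD(1,2)[OF \<gamma>] n]]]
    by metis
qed

text \<open>Apply \<open>\<alpha>\<close> to the formula \<open>htpy_boundary\<close>. Its
  correction terms are harmless, because \<open>p\<close> is a morphism and the failure
  \<open>Y\<close> of the composite is multiplied by the homotopy. What survives is
  \<open>- Y\<close> itself, which equals \<open>- \<phi> \<bullet> mor_defect \<gamma>\<close> in
  leading order.\<close>

lemma htpy_defect_cycle:
  assumes \<gamma>: "op S P 0 \<gamma>" and \<eta>: "op S Q (- 1) \<eta>" and n: "Null R S P n (mor_defect \<gamma>)" "Null R S Q n (htpy_defect \<gamma> \<eta>)"
  shows "Null R S Q (Suc n) (\<alpha> \<bullet> htpy_defect \<gamma> \<eta> + \<phi> \<bullet> mor_defect \<gamma>)"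
proof -
  let ?q = "through \<gamma>" and ?W = "htpy_defect \<gamma> \<eta>" and ?d = "coder \<sigma>" and ?X = "mor_defect \<gamma>"
  let ?P = "star p" and ?Q = "star ?q" and ?D = "htpy p \<eta> ?q"
  note q = op_through[OF \<gamma>] and W = op_htpy_defect[OF \<gamma> \<eta>]
  define M where "M = \<alpha> \<bullet> ?P - p \<bullet> ?d"
  define Y where "Y = \<alpha> \<bullet> ?Q - ?q \<bullet> ?d"
  have m\<alpha>: "mlin R Q Q \<alpha>" by (rule opD(1)[OF op_\<alpha>])
  have mP: "mlin R S Q ?P" and mQ: "mlin R S Q ?Q"
    using mlin_star[OF opD(1)[OF p] lv_Nil[OF opD(2)[OF p]]] mlin_star[OF opD(1)[OF q] lv_Nil[OF opD(2)[OF q]]] .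
  have mD: "mlin R S Q ?D" using p \<eta> q by (intro mlin_htpy) (auto simp: op_def)
  have D1: "Null R S Q 1 ?D"
    using mlinD(1)[OF mD] opD(2)[OF \<eta>] by (auto simp: Null_def htpy_def)
  have M: "Nul R S Q M" unfolding M_def by (rule p_mor)
  have Y: "Null R S Q (Suc n) (Y - \<phi> \<bullet> ?X)" unfolding Y_def by (rule through_defect[OF \<gamma> n(1)])
  have Yn: "Null R S Q n Y"
    by (rule Null_cancel[OF Null_mono[OF Y] Null_comp_left[OF opD(1)[OF op_\<phi>] n(1)]]) simp
  have PQ: "?P * (p - ?q) * ?Q = ?P - ?Q"
    using star_diff[OF lv_Nil[OF opD(2)[OF p]] lv_Nil[OF opD(2)[OF q]]] by (simp add: algebra_simps)
  have "\<alpha> \<bullet> ?D + \<eta> \<bullet> ?d = (p - ?q) - ?W" by (simp add: htpy_defect_def)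
  then have "coder \<alpha> \<bullet> ?D + ?D \<bullet> ?d = ?P * ((p - ?q) - ?W) * ?Q + ?P * sg M * ?D - sg ?D * Y * ?Q"
    using htpy_boundary[OF opD(2)[OF p] opD(2)[OF \<eta>] opD(2)[OF q] opD(2)[OF \<sigma>(1)]
        opD(3)[OF p] opD(3)[OF \<eta>] opD(3)[OF q] opD(3)[OF \<sigma>(1)], of \<alpha>] unfolding M_def Y_def by simp
  also have "\<dots> = ?P - ?Q - ?P * ?W * ?Q + ?P * sg M * ?D - sg ?D * Y * ?Q"
    using PQ by (simp add: right_diff_distrib left_diff_distrib)
  finally have b: "\<alpha> \<bullet> (coder \<alpha> \<bullet> ?D) + \<alpha> \<bullet> (?D \<bullet> ?d) =
      \<alpha> \<bullet> ?P - \<alpha> \<bullet> ?Q - \<alpha> \<bullet> (?P * ?W * ?Q) + \<alpha> \<bullet> (?P * sg M * ?D) - \<alpha> \<bullet> (sg ?D * Y * ?Q)"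
    by (metis comp_simps(4,6))
  have a: "\<alpha> \<bullet> (?D \<bullet> ?d) = p \<bullet> ?d - ?q \<bullet> ?d - ?W \<bullet> ?d - \<eta> \<bullet> (?d \<bullet> ?d)"
    by (simp add: htpy_defect_def comp_assoc)
  have "\<alpha> \<bullet> ?W + \<phi> \<bullet> ?X = M - (Y - \<phi> \<bullet> ?X) + ?W \<bullet> ?d + \<eta> \<bullet> (?d \<bullet> ?d) - \<alpha> \<bullet> (coder \<alpha> \<bullet> ?D)
      + \<alpha> \<bullet> (?P * sg M * ?D) - \<alpha> \<bullet> (sg ?D * Y * ?Q) - \<alpha> \<bullet> (?P * ?W * ?Q - ?W)"
    using b unfolding a M_def Y_def by (simp add: algebra_simps)
  also have "Null R S Q (Suc n) \<dots>"
  proof (rule Null_diff[OF Null_diff[OF Null_add[OF Null_diff[OF Null_add[OF Null_add[OF Null_diff[OF spec[OF M] Y]]]]]]])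
    show "Null R S Q (Suc n) (?W \<bullet> ?d)"
      by (rule Null_comp_coder_op[OF gS opD(1)[OF W] n(2) \<sigma>(1,2)])
    show "Null R S Q (Suc n) (\<eta> \<bullet> (?d \<bullet> ?d))"
      by (rule Null_comp_left[OF opD(1)[OF \<eta>] spec[OF coder_square_null[OF gS \<sigma>(1,3)]]])
    show "Null R S Q (Suc n) (\<alpha> \<bullet> (coder \<alpha> \<bullet> ?D))"
      by (rule spec[OF alpha_square_comp[OF mD]])
    show "Null R S Q (Suc n) (\<alpha> \<bullet> (?P * sg M * ?D))"
      by (rule Null_comp_left[OF m\<alpha> Null_mult_right[OF mD Null_mult_left[OF mP Null_sg[OF spec[OF M]]]]])
    \<comment> \<open>\<open>?D\<close> kills the empty word and so contributes the missing order to
      \<open>Y\<close>.\<close>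
    show "Null R S Q (Suc n) (\<alpha> \<bullet> (sg ?D * Y * ?Q))"
      using Null_mult_right[OF mQ Null_mult[OF Null_sg[OF D1] Yn]] by (intro Null_comp_left[OF m\<alpha>]) simp
    show "Null R S Q (Suc n) (\<alpha> \<bullet> (?P * ?W * ?Q - ?W))"
      by (rule Null_comp_left[OF m\<alpha> Null_star_sandwich(1)[OF opD(1,2)[OF p] opD(1,2)[OF q] n(2)]])
  qed
  finally show ?thesis .
qed

text \<open>No linear term survives, since the structures on both sides are null on letters. A
  correction of the lift in length \<open>k\<close> therefore keeps its equation intact in that
  length.\<close>

lemma mor_defect_change:
  assumes \<gamma>: "op S P 0 \<gamma>" and \<gamma>': "op S P 0 \<gamma>'" and k: "Null R S P k (\<gamma>' - \<gamma>)"
  shows "Null R S P (Suc k) (mor_defect \<gamma>' - mor_defect \<gamma>)"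
proof -
  note o = op_diff[OF \<gamma>' \<gamma>]
  have "mor_defect \<gamma>' - mor_defect \<gamma> = \<beta> \<bullet> (star \<gamma>' - star \<gamma> - (\<gamma>' - \<gamma>)) + \<beta> \<bullet> (\<gamma>' - \<gamma>) - (\<gamma>' - \<gamma>) \<bullet> coder \<sigma>"
    by (simp add: mor_defect_def algebra_simps)
  also have "Null R S P (Suc k) \<dots>"
    by (rule Null_diff[OF Null_add[OF Null_comp_left[OF opD(1)[OF \<beta>(1)] Null_star_diff_leading[OF opD(1,2)[OF \<gamma>] opD(1,2)[OF \<gamma>'] k]]
        Nul_lv_comp_lv[OF \<beta>(2) opD(1,2)[OF o]]] Null_comp_coder_op[OF gS opD(1)[OF o] k \<sigma>(1,2)]])
  finally show ?thesis .
qed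

text \<open>The end of the homotopy moves by \<open>\<phi> \<bullet> (\<gamma>' - \<gamma>)\<close>
  and its differential by \<open>\<alpha> \<bullet> (\<eta>' - \<eta>)\<close>. These are exactly
  the two kinds of correction that \<open>decompose\<close> supplies.\<close>

lemma htpy_defect_change:
  assumes \<gamma>: "op S P 0 \<gamma>" and \<gamma>': "op S P 0 \<gamma>'" and \<eta>: "op S Q (- 1) \<eta>" and \<eta>': "op S Q (- 1) \<eta>'"
    and k: "Null R S P k (\<gamma>' - \<gamma>)" "Null R S Q k (\<eta>' - \<eta>)"
  shows "Null R S Q (Suc k) (htpy_defect \<gamma>' \<eta>' - htpy_defect \<gamma> \<eta> + \<phi> \<bullet> (\<gamma>' - \<gamma>) + \<alpha> \<bullet> (\<eta>' - \<eta>))"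
    and "Null R S Q k (htpy_defect \<gamma>' \<eta>' - htpy_defect \<gamma> \<eta>)"
proof -
  let ?q = "through \<gamma>" and ?q' = "through \<gamma>'"
  note q = op_through[OF \<gamma>] and q' = op_through[OF \<gamma>']
  note m\<alpha> = opD(1)[OF op_\<alpha>] and m\<phi> = opD(1)[OF op_\<phi>]
  let ?D = "htpy p \<eta> ?q" and ?D' = "htpy p \<eta>' ?q'"
  have dq: "Null R S Q (Suc k) (?q' - ?q - \<phi> \<bullet> (\<gamma>' - \<gamma>))"
    using Null_comp_left[OF m\<phi> Null_star_diff_leading[OF opD(1,2)[OF \<gamma>] opD(1,2)[OF \<gamma>'] k(1)]] by simp
  have "Null R S Q k (?q' - ?q)"
    by (rule Null_cancel[OF Null_mono[OF dq] Null_comp_left[OF m\<phi> k(1)]]) simp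
  then have dQ: "Null R S Q k (star ?q' - star ?q)"
    by (intro Null_star_diff opD[OF q] opD[OF q'])
  have \<eta>1: "Null R S Q 1 \<eta>" by (rule Null_lv[OF opD(1,2)[OF \<eta>]])
  have mP: "mlin R S Q (star p)"
    using mlin_star[OF opD(1)[OF p] lv_Nil[OF opD(2)[OF p]]] .
  have dD_eq: "?D' - ?D - (\<eta>' - \<eta>) = (sg (star p) * (\<eta>' - \<eta>) * star ?q' - (\<eta>' - \<eta>)) + sg (star p) * (\<eta> * (star ?q' - star ?q))"
    by (simp add: htpy_def algebra_simps)
  have "Null R S Q (Suc k) (sg (star p) * (\<eta> * (star ?q' - star ?q)))"
    using Null_mult_left[OF mlin_sg[OF mP] Null_mult[OF \<eta>1 dQ]] by simp
  then have dD: "Null R S Q (Suc k) (?D' - ?D - (\<eta>' - \<eta>))"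
    unfolding dD_eq by (rule Null_add[OF Null_star_sandwich(2)[OF opD(1,2)[OF p] opD(1,2)[OF q'] k(2)]])
  have id: "htpy_defect \<gamma>' \<eta>' - htpy_defect \<gamma> \<eta> + \<phi> \<bullet> (\<gamma>' - \<gamma>) + \<alpha> \<bullet> (\<eta>' - \<eta>) =
      - (?q' - ?q - \<phi> \<bullet> (\<gamma>' - \<gamma>)) - \<alpha> \<bullet> (?D' - ?D - (\<eta>' - \<eta>)) - (\<eta>' - \<eta>) \<bullet> coder \<sigma>"
    by (simp add: htpy_defect_def algebra_simps)
  show 1: "Null R S Q (Suc k) (htpy_defect \<gamma>' \<eta>' - htpy_defect \<gamma> \<eta> + \<phi> \<bullet> (\<gamma>' - \<gamma>) + \<alpha> \<bullet> (\<eta>' - \<eta>))"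
    unfolding id
    by (rule Null_diff[OF Null_diff[OF Null_uminus[OF dq] Null_comp_left[OF m\<alpha> dD]]
        Null_comp_coder_op[OF gS opD(1)[OF op_diff[OF \<eta>' \<eta>]] k(2) \<sigma>(1,2)]])
  have "htpy_defect \<gamma>' \<eta>' - htpy_defect \<gamma> \<eta> =
     (htpy_defect \<gamma>' \<eta>' - htpy_defect \<gamma> \<eta> + \<phi> \<bullet> (\<gamma>' - \<gamma>) + \<alpha> \<bullet> (\<eta>' - \<eta>)) - \<phi> \<bullet> (\<gamma>' - \<gamma>) - \<alpha> \<bullet> (\<eta>' - \<eta>)"
    by simp
  also have "Null R S Q k \<dots>"
    by (rule Null_diff[OF Null_diff[OF Null_mono[OF 1] Null_comp_left[OF m\<phi> k(1)]] Null_comp_left[OF m\<alpha> k(2)]]) simp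
  finally show "Null R S Q k (htpy_defect \<gamma>' \<eta>' - htpy_defect \<gamma> \<eta>)" .
qed

definition partial_lift :: "nat \<Rightarrow> ('s word \<Rightarrow> 'm) \<Rightarrow> ('s word \<Rightarrow> 'n) \<Rightarrow> bool" where
  "partial_lift n g h \<longleftrightarrow> fam S P 0 g \<and> fam S Q (- 1) h \<and>
     Null R S P n (mor_defect (fop 0 g)) \<and> Null R S Q n (htpy_defect (fop 0 g) (fop (- 1) h))"

text \<open>\<open>separate\<close>, with the homotopy defect in the place of the morphism defect,
  shows that the lift satisfies its equation in length \<open>n\<close> even before it is corrected
  there. Adding \<open>\<omega>\<close> to the lift and \<open>\<nu>\<close> to the homotopy then
  removes the homotopy defect.\<close>

lemma partial_lift_step:
  assumes gh: "partial_lift n g h" and n: "n > 0"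
  obtains g' h' where "partial_lift (Suc n) g' h'"
    "Null R S P n (fop 0 g' - fop 0 g)" "Null R S Q n (fop (- 1) h' - fop (- 1) h)"
proof -
  let ?\<gamma> = "fop 0 g" and ?\<eta> = "fop (- 1) h"
  have g: "fam S P 0 g" and h: "fam S Q (- 1) h" and X: "Null R S P n (mor_defect ?\<gamma>)"
    and W: "Null R S Q n (htpy_defect ?\<gamma> ?\<eta>)"
    using gh by (auto simp: partial_lift_def)
  note o = op_fop[OF g gP] op_fop[OF h gQ]
  have oX: "op S P (0 + 1) (mor_defect ?\<gamma>)" using op_mor_defect[OF o(1)] by simp
  have sep: "Null R S P (Suc n) (mor_defect ?\<gamma>)" "Null R S Q (Suc n) (\<alpha> \<bullet> htpy_defect ?\<gamma> ?\<eta>)"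
    by (rule separate[OF gS op_htpy_defect[OF o] oX f htpy_defect_cycle[OF o X W]])+
  obtain \<omega> \<nu> where \<omega>: "fam S P 0 \<omega>" "Null R S P n (fop 0 \<omega>)" and \<nu>: "fam S Q (0 - 1) \<nu>" "Null R S Q n (fop (0 - 1) \<nu>)"
    and W': "Null R S Q (Suc n) (htpy_defect ?\<gamma> ?\<eta> - \<phi> \<bullet> fop 0 \<omega> - \<alpha> \<bullet> fop (0 - 1) \<nu>)"
    using decompose[OF freeS op_htpy_defect[OF o] W sep(2) n f] by blast
  have \<nu>': "fam S Q (- 1) \<nu>" "Null R S Q n (fop (- 1) \<nu>)" using \<nu> by simp_all
  obtain g' where g': "fam S P 0 g'" "Nul R S P (fop 0 g' - ?\<gamma> - fop 0 \<omega>)"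
    using fam_add_represent[OF gS gP g \<omega>(1)] .
  obtain h' where h': "fam S Q (- 1) h'" "Nul R S Q (fop (- 1) h' - ?\<eta> - fop (- 1) \<nu>)"
    using fam_add_represent[OF gS gQ h \<nu>'(1)] .
  have dg: "Null R S P n (fop 0 g' - ?\<gamma>)" using Null_add[OF spec[OF g'(2)] \<omega>(2)] by simp
  have dh: "Null R S Q n (fop (- 1) h' - ?\<eta>)" using Null_add[OF spec[OF h'(2)] \<nu>'(2)] by simp
  note o' = op_fop[OF g'(1) gP] op_fop[OF h'(1) gQ]
  have "htpy_defect (fop 0 g') (fop (- 1) h') =
      (htpy_defect (fop 0 g') (fop (- 1) h') - htpy_defect ?\<gamma> ?\<eta> + \<phi> \<bullet> (fop 0 g' - ?\<gamma>) + \<alpha> \<bullet> (fop (- 1) h' - ?\<eta>))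
      - \<phi> \<bullet> (fop 0 g' - ?\<gamma> - fop 0 \<omega>) - \<alpha> \<bullet> (fop (- 1) h' - ?\<eta> - fop (- 1) \<nu>)
      + (htpy_defect ?\<gamma> ?\<eta> - \<phi> \<bullet> fop 0 \<omega> - \<alpha> \<bullet> fop (0 - 1) \<nu>)"
    by (simp add: algebra_simps)
  also have "Null R S Q (Suc n) \<dots>"
    by (rule Null_add[OF Null_diff[OF Null_diff[OF htpy_defect_change(1)[OF o(1) o'(1) o(2) o'(2) dg dh]
        Null_comp_left[OF opD(1)[OF op_\<phi>] spec[OF g'(2)]]] Null_comp_left[OF opD(1)[OF op_\<alpha>] spec[OF h'(2)]]] W'])
  finally have "Null R S Q (Suc n) (htpy_defect (fop 0 g') (fop (- 1) h'))" .
  moreover have "Null R S P (Suc n) (mor_defect (fop 0 g'))"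
    by (rule Null_cancel[OF mor_defect_change[OF o(1) o'(1) dg] sep(1)])
  ultimately have "partial_lift (Suc n) g' h'" using g'(1) h'(1) by (simp add: partial_lift_def)
  with dg dh show ?thesis using that by blast
qed

text \<open>Order 1 concerns the empty word only, so zero maps will do. The linear part of the lift
  arises in the first step and is recognised in \<open>morphism_lift\<close> as the map induced in
  homology.\<close>

lemma partial_lift_start: "\<exists>g h. partial_lift 1 g h"
proof -
  let ?g = "\<lambda>w :: 's word. \<zero>\<^bsub>P (wdeg w + 0)\<^esub>" and ?h = "\<lambda>w :: 's word. \<zero>\<^bsub>Q (wdeg w + (- 1))\<^esub>"
  have "fam S P 0 ?g" "fam S Q (- 1) ?h"
    by (rule fam_zero[OF gP], rule fam_zero[OF gQ])
  moreover from this have "Null R S P 1 (mor_defect (fop 0 ?g))" "Null R S Q 1 (htpy_defect (fop 0 ?g) (fop (- 1) ?h))"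
    using op_mor_defect op_htpy_defect op_fop gP gQ
    by (intro Null_lv opD(1)[OF op_mor_defect] opD(2)[OF op_mor_defect] opD(1)[OF op_htpy_defect] opD(2)[OF op_htpy_defect]; blast)+
  ultimately have "partial_lift 1 ?g ?h" by (simp add: partial_lift_def)
  then show ?thesis by blast
qed

theorem lift_exists:
  obtains g h where "fam S P 0 g" "fam S Q (- 1) h" "Nul R S P (\<beta> \<bullet> star (fop 0 g) - fop 0 g \<bullet> coder \<sigma>)"
    "Nul R S Q (p - through (fop 0 g) - \<alpha> \<bullet> htpy p (fop (- 1) h) (through (fop 0 g)) - fop (- 1) h \<bullet> coder \<sigma>)"
proof -
  have "\<exists>s. \<forall>i. partial_lift (i + 1) (fst (s i)) (snd (s i)) \<and>
      (Null R S P (i + 1) (fop 0 (fst (s (Suc i))) - fop 0 (fst (s i))) \<and>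
      Null R S Q (i + 1) (fop (- 1) (snd (s (Suc i))) - fop (- 1) (snd (s i))))"
  proof (rule dependent_nat_choice)
    show "\<exists>s. partial_lift (0 + 1) (fst s) (snd s)"
      using partial_lift_start by (metis add_0 fst_conv snd_conv)
  next
    fix s i assume "partial_lift (i + 1) (fst s) (snd s)"
    then obtain g h where "partial_lift (Suc (i + 1)) g h" "Null R S P (i + 1) (fop 0 g - fop 0 (fst s))"
      "Null R S Q (i + 1) (fop (- 1) h - fop (- 1) (snd s))"
      by (rule partial_lift_step) simp
    then show "\<exists>s'. partial_lift (Suc i + 1) (fst s') (snd s') \<and>
      (Null R S P (i + 1) (fop 0 (fst s') - fop 0 (fst s)) \<and> Null R S Q (i + 1) (fop (- 1) (snd s') - fop (- 1) (snd s)))"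
      by (intro exI[of _ "(g, h)"]) simp
  qed
  then obtain s where s: "\<And>i. partial_lift (i + 1) (fst (s i)) (snd (s i))"
    "\<And>i. Null R S P (i + 1) (fop 0 (fst (s (Suc i))) - fop 0 (fst (s i)))"
    "\<And>i. Null R S Q (i + 1) (fop (- 1) (snd (s (Suc i))) - fop (- 1) (snd (s i)))" by blast
  define gs where "gs i = fst (s i)" for i
  define hs where "hs i = snd (s i)" for i
  have gh: "fam S P 0 (gs i)" "fam S Q (- 1) (hs i)"
    "Null R S P (i + 1) (mor_defect (fop 0 (gs i)))" "Null R S Q (i + 1) (htpy_defect (fop 0 (gs i)) (fop (- 1) (hs i)))" for i
    using s(1)[of i] by (auto simp: partial_lift_def gs_def hs_def)
  obtain g where g: "fam S P 0 g" "\<And>i. Null R S P (i + 1) (fop 0 g - fop 0 (gs i))"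
    by (rule limit_family[OF gP gh(1) s(2)[folded gs_def]], simp, rule that)
  obtain h where h: "fam S Q (- 1) h" "\<And>i. Null R S Q (i + 1) (fop (- 1) h - fop (- 1) (hs i))"
    by (rule limit_family[OF gQ gh(2) s(3)[folded hs_def]], simp, rule that)
  note o = op_fop[OF g(1) gP] op_fop[OF h(1) gQ] and os = op_fop[OF gh(1) gP] op_fop[OF gh(2) gQ]
  have "Null R S P i (mor_defect (fop 0 g))" for i
    by (rule Null_mono[OF Null_cancel[OF Null_mono[OF mor_defect_change[OF os(1) o(1) g(2)]] gh(3)[of i]]]) simp_all
  moreover have "Null R S Q i (htpy_defect (fop 0 g) (fop (- 1) h))" for i
    by (rule Null_mono[OF Null_cancel[OF htpy_defect_change(2)[OF os(1) o(1) os(2) o(2) g(2) h(2)] gh(4)[of i]]]) simp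
  ultimately show ?thesis using g(1) h(1) by (intro that[of g h]) (simp_all add: mor_defect_def htpy_defect_def)
qed

end

section \<open>Inverting unipotent morphisms\<close>

context cring
begin

text \<open>The inverse is the geometric series in \<open>ident - star \<gamma>\<close>, which lowers word length.\<close>

lemma right_inverse_exists:
  assumes P: "gmod P" and g: "fam P P 0 g" and unip: "Null R P P 2 (fop 0 g - pr)"
  obtains k where "fam P P 0 k" "Nul R P P (fop 0 k \<bullet> star (fop 0 g) - pr)" "Null R P P 2 (fop 0 k - pr)"
proof -
  let ?\<gamma> = "fop 0 g"
  define N where "N = star ?\<gamma> - ident"
  note o = op_fop[OF g P]
  have mN: "mlin R P P N"
    unfolding N_def using mlin_star[OF opD(1)[OF o]] by (intro mlin_diff mlin_ident gmodD[OF P]) simp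
  have hN: "hom 0 N" unfolding N_def using hom_star[OF opD(3)[OF o]] by (intro hom_diff) simp_all
  have oN: "op P P 0 (a \<bullet> N)" if "op P P 0 a" for a
  proof -
    have "hom (0 + 0) (a \<bullet> N)" by (rule hom_comp[OF opD(3)[OF that] hN])
    moreover have "app N [] = 0" by (simp add: N_def one_sums)
    ultimately show ?thesis
      unfolding op_def using that by (auto intro!: mlin_comp[OF opD(1)[OF that] mN] lv_comp simp: op_def)
  qed
  \<comment> \<open>Term \<open>i\<close> is the projection to letters of the \<open>i\<close>-th
    power of \<open>- N\<close>.\<close>
  define t where "t i = ((\<lambda>a. - (a \<bullet> N)) ^^ i) pr" for i
  have t_Suc: "t (Suc i) = - (t i \<bullet> N)" for i by (simp add: t_def)
  have t0: "t 0 = pr" by (simp add: t_def)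
  have opr: "op P P 0 pr" using mlin_pr[OF P] by (simp add: op_def lv_pr)
  have neg: "op P P 0 (- a)" if "op P P 0 a" for a
    using that by (simp add: op_def mlin_uminus lv_uminus hom_uminus)
  have ot: "op P P 0 (t i)" for i
    by (induction i) (auto simp: t0 t_Suc opr intro!: neg oN)
  have nt: "Null R P P (Suc i) (t i)" for i
  proof (induction i)
    case 0
    then show ?case using Null_lv[OF opD(1,2)[OF opr]] by (simp add: t0)
  next
    case (Suc i)
    then show ?case
      unfolding t_Suc N_def using Null_comp_unipotent[OF P opD(1)[OF ot] Suc opD(1,2)[OF o] unip] by (intro Null_uminus) simp
  qed
  define s where "s n = (\<Sum>i<n. t i)" for n
  have os: "op P P 0 (s n)" for n
  proof (induction n)
    case 0
    show ?case by (simp add: s_def op_def mlin_zero lv_zero)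
  next
    case (Suc n)
    from op_add[OF Suc ot] show ?case by (simp add: s_def)
  qed
  \<comment> \<open>Telescoping: composing a term with \<open>star ?\<gamma>\<close>, which is
    \<open>ident + N\<close>, gives its difference to the next term.\<close>
  have series: "s n \<bullet> star ?\<gamma> - pr = - t n" for n
  proof (induction n)
    case 0
    then show ?case by (simp add: s_def t0)
  next
    case (Suc n)
    have "t n \<bullet> star ?\<gamma> = t n - t (Suc n)" by (simp add: t_Suc N_def)
    moreover have "s (Suc n) \<bullet> star ?\<gamma> - pr = (s n \<bullet> star ?\<gamma> - pr) + t n \<bullet> star ?\<gamma>" by (simp add: s_def)
    ultimately show ?case unfolding Suc by simp
  qed
  \<comment> \<open>Only families can be glued by word length, so the partial sums are first
    replaced by families modulo the relations.\<close>
  have "\<exists>k. fam P P 0 k \<and> Nul R P P (s n - fop 0 k)" for n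
    using op_represent[OF P P os[of n]] by metis
  then obtain k where k: "\<And>n. fam P P 0 (k n)" "\<And>n. Nul R P P (s n - fop 0 (k n))" by metis
  have step: "Null R P P (i + 1) (fop 0 (k (Suc i)) - fop 0 (k i))" for i
  proof -
    have "fop 0 (k (Suc i)) - fop 0 (k i) = t i - (s (Suc i) - fop 0 (k (Suc i))) + (s i - fop 0 (k i))"
      by (simp add: s_def)
    also have "Null R P P (Suc i) \<dots>"
      by (rule Null_add[OF Null_diff[OF nt spec[OF k(2)]] spec[OF k(2)]])
    finally show ?thesis by simp
  qed
  obtain k' where k': "fam P P 0 k'" "\<And>i. Null R P P (i + 1) (fop 0 k' - fop 0 (k i))"
    by (rule limit_family[OF P k(1) step], simp, rule that)
  have ks: "Null R P P (i + 1) (fop 0 k' - s i)" for i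
    using Null_diff[OF k'(2)[of i] spec[OF k(2)[of i]]] by simp
  have "Null R P P i (fop 0 k' \<bullet> star ?\<gamma> - pr)" for i
  proof -
    define a where "a = fop 0 k' - s i"
    have a: "mlin R P P a" "Null R P P i a"
      using Null_mono[OF ks[of i], of i] opD(1)[OF op_diff[OF op_fop[OF k'(1) P] os[of i]]] by (auto simp: a_def)
    have "Null R P P i (a \<bullet> N + a)"
      using Null_mono[OF Null_comp_unipotent[OF P a opD(1,2)[OF o] unip], of i] a(2) unfolding N_def by (intro Null_add) simp_all
    then have "Null R P P i (a \<bullet> star ?\<gamma>)" by (simp add: N_def)
    moreover have "fop 0 k' \<bullet> star ?\<gamma> - pr = a \<bullet> star ?\<gamma> - t i"
      using series[of i] by (simp add: a_def algebra_simps)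
    ultimately show ?thesis using Null_diff[OF _ Null_mono[OF nt[of i], of i]] by simp
  qed
  moreover have "Null R P P 2 (fop 0 k' - pr)"
    using ks[of 1] by (simp add: s_def t0 numeral_2_eq_2)
  ultimately show ?thesis using k'(1) by (intro that) auto
qed

end

section \<open>Suspension\<close>

definition susp_word :: "'a word \<Rightarrow> 'a word" where
  "susp_word w = map (\<lambda>(k, x). (k - 1, x)) w"

lemma susp_word_simps [simp]:
  "susp_word [] = []" "susp_word ((k, x) # w) = (k - 1, x) # susp_word w" "susp_word (u @ v) = susp_word u @ susp_word v"
  "desusp_word [] = []" "desusp_word ((k, x) # w) = (k + 1, x) # desusp_word w" "desusp_word (u @ v) = desusp_word u @ desusp_word v"
  "length (susp_word w) = length w" "length (desusp_word w) = length w"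
  "desusp_word (susp_word w) = w" "susp_word (desusp_word w) = w"
  by (auto simp: susp_word_def desusp_word_def comp_def case_prod_unfold)

lemma desusp_word_eq_Nil [simp]: "desusp_word w = [] \<longleftrightarrow> w = []"
  by (simp add: desusp_word_def)

lemma wdeg_desusp_word: "wdeg (desusp_word w) = wdeg w + int (length w)"
  by (induction w) (auto simp: desusp_word_def)

lemma wdeg_susp_word: "wdeg (susp_word w) = wdeg w - int (length w)"
  by (induction w) (auto simp: susp_word_def)

lemma words_desusp [simp]: "desusp_word w \<in> words M \<longleftrightarrow> w \<in> words (susp M)"
  by (auto simp: words_def desusp_word_def susp_def)

lemma words_susp [simp]: "susp_word w \<in> words (susp M) \<longleftrightarrow> w \<in> words M"
  using words_desusp[of "susp_word w" M] by simp

lemma susp_exp_slot: "susp_exp (u @ (k, x) # v) = susp_exp (u @ (k, y) # v)"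
  by (induction u) auto

text \<open>The value of \<open>bar_op\<close> without its degree; it makes the operators of the bar
  construction instances of \<open>fop\<close>.\<close>

definition bfam :: "(int \<Rightarrow> ('r, 'b) module) \<Rightarrow> int \<Rightarrow> ('a word \<Rightarrow> 'b) \<Rightarrow> 'a word \<Rightarrow> 'b" where
  "bfam N e f w = sgn_mod (susp N (wdeg w + e)) (susp_exp (desusp_word w)) (f (desusp_word w))"

lemma lop_bar_op: "lop (bar_op N e f) = fop e (bfam N e f)"
  unfolding fop_def bar_op_def bfam_def by (rule oper_eqI) (simp add: app_lop bar_op_def)

context cring
begin

lemma sgn_mod_simps:
  assumes "module R N" "x \<in> carrier N"
  shows "sgn_mod N e x \<in> carrier N" "sgn_mod N e (sgn_mod N e x) = x"
    "y \<in> carrier N \<Longrightarrow> sgn_mod N e (x \<oplus>\<^bsub>N\<^esub> y) = sgn_mod N e x \<oplus>\<^bsub>N\<^esub> sgn_mod N e y"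
    "c \<in> carrier R \<Longrightarrow> sgn_mod N e (c \<odot>\<^bsub>N\<^esub> x) = c \<odot>\<^bsub>N\<^esub> sgn_mod N e x"
proof -
  interpret N: module R N by fact
  show "sgn_mod N e x \<in> carrier N" "sgn_mod N e (sgn_mod N e x) = x"
    "y \<in> carrier N \<Longrightarrow> sgn_mod N e (x \<oplus>\<^bsub>N\<^esub> y) = sgn_mod N e x \<oplus>\<^bsub>N\<^esub> sgn_mod N e y"
    "c \<in> carrier R \<Longrightarrow> sgn_mod N e (c \<odot>\<^bsub>N\<^esub> x) = c \<odot>\<^bsub>N\<^esub> sgn_mod N e x"
    using assms(2) by (auto simp: sgn_mod_def N.minus_add N.a_comm N.smult_r_minus)
qed

lemma gmod_susp [simp]: "gmod M \<Longrightarrow> gmod (susp M)"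
  by (simp add: gmod_def susp_def)

lemma graded_module_iff: "graded_module R M \<longleftrightarrow> gmod M"
  by (simp add: graded_module_def gmod_def is_cring)

lemma graded_mapsD:
  assumes "graded_maps R M N c f"
  shows "w \<in> words M \<Longrightarrow> w \<noteq> [] \<Longrightarrow> f w \<in> carrier (N (wdeg w + c - int (length w)))"
    and "u \<in> words M \<Longrightarrow> v \<in> words M \<Longrightarrow> x \<in> carrier (M k) \<Longrightarrow> y \<in> carrier (M k) \<Longrightarrow>
      f (u @ [(k, x \<oplus>\<^bsub>M k\<^esub> y)] @ v) = f (u @ [(k, x)] @ v)
        \<oplus>\<^bsub>N (wdeg u + k + wdeg v + c - int (length u + 1 + length v))\<^esub> f (u @ [(k, y)] @ v)"
    and "u \<in> words M \<Longrightarrow> v \<in> words M \<Longrightarrow> r \<in> carrier R \<Longrightarrow> x \<in> carrier (M k) \<Longrightarrow>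
      f (u @ [(k, r \<odot>\<^bsub>M k\<^esub> x)] @ v) =
        r \<odot>\<^bsub>N (wdeg u + k + wdeg v + c - int (length u + 1 + length v))\<^esub> f (u @ [(k, x)] @ v)"
  using assms unfolding graded_maps_def by blast+

lemma graded_maps_bfam:
  assumes N: "gmod N" and f: "graded_maps R M N (e + 1) f"
  shows "fam (susp M) (susp N) e (bfam N e f)"
proof (rule famI)
  have closed: "f (desusp_word w) \<in> carrier (susp N (wdeg w + e))" if "w \<in> words (susp M)" "w \<noteq> []" for w
  proof -
    have "f (desusp_word w) \<in> carrier (N (wdeg (desusp_word w) + (e + 1) - int (length (desusp_word w))))"
      using f that unfolding graded_maps_def by (metis desusp_word_eq_Nil words_desusp)
    then show ?thesis by (simp add: wdeg_desusp_word susp_def algebra_simps)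
  qed
  note sm = sgn_mod_simps[OF gmodD[OF gmod_susp[OF N]]]
  show "bfam N e f w \<in> carrier (susp N (wdeg w + e))" if "w \<in> words (susp M)" "w \<noteq> []" for w
    unfolding bfam_def by (rule sm(1)[OF closed[OF that]])
  fix u v k x assume *: "u \<in> words (susp M)" "v \<in> words (susp M)" "x \<in> carrier (susp M k)"
  let ?j = "wdeg u + k + wdeg v + e"
  let ?f = "\<lambda>z. f (desusp_word u @ [(k + 1, z)] @ desusp_word v)"
  have c: "?f z \<in> carrier (susp N ?j)" if "z \<in> carrier (susp M k)" for z
    using closed[of "u @ [(k, z)] @ v"] * that by (simp add: add.assoc)
  have b: "bfam N e f (u @ [(k, z)] @ v) =
      sgn_mod (susp N ?j) (susp_exp (desusp_word u @ (k + 1, x) # desusp_word v)) (?f z)" for z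
    unfolding bfam_def by (simp add: add.assoc susp_exp_slot[of _ _ z _ x])
  have idx: "wdeg (desusp_word u) + (k + 1) + wdeg (desusp_word v) + (e + 1)
      - int (length (desusp_word u) + 1 + length (desusp_word v)) = ?j + 1"
    by (simp add: wdeg_desusp_word)
  show "bfam N e f (u @ [(k, x \<oplus>\<^bsub>susp M k\<^esub> y)] @ v) =
      bfam N e f (u @ [(k, x)] @ v) \<oplus>\<^bsub>susp N ?j\<^esub> bfam N e f (u @ [(k, y)] @ v)" if y: "y \<in> carrier (susp M k)" for y
  proof -
    have "?f (x \<oplus>\<^bsub>M (k + 1)\<^esub> y) = ?f x \<oplus>\<^bsub>N (?j + 1)\<^esub> ?f y"
      using graded_mapsD(2)[OF f, of "desusp_word u" "desusp_word v" x "k + 1" y] * y unfolding idx by (simp add: susp_def)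
    then show ?thesis unfolding b using sm(3)[OF c c, of x y] * y by (simp add: susp_def)
  qed
  show "bfam N e f (u @ [(k, r \<odot>\<^bsub>susp M k\<^esub> x)] @ v) = r \<odot>\<^bsub>susp N ?j\<^esub> bfam N e f (u @ [(k, x)] @ v)"
    if r: "r \<in> carrier R" for r
  proof -
    have "?f (r \<odot>\<^bsub>M (k + 1)\<^esub> x) = r \<odot>\<^bsub>N (?j + 1)\<^esub> ?f x"
      using graded_mapsD(3)[OF f, of "desusp_word u" "desusp_word v" r x "k + 1"] * r unfolding idx by (simp add: susp_def)
    then show ?thesis unfolding b using sm(4)[OF c r, of x] * by (simp add: susp_def)
  qed
qed

text \<open>The suspension sign squares to one, so the same sign turns a family on the suspensions
  back into graded maps.\<close>

lemma bfam_surj: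
  assumes N: "gmod N" and b: "fam (susp M) (susp N) e b"
  obtains f where "graded_maps R M N (e + 1) f" "\<And>w. w \<in> words (susp M) \<Longrightarrow> w \<noteq> [] \<Longrightarrow> bfam N e f w = b w"
proof -
  define f where "f w = sgn_mod (susp N (wdeg w - int (length w) + e)) (susp_exp w) (b (susp_word w))" for w
  note sm = sgn_mod_simps[OF gmodD[OF gmod_susp[OF N]]]
  have f_b: "bfam N e f w = b w" if "w \<in> words (susp M)" "w \<noteq> []" for w
    using sm(2)[OF famD(1)[OF b that]] by (simp add: bfam_def f_def wdeg_desusp_word)
  have "graded_maps R M N (e + 1) f"
    unfolding graded_maps_def
  proof (intro conjI ballI impI allI)
    fix w assume "w \<in> words M" "w \<noteq> []"
    then show "f w \<in> carrier (N (wdeg w + (e + 1) - int (length w)))"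
      using sm(1)[OF famD(1)[OF b, of "susp_word w"], of "susp_exp w"]
      by (simp add: f_def wdeg_susp_word susp_def algebra_simps flip: length_greater_0_conv)
  next
    fix u v k x y assume *: "u \<in> words M" "v \<in> words M" "x \<in> carrier (M k)" "y \<in> carrier (M k)"
    let ?j = "wdeg u + k + wdeg v + (e + 1) - int (length u + 1 + length v)"
    let ?b = "\<lambda>z. b (susp_word u @ [(k - 1, z)] @ susp_word v)"
    have j: "wdeg (susp_word u) + (k - 1) + wdeg (susp_word v) + e = ?j - 1" by (simp add: wdeg_susp_word)
    have c: "?b z \<in> carrier (susp N (?j - 1))" if "z \<in> carrier (M k)" for z
      using famD(1)[OF b, of "susp_word u @ [(k - 1, z)] @ susp_word v"] * that unfolding j[symmetric] by (simp add: susp_def add.assoc)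
    have fz: "f (u @ [(k, z)] @ v) = sgn_mod (susp N (?j - 1)) (susp_exp (u @ (k, x) # v)) (?b z)" for z
      unfolding f_def by (simp add: susp_exp_slot[of _ _ z _ x] algebra_simps)
    have "?b (x \<oplus>\<^bsub>M k\<^esub> y) = ?b x \<oplus>\<^bsub>susp N (?j - 1)\<^esub> ?b y"
      using famD(2)[OF b, of "susp_word u" "susp_word v" x "k - 1" y] * unfolding j by (simp add: susp_def)
    then show "f (u @ [(k, x \<oplus>\<^bsub>M k\<^esub> y)] @ v) = f (u @ [(k, x)] @ v) \<oplus>\<^bsub>N ?j\<^esub> f (u @ [(k, y)] @ v)"
      unfolding fz using sm(3)[OF c c, of x y] * by (simp add: susp_def)
  next
    fix u v k r x assume *: "u \<in> words M" "v \<in> words M" "r \<in> carrier R" "x \<in> carrier (M k)"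
    let ?j = "wdeg u + k + wdeg v + (e + 1) - int (length u + 1 + length v)"
    let ?b = "\<lambda>z. b (susp_word u @ [(k - 1, z)] @ susp_word v)"
    have j: "wdeg (susp_word u) + (k - 1) + wdeg (susp_word v) + e = ?j - 1" by (simp add: wdeg_susp_word)
    have c: "?b z \<in> carrier (susp N (?j - 1))" if "z \<in> carrier (M k)" for z
      using famD(1)[OF b, of "susp_word u @ [(k - 1, z)] @ susp_word v"] * that unfolding j[symmetric] by (simp add: susp_def add.assoc)
    have fz: "f (u @ [(k, z)] @ v) = sgn_mod (susp N (?j - 1)) (susp_exp (u @ (k, x) # v)) (?b z)" for z
      unfolding f_def by (simp add: susp_exp_slot[of _ _ z _ x] algebra_simps)
    have "?b (r \<odot>\<^bsub>M k\<^esub> x) = r \<odot>\<^bsub>susp N (?j - 1)\<^esub> ?b x"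
      using famD(3)[OF b, of "susp_word u" "susp_word v" r x "k - 1"] * unfolding j by (simp add: susp_def)
    then show "f (u @ [(k, r \<odot>\<^bsub>M k\<^esub> x)] @ v) = r \<odot>\<^bsub>N ?j\<^esub> f (u @ [(k, x)] @ v)"
      unfolding fz using sm(4)[OF c *(3), of x] * by (simp add: susp_def)
  qed
  then show ?thesis using f_b by (rule that)
qed

section \<open>Morphisms and homotopies in terms of their projections\<close>

abbreviation bop :: "(int \<Rightarrow> ('a, 'n) module) \<Rightarrow> int \<Rightarrow> ('m word \<Rightarrow> 'n) \<Rightarrow> (int \<times> 'm, int \<times> 'n) oper" where
  "bop N e f \<equiv> fop e (bfam N e f)"

lemma op_bop: "gmod N \<Longrightarrow> graded_maps R M N (e + 1) f \<Longrightarrow> op (susp M) (susp N) e (bop N e f)"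
  by (intro op_fop graded_maps_bfam gmod_susp)

lemma op_bop_cases:
  "gmod N \<Longrightarrow> graded_maps R M N 2 f \<Longrightarrow> op (susp M) (susp N) 1 (bop N 1 f)"
  "gmod N \<Longrightarrow> graded_maps R M N 1 f \<Longrightarrow> op (susp M) (susp N) 0 (bop N 0 f)"
  "gmod N \<Longrightarrow> graded_maps R M N 0 f \<Longrightarrow> op (susp M) (susp N) (- 1) (bop N (- 1) f)"
  using op_bop[of N M 1 f] op_bop[of N M 0 f] op_bop[of N M "- 1" f] by simp_all

text \<open>Turns operators found by obstruction theory into sequences of multilinear maps as in the
  definitions, at the price of a null error.\<close>

lemma bop_surj:
  assumes "gmod M" "gmod N" "op (susp M) (susp N) e a"
  obtains f where "graded_maps R M N (e + 1) f" "Nul R (susp M) (susp N) (a - bop N e f)"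
proof -
  obtain b where b: "fam (susp M) (susp N) e b" "Nul R (susp M) (susp N) (a - fop e b)"
    using op_represent[OF gmod_susp[OF assms(1)] gmod_susp[OF assms(2)] assms(3)] .
  obtain f where f: "graded_maps R M N (e + 1) f" "\<And>w. w \<in> words (susp M) \<Longrightarrow> w \<noteq> [] \<Longrightarrow> bfam N e f w = b w"
    using bfam_surj[OF assms(2) b(1)] by blast
  have "app (a - bop N e f) w = app (a - fop e b) w" if "w \<in> words (susp M)" for w
    using f(2)[OF that] by (simp add: app_fop)
  then have "Nul R (susp M) (susp N) (a - bop N e f)"
    using b(2) by (simp add: Null_def)
  with f(1) show ?thesis by (rule that)
qed

lemma rext_comp: "rext a (rext b u) = rext (a \<bullet> b) u"
  by (induction u rule: frag_induct_all) (auto simp: app_comp)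

lemma rext_oper_simps:
  "rext 0 u = 0" "rext ident u = u" "rext (a + b) u = rext a u + rext b u" "rext (a - b) u = rext a u - rext b u"
proof -
  have "rext 0 u = 0 \<and> rext ident u = u \<and> rext (a + b) u = rext a u + rext b u \<and> rext (a - b) u = rext a u - rext b u"
    by (induction u rule: frag_induct_all) (auto simp: algebra_simps)
  then show "rext 0 u = 0" "rext ident u = u" "rext (a + b) u = rext a u + rext b u" "rext (a - b) u = rext a u - rext b u"
    by blast+
qed

text \<open>The symbols \<open>(r, w)\<close> generate the tensors and \<open>nul\<close> tests all
  coefficients \<open>r\<close>, so an identity between maps of tensors amounts to a null difference
  of operators.\<close>

lemma tensor_eq_rext:
  assumes a: "mlin R P Q a" and b: "mlin R P Q b"
  shows "(\<forall>u\<in>tensor_elems R P. tensor_eq R Q (rext a u) (rext b u)) \<longleftrightarrow> Nul R P Q (a - b)"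
proof
  assume *: "\<forall>u\<in>tensor_elems R P. tensor_eq R Q (rext a u) (rext b u)"
  show "Nul R P Q (a - b)"
  proof (rule NulI)
    show "good Q (app (a - b) w)" if "w \<in> words P" for w using mlinD(1)[OF mlin_diff[OF a b] that] .
    show "nul R Q (app (a - b) w)" if "w \<in> words P" for w
      unfolding nul_def
    proof
      fix r assume "r \<in> carrier R"
      then have "frag_of (r, w) \<in> tensor_elems R P" using that by (simp add: tensor_elems_def)
      with * show "tens r (app (a - b) w) \<in> tensor_rels R Q" by (force simp: tensor_eq_def)
    qed
  qed
next
  assume *: "Nul R P Q (a - b)"
  have n: "tens r (app a w) - tens r (app b w) \<in> tensor_rels R Q" if "w \<in> words P" "r \<in> carrier R" for w r
    using NulD[OF * that(1)] that(2) by (simp add: nul_def)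
  have "rext (a - b) u \<in> tensor_rels R Q" if "u \<in> tensor_elems R P" for u
    using that[unfolded tensor_elems_def mem_Collect_eq]
    by (induction u rule: frag_induction) (auto intro: tensor_rels.diff n)
  then show "\<forall>u\<in>tensor_elems R P. tensor_eq R Q (rext a u) (rext b u)"
    by (simp add: tensor_eq_def rext_oper_simps)
qed

text \<open>Composing with \<open>pr\<close> projects the square of the coderivation to its
  letter-valued part, and \<open>coder_square_null\<close> recovers the square from that
  part.\<close>

lemma ainf_algebra_iff:
  "ainf_algebra R M m \<longleftrightarrow> gmod M \<and> graded_maps R M M 2 m \<and>
    Nul R (susp M) (susp M) (bop M 1 m \<bullet> coder (bop M 1 m))"
proof -
  have "(\<forall>u\<in>tensor_elems R (susp M). tensor_eq R (susp M) (bar_diff M m (bar_diff M m u)) 0) \<longleftrightarrow>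
      Nul R (susp M) (susp M) (bop M 1 m \<bullet> coder (bop M 1 m))" if M: "gmod M" "graded_maps R M M 2 m"
  proof -
    let ?\<beta> = "bop M 1 m" and ?P = "susp M"
    note P = gmod_susp[OF M(1)]
    note o = op_bop_cases(1)[OF M]
    have m: "mlin R ?P ?P (coder ?\<beta> \<bullet> coder ?\<beta>)" using mlin_coder[OF P opD(1)[OF o]] by (intro mlin_comp)
    have "(\<forall>u\<in>tensor_elems R ?P. tensor_eq R ?P (bar_diff M m (bar_diff M m u)) 0) \<longleftrightarrow>
        Nul R ?P ?P (coder ?\<beta> \<bullet> coder ?\<beta>)"
      using tensor_eq_rext[OF m mlin_zero] by (simp add: bar_diff_eq lop_bar_op rext_comp rext_oper_simps)
    also have "\<dots> \<longleftrightarrow> Nul R ?P ?P (?\<beta> \<bullet> coder ?\<beta>)"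
    proof
      assume "Nul R ?P ?P (coder ?\<beta> \<bullet> coder ?\<beta>)"
      then have "Nul R ?P ?P (pr \<bullet> (coder ?\<beta> \<bullet> coder ?\<beta>))" using Null_comp_left[OF mlin_pr[OF P]] by blast
      then show "Nul R ?P ?P (?\<beta> \<bullet> coder ?\<beta>)" by (simp add: comp_assoc[symmetric] pr_comp_coder[OF opD(2)[OF o]])
    qed (rule coder_square_null[OF P o])
    finally show ?thesis .
  qed
  then show ?thesis by (auto simp: ainf_algebra_def graded_module_iff)
qed

text \<open>In one direction project with \<open>pr\<close>; in the other, the difference of the two
  composites is a convolution product whose middle factor is the projected equation.\<close>

lemma ainf_morphism_iff:
  "ainf_morphism R M m N n f \<longleftrightarrow> ainf_algebra R M m \<and> ainf_algebra R N n \<and> graded_maps R M N 1 f \<and>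
    Nul R (susp M) (susp N) (bop N 1 n \<bullet> star (bop N 0 f) - bop N 0 f \<bullet> coder (bop M 1 m))"
proof -
  have "(\<forall>u\<in>tensor_elems R (susp M). tensor_eq R (susp N) (bar_diff N n (bar_map N f u)) (bar_map N f (bar_diff M m u))) \<longleftrightarrow>
      Nul R (susp M) (susp N) (bop N 1 n \<bullet> star (bop N 0 f) - bop N 0 f \<bullet> coder (bop M 1 m))"
    if M: "ainf_algebra R M m" and N: "ainf_algebra R N n" and f: "graded_maps R M N 1 f"
  proof -
    let ?\<beta> = "bop M 1 m" and ?\<alpha> = "bop N 1 n" and ?\<phi> = "bop N 0 f" and ?P = "susp M" and ?Q = "susp N"
    have gM: "gmod M" and gN: "gmod N" using M N by (auto simp: ainf_algebra_iff)
    note P = gmod_susp[OF gM] and Q = gmod_susp[OF gN]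
    have \<beta>: "op ?P ?P 1 ?\<beta>" and \<alpha>: "op ?Q ?Q 1 ?\<alpha>" and \<phi>: "op ?P ?Q 0 ?\<phi>"
      using M N f gM gN by (auto simp: ainf_algebra_iff intro: op_bop_cases)
    have F: "mlin R ?P ?Q (star ?\<phi>)" by (rule mlin_star[OF opD(1)[OF \<phi>] lv_Nil[OF opD(2)[OF \<phi>]]])
    have comm: "coder ?\<alpha> \<bullet> star ?\<phi> - star ?\<phi> \<bullet> coder ?\<beta> =
        sg (star ?\<phi>) * (?\<alpha> \<bullet> star ?\<phi> - ?\<phi> \<bullet> coder ?\<beta>) * star ?\<phi>"
      unfolding coder_comp_star[OF opD(2,3)[OF \<phi>]] star_comp_coder[OF opD(2)[OF \<phi>] opD(2)[OF \<beta>]] by (simp add: algebra_simps)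
    have m: "mlin R ?P ?Q (coder ?\<alpha> \<bullet> star ?\<phi>)" "mlin R ?P ?Q (star ?\<phi> \<bullet> coder ?\<beta>)"
      using mlin_comp[OF mlin_coder[OF Q opD(1)[OF \<alpha>]] F] mlin_comp[OF F mlin_coder[OF P opD(1)[OF \<beta>]]] .
    have "(\<forall>u\<in>tensor_elems R ?P. tensor_eq R ?Q (bar_diff N n (bar_map N f u)) (bar_map N f (bar_diff M m u))) \<longleftrightarrow>
        Nul R ?P ?Q (coder ?\<alpha> \<bullet> star ?\<phi> - star ?\<phi> \<bullet> coder ?\<beta>)"
      using tensor_eq_rext[OF m] by (simp add: bar_diff_eq bar_map_eq lop_bar_op rext_comp)
    also have "\<dots> \<longleftrightarrow> Nul R ?P ?Q (?\<alpha> \<bullet> star ?\<phi> - ?\<phi> \<bullet> coder ?\<beta>)"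
    proof
      assume "Nul R ?P ?Q (coder ?\<alpha> \<bullet> star ?\<phi> - star ?\<phi> \<bullet> coder ?\<beta>)"
      then have "Nul R ?P ?Q (pr \<bullet> (coder ?\<alpha> \<bullet> star ?\<phi> - star ?\<phi> \<bullet> coder ?\<beta>))"
        using Null_comp_left[OF mlin_pr[OF Q]] by blast
      then show "Nul R ?P ?Q (?\<alpha> \<bullet> star ?\<phi> - ?\<phi> \<bullet> coder ?\<beta>)"
        by (simp add: comp_assoc[symmetric] pr_comp_coder[OF opD(2)[OF \<alpha>]] pr_comp_star[OF opD(2)[OF \<phi>]])
    next
      assume *: "Nul R ?P ?Q (?\<alpha> \<bullet> star ?\<phi> - ?\<phi> \<bullet> coder ?\<beta>)"
      show "Nul R ?P ?Q (coder ?\<alpha> \<bullet> star ?\<phi> - star ?\<phi> \<bullet> coder ?\<beta>)"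
        unfolding comm by (intro allI Null_mult_right[OF F] Null_mult_left[OF mlin_sg[OF F]] spec[OF *])
    qed
    finally show ?thesis .
  qed
  then show ?thesis by (auto simp: ainf_morphism_def)
qed

text \<open>Between two morphisms the correction terms of \<open>htpy_boundary\<close> are null, and
  by the resolvent identity its main term is the difference of the two coalgebra maps.\<close>

lemma ainf_homotopicI:
  assumes f: "ainf_morphism R M m N n f" and g: "ainf_morphism R M m N n g" and h: "graded_maps R M N 0 h"
    and W: "Nul R (susp M) (susp N) (bop N 0 f - bop N 0 g
      - bop N 1 n \<bullet> htpy (bop N 0 f) (bop N (- 1) h) (bop N 0 g) - bop N (- 1) h \<bullet> coder (bop M 1 m))"
  shows "ainf_homotopic R M m N n f g"
proof -
  let ?\<beta> = "bop M 1 m" and ?\<alpha> = "bop N 1 n" and ?p = "bop N 0 f" and ?q = "bop N 0 g" and ?\<eta> = "bop N (- 1) h"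
    and ?P = "susp M" and ?Q = "susp N"
  let ?D = "htpy ?p ?\<eta> ?q"
  have gM: "gmod M" and gN: "gmod N" using f by (auto simp: ainf_morphism_iff ainf_algebra_iff)
  note P = gmod_susp[OF gM] and Q = gmod_susp[OF gN]
  have \<beta>: "op ?P ?P 1 ?\<beta>" and \<alpha>: "op ?Q ?Q 1 ?\<alpha>" and p: "op ?P ?Q 0 ?p" and q: "op ?P ?Q 0 ?q" and \<eta>: "op ?P ?Q (- 1) ?\<eta>"
    using f g h gM gN by (auto simp: ainf_morphism_iff ainf_algebra_iff intro: op_bop_cases)
  have mP: "mlin R ?P ?Q (star ?p)" and mQ: "mlin R ?P ?Q (star ?q)"
    using mlin_star[OF opD(1)[OF p] lv_Nil[OF opD(2)[OF p]]] mlin_star[OF opD(1)[OF q] lv_Nil[OF opD(2)[OF q]]] .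
  have mD: "mlin R ?P ?Q ?D" by (rule mlin_htpy[OF opD(1)[OF p] opD(1)[OF \<eta>] opD(1)[OF q] opD(2)[OF p] opD(2)[OF q]])
  have M: "Nul R ?P ?Q (?\<alpha> \<bullet> star ?p - ?p \<bullet> coder ?\<beta>)" and Y: "Nul R ?P ?Q (?\<alpha> \<bullet> star ?q - ?q \<bullet> coder ?\<beta>)"
    using f g by (auto simp: ainf_morphism_iff)
  have PQ: "star ?p * (?p - ?q) * star ?q = star ?p - star ?q"
    using star_diff[OF lv_Nil[OF opD(2)[OF p]] lv_Nil[OF opD(2)[OF q]]] by (simp add: algebra_simps)
  define W' where "W' = ?p - ?q - ?\<alpha> \<bullet> ?D - ?\<eta> \<bullet> coder ?\<beta>"
  have "?\<alpha> \<bullet> ?D + ?\<eta> \<bullet> coder ?\<beta> = (?p - ?q) - W'" by (simp add: W'_def)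
  then have "coder ?\<alpha> \<bullet> ?D + ?D \<bullet> coder ?\<beta> = star ?p * ((?p - ?q) - W') * star ?q
      + star ?p * sg (?\<alpha> \<bullet> star ?p - ?p \<bullet> coder ?\<beta>) * ?D - sg ?D * (?\<alpha> \<bullet> star ?q - ?q \<bullet> coder ?\<beta>) * star ?q"
    using htpy_boundary[OF opD(2)[OF p] opD(2)[OF \<eta>] opD(2)[OF q] opD(2)[OF \<beta>]
        opD(3)[OF p] opD(3)[OF \<eta>] opD(3)[OF q] opD(3)[OF \<beta>], of ?\<alpha>] by simp
  then have eq: "star ?p - star ?q - (coder ?\<alpha> \<bullet> ?D + ?D \<bullet> coder ?\<beta>) = star ?p * W' * star ?q
      - star ?p * sg (?\<alpha> \<bullet> star ?p - ?p \<bullet> coder ?\<beta>) * ?D + sg ?D * (?\<alpha> \<bullet> star ?q - ?q \<bullet> coder ?\<beta>) * star ?q"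
    using PQ by (simp add: right_diff_distrib left_diff_distrib)
  have "Nul R ?P ?Q (star ?p - star ?q - (coder ?\<alpha> \<bullet> ?D + ?D \<bullet> coder ?\<beta>))"
    unfolding eq
  proof
    fix k
    show "Null R ?P ?Q k (star ?p * W' * star ?q - star ?p * sg (?\<alpha> \<bullet> star ?p - ?p \<bullet> coder ?\<beta>) * ?D
      + sg ?D * (?\<alpha> \<bullet> star ?q - ?q \<bullet> coder ?\<beta>) * star ?q)"
      by (rule Null_add[OF Null_diff[OF Null_mult_right[OF mQ Null_mult_left[OF mP spec[OF W[folded W'_def]]]]
          Null_mult_right[OF mD Null_mult_left[OF mP Null_sg[OF spec[OF M]]]]] Null_mult_right[OF mQ Null_mult_left[OF mlin_sg[OF mD] spec[OF Y]]]])
  qed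
  then have "\<forall>u\<in>tensor_elems R ?P. tensor_eq R ?Q (rext (star ?p - star ?q) u) (rext (coder ?\<alpha> \<bullet> ?D + ?D \<bullet> coder ?\<beta>) u)"
    using tensor_eq_rext[OF mlin_diff[OF mP mQ] mlin_add[OF mlin_comp[OF mlin_coder[OF Q opD(1)[OF \<alpha>]] mD]
        mlin_comp[OF mD mlin_coder[OF P opD(1)[OF \<beta>]]]]] by blast
  then show ?thesis
    unfolding ainf_homotopic_def using f g h
    by (intro conjI exI[of _ h]) (simp_all add: bar_diff_eq bar_map_eq bar_homotopy_eq lop_bar_op rext_comp rext_oper_simps)
qed

text \<open>\<open>c\<close> agrees with the projection of the composite only modulo relations. That
  it is a morphism follows by transporting the equations of \<open>f\<close> and \<open>g\<close>
  along this null difference.\<close>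

lemma ainf_compositeI:
  assumes f: "ainf_morphism R M m N n f" and g: "ainf_morphism R N n T t g" and c: "graded_maps R M T 1 c"
    and eq: "Nul R (susp M) (susp T) (bop T 0 g \<bullet> star (bop N 0 f) - bop T 0 c)"
  shows "ainf_composite R M m N n T t g f c"
proof -
  let ?F = "bop N 0 f" and ?G = "bop T 0 g" and ?C = "bop T 0 c" and ?P = "susp M" and ?Q = "susp N" and ?T = "susp T"
  let ?dM = "coder (bop M 1 m)" and ?dN = "coder (bop N 1 n)" and ?\<tau> = "bop T 1 t"
  have M: "ainf_algebra R M m" and N: "ainf_algebra R N n" and T: "ainf_algebra R T t" using f g by (auto simp: ainf_morphism_iff)
  then have gM: "gmod M" and gN: "gmod N" and gT: "gmod T" by (auto simp: ainf_algebra_iff)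
  note P = gmod_susp[OF gM] and Q = gmod_susp[OF gN] and T' = gmod_susp[OF gT]
  have oM: "op ?P ?P 1 (bop M 1 m)" and oN: "op ?Q ?Q 1 (bop N 1 n)" and oT: "op ?T ?T 1 ?\<tau>"
    and oF: "op ?P ?Q 0 ?F" and oG: "op ?Q ?T 0 ?G" and oC: "op ?P ?T 0 ?C"
    using f g c gM gN gT by (auto simp: ainf_morphism_iff ainf_algebra_iff intro: op_bop_cases)
  have F: "Nul R ?P ?Q (bop N 1 n \<bullet> star ?F - ?F \<bullet> ?dM)" and G: "Nul R ?Q ?T (?\<tau> \<bullet> star ?G - ?G \<bullet> ?dN)"
    using f g by (auto simp: ainf_morphism_iff)
  have sF: "mlin R ?P ?Q (star ?F)" and sG: "mlin R ?Q ?T (star ?G)" and sC: "mlin R ?P ?T (star ?C)"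
    using mlin_star opD(1) opD(2) lv_Nil oF oG oC by meson+
  note oGF = op_comp_star[OF oG oF]
  have GF: "star ?G \<bullet> star ?F = star (?G \<bullet> star ?F)" by (rule comp_star[OF opD(2)[OF oF] opD(2)[OF oG]])
  have sC_eq: "Nul R ?P ?T (star ?C - star ?G \<bullet> star ?F)"
    unfolding GF
  proof (intro allI Null_star_diff opD(1)[OF oGF] opD(2)[OF oGF] opD(1)[OF oC] opD(2)[OF oC])
    fix k show "Null R ?P ?T k (?C - ?G \<bullet> star ?F)" using Null_uminus[OF spec[OF eq]] by simp
  qed
  have comm: "?dN \<bullet> star ?F - star ?F \<bullet> ?dM = sg (star ?F) * (bop N 1 n \<bullet> star ?F - ?F \<bullet> ?dM) * star ?F"
    unfolding coder_comp_star[OF opD(2,3)[OF oF]] star_comp_coder[OF opD(2)[OF oF] opD(2)[OF oM]] by (simp add: algebra_simps)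
  have dF: "Nul R ?P ?Q (?dN \<bullet> star ?F - star ?F \<bullet> ?dM)"
    unfolding comm by (intro allI Null_mult_right[OF sF] Null_mult_left[OF mlin_sg[OF sF]] spec[OF F])
  have id: "?\<tau> \<bullet> star ?C - ?C \<bullet> ?dM = ?\<tau> \<bullet> (star ?C - star ?G \<bullet> star ?F) + (?\<tau> \<bullet> star ?G - ?G \<bullet> ?dN) \<bullet> star ?F
      + ?G \<bullet> (?dN \<bullet> star ?F - star ?F \<bullet> ?dM) + (?G \<bullet> star ?F - ?C) \<bullet> ?dM"
    by (simp add: comp_assoc)
  have "Nul R ?P ?T (?\<tau> \<bullet> star ?C - ?C \<bullet> ?dM)"
    unfolding id
  proof
    fix k
    show "Null R ?P ?T k (?\<tau> \<bullet> (star ?C - star ?G \<bullet> star ?F) + (?\<tau> \<bullet> star ?G - ?G \<bullet> ?dN) \<bullet> star ?F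
      + ?G \<bullet> (?dN \<bullet> star ?F - star ?F \<bullet> ?dM) + (?G \<bullet> star ?F - ?C) \<bullet> ?dM)"
      by (rule Null_add[OF Null_add[OF Null_add[OF Null_comp_left[OF opD(1)[OF oT] spec[OF sC_eq]] spec[OF Nul_comp_right[OF G sF]]]
          Null_comp_left[OF opD(1)[OF oG] spec[OF dF]]] spec[OF Nul_comp_right[OF eq mlin_coder[OF P opD(1)[OF oM]]]]])
  qed
  then have "ainf_morphism R M m T t c" using M T c by (simp add: ainf_morphism_iff)
  moreover have "\<forall>u\<in>tensor_elems R ?P. tensor_eq R ?T (bar_map T c u) (bar_map T g (bar_map N f u))"
    using tensor_eq_rext[OF sC mlin_comp[OF sG sF]] sC_eq by (simp add: bar_map_eq lop_bar_op rext_comp)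
  ultimately show ?thesis using f g by (simp add: ainf_composite_def)
qed

end

section \<open>Unipotent morphisms are isomorphisms\<close>

context cring
begin

lemma star_comp_Nul_ident:
  assumes P: "gmod P" and \<gamma>: "op P P 0 \<gamma>" and \<kappa>: "op P P 0 \<kappa>" and "Nul R P P (\<kappa> \<bullet> star \<gamma> - pr)"
  shows "Nul R P P (star \<kappa> \<bullet> star \<gamma> - ident)"
proof -
  note o = op_comp_star[OF \<kappa> \<gamma>]
  have "Nul R P P (star (\<kappa> \<bullet> star \<gamma>) - star pr)"
    using assms(4) by (intro allI Null_star_diff mlin_pr[OF P] lv_pr opD(1)[OF o] opD(2)[OF o]) blast
  then show ?thesis
    by (simp add: comp_star[OF opD(2)[OF \<gamma>] opD(2)[OF \<kappa>]] ident_eq_star)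
qed

text \<open>If G is the coalgebra map, \<open>right_inverse_exists\<close> gives K with K G = id.
  Its projection is again the identity on letters, so there is L with L K = id; then L = G and K is
  a two-sided inverse. Being inverse to a map that commutes with the differentials, K does so
  too.\<close>

lemma ainf_isomorphismI:
  assumes g: "ainf_morphism R M m M n g" and unip: "Null R (susp M) (susp M) 2 (bop M 0 g - pr)"
  shows "ainf_isomorphism R M m M n g"
proof -
  let ?P = "susp M" and ?\<gamma> = "bop M 0 g" and ?\<beta> = "bop M 1 m" and ?\<delta> = "bop M 1 n"
  have M: "ainf_algebra R M m" "ainf_algebra R M n" using g by (auto simp: ainf_morphism_iff)
  then have gM: "gmod M" by (simp add: ainf_algebra_iff)
  note P = gmod_susp[OF gM]
  have \<gamma>: "op ?P ?P 0 ?\<gamma>" and \<beta>: "op ?P ?P 1 ?\<beta>" and \<delta>: "op ?P ?P 1 ?\<delta>" and fam_g: "fam ?P ?P 0 (bfam M 0 g)"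
    using g M gM graded_maps_bfam[OF gM, of M 0 g] by (auto simp: ainf_morphism_iff ainf_algebra_iff intro: op_bop_cases)
  obtain k where k: "fam ?P ?P 0 k" "Nul R ?P ?P (fop 0 k \<bullet> star ?\<gamma> - pr)" "Null R ?P ?P 2 (fop 0 k - pr)"
    using right_inverse_exists[OF P fam_g unip] .
  obtain h where h: "graded_maps R M M (0 + 1) h" "Nul R ?P ?P (fop 0 k - bop M 0 h)"
    using bop_surj[OF gM gM op_fop[OF k(1) P]] .
  let ?\<kappa> = "bop M 0 h"
  have h1: "graded_maps R M M 1 h" using h(1) by simp
  note \<kappa> = op_bop_cases(2)[OF gM h1]
  have m\<Gamma>: "mlin R ?P ?P (star ?\<gamma>)" and mK: "mlin R ?P ?P (star ?\<kappa>)"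
    using mlin_star opD(1) opD(2) lv_Nil \<gamma> \<kappa> by meson+
  have "Nul R ?P ?P (?\<kappa> \<bullet> star ?\<gamma> - pr)"
  proof
    fix i
    have "?\<kappa> \<bullet> star ?\<gamma> - pr = (fop 0 k \<bullet> star ?\<gamma> - pr) - (fop 0 k - ?\<kappa>) \<bullet> star ?\<gamma>" by simp
    then show "Null R ?P ?P i (?\<kappa> \<bullet> star ?\<gamma> - pr)"
      using Null_diff[OF spec[OF k(2)] spec[OF Nul_comp_right[OF h(2) m\<Gamma>]]] by metis
  qed
  then have K\<Gamma>: "Nul R ?P ?P (star ?\<kappa> \<bullet> star ?\<gamma> - ident)" by (rule star_comp_Nul_ident[OF P \<gamma> \<kappa>])
  have "Null R ?P ?P 2 (?\<kappa> - pr)"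
    using Null_diff[OF k(3) spec[OF h(2)]] by simp
  then obtain l where l: "fam ?P ?P 0 l" "Nul R ?P ?P (fop 0 l \<bullet> star ?\<kappa> - pr)"
    using right_inverse_exists[OF P graded_maps_bfam[OF gM h(1)]] by metis
  note \<Lambda> = op_fop[OF l(1) P]
  let ?\<Lambda> = "star (fop 0 l)"
  have m\<Lambda>: "mlin R ?P ?P ?\<Lambda>" using mlin_star opD(1) opD(2) lv_Nil \<Lambda> by meson
  have \<Lambda>K: "Nul R ?P ?P (?\<Lambda> \<bullet> star ?\<kappa> - ident)" by (rule star_comp_Nul_ident[OF P \<kappa> \<Lambda> l(2)])
  have \<Gamma>K: "Nul R ?P ?P (star ?\<gamma> \<bullet> star ?\<kappa> - ident)"
  proof
    fix i
    \<comment> \<open>The bracket is \<open>star ?\<gamma> - ?\<Lambda>\<close>, written as the two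
      ways of simplifying
      \<open>?\<Lambda> \<bullet> star ?\<kappa> \<bullet> star ?\<gamma>\<close>.\<close>
    have "star ?\<gamma> \<bullet> star ?\<kappa> - ident = (?\<Lambda> \<bullet> (star ?\<kappa> \<bullet> star ?\<gamma> - ident) - (?\<Lambda> \<bullet> star ?\<kappa> - ident) \<bullet> star ?\<gamma>) \<bullet> star ?\<kappa>
        + (?\<Lambda> \<bullet> star ?\<kappa> - ident)"
      by (simp add: comp_assoc)
    moreover have "Nul R ?P ?P (?\<Lambda> \<bullet> (star ?\<kappa> \<bullet> star ?\<gamma> - ident) - (?\<Lambda> \<bullet> star ?\<kappa> - ident) \<bullet> star ?\<gamma>)"
      using Null_diff[OF Null_comp_left[OF m\<Lambda> spec[OF K\<Gamma>]] spec[OF Nul_comp_right[OF \<Lambda>K m\<Gamma>]]] by blast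
    ultimately show "Null R ?P ?P i (star ?\<gamma> \<bullet> star ?\<kappa> - ident)"
      using Null_add[OF spec[OF Nul_comp_right[OF _ mK]] spec[OF \<Lambda>K]] by metis
  qed
  let ?d\<beta> = "coder ?\<beta>" and ?d\<delta> = "coder ?\<delta>"
  have m\<beta>: "mlin R ?P ?P ?d\<beta>" and m\<delta>: "mlin R ?P ?P ?d\<delta>" using mlin_coder[OF P] opD(1) \<beta> \<delta> by blast+
  have g': "Nul R ?P ?P (?\<delta> \<bullet> star ?\<gamma> - ?\<gamma> \<bullet> ?d\<beta>)" using g by (simp add: ainf_morphism_iff)
  have comm: "?d\<delta> \<bullet> star ?\<gamma> - star ?\<gamma> \<bullet> ?d\<beta> = sg (star ?\<gamma>) * (?\<delta> \<bullet> star ?\<gamma> - ?\<gamma> \<bullet> ?d\<beta>) * star ?\<gamma>"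
    unfolding coder_comp_star[OF opD(2,3)[OF \<gamma>]] star_comp_coder[OF opD(2)[OF \<gamma>] opD(2)[OF \<beta>]] by (simp add: algebra_simps)
  have d\<Gamma>: "Nul R ?P ?P (?d\<delta> \<bullet> star ?\<gamma> - star ?\<gamma> \<bullet> ?d\<beta>)"
    unfolding comm by (intro allI Null_mult_right[OF m\<Gamma>] Null_mult_left[OF mlin_sg[OF m\<Gamma>]] spec[OF g'])
  have "Nul R ?P ?P (?d\<beta> \<bullet> star ?\<kappa> - star ?\<kappa> \<bullet> ?d\<delta>)"
  proof
    fix i
    have id: "?d\<beta> \<bullet> star ?\<kappa> - star ?\<kappa> \<bullet> ?d\<delta> = (star ?\<kappa> \<bullet> ?d\<delta>) \<bullet> (star ?\<gamma> \<bullet> star ?\<kappa> - ident)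
        - (star ?\<kappa> \<bullet> star ?\<gamma> - ident) \<bullet> (?d\<beta> \<bullet> star ?\<kappa>) - star ?\<kappa> \<bullet> ((?d\<delta> \<bullet> star ?\<gamma> - star ?\<gamma> \<bullet> ?d\<beta>) \<bullet> star ?\<kappa>)"
      by (simp add: comp_assoc)
    show "Null R ?P ?P i (?d\<beta> \<bullet> star ?\<kappa> - star ?\<kappa> \<bullet> ?d\<delta>)"
      unfolding id
      by (rule Null_diff[OF Null_diff[OF Null_comp_left[OF mlin_comp[OF mK m\<delta>] spec[OF \<Gamma>K]]
          spec[OF Nul_comp_right[OF K\<Gamma> mlin_comp[OF m\<beta> mK]]]] Null_comp_left[OF mK spec[OF Nul_comp_right[OF d\<Gamma> mK]]]])
  qed
  then have "Nul R ?P ?P (pr \<bullet> (?d\<beta> \<bullet> star ?\<kappa> - star ?\<kappa> \<bullet> ?d\<delta>))" using Null_comp_left[OF mlin_pr[OF P]] by blast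
  then have "Nul R ?P ?P (?\<beta> \<bullet> star ?\<kappa> - ?\<kappa> \<bullet> ?d\<delta>)"
    by (simp add: comp_assoc[symmetric] pr_comp_coder[OF opD(2)[OF \<beta>]] pr_comp_star[OF opD(2)[OF \<kappa>]])
  then have "ainf_morphism R M n M m h" using M h1 by (simp add: ainf_morphism_iff)
  moreover have "\<forall>u\<in>tensor_elems R ?P. tensor_eq R ?P (bar_map M h (bar_map M g u)) u"
    using tensor_eq_rext[OF mlin_comp[OF mK m\<Gamma>] mlin_ident[OF gmodD[OF P]]] K\<Gamma>
    by (simp add: bar_map_eq lop_bar_op rext_comp rext_oper_simps)
  moreover have "\<forall>u\<in>tensor_elems R ?P. tensor_eq R ?P (bar_map M g (bar_map M h u)) u"
    using tensor_eq_rext[OF mlin_comp[OF m\<Gamma> mK] mlin_ident[OF gmodD[OF P]]] \<Gamma>K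
    by (simp add: bar_map_eq lop_bar_op rext_comp rext_oper_simps)
  ultimately show ?thesis using g unfolding ainf_isomorphism_def by blast
qed

end

section \<open>Evaluation on short words and truncation\<close>

lemma sum_cuts_Cons: "sum f (cuts (x # w)) = f ([], x # w) + (\<Sum>(u, v)\<in>cuts w. f (x # u, v))"
proof -
  have "cuts (x # w) = insert ([], x # w) ((\<lambda>(u, v). (x # u, v)) ` cuts w)"
  proof (intro equalityI subsetI, goal_cases)
    case (1 p)
    then obtain u v where p: "p = (u, v)" "u @ v = x # w" by (auto simp: cuts_def)
    then show ?case by (cases u) force+
  qed auto
  moreover have "inj_on (\<lambda>(u, v). (x # u, v)) (cuts w)" by (auto simp: inj_on_def)
  moreover have "([], x # w) \<notin> (\<lambda>(u, v). (x # u, v)) ` cuts w" by auto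
  ultimately show ?thesis by (simp add: sum.reindex case_prod_unfold)
qed

lemma app_star_Cons:
  assumes "app \<phi> [] = 0"
  shows "app (star \<phi>) (x # w) = (\<Sum>(u, v)\<in>cuts w. app \<phi> (x # u) * app (star \<phi>) v)"
proof -
  have "app (star \<phi>) (x # w) = app (1 + \<phi> * star \<phi>) (x # w)" using star_unfold[OF assms] by simp
  then show ?thesis using assms by (simp add: app_mult sum_cuts_Cons)
qed

lemma app_coder_Cons:
  assumes "lv \<beta>"
  shows "app (coder \<beta>) (x # w) = (if even (fst x) then frag_of [x] * app (coder \<beta>) w else - (frag_of [x] * app (coder \<beta>) w))
    + (\<Sum>(u, v)\<in>cuts w. app \<beta> (x # u) * frag_of v)"
proof -
  have "coder \<beta> = sg pr * coder \<beta> + \<beta> * ident"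
    using htpy_unfold[OF lv_pr, of \<beta> pr] by (simp add: coder_eq_htpy ident_eq_star)
  then have "app (coder \<beta>) (x # w) = app (sg pr * coder \<beta>) (x # w) + app (\<beta> * ident) (x # w)" by (metis app_simps(3))
  moreover have "app (sg pr * coder \<beta>) (x # w) = app (sg pr) [x] * app (coder \<beta>) w"
    unfolding app_mult sum_cuts_Cons by (subst sum_cuts_first) (auto simp: app_sg app_pr)
  moreover have "app (\<beta> * ident) (x # w) = (\<Sum>(u, v)\<in>cuts w. app \<beta> (x # u) * frag_of v)"
    using assms by (simp add: app_mult sum_cuts_Cons)
  ultimately show ?thesis by (auto simp: app_sg app_pr)
qed

lemma app_coder_Nil: "lv \<beta> \<Longrightarrow> app (coder \<beta>) [] = 0"
  by (simp add: coder_def)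

text \<open>On long words an operation of a dg algebra gives the letter of a zero element, which is
  null but not the zero sum. Truncation makes it vanish exactly, so that arguments by length apply
  and only short words have to be computed.\<close>

definition up_to :: "nat \<Rightarrow> ('x, 'y) oper \<Rightarrow> ('x, 'y) oper" where
  "up_to n a = Op (\<lambda>w. if length w \<le> n then app a w else 0)"

lemma app_up_to: "app (up_to n a) w = (if length w \<le> n then app a w else 0)"
  by (simp add: up_to_def)

lemma lv_up_to: "lv a \<Longrightarrow> lv (up_to n a)"
  by (auto simp: lv_def app_up_to)

lemma mlin_up_to: "mlin R P Q a \<Longrightarrow> mlin R P Q (up_to n a)"
  by (auto simp: mlin_def app_up_to rel_def)

lemma lv_keys_length: "lv a \<Longrightarrow> v \<in> Poly_Mapping.keys (app a w) \<Longrightarrow> length v = 1 \<and> w \<noteq> []"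
  unfolding lv_def by (cases "w = []") (simp, fastforce)

lemma app_comp_vanish:
  assumes "\<And>v. v \<in> Poly_Mapping.keys (app b w) \<Longrightarrow> app a v = 0"
  shows "app (a \<bullet> b) w = 0"
  unfolding app_comp ext_def by (rule frag_extend_eq_0[OF assms])

text \<open>One application merges at most two letters. So a word longer than three keeps a length
  above two, where the truncated operation vanishes.\<close>

lemma coder_up_to_two_length:
  assumes "lv \<beta>" "v \<in> Poly_Mapping.keys (app (coder (up_to 2 \<beta>)) w)"
  shows "length w \<le> length v + 1"
proof -
  have "supp (\<lambda>w v. length w \<le> length v + 1) (sg ident * up_to 2 \<beta>)"
  proof (rule supp_mult)
    show "supp (\<lambda>w v. length w = length v) (sg ident)" by (intro supp_sg) (simp add: supp_def)
    show "supp (\<lambda>w v. length w \<le> 2 \<and> length v = 1) (up_to 2 \<beta>)"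
      using lv_keys_length[OF assms(1)] by (auto simp: supp_def app_up_to)
  qed auto
  then have "supp (\<lambda>w v. length w \<le> length v + 1) (coder (up_to 2 \<beta>))"
    unfolding coder_def by (rule supp_mult[where \<Psi> = "\<lambda>w v. length w = length v"]) (auto simp: supp_def)
  with assms(2) show ?thesis by (auto simp: supp_def)
qed

lemma star_up_to_one_length:
  assumes "lv \<phi>" "v \<in> Poly_Mapping.keys (app (star (up_to 1 \<phi>)) w)"
  shows "length v = length w"
proof -
  have "supp (\<lambda>w v. length v = length w) (star (up_to 1 \<phi>))"
  proof (rule supp_star)
    show "supp (\<lambda>w v. length v = length w) (up_to 1 \<phi>)"
      unfolding supp_def
    proof (intro allI ballI)
      fix w v assume v: "v \<in> Poly_Mapping.keys (app (up_to 1 \<phi>) w)"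
      then have "length w \<le> 1" by (auto simp: app_up_to split: if_splits)
      then show "length v = length w"
        using lv_keys_length[OF lv_up_to[OF assms(1)] v] by (cases w) auto
    qed
  qed (use assms(1) in \<open>auto simp: app_up_to\<close>)
  with assms(2) show ?thesis by (auto simp: supp_def)
qed

lemma (in cring) linear_map_minus:
  assumes "module R N" "module R L" "linear_map R N L f" "x \<in> carrier N"
  shows "f (\<ominus>\<^bsub>N\<^esub> x) = \<ominus>\<^bsub>L\<^esub> f x"
proof -
  interpret N: module R N by fact
  interpret L: module R L by fact
  have "\<ominus>\<^bsub>N\<^esub> x = (\<ominus> \<one>) \<odot>\<^bsub>N\<^esub> x" "(\<ominus> \<one>) \<odot>\<^bsub>L\<^esub> f x = \<ominus>\<^bsub>L\<^esub> f x"
    using assms(4) linear_mapD(1)[OF assms(3,4)] by (simp_all add: N.smult_l_minus L.smult_l_minus)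
  then show ?thesis using linear_mapD(3)[OF assms(3) _ assms(4), of "\<ominus> \<one>"] by simp
qed

section \<open>Differential graded algebras\<close>

locale dga_algebra = cring R for R (structure) +
  fixes A :: "('a, 'n) dga"
  assumes dg_algebra: "dg_algebra R A"
begin

abbreviation "M \<equiv> dg_mod A"
abbreviation "d \<equiv> dg_diff A"
abbreviation "mu \<equiv> dg_mult A"

lemma gM: "gmod M"
  using dg_algebra by (simp add: dg_algebra_def Let_def graded_module_iff)

lemma modM: "module R (M k)"
  by (rule gmodD[OF gM])

lemma d_linear: "linear_map R (M k) (M (k + 1)) (d k)"
  and d_d: "x \<in> carrier (M k) \<Longrightarrow> d (k + 1) (d k x) = \<zero>\<^bsub>M (k + 2)\<^esub>"
  and mu_right: "x \<in> carrier (M k) \<Longrightarrow> linear_map R (M l) (M (k + l)) (\<lambda>y. mu k l x y)"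
  and mu_left: "y \<in> carrier (M l) \<Longrightarrow> linear_map R (M k) (M (k + l)) (\<lambda>x. mu k l x y)"
  and mu_assoc: "x \<in> carrier (M j) \<Longrightarrow> y \<in> carrier (M k) \<Longrightarrow> z \<in> carrier (M l) \<Longrightarrow>
    mu (j + k) l (mu j k x y) z = mu j (k + l) x (mu k l y z)"
  and leibniz: "x \<in> carrier (M k) \<Longrightarrow> y \<in> carrier (M l) \<Longrightarrow> d (k + l) (mu k l x y) =
    mu (k + 1) l (d k x) y \<oplus>\<^bsub>M (k + l + 1)\<^esub> sgn_mod (M (k + l + 1)) k (mu k (l + 1) x (d l y))"
  using dg_algebra unfolding dg_algebra_def Let_def by blast+

lemma mu_closed: "x \<in> carrier (M k) \<Longrightarrow> y \<in> carrier (M l) \<Longrightarrow> mu k l x y \<in> carrier (M (k + l))"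
  using linear_mapD(1)[OF mu_right] .

lemma d_closed: "x \<in> carrier (M k) \<Longrightarrow> d k x \<in> carrier (M (k + 1))"
  using linear_mapD(1)[OF d_linear] .

lemma ops_long: "length w \<ge> 3 \<Longrightarrow> dga_ops A w = \<zero>\<^bsub>M (wdeg w + 2 - int (length w))\<^esub>"
  by (cases "(A, w)" rule: dga_ops.cases) auto

lemma graded_maps_ops: "graded_maps R M M 2 (dga_ops A)"
  unfolding graded_maps_def
proof (intro conjI ballI impI allI)
  fix w assume w: "w \<in> words M" "w \<noteq> []"
  interpret Z: module R "M (wdeg w + 2 - int (length w))" by (rule modM)
  consider k x where "w = [(k, x)]" | k x l y where "w = [(k, x), (l, y)]" | "length w \<ge> 3"
    using w(2) by (cases "(A, w)" rule: dga_ops.cases) (auto simp: numeral_3_eq_3)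
  then show "dga_ops A w \<in> carrier (M (wdeg w + 2 - int (length w)))"
    by cases (use w d_closed[unfolded add.commute[of _ "1 :: int"]] mu_closed in \<open>auto simp: ops_long\<close>)
next
  fix u v k x y assume *: "u \<in> words M" "v \<in> words M" "x \<in> carrier (M k)" "y \<in> carrier (M k)"
  let ?j = "wdeg u + k + wdeg v + 2 - int (length u + 1 + length v)"
  interpret Z: module R "M ?j" by (rule modM)
  consider "u = []" "v = []" | l z where "u = []" "v = [(l, z)]" | l z where "u = [(l, z)]" "v = []" | "length u + length v \<ge> 2"
    by (cases u; cases v; cases "tl u"; cases "tl v") auto
  then show "dga_ops A (u @ [(k, x \<oplus>\<^bsub>M k\<^esub> y)] @ v) =
      dga_ops A (u @ [(k, x)] @ v) \<oplus>\<^bsub>M ?j\<^esub> dga_ops A (u @ [(k, y)] @ v)"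
  proof cases
    case 4
    then show ?thesis using Z.l_zero[OF Z.zero_closed] by (simp add: ops_long algebra_simps)
  qed (use * linear_mapD(2)[OF d_linear] linear_mapD(2)[OF mu_left] linear_mapD(2)[OF mu_right] in \<open>auto simp: algebra_simps\<close>)
next
  fix u v k r x assume *: "u \<in> words M" "v \<in> words M" "r \<in> carrier R" "x \<in> carrier (M k)"
  let ?j = "wdeg u + k + wdeg v + 2 - int (length u + 1 + length v)"
  interpret Z: module R "M ?j" by (rule modM)
  consider "u = []" "v = []" | l z where "u = []" "v = [(l, z)]" | l z where "u = [(l, z)]" "v = []" | "length u + length v \<ge> 2"
    by (cases u; cases v; cases "tl u"; cases "tl v") auto
  then show "dga_ops A (u @ [(k, r \<odot>\<^bsub>M k\<^esub> x)] @ v) = r \<odot>\<^bsub>M ?j\<^esub> dga_ops A (u @ [(k, x)] @ v)"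
  proof cases
    case 4
    then show ?thesis using Z.smult_r_null[OF *(3)] by (simp add: ops_long algebra_simps)
  qed (use * linear_mapD(3)[OF d_linear] linear_mapD(3)[OF mu_left] linear_mapD(3)[OF mu_right] in \<open>auto simp: algebra_simps\<close>)
qed

abbreviation "bA \<equiv> bfam M 1 (dga_ops A)"
abbreviation "\<alpha>A \<equiv> bop M 1 (dga_ops A)"

lemma bA_one: "bA [(k, x)] = d (k + 1) x"
  by (simp add: bfam_def sgn_mod_def)

lemma bA_two: "bA [(k, x), (l, y)] = sgn_mod (M (k + l + 2)) (k + 1) (mu (k + 1) (l + 1) x y)"
  by (simp add: bfam_def susp_def add.assoc)

lemma op_A: "op (susp M) (susp M) 1 \<alpha>A"
  by (rule op_bop_cases(1)[OF gM graded_maps_ops])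

lemma Nul_A_up_to: "Nul R (susp M) (susp M) (\<alpha>A - up_to 2 \<alpha>A)"
proof (rule NulI)
  fix w assume w: "w \<in> words (susp M)"
  show "good (susp M) (app (\<alpha>A - up_to 2 \<alpha>A) w)"
    by (rule mlinD(1)[OF mlin_diff[OF opD(1)[OF op_A] mlin_up_to[OF opD(1)[OF op_A]]] w])
  show "nul R (susp M) (app (\<alpha>A - up_to 2 \<alpha>A) w)"
  proof (cases "length w \<le> 2")
    case False
    interpret Z: module R "M (wdeg w + 2)" by (rule modM)
    have "bA w = \<zero>\<^bsub>susp M (wdeg w + 1)\<^esub>"
      using False ops_long[of "desusp_word w"]
      by (simp add: bfam_def susp_def sgn_mod_def wdeg_desusp_word add.commute[of 2])
    then show ?thesis using False letter_zero[OF gmod_susp[OF gM], of "wdeg w + 1"] by (auto simp: app_up_to app_fop)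
  qed (simp add: app_up_to)
qed

lemma letters_cancel:
  assumes P: "gmod P" and x: "x \<in> carrier (P k)" "y \<in> carrier (P k)" "x \<oplus>\<^bsub>P k\<^esub> y = \<zero>\<^bsub>P k\<^esub>"
  shows "nul R P (frag_of [(k, x)] + frag_of [(k, y)])"
  using nul_diff[OF letter_zero[OF P, of k] letter_add[OF P x(1,2)]] x(3) by (simp add: add.commute)

lemma letter_neg:
  assumes P: "gmod P" and x: "x \<in> carrier (P k)"
  shows "nul R P (frag_of [(k, \<ominus>\<^bsub>P k\<^esub> x)] + frag_of [(k, x)])"
proof -
  interpret Z: module R "P k" by (rule gmodD[OF P])
  show ?thesis using x by (intro letters_cancel P) (simp_all add: Z.l_neg)
qed

lemma mu_minus:
  assumes "x \<in> carrier (M k)" "y \<in> carrier (M l)"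
  shows "mu k l (\<ominus>\<^bsub>M k\<^esub> x) y = \<ominus>\<^bsub>M (k + l)\<^esub> mu k l x y" "mu k l x (\<ominus>\<^bsub>M l\<^esub> y) = \<ominus>\<^bsub>M (k + l)\<^esub> mu k l x y"
  using linear_map_minus[OF modM modM mu_left[OF assms(2)] assms(1)] linear_map_minus[OF modM modM mu_right[OF assms(1)] assms(2)] .

text \<open>On two letters the square is the Leibniz rule. The degrees are written
  \<open>k - 1\<close> and \<open>l - 1\<close> so that the letters lie in \<open>M k\<close> and
  \<open>M l\<close>; the Koszul and suspension signs depend on the parity of \<open>k\<close>,
  whence the case distinction.\<close>

lemma A_square_two:
  assumes x: "x \<in> carrier (M k)" and y: "y \<in> carrier (M l)"
  shows "nul R (susp M) (app (up_to 2 \<alpha>A \<bullet> coder (up_to 2 \<alpha>A)) [(k - 1, x), (l - 1, y)])"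
proof -
  note P = gmod_susp[OF gM]
  let ?m = "mu k l x y" and ?p = "mu (k + 1) l (d k x) y" and ?q = "mu k (l + 1) x (d l y)"
  interpret Z: module R "M (k + l + 1)" by (rule modM)
  have m: "?m \<in> carrier (M (k + l))" and p: "?p \<in> carrier (M (k + l + 1))" and q: "?q \<in> carrier (M (k + l + 1))"
    using mu_closed[OF x y] mu_closed[OF d_closed[OF x] y] mu_closed[OF x d_closed[OF y]] by (simp_all add: ac_simps)
  have b: "bA [(k - 1, x), (l - 1, y)] = sgn_mod (M (k + l)) k ?m"
    "bA [(k, d k x), (l - 1, y)] = sgn_mod (M (k + l + 1)) (k + 1) ?p"
    "bA [(k - 1, x), (l, d l y)] = sgn_mod (M (k + l + 1)) k ?q"
    "bA [(k - 1, x)] = d k x" "bA [(l - 1, y)] = d l y" "bA [(k + l - 1, z)] = d (k + l) z" for z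
    by (simp_all add: bA_one bA_two ac_simps)
  have "app (up_to 2 \<alpha>A \<bullet> coder (up_to 2 \<alpha>A)) [(k - 1, x), (l - 1, y)] =
      (if even k then - frag_of [(k + l, sgn_mod (M (k + l + 1)) k ?q)] else frag_of [(k + l, sgn_mod (M (k + l + 1)) k ?q)])
      + (frag_of [(k + l, sgn_mod (M (k + l + 1)) (k + 1) ?p)] + frag_of [(k + l, d (k + l) (sgn_mod (M (k + l)) k ?m))])"
    using b(6)[of "sgn_mod (M (k + l)) k ?m"]
    by (simp add: app_comp app_coder_Cons app_coder_Nil lv_up_to app_up_to app_fop sum_cuts_Cons frag_of_mult b algebra_simps)
  moreover have "d (k + l) (sgn_mod (M (k + l)) k ?m) = sgn_mod (M (k + l + 1)) k (d (k + l) ?m)"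
    using linear_map_minus[OF modM modM d_linear m] by (simp add: sgn_mod_def)
  moreover have "nul R (susp M) ((if even k then - frag_of [(k + l, sgn_mod (M (k + l + 1)) k ?q)] else frag_of [(k + l, sgn_mod (M (k + l + 1)) k ?q)])
      + (frag_of [(k + l, sgn_mod (M (k + l + 1)) (k + 1) ?p)] + frag_of [(k + l, sgn_mod (M (k + l + 1)) k (d (k + l) ?m))]))"
  proof (cases "even k")
    case True
    have 1: "nul R (susp M) (frag_of [(k + l, ?p \<oplus>\<^bsub>M (k + l + 1)\<^esub> ?q)] - frag_of [(k + l, ?p)] - frag_of [(k + l, ?q)])"
      and 2: "nul R (susp M) (frag_of [(k + l, \<ominus>\<^bsub>M (k + l + 1)\<^esub> ?p)] + frag_of [(k + l, ?p)])"
      using letter_add[OF P, of ?p "k + l" ?q] letter_neg[OF P, of ?p "k + l"] p q by (simp_all add: susp_def)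
    from nul_add[OF 1 2] show ?thesis using True leibniz[OF x y] by (simp add: sgn_mod_def algebra_simps)
  next
    case False
    let ?n = "\<ominus>\<^bsub>M (k + l + 1)\<^esub> ?q"
    have 1: "nul R (susp M) (frag_of [(k + l, \<ominus>\<^bsub>M (k + l + 1)\<^esub> (?p \<oplus>\<^bsub>M (k + l + 1)\<^esub> ?n))] + frag_of [(k + l, ?p \<oplus>\<^bsub>M (k + l + 1)\<^esub> ?n)])"
      and 2: "nul R (susp M) (frag_of [(k + l, ?p \<oplus>\<^bsub>M (k + l + 1)\<^esub> ?n)] - frag_of [(k + l, ?p)] - frag_of [(k + l, ?n)])"
      using letter_add[OF P, of ?p "k + l" ?n] letter_neg[OF P, of "?p \<oplus>\<^bsub>M (k + l + 1)\<^esub> ?n" "k + l"] p q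
      by (simp_all add: susp_def)
    from nul_diff[OF 1 2] show ?thesis using False leibniz[OF x y] by (simp add: sgn_mod_def algebra_simps)
  qed
  ultimately show ?thesis by simp
qed

text \<open>On three letters only the two iterated products contribute. Associativity makes them
  equal up to sign, and the Koszul sign of passing \<open>x\<close>, whose suspended degree is
  \<open>j - 1\<close>, makes the signs opposite.\<close>

lemma A_square_three:
  assumes x: "x \<in> carrier (M j)" and y: "y \<in> carrier (M k)" and z: "z \<in> carrier (M l)"
  shows "nul R (susp M) (app (up_to 2 \<alpha>A \<bullet> coder (up_to 2 \<alpha>A)) [(j - 1, x), (k - 1, y), (l - 1, z)])"
proof -
  note P = gmod_susp[OF gM]
  let ?n = "mu j (k + l) x (mu k l y z)"
  interpret Z: module R "M (j + k + l)" by (rule modM)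
  have xy: "mu j k x y \<in> carrier (M (j + k))" and yz: "mu k l y z \<in> carrier (M (k + l))" using mu_closed x y z by blast+
  have n: "?n \<in> carrier (M (j + k + l))" using mu_closed[OF x yz] by (simp add: ac_simps)
  have b: "bA [(j - 1, x), (k - 1, y)] = sgn_mod (M (j + k)) j (mu j k x y)"
    "bA [(k - 1, y), (l - 1, z)] = sgn_mod (M (k + l)) k (mu k l y z)"
    "bA [(j + k - 1, w), (l - 1, z)] = sgn_mod (M (j + k + l)) (j + k) (mu (j + k) l w z)"
    "bA [(j - 1, x), (k + l - 1, w)] = sgn_mod (M (j + k + l)) j (mu j (k + l) x w)" for w
    by (simp_all add: bA_two ac_simps)
  have 1: "mu (j + k) l (sgn_mod (M (j + k)) j (mu j k x y)) z = sgn_mod (M (j + k + l)) j ?n"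
    using mu_minus(1)[OF xy z] mu_assoc[OF x y z] by (simp add: sgn_mod_def)
  have 2: "mu j (k + l) x (sgn_mod (M (k + l)) k (mu k l y z)) = sgn_mod (M (j + k + l)) k ?n"
    using mu_minus(2)[OF x yz] by (simp add: sgn_mod_def ac_simps)
  have "app (up_to 2 \<alpha>A \<bullet> coder (up_to 2 \<alpha>A)) [(j - 1, x), (k - 1, y), (l - 1, z)] =
      (if even j then - frag_of [(j + k + l - 1, sgn_mod (M (j + k + l)) j (sgn_mod (M (j + k + l)) k ?n))]
       else frag_of [(j + k + l - 1, sgn_mod (M (j + k + l)) j (sgn_mod (M (j + k + l)) k ?n))])
      + frag_of [(j + k + l - 1, sgn_mod (M (j + k + l)) (j + k) (sgn_mod (M (j + k + l)) j ?n))]"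
    using b(3)[of "sgn_mod (M (j + k)) j (mu j k x y)"] b(4)[of "sgn_mod (M (k + l)) k (mu k l y z)"]
    by (simp add: app_comp app_coder_Cons app_coder_Nil lv_up_to app_up_to app_fop sum_cuts_Cons frag_of_mult b(1,2) 1 2 algebra_simps)
  moreover have "nul R (susp M) (frag_of [(j + k + l - 1, \<ominus>\<^bsub>M (j + k + l)\<^esub> ?n)] + frag_of [(j + k + l - 1, ?n)])"
    using letter_neg[OF P, of ?n "j + k + l - 1"] n by (simp add: susp_def)
  moreover from this have "nul R (susp M) (frag_of [(j + k + l - 1, ?n)] + frag_of [(j + k + l - 1, \<ominus>\<^bsub>M (j + k + l)\<^esub> ?n)])"
    by (simp only: add.commute)
  ultimately show ?thesis
    using Z.minus_minus[OF n] by (cases "even j"; cases "even k") (simp_all add: sgn_mod_def)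
qed

lemma A_square_small:
  assumes w: "w \<in> words (susp M)" and len: "length w \<le> 3"
  shows "nul R (susp M) (app (up_to 2 \<alpha>A \<bullet> coder (up_to 2 \<alpha>A)) w)"
proof -
  consider "w = []" | k x where "w = [(k - 1, x)]" | k x l y where "w = [(k - 1, x), (l - 1, y)]"
    | j x k y l z where "w = [(j - 1, x), (k - 1, y), (l - 1, z)]"
  proof -
    have e: "\<exists>k x. p = (k - 1, x)" for p :: "int \<times> 'n" by (metis add_diff_cancel_right' surj_pair)
    show ?thesis
    proof (cases w)
      case (Cons p w1)
      show ?thesis
      proof (cases w1)
        case Nil
        then show ?thesis using Cons e[of p] that(2) by blast
      next
        case (Cons q w2)
        show ?thesis
        proof (cases w2)
          case Nil
          then show ?thesis using Cons \<open>w = p # w1\<close> e[of p] e[of q] that(3) by blast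
        next
          case (Cons r w3)
          then have "w = [p, q, r]" using \<open>w = p # w1\<close> \<open>w1 = q # w2\<close> len by simp
          then show ?thesis using e[of p] e[of q] e[of r] that(4) by blast
        qed
      qed
    qed (rule that(1))
  qed
  then show ?thesis
  proof cases
    case 1
    then show ?thesis by (simp add: app_comp app_coder_Nil lv_up_to)
  next
    case 2
    then have "app (up_to 2 \<alpha>A \<bullet> coder (up_to 2 \<alpha>A)) w = frag_of [(k + 1, d (k + 1) (d k x))]"
      by (simp add: app_comp app_coder_Cons app_coder_Nil lv_up_to app_up_to app_fop bA_one)
    then show ?thesis using 2 w d_d[of x k] letter_zero[OF gmod_susp[OF gM], of "k + 1"] by (simp add: susp_def add.commute[of 2])
  next
    case 3
    then show ?thesis using A_square_two w by (simp add: susp_def)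
  next
    case 4
    then show ?thesis using A_square_three w by (simp add: susp_def)
  qed
qed

text \<open>Replacing the operations by their truncations costs a null operator. For these the
  square is computed on words of length at most three and vanishes by length beyond.\<close>

lemma A_square: "Nul R (susp M) (susp M) (\<alpha>A \<bullet> coder \<alpha>A)"
proof
  fix k
  let ?P = "susp M" and ?b = "up_to 2 \<alpha>A"
  note P = gmod_susp[OF gM]
  have lb: "lv ?b" and mb: "mlin R ?P ?P ?b" using lv_up_to[OF opD(2)[OF op_A]] mlin_up_to[OF opD(1)[OF op_A]] .
  have mdb: "mlin R ?P ?P (coder ?b)" by (rule mlin_coder[OF P mb])
  have "Nul R ?P ?P (?b \<bullet> coder ?b)"
  proof (rule NulI)
    fix w assume w: "w \<in> words ?P"
    show "good ?P (app (?b \<bullet> coder ?b) w)" by (rule mlinD(1)[OF mlin_comp[OF mb mdb] w])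
    show "nul R ?P (app (?b \<bullet> coder ?b) w)"
    proof (cases "length w \<le> 3")
      case False
      then have "app (?b \<bullet> coder ?b) w = 0"
        using coder_up_to_two_length[OF opD(2)[OF op_A]] by (intro app_comp_vanish) (fastforce simp: app_up_to)
      then show ?thesis by simp
    qed (rule A_square_small[OF w])
  qed
  moreover have "coder \<alpha>A - coder ?b = sg ident * (\<alpha>A - ?b) * ident" by (simp add: coder_def algebra_simps)
  then have "Null R ?P ?P k (coder \<alpha>A - coder ?b)"
    using Nul_A_up_to by (simp only:) (intro Null_mult_left Null_mult_right mlin_sg mlin_ident gmodD[OF P]; blast)
  moreover have "\<alpha>A \<bullet> coder \<alpha>A = \<alpha>A \<bullet> (coder \<alpha>A - coder ?b) + (\<alpha>A - ?b) \<bullet> coder ?b + ?b \<bullet> coder ?b" by simp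
  ultimately show "Null R ?P ?P k (\<alpha>A \<bullet> coder \<alpha>A)"
    using Null_add[OF Null_add[OF Null_comp_left[OF opD(1)[OF op_A]] spec[OF Nul_comp_right[OF Nul_A_up_to mdb]]]] by metis
qed

lemma ainf_A: "ainf_algebra R M (dga_ops A)"
  using gM graded_maps_ops A_square by (simp add: ainf_algebra_iff)

end

lemma bfam_one: "bfam N e f [(k, x)] = f [(k + 1, x)]"
  by (simp add: bfam_def sgn_mod_def)

lemma app_star_one:
  assumes "lv \<phi>"
  shows "app (star \<phi>) [z] = app \<phi> [z]"
  using assms by (simp add: app_star_Cons)

lemma app_star_two:
  assumes "lv \<phi>"
  shows "app (star \<phi>) [y, z] = app \<phi> [y] * app \<phi> [z] + app \<phi> [y, z]"
  using assms by (simp add: app_star_Cons sum_cuts_Cons)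

section \<open>The homology algebra of a dg algebra\<close>

context dga_algebra
begin

abbreviation "H \<equiv> dga_homology A"
abbreviation "bd \<equiv> boundaries M d"
abbreviation "cls \<equiv> hclass M d"

lemma cycles_iff: "x \<in> cycles M d k \<longleftrightarrow> x \<in> carrier (M k) \<and> d k x = \<zero>\<^bsub>M (k + 1)\<^esub>"
  by (simp add: cycles_def)

lemma bd_iff: "x \<in> bd k \<longleftrightarrow> (\<exists>y\<in>carrier (M (k - 1)). x = d (k - 1) y)"
  by (auto simp: boundaries_def)

lemma d_linear_pred: "linear_map R (M (k - 1)) (M k) (d (k - 1))"
  using d_linear[of "k - 1"] by simp

lemma bd_subset: "bd k \<subseteq> carrier (M k)"
  using linear_mapD(1)[OF d_linear_pred] by (auto simp: bd_iff)

lemma bd_subgroup: "abelian_subgroup (bd k) (M k)"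
proof -
  interpret Mk: module R "M k" by (rule modM)
  interpret Mk1: module R "M (k - 1)" by (rule modM)
  have "additive_subgroup (bd k) (M k)"
  proof (intro additive_subgroup.intro subgroup.intro)
    show "x \<otimes>\<^bsub>add_monoid (M k)\<^esub> y \<in> bd k" if "x \<in> bd k" "y \<in> bd k" for x y
      using that linear_mapD(2)[OF d_linear_pred, symmetric] by (auto simp: bd_iff intro!: bexI[OF _ Mk1.a_closed])
    show "\<one>\<^bsub>add_monoid (M k)\<^esub> \<in> bd k"
      using linear_map_zero[OF modM modM d_linear_pred] by (auto simp: bd_iff intro!: bexI[OF _ Mk1.zero_closed])
    show "inv\<^bsub>add_monoid (M k)\<^esub> x \<in> bd k" if "x \<in> bd k" for x
      using that linear_map_minus[OF modM modM d_linear_pred]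
      by (auto simp: bd_iff a_inv_def[symmetric] intro!: bexI[OF _ Mk1.a_inv_closed])
  qed (use bd_subset in auto)
  then show ?thesis
    by (intro abelian_subgroupI3 Mk.abelian_group_axioms)
qed

lemma bd_smult: "c \<in> carrier R \<Longrightarrow> x \<in> bd k \<Longrightarrow> c \<odot>\<^bsub>M k\<^esub> x \<in> bd k"
proof -
  interpret Mk1: module R "M (k - 1)" by (rule modM)
  show "c \<in> carrier R \<Longrightarrow> x \<in> bd k \<Longrightarrow> c \<odot>\<^bsub>M k\<^esub> x \<in> bd k"
    using linear_mapD(3)[OF d_linear_pred, symmetric] by (auto simp: bd_iff intro!: bexI[OF _ Mk1.smult_closed])
qed

lemma bd_add: "x \<in> bd k \<Longrightarrow> y \<in> bd k \<Longrightarrow> x \<oplus>\<^bsub>M k\<^esub> y \<in> bd k"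
  by (rule additive_subgroup.a_closed[OF abelian_subgroup.axioms(1)[OF bd_subgroup]])

lemma bd_carrier: "x \<in> bd k \<Longrightarrow> x \<in> carrier (M k)"
  using bd_subset by blast

lemma cls_iff: "z \<in> cls k x \<longleftrightarrow> (\<exists>b\<in>bd k. z = b \<oplus>\<^bsub>M k\<^esub> x)"
  by (auto simp: hclass_def a_r_coset_def')

lemma set_add_iff: "z \<in> X <+>\<^bsub>M k\<^esub> Y \<longleftrightarrow> (\<exists>x\<in>X. \<exists>y\<in>Y. z = x \<oplus>\<^bsub>M k\<^esub> y)"
  by (auto simp: set_add_def')

lemma H_simps: "carrier (H k) = cls k ` cycles M d k" "\<zero>\<^bsub>H k\<^esub> = bd k" "X \<oplus>\<^bsub>H k\<^esub> Y = X <+>\<^bsub>M k\<^esub> Y"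
  "c \<odot>\<^bsub>H k\<^esub> X = bd k <+>\<^bsub>M k\<^esub> (\<lambda>x. c \<odot>\<^bsub>M k\<^esub> x) ` X"
  by (simp_all add: homology_def)

lemma cls_add: "x \<in> carrier (M k) \<Longrightarrow> y \<in> carrier (M k) \<Longrightarrow> cls k (x \<oplus>\<^bsub>M k\<^esub> y) = cls k x \<oplus>\<^bsub>H k\<^esub> cls k y"
  using abelian_subgroup.a_rcos_sum[OF bd_subgroup] by (simp add: H_simps hclass_def)

lemma cls_eq_iff:
  assumes "x \<in> carrier (M k)" "y \<in> carrier (M k)"
  shows "cls k x = cls k y \<longleftrightarrow> (\<exists>b\<in>bd k. x = b \<oplus>\<^bsub>M k\<^esub> y)"
proof
  interpret B: abelian_subgroup "bd k" "M k" by (rule bd_subgroup)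
  show "\<exists>b\<in>bd k. x = b \<oplus>\<^bsub>M k\<^esub> y" if "cls k x = cls k y"
  proof -
    have "x \<in> cls k x" using assms by (auto simp: hclass_def B.a_rcos_self)
    then show ?thesis using that cls_iff by metis
  qed
  show "cls k x = cls k y" if "\<exists>b\<in>bd k. x = b \<oplus>\<^bsub>M k\<^esub> y"
  proof -
    have "x \<in> bd k +>\<^bsub>M k\<^esub> y" using that by (simp add: cls_iff[unfolded hclass_def])
    then show ?thesis unfolding hclass_def using B.a_repr_independence' assms by metis
  qed
qed

lemma cls_smult:
  assumes c: "c \<in> carrier R" and x: "x \<in> carrier (M k)"
  shows "cls k (c \<odot>\<^bsub>M k\<^esub> x) = c \<odot>\<^bsub>H k\<^esub> cls k x"
proof -
  interpret Mk: module R "M k" by (rule modM)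
  have b: "b \<in> carrier (M k)" if "b \<in> bd k" for b using that bd_subset by blast
  show ?thesis
  proof (intro equalityI subsetI)
    fix z assume "z \<in> cls k (c \<odot>\<^bsub>M k\<^esub> x)"
    then obtain b where b1: "b \<in> bd k" "z = b \<oplus>\<^bsub>M k\<^esub> c \<odot>\<^bsub>M k\<^esub> x" by (auto simp: cls_iff)
    have "x \<in> cls k x" unfolding hclass_def by (rule abelian_subgroup.a_rcos_self[OF bd_subgroup x])
    then show "z \<in> c \<odot>\<^bsub>H k\<^esub> cls k x" unfolding H_simps set_add_iff using b1 by blast
  next
    fix z assume "z \<in> c \<odot>\<^bsub>H k\<^esub> cls k x"
    then obtain b b' where b1: "b \<in> bd k" "b' \<in> bd k" "z = b \<oplus>\<^bsub>M k\<^esub> c \<odot>\<^bsub>M k\<^esub> (b' \<oplus>\<^bsub>M k\<^esub> x)"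
      unfolding H_simps set_add_iff by (auto simp: cls_iff)
    then have "z = (b \<oplus>\<^bsub>M k\<^esub> c \<odot>\<^bsub>M k\<^esub> b') \<oplus>\<^bsub>M k\<^esub> c \<odot>\<^bsub>M k\<^esub> x"
      using b c x by (simp add: Mk.smult_r_distr Mk.a_assoc)
    then show "z \<in> cls k (c \<odot>\<^bsub>M k\<^esub> x)"
      using b1 bd_add[OF b1(1) bd_smult[OF c b1(2)]] by (auto simp: cls_iff)
  qed
qed

lemma cls_zero: "cls k \<zero>\<^bsub>M k\<^esub> = bd k"
proof -
  interpret Mk: module R "M k" by (rule modM)
  show ?thesis using bd_carrier by (auto simp: cls_iff)
qed

lemma cls_zero_iff: "x \<in> carrier (M k) \<Longrightarrow> cls k x = \<zero>\<^bsub>H k\<^esub> \<longleftrightarrow> x \<in> bd k"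
proof -
  assume x: "x \<in> carrier (M k)"
  interpret Mk: module R "M k" by (rule modM)
  have "cls k x = cls k \<zero>\<^bsub>M k\<^esub> \<longleftrightarrow> x \<in> bd k"
    unfolding cls_eq_iff[OF x Mk.zero_closed] using bd_carrier by (auto intro!: bexI[of _ x])
  then show ?thesis by (simp add: cls_zero H_simps)
qed

lemma set_add_singleton: "bd k <+>\<^bsub>M k\<^esub> {y} = cls k y"
  by (auto simp: cls_iff set_add_iff)

lemma mu_zero: "x \<in> carrier (M k) \<Longrightarrow> mu k l x \<zero>\<^bsub>M l\<^esub> = \<zero>\<^bsub>M (k + l)\<^esub>"
  "y \<in> carrier (M l) \<Longrightarrow> mu k l \<zero>\<^bsub>M k\<^esub> y = \<zero>\<^bsub>M (k + l)\<^esub>"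
  by (rule linear_map_zero[OF modM modM mu_right], assumption) (rule linear_map_zero[OF modM modM mu_left])

text \<open>Write the boundary as \<open>d c\<close>; since \<open>y\<close> is a cycle, the Leibniz
  rule makes the product of \<open>c\<close> and \<open>y\<close> a primitive.\<close>

lemma mu_bd_left:
  assumes b: "b \<in> bd k" and y: "y \<in> cycles M d l"
  shows "mu k l b y \<in> bd (k + l)"
proof -
  obtain c where c: "c \<in> carrier (M (k - 1))" "b = d (k - 1) c" using b by (auto simp: bd_iff)
  have y': "y \<in> carrier (M l)" "d l y = \<zero>\<^bsub>M (l + 1)\<^esub>" using y by (auto simp: cycles_iff)
  interpret Z: module R "M (k + l)" by (rule modM)
  have m: "mu k l b y \<in> carrier (M (k + l))" by (rule mu_closed[OF bd_carrier[OF b] y'(1)])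
  have "d (k + l - 1) (mu (k - 1) l c y) = mu k l b y \<oplus>\<^bsub>M (k + l)\<^esub> sgn_mod (M (k + l)) (k - 1) \<zero>\<^bsub>M (k + l)\<^esub>"
    using leibniz[OF c(1) y'(1)] mu_zero(1)[OF c(1), of "l + 1"] c(2) y'(2) by (simp add: algebra_simps)
  then have "d (k + l - 1) (mu (k - 1) l c y) = mu k l b y" using m by (simp add: sgn_mod_def)
  moreover have "mu (k - 1) l c y \<in> carrier (M (k + l - 1))" using mu_closed[OF c(1) y'(1)] by (simp add: algebra_simps)
  ultimately show ?thesis unfolding bd_iff by metis
qed

lemma mu_bd_right:
  assumes x: "x \<in> cycles M d k" and b: "b \<in> bd l"
  shows "mu k l x b \<in> bd (k + l)"
proof -
  obtain c where c: "c \<in> carrier (M (l - 1))" "b = d (l - 1) c" using b by (auto simp: bd_iff)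
  have x': "x \<in> carrier (M k)" "d k x = \<zero>\<^bsub>M (k + 1)\<^esub>" using x by (auto simp: cycles_iff)
  interpret Z: module R "M (k + l)" by (rule modM)
  have m: "mu k l x b \<in> carrier (M (k + l))" by (rule mu_closed[OF x'(1) bd_carrier[OF b]])
  have c': "mu k (l - 1) x c \<in> carrier (M (k + l - 1))" using mu_closed[OF x'(1) c(1)] by (simp add: algebra_simps)
  have "d (k + l - 1) (mu k (l - 1) x c) = \<zero>\<^bsub>M (k + l)\<^esub> \<oplus>\<^bsub>M (k + l)\<^esub> sgn_mod (M (k + l)) k (mu k l x b)"
    using leibniz[OF x'(1) c(1)] mu_zero(2)[OF c(1), of "k + 1"] c(2) x'(2) by (simp add: algebra_simps)
  then have "d (k + l - 1) (mu k (l - 1) x c) = sgn_mod (M (k + l)) k (mu k l x b)" using m by (simp add: sgn_mod_def)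
  then have "sgn_mod (M (k + l)) k (mu k l x b) \<in> bd (k + l)" using c' unfolding bd_iff by metis
  moreover have "\<ominus>\<^bsub>M (k + l)\<^esub> z \<in> bd (k + l)" if "z \<in> bd (k + l)" for z
    using additive_subgroup.a_inv_closed[OF abelian_subgroup.axioms(1)[OF bd_subgroup]] that modM
    by (simp add: module.axioms)
  ultimately show ?thesis using m Z.minus_minus[OF m] by (metis sgn_mod_def)
qed

text \<open>The definition multiplies cosets as sets. The result is a single coset because the
  product of a boundary and a cycle, in either order, is a boundary.\<close>

lemma homology_mult_cls:
  assumes x: "x \<in> cycles M d k" and y: "y \<in> cycles M d l"
  shows "homology_mult A k l (cls k x) (cls l y) = cls (k + l) (mu k l x y)"
proof -
  interpret Mk: module R "M k" by (rule modM)
  interpret Ml: module R "M l" by (rule modM)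
  interpret Z: module R "M (k + l)" by (rule modM)
  have x': "x \<in> carrier (M k)" and y': "y \<in> carrier (M l)" using x y by (auto simp: cycles_iff)
  have mu_cls: "mu k l x1 y1 \<in> cls (k + l) (mu k l x y)" if xy: "x1 \<in> cls k x" "y1 \<in> cls l y" for x1 y1
  proof -
    obtain b c where b: "b \<in> bd k" "x1 = b \<oplus>\<^bsub>M k\<^esub> x" and c: "c \<in> bd l" "y1 = c \<oplus>\<^bsub>M l\<^esub> y"
      using xy unfolding cls_iff by blast
    \<comment> \<open>The boundary \<open>b\<close> is multiplied by the varied representative
      \<open>y1\<close>, so \<open>y1\<close> has to be a cycle as well.\<close>
    have bd_cyc: "d l c = \<zero>\<^bsub>M (l + 1)\<^esub>" using c(1) d_d[of _ "l - 1"] by (auto simp: bd_iff algebra_simps)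
    have y1: "y1 \<in> cycles M d l"
      using y bd_carrier[OF c(1)] bd_cyc linear_mapD(2)[OF d_linear bd_carrier[OF c(1)] y'] modM[of "l + 1"]
      by (simp add: cycles_iff c(2) module_def abelian_group_def abelian_monoid.l_zero abelian_monoid.zero_closed)
    then have y1': "y1 \<in> carrier (M l)" by (simp add: cycles_iff)
    note bc = bd_carrier[OF b(1)] and cc = bd_carrier[OF c(1)]
    have "mu k l x1 y1 = mu k l b y1 \<oplus>\<^bsub>M (k + l)\<^esub> (mu k l x c \<oplus>\<^bsub>M (k + l)\<^esub> mu k l x y)"
      using linear_mapD(2)[OF mu_left[OF y1'] bc x'] linear_mapD(2)[OF mu_right[OF x'] cc y'] b(2) c(2) by simp
    also have "\<dots> = (mu k l b y1 \<oplus>\<^bsub>M (k + l)\<^esub> mu k l x c) \<oplus>\<^bsub>M (k + l)\<^esub> mu k l x y"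
      using mu_closed[OF bc y1'] mu_closed[OF x' cc] mu_closed[OF x' y'] by (simp add: Z.a_assoc)
    finally show ?thesis
      using bd_add[OF mu_bd_left[OF b(1) y1] mu_bd_right[OF x c(1)]] by (auto simp: cls_iff)
  qed
  then have 1: "z \<in> cls (k + l) (mu k l x y)" if zin: "z \<in> homology_mult A k l (cls k x) (cls l y)" for z
  proof -
    obtain b x1 y1 where z: "b \<in> bd (k + l)" "x1 \<in> cls k x" "y1 \<in> cls l y" "z = b \<oplus>\<^bsub>M (k + l)\<^esub> mu k l x1 y1"
      using zin by (auto simp: homology_mult_def set_add_iff)
    then obtain c where c: "c \<in> bd (k + l)" "mu k l x1 y1 = c \<oplus>\<^bsub>M (k + l)\<^esub> mu k l x y"
      using mu_cls[OF z(2,3)] by (auto simp: cls_iff)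
    have "z = (b \<oplus>\<^bsub>M (k + l)\<^esub> c) \<oplus>\<^bsub>M (k + l)\<^esub> mu k l x y"
      using z(4) c(2) bd_carrier[OF z(1)] bd_carrier[OF c(1)] mu_closed[OF x' y'] by (simp add: Z.a_assoc)
    then show ?thesis using bd_add[OF z(1) c(1)] by (auto simp: cls_iff)
  qed
  have "x \<in> cls k x" "y \<in> cls l y"
    unfolding hclass_def using abelian_subgroup.a_rcos_self[OF bd_subgroup] x' y' by blast+
  then have "z \<in> homology_mult A k l (cls k x) (cls l y)" if "z \<in> cls (k + l) (mu k l x y)" for z
    using that by (force simp: homology_mult_def set_add_iff cls_iff)
  with 1 show ?thesis by blast
qed

end

section \<open>Minimal models of a dg algebra with free homology\<close>

locale dga_free = dga_algebra +
  assumes free: "\<And>k. free_module R (dga_homology A k)"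

text \<open>Suspension shifts degrees by one, whence the class map in degree \<open>k + 1\<close>.
  On a single letter the suspension sign is trivial, so the first component of the structure is the
  differential itself.\<close>

sublocale dga_free \<subseteq> hcomplex R "susp M" bA "susp H" "\<lambda>k. cls (k + 1)"
proof unfold_locales
  show "gmod (susp M)" by (rule gmod_susp[OF gM])
  show "free_module R (susp H k)" for k unfolding susp_def by (rule free)
  show "fam (susp M) (susp M) 1 bA" using graded_maps_bfam[OF gM, of M 1] graded_maps_ops by simp
  show "Nul R (susp M) (susp M) (\<alpha>A \<bullet> coder \<alpha>A)" by (rule A_square)
  fix k
  have cyc: "z \<in> carrier (susp M k) \<and> bA [(k, z)] = \<zero>\<^bsub>susp M (k + 1)\<^esub> \<longleftrightarrow> z \<in> cycles M d (k + 1)" for z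
    by (simp add: bA_one susp_def cycles_iff)
  show "cls (k + 1) z \<in> carrier (susp H k)" if "z \<in> carrier (susp M k)" "bA [(k, z)] = \<zero>\<^bsub>susp M (k + 1)\<^esub>" for z
    using that cyc[of z] by (auto simp: susp_def H_simps)
  show "cls (k + 1) (y \<oplus>\<^bsub>susp M k\<^esub> z) = cls (k + 1) y \<oplus>\<^bsub>susp H k\<^esub> cls (k + 1) z"
    if "y \<in> carrier (susp M k)" "z \<in> carrier (susp M k)" for y z
    using that cls_add by (simp add: susp_def)
  show "cls (k + 1) (c \<odot>\<^bsub>susp M k\<^esub> z) = c \<odot>\<^bsub>susp H k\<^esub> cls (k + 1) z" if "c \<in> carrier R" "z \<in> carrier (susp M k)" for c z
    using that cls_smult by (simp add: susp_def)
  show "cls (k + 1) z = \<zero>\<^bsub>susp H k\<^esub> \<longleftrightarrow> (\<exists>y\<in>carrier (susp M (k - 1)). z = bA [(k - 1, y)])" if "z \<in> carrier (susp M k)" for z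
    using that cls_zero_iff[of z "k + 1"] by (simp add: susp_def bd_iff bA_one)
  show "\<exists>z\<in>carrier (susp M k). bA [(k, z)] = \<zero>\<^bsub>susp M (k + 1)\<^esub> \<and> cls (k + 1) z = x" if "x \<in> carrier (susp H k)" for x
  proof -
    obtain z where "z \<in> cycles M d (k + 1)" "x = cls (k + 1) z" using \<open>x \<in> carrier (susp H k)\<close> by (auto simp: susp_def H_simps)
    then show ?thesis using cyc[of z] by blast
  qed
qed

context dga_free
begin

lemma gH: "gmod H"
  using free by (simp add: gmod_def free_module_def)

lemma cycle_iff: "cycle k z \<longleftrightarrow> z \<in> cycles M d (k + 1)"
  by (simp add: cycle_def bA_one susp_def cycles_iff)

lemma representing_iff:
  assumes "graded_maps R H M 1 f"
  shows "representing (bfam M 0 f) \<longleftrightarrow>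
    (\<forall>k. \<forall>X\<in>carrier (H k). f [(k, X)] \<in> cycles M d k \<and> cls k (f [(k, X)]) = X)"
proof -
  have "fam (susp H) (susp M) 0 (bfam M 0 f)" using graded_maps_bfam[OF gM, of H 0 f] assms by simp
  then have "representing (bfam M 0 f) \<longleftrightarrow> (\<forall>k. \<forall>X\<in>carrier (susp H k). f [(k + 1, X)] \<in> cycles M d (k + 1) \<and> cls (k + 1) (f [(k + 1, X)]) = X)"
    by (simp add: representing_def cycle_iff bfam_one)
  also have "\<dots> \<longleftrightarrow> (\<forall>k. \<forall>X\<in>carrier (H k). f [(k, X)] \<in> cycles M d k \<and> cls k (f [(k, X)]) = X)"
    unfolding susp_def by (metis diff_add_cancel)
  finally show ?thesis .
qed

lemma minimal_iff:
  assumes "graded_maps R H H 2 m"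
  shows "Null R (susp H) (susp H) 2 (bop H 1 m) \<longleftrightarrow> (\<forall>k. \<forall>X\<in>carrier (H k). m [(k, X)] = \<zero>\<^bsub>H (k + 1)\<^esub>)"
proof -
  have fam: "fam (susp H) (susp H) 1 (bfam H 1 m)" using graded_maps_bfam[OF gH, of H 1 m] assms by simp
  have "Null R (susp H) (susp H) 2 (bop H 1 m) \<longleftrightarrow> (\<forall>k. \<forall>X\<in>carrier (susp H k). bfam H 1 m [(k, X)] = \<zero>\<^bsub>susp H (k + 1)\<^esub>)"
    unfolding Null_fop_iff[OF gmod_susp[OF gH] fam]
  proof (intro iffI allI ballI impI)
    fix w assume *: "\<forall>k. \<forall>X\<in>carrier (susp H k). bfam H 1 m [(k, X)] = \<zero>\<^bsub>susp H (k + 1)\<^esub>"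
      and w: "w \<in> words (susp H)" "w \<noteq> []" "length w < 2"
    then obtain k X where "w = [(k, X)]" by (cases w) auto
    then show "bfam H 1 m w = \<zero>\<^bsub>susp H (wdeg w + 1)\<^esub>" using * w by simp
  next
    fix k X assume "\<forall>w\<in>words (susp H). w \<noteq> [] \<longrightarrow> length w < 2 \<longrightarrow> bfam H 1 m w = \<zero>\<^bsub>susp H (wdeg w + 1)\<^esub>"
      and "X \<in> carrier (susp H k)"
    then show "bfam H 1 m [(k, X)] = \<zero>\<^bsub>susp H (k + 1)\<^esub>" by (auto dest: bspec[of _ _ "[(k, X)]"])
  qed
  also have "\<dots> \<longleftrightarrow> (\<forall>k. \<forall>X\<in>carrier (H k). m [(k, X)] = \<zero>\<^bsub>H (k + 1)\<^esub>)"
    unfolding bfam_one susp_def by (metis diff_add_cancel)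
  finally show ?thesis .
qed

text \<open>With \<open>m\<^sub>1 = 0\<close> the only boundary is zero, so classes are singletons.
  This makes explicit the identification of \<open>H\<close> with its own homology in the definition
  of \<open>minimal_model\<close>.\<close>

lemma homology_of_minimal:
  assumes "\<forall>k. \<forall>X\<in>carrier (H k). m [(k, X)] = \<zero>\<^bsub>H (k + 1)\<^esub>" and X: "X \<in> carrier (H k)"
  shows "hclass H (arity_one m) k X = {X}"
proof -
  interpret Hk: module R "H k" by (rule gmodD[OF gH])
  interpret Hk1: module R "H (k - 1)" by (rule gmodD[OF gH])
  have "boundaries H (arity_one m) k = {\<zero>\<^bsub>H k\<^esub>}"
    using assms(1) Hk1.zero_closed by (force simp: boundaries_def arity_one_def)
  then show ?thesis using X by (simp add: hclass_def a_r_coset_def')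
qed

lemma carrier_homology_of_minimal:
  assumes "\<forall>k. \<forall>X\<in>carrier (H k). m [(k, X)] = \<zero>\<^bsub>H (k + 1)\<^esub>"
  shows "carrier (homology H (arity_one m) k) = (\<lambda>X. {X}) ` carrier (H k)"
proof -
  have "cycles H (arity_one m) k = carrier (H k)" using assms by (auto simp: cycles_def arity_one_def)
  then show ?thesis using homology_of_minimal[OF assms] by (auto simp: homology_def)
qed

lemma induced_map_singleton: "induced_map M d (arity_one f) k {X} = cls k (f [(k, X)])"
  by (simp add: induced_map_def arity_one_def set_add_singleton)

lemma arity_one_ops: "arity_one (dga_ops A) = d"
  by (simp add: arity_one_def fun_eq_iff)

lemma minimal_modelD:
  assumes mm: "minimal_model R A m f"
  shows "ainf_morphism R H m M (dga_ops A) f" "Null R (susp H) (susp H) 2 (bop H 1 m)" "representing (bfam M 0 f)"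
    "graded_maps R H H 2 m" "graded_maps R H M 1 f"
proof -
  let ?\<beta> = "bop H 1 m" and ?\<phi> = "bop M 0 f"
  show mor: "ainf_morphism R H m M (dga_ops A) f"
    using mm by (simp add: minimal_model_def ainf_weak_equivalence_def)
  then show m: "graded_maps R H H 2 m" and f: "graded_maps R H M 1 f" by (auto simp: ainf_morphism_iff ainf_algebra_iff)
  have m1: "\<forall>k. \<forall>X\<in>carrier (H k). m [(k, X)] = \<zero>\<^bsub>H (k + 1)\<^esub>" using mm by (simp add: minimal_model_def minimal_ainf_algebra_def)
  then show N2: "Null R (susp H) (susp H) 2 ?\<beta>" using minimal_iff[OF m] by simp
  have \<phi>: "op (susp H) (susp M) 0 ?\<phi>" and \<beta>: "op (susp H) (susp H) 1 ?\<beta>"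
    using op_bop_cases gM gH m f by blast+
  \<comment> \<open>On letters this side of the morphism equation vanishes by minimality, so there
    the equation says that \<open>f\<close> takes cycles as values.\<close>
  have "Null R (susp H) (susp M) (Suc 1) (?\<phi> \<bullet> coder ?\<beta>)"
    by (rule Null_comp_coder_op[OF gmod_susp[OF gH] opD(1)[OF \<phi>] Null_lv[OF opD(1,2)[OF \<phi>]] \<beta> N2])
  moreover have "Nul R (susp H) (susp M) (\<alpha>A \<bullet> star ?\<phi> - ?\<phi> \<bullet> coder ?\<beta>)" using mor by (simp add: ainf_morphism_iff)
  ultimately have \<alpha>F: "Null R (susp H) (susp M) (Suc 1) (\<alpha>A \<bullet> star ?\<phi>)" using Null_cancel by blast
  have "f [(k, X)] \<in> cycles M d k" if X: "X \<in> carrier (H k)" for k X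
  proof -
    have fX: "f [(k, X)] \<in> carrier (M k)" using graded_mapsD(1)[OF f, of "[(k, X)]"] X by simp
    have "nul R (susp M) (app (\<alpha>A \<bullet> star ?\<phi>) [(k - 1, X)])"
      using NullD(2)[OF \<alpha>F, of "[(k - 1, X)]"] X by (simp add: susp_def)
    then have "nul R (susp M) (frag_of [(k, d k (f [(k, X)]))])"
      by (simp add: app_comp app_star_one app_fop bfam_one bA_one)
    then show ?thesis
      using letter_nul[OF gmod_susp[OF gM], of "d k (f [(k, X)])" k] fX d_closed[OF fX] by (simp add: susp_def cycles_iff)
  qed
  moreover have "cls k (f [(k, X)]) = X" if X: "X \<in> carrier (H k)" for k X
  proof -
    have "induced_map M d (arity_one f) k (hclass H (arity_one m) k X) = X" using mm X by (simp add: minimal_model_def)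
    then show ?thesis unfolding homology_of_minimal[OF m1 X] induced_map_singleton .
  qed
  ultimately show "representing (bfam M 0 f)" by (simp add: representing_iff[OF f])
qed

text \<open>That \<open>m\<^sub>2\<close> is the product of homology comes from the morphism
  equation on words of length two: up to signs, the product of representing cycles differs from
  \<open>f\<^sub>1\<close> of the binary operation by the differential of \<open>f\<^sub>2\<close>,
  and it remains to take classes.\<close>

lemma minimal_modelI:
  assumes mor: "ainf_morphism R H m M (dga_ops A) f" and N2: "Null R (susp H) (susp H) 2 (bop H 1 m)"
    and rep: "representing (bfam M 0 f)"
  shows "minimal_model R A m f"
proof -
  let ?\<beta> = "bop H 1 m" and ?\<phi> = "bop M 0 f" and ?P = "susp H" and ?Q = "susp M"
  have m: "graded_maps R H H 2 m" and f: "graded_maps R H M 1 f" and alg: "ainf_algebra R H m"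
    using mor by (auto simp: ainf_morphism_iff ainf_algebra_iff)
  have m1: "\<forall>k. \<forall>X\<in>carrier (H k). m [(k, X)] = \<zero>\<^bsub>H (k + 1)\<^esub>" using minimal_iff[OF m] N2 by simp
  have f_rep: "f [(k, X)] \<in> cycles M d k" "cls k (f [(k, X)]) = X" if "X \<in> carrier (H k)" for k X
    using rep that by (simp_all add: representing_iff[OF f])
  have \<phi>: "op ?P ?Q 0 ?\<phi>" and \<beta>: "op ?P ?P 1 ?\<beta>"
    using op_bop_cases gM gH m f by blast+
  have eq: "Nul R ?P ?Q (\<alpha>A \<bullet> star ?\<phi> - ?\<phi> \<bullet> coder ?\<beta>)" using mor by (simp add: ainf_morphism_iff)
  \<comment> \<open>As \<open>?\<beta>\<close> has order 2, the coderivation differs from it only in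
    order 3, so on two letters \<open>?\<beta>\<close> may stand for it.\<close>
  have "Null R ?P ?P (Suc 2) (coder ?\<beta> - ?\<beta>)"
    using Null_coder_diff_leading[OF gmod_susp[OF gH], of 2 ?\<beta> 0] N2 by (simp add: coder_def)
  then have "Null R ?P ?Q (Suc 2) (\<alpha>A \<bullet> star ?\<phi> - ?\<phi> \<bullet> ?\<beta>)"
    using Null_add[OF spec[OF eq] Null_comp_left[OF opD(1)[OF \<phi>]]] by fastforce
  then have two: "nul R ?Q (app (\<alpha>A \<bullet> star ?\<phi> - ?\<phi> \<bullet> ?\<beta>) w)" if "w \<in> words ?P" "length w = 2" for w
    using NullD(2) that by fastforce
  have mult: "m [(k, X), (l, Y)] = homology_mult A k l X Y" if X: "X \<in> carrier (H k)" and Y: "Y \<in> carrier (H l)" for k l X Y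
  proof -
    let ?x = "f [(k, X)]" and ?y = "f [(l, Y)]" and ?s = "f [(k, X), (l, Y)]" and ?p = "m [(k, X), (l, Y)]" and ?n = "k + l"
    interpret Z: module R "M ?n" by (rule modM)
    interpret HZ: module R "H ?n" by (rule gmodD[OF gH])
    have x: "?x \<in> cycles M d k" "?x \<in> carrier (M k)" "cls k ?x = X" and y: "?y \<in> cycles M d l" "?y \<in> carrier (M l)" "cls l ?y = Y"
      using f_rep[OF X] f_rep[OF Y] by (auto simp: cycles_iff)
    have s: "?s \<in> carrier (M (?n - 1))" using graded_mapsD(1)[OF f, of "[(k, X), (l, Y)]"] X Y by (simp add: algebra_simps)
    have p: "?p \<in> carrier (H ?n)" using graded_mapsD(1)[OF m, of "[(k, X), (l, Y)]"] X Y by simp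
    have cyc: "mu k l ?x ?y \<in> cycles M d ?n"
    proof -
      interpret Z1: module R "M (1 + ?n)" by (rule modM)
      show ?thesis
        using leibniz[OF x(2) y(2)] x y mu_closed[OF x(2) y(2)] mu_zero(1)[OF x(2), of "l + 1"] mu_zero(2)[OF y(2), of "k + 1"]
        by (simp add: cycles_iff sgn_mod_def algebra_simps)
    qed
    \<comment> \<open>For a word of two letters the suspension exponent is the degree
      \<open>k\<close> of the first, so all three values carry the same sign, which is removed at
      the end.\<close>
    let ?e = "sgn_mod (H ?n) k ?p" and ?u = "sgn_mod (M ?n) k (mu k l ?x ?y)" and ?t = "sgn_mod (M (?n - 1)) k ?s"
    have e: "?e \<in> carrier (H ?n)" by (rule sgn_mod_simps(1)[OF gmodD[OF gH] p])
    have u: "?u \<in> carrier (M ?n)" by (rule sgn_mod_simps(1)[OF modM mu_closed[OF x(2) y(2)]])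
    have t: "?t \<in> carrier (M (?n - 1))" by (rule sgn_mod_simps(1)[OF modM s])
    have dt: "d (?n - 1) ?t \<in> bd ?n" using t by (auto simp: bd_iff)
    have b: "bfam H 1 m [(k - 1, X), (l - 1, Y)] = ?e" "bfam M 0 f [(k - 1, X), (l - 1, Y)] = ?t"
      "bA [(k - 1, ?x), (l - 1, ?y)] = ?u"
      by (simp_all add: bfam_def susp_def algebra_simps)
    have "nul R ?Q (app (\<alpha>A \<bullet> star ?\<phi> - ?\<phi> \<bullet> ?\<beta>) [(k - 1, X), (l - 1, Y)])"
      by (rule two) (use X Y in \<open>simp_all add: susp_def\<close>)
    moreover have "app (\<alpha>A \<bullet> star ?\<phi>) [(k - 1, X), (l - 1, Y)] = frag_of [(?n - 1, ?u)] + frag_of [(?n - 1, d (?n - 1) ?t)]"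
      by (simp add: app_comp app_star_two app_fop frag_of_mult bfam_one b bA_one algebra_simps)
    moreover have "app (?\<phi> \<bullet> ?\<beta>) [(k - 1, X), (l - 1, Y)] = frag_of [(?n - 1, f [(?n, ?e)])]"
      by (simp add: app_comp app_fop bfam_one b algebra_simps)
    ultimately have "nul R ?Q (frag_of [(?n - 1, ?u)] + frag_of [(?n - 1, d (?n - 1) ?t)] - frag_of [(?n - 1, f [(?n, ?e)])])"
      by simp
    from nul_add[OF letter_add[OF gmod_susp[OF gM], of ?u "?n - 1" "d (?n - 1) ?t"] this]
    have "nul R ?Q (frag_of [(?n - 1, ?u \<oplus>\<^bsub>M ?n\<^esub> d (?n - 1) ?t)] - frag_of [(?n - 1, f [(?n, ?e)])])"
      using u bd_carrier[OF dt] by (simp add: susp_def algebra_simps)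
    then have "?u \<oplus>\<^bsub>M ?n\<^esub> d (?n - 1) ?t = f [(?n, ?e)]"
      by (rule letter_eq[OF gmod_susp[OF gM], rotated 2]) (use u bd_carrier[OF dt] f_rep[OF e] in \<open>simp_all add: susp_def cycles_iff\<close>)
    moreover have "cls ?n (?u \<oplus>\<^bsub>M ?n\<^esub> d (?n - 1) ?t) = cls ?n ?u"
      unfolding cls_eq_iff[OF Z.a_closed[OF u bd_carrier[OF dt]] u] using dt Z.a_comm[OF u bd_carrier[OF dt]] by blast
    ultimately have "cls ?n ?u = cls ?n (f [(?n, ?e)])" by simp
    then have "cls ?n ?u = ?e" using f_rep(2)[OF e] by simp
    moreover have "cls ?n ?u = sgn_mod (H ?n) k (cls ?n (mu k l ?x ?y))"
    proof -
      have "cls ?n (\<ominus>\<^bsub>M ?n\<^esub> z) = \<ominus>\<^bsub>H ?n\<^esub> cls ?n z" if z: "z \<in> cycles M d ?n" for z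
      proof -
        have z': "z \<in> carrier (M ?n)" and cz: "cls ?n z \<in> carrier (H ?n)" using z by (auto simp: cycles_iff H_simps)
        have "cls ?n (\<ominus>\<^bsub>M ?n\<^esub> z) = cls ?n ((\<ominus> \<one>) \<odot>\<^bsub>M ?n\<^esub> z)" using z' by (simp add: Z.smult_l_minus)
        also have "\<dots> = (\<ominus> \<one>) \<odot>\<^bsub>H ?n\<^esub> cls ?n z" using cls_smult[OF _ z', of "\<ominus> \<one>"] by simp
        finally show ?thesis using cz by (simp add: HZ.smult_l_minus)
      qed
      then show ?thesis using cyc by (simp add: sgn_mod_def)
    qed
    moreover have "cls ?n (mu k l ?x ?y) = homology_mult A k l X Y"
      using homology_mult_cls[OF x(1) y(1)] x(3) y(3) by simp
    ultimately have "sgn_mod (H ?n) k (homology_mult A k l X Y) = ?e" by simp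
    moreover have "homology_mult A k l X Y \<in> carrier (H ?n)"
      using cyc homology_mult_cls[OF x(1) y(1)] x(3) y(3) by (auto simp: H_simps)
    ultimately show ?thesis using sgn_mod_simps(2)[OF gmodD[OF gH]] p by metis
  qed
  have ind: "induced_map M d (arity_one f) k (hclass H (arity_one m) k X) = X" if "X \<in> carrier (H k)" for k X
    using homology_of_minimal[OF m1 that] f_rep(2)[OF that] by (simp add: induced_map_singleton)
  \<comment> \<open>Classes of the source are singletons, and the induced map sends the singleton of
    \<open>X\<close> to \<open>X\<close>.\<close>
  have "bij_betw (induced_map M d (arity_one f) k) (carrier (homology H (arity_one m) k)) (carrier (homology M d k))" for k
    unfolding carrier_homology_of_minimal[OF m1]
    by (rule bij_betw_byWitness[where f' = "\<lambda>X. {X}"]) (use f_rep in \<open>auto simp: induced_map_singleton\<close>)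
  then have "ainf_weak_equivalence R H m M (dga_ops A) f"
    using mor by (simp add: ainf_weak_equivalence_def arity_one_ops)
  then show ?thesis
    using alg m1 mult ind by (simp add: minimal_model_def minimal_ainf_algebra_def)
qed

theorem minimal_model_exists: "\<exists>m f. minimal_model R A m f"
proof -
  let ?P = "susp H" and ?Q = "susp M"
  obtain b f0 where b: "fam ?P ?P 1 b" "Null R ?P ?P 2 (fop 1 b)" "representing f0"
    "Nul R ?P ?Q (\<alpha>A \<bullet> star (fop 0 f0) - fop 0 f0 \<bullet> coder (fop 1 b))" "Nul R ?P ?P (fop 1 b \<bullet> coder (fop 1 b))"
    by (rule model_exists)
  have f0: "fam ?P ?Q 0 f0" using b(3) by (simp add: representing_def)
  note o = op_fop[OF b(1) gmod_susp[OF gH]] op_fop[OF f0 gmod_susp[OF gM]]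
  obtain m where m: "graded_maps R H H (1 + 1) m" "Nul R ?P ?P (fop 1 b - bop H 1 m)" using bop_surj[OF gH gH o(1)] .
  obtain f where f: "graded_maps R H M (0 + 1) f" "Nul R ?P ?Q (fop 0 f0 - bop M 0 f)" using bop_surj[OF gH gM o(2)] .
  have m2: "graded_maps R H H 2 m" and f1: "graded_maps R H M 1 f" using m f by simp_all
  have o': "op ?P ?P 1 (bop H 1 m)" "op ?P ?Q 0 (bop M 0 f)" using op_bop_cases gM gH m2 f1 by blast+
  have dm: "Nul R ?P ?P (bop H 1 m - fop 1 b)" using Null_uminus[OF spec[OF m(2)]] by simp
  have df: "Nul R ?P ?Q (bop M 0 f - fop 0 f0)" using Null_uminus[OF spec[OF f(2)]] by simp
  have N2: "Null R ?P ?P 2 (bop H 1 m)" using Null_cancel[OF spec[OF dm] b(2)] .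
  have rep: "representing (bfam M 0 f)"
    using representing_change[OF b(3) _ spec[OF df]] graded_maps_bfam[OF gM f(1)] by blast
  \<comment> \<open>The graded maps agree with the families found above only modulo relations, so
    the equations are transferred by the change lemmas.\<close>
  have "Null R ?P ?Q k (defect (bop H 1 m) (bop M 0 f))" for k
    by (rule Null_cancel[OF defect_change(2)[OF o(1) b(2) o'(1) N2 o(2) o'(2) spec[OF dm] spec[OF df]]])
      (use b(4) in \<open>simp add: defect_def\<close>)
  moreover have "Null R ?P ?P k (bop H 1 m \<bullet> coder (bop H 1 m))" for k
    by (rule Null_mono[OF Null_cancel[OF square_change[OF gmod_susp[OF gH] o(1) b(2) o'(1) N2 spec[OF dm, of k]] spec[OF b(5)]]]) simp
  ultimately have "ainf_morphism R H m M (dga_ops A) f"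
    using m2 f1 gH ainf_A by (simp add: ainf_morphism_iff ainf_algebra_iff defect_def)
  then have "minimal_model R A m f" using N2 rep by (rule minimal_modelI)
  then show ?thesis by blast
qed

end

section \<open>Maps of dg algebras as strict morphisms\<close>

locale dga_morphism = cring R + A: dga_algebra R A + B: dga_algebra R B
  for R :: "('a, 'x) ring_scheme" (structure) and A :: "('a, 'n) dga" and B :: "('a, 'k) dga" +
  fixes g :: "int \<Rightarrow> 'n \<Rightarrow> 'k"
  assumes dga_map: "dga_map R A B g"
begin

lemma linear: "linear_map R (A.M k) (B.M k) (g k)"
  and chain: "x \<in> carrier (A.M k) \<Longrightarrow> g (k + 1) (A.d k x) = B.d k (g k x)"
  and mult: "x \<in> carrier (A.M k) \<Longrightarrow> y \<in> carrier (A.M l) \<Longrightarrow> g (k + l) (A.mu k l x y) = B.mu k l (g k x) (g l y)"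
  using dga_map unfolding dga_map_def by blast+

lemma strict_long: "length w \<ge> 2 \<Longrightarrow> strict_morphism B g w = \<zero>\<^bsub>B.M (wdeg w + 1 - int (length w))\<^esub>"
  by (cases "(B, g, w)" rule: strict_morphism.cases) auto

lemma graded_maps_strict: "graded_maps R A.M B.M 1 (strict_morphism B g)"
  unfolding graded_maps_def
proof (intro conjI ballI impI allI)
  fix w assume w: "w \<in> words A.M" "w \<noteq> []"
  interpret Z: module R "B.M (wdeg w + 1 - int (length w))" by (rule B.modM)
  consider k x where "w = [(k, x)]" | "length w \<ge> 2"
    using w(2) by (cases "(B, g, w)" rule: strict_morphism.cases) auto
  then show "strict_morphism B g w \<in> carrier (B.M (wdeg w + 1 - int (length w)))"
    by cases (use w linear_mapD(1)[OF linear] in \<open>auto simp: strict_long\<close>)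
next
  fix u v k x y assume *: "u \<in> words A.M" "v \<in> words A.M" "x \<in> carrier (A.M k)" "y \<in> carrier (A.M k)"
  let ?j = "wdeg u + k + wdeg v + 1 - int (length u + 1 + length v)"
  interpret Z: module R "B.M ?j" by (rule B.modM)
  consider "u = []" "v = []" | "length u + length v \<ge> 1"
    by (cases u; cases v) auto
  then show "strict_morphism B g (u @ [(k, x \<oplus>\<^bsub>A.M k\<^esub> y)] @ v) =
      strict_morphism B g (u @ [(k, x)] @ v) \<oplus>\<^bsub>B.M ?j\<^esub> strict_morphism B g (u @ [(k, y)] @ v)"
  proof cases
    case 2
    then show ?thesis using Z.l_zero[OF Z.zero_closed] by (simp add: strict_long algebra_simps)
  qed (use * linear_mapD(2)[OF linear] in auto)
next
  fix u v k r x assume *: "u \<in> words A.M" "v \<in> words A.M" "r \<in> carrier R" "x \<in> carrier (A.M k)"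
  let ?j = "wdeg u + k + wdeg v + 1 - int (length u + 1 + length v)"
  interpret Z: module R "B.M ?j" by (rule B.modM)
  consider "u = []" "v = []" | "length u + length v \<ge> 1"
    by (cases u; cases v) auto
  then show "strict_morphism B g (u @ [(k, r \<odot>\<^bsub>A.M k\<^esub> x)] @ v) =
      r \<odot>\<^bsub>B.M ?j\<^esub> strict_morphism B g (u @ [(k, x)] @ v)"
  proof cases
    case 2
    then show ?thesis using Z.smult_r_null[OF *(3)] by (simp add: strict_long algebra_simps)
  qed (use * linear_mapD(3)[OF linear] in auto)
qed

abbreviation "G \<equiv> bop B.M 0 (strict_morphism B g)"

lemma op_G: "op (susp A.M) (susp B.M) 0 G"
  by (rule op_bop_cases(2)[OF B.gM graded_maps_strict])

lemma Nul_G_up_to: "Nul R (susp A.M) (susp B.M) (G - up_to 1 G)"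
proof (rule NulI)
  fix w assume w: "w \<in> words (susp A.M)"
  show "good (susp B.M) (app (G - up_to 1 G) w)"
    by (rule mlinD(1)[OF mlin_diff[OF opD(1)[OF op_G] mlin_up_to[OF opD(1)[OF op_G]]] w])
  show "nul R (susp B.M) (app (G - up_to 1 G) w)"
  proof (cases "length w \<le> 1")
    case False
    interpret Z: module R "B.M (wdeg w + 1)" by (rule B.modM)
    have "bfam B.M 0 (strict_morphism B g) w = \<zero>\<^bsub>susp B.M (wdeg w)\<^esub>"
      using False strict_long[of "desusp_word w"] by (simp add: bfam_def susp_def sgn_mod_def wdeg_desusp_word)
    then show ?thesis using False letter_zero[OF gmod_susp[OF B.gM], of "wdeg w"] by (auto simp: app_up_to app_fop)
  qed (simp add: app_up_to)
qed

lemma strict_small: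
  assumes w: "w \<in> words (susp A.M)" and len: "length w \<le> 2"
  shows "app (up_to 2 B.\<alpha>A \<bullet> star (up_to 1 G) - up_to 1 G \<bullet> coder (up_to 2 A.\<alpha>A)) w = 0"
proof -
  have e: "\<exists>k x. p = (k - 1, x)" for p :: "int \<times> 'n" by (metis add_diff_cancel_right' surj_pair)
  consider "w = []" | k x where "w = [(k - 1, x)]" | k x l y where "w = [(k - 1, x), (l - 1, y)]"
  proof (cases w)
    case (Cons p v)
    then show ?thesis
      using len e[of p] e[of "hd v"] that by (cases v) auto
  qed
  then show ?thesis
  proof cases
    case 1
    then show ?thesis by (simp add: app_comp app_coder_Nil lv_up_to app_up_to app_fop one_sums)
  next
    case (2 k x)
    then show ?thesis
      using w chain[of x k]
      by (simp add: app_comp app_star_one app_coder_Cons app_coder_Nil lv_up_to app_up_to app_fop bfam_one susp_def add.commute)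
  next
    case (3 k x l y)
    have xy: "x \<in> carrier (A.M k)" "y \<in> carrier (A.M l)" using w 3 by (simp_all add: susp_def)
    have b: "A.bA [(k - 1, x), (l - 1, y)] = sgn_mod (A.M (k + l)) k (A.mu k l x y)"
      "B.bA [(k - 1, g k x), (l - 1, g l y)] = sgn_mod (B.M (k + l)) k (B.mu k l (g k x) (g l y))"
      by (simp_all add: A.bA_two B.bA_two ac_simps)
    have "g (k + l) (sgn_mod (A.M (k + l)) k (A.mu k l x y)) = sgn_mod (B.M (k + l)) k (B.mu k l (g k x) (g l y))"
      using linear_map_minus[OF A.modM B.modM linear A.mu_closed[OF xy]] mult[OF xy] by (simp add: sgn_mod_def)
    then show ?thesis
      using 3 by (simp add: app_comp app_star_two app_coder_Cons app_coder_Nil lv_up_to app_up_to app_fop sum_cuts_Cons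
          frag_of_mult bfam_one b algebra_simps)
  qed
qed

text \<open>After truncation both sides vanish on words longer than two for reasons of length; on
  one and two letters the equation is compatibility with differentials and products.\<close>

lemma strict_morphism_eq: "Nul R (susp A.M) (susp B.M) (B.\<alpha>A \<bullet> star G - G \<bullet> coder A.\<alpha>A)"
proof
  fix k
  let ?P = "susp A.M" and ?Q = "susp B.M" and ?a = "up_to 2 A.\<alpha>A" and ?b = "up_to 2 B.\<alpha>A" and ?G = "up_to 1 G"
  note P = gmod_susp[OF A.gM] and lG = lv_up_to[OF opD(2)[OF op_G]]
  have m: "mlin R ?P ?P (coder ?a)" "mlin R ?Q ?Q ?b" "mlin R ?P ?Q ?G"
    using mlin_coder[OF P mlin_up_to] mlin_up_to opD(1)[OF A.op_A] opD(1)[OF B.op_A] opD(1)[OF op_G] by blast+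
  have mG: "mlin R ?P ?Q (star G)" "mlin R ?P ?Q (star ?G)"
    using mlin_star[OF opD(1)[OF op_G] lv_Nil[OF opD(2)[OF op_G]]] mlin_star[OF m(3) lv_Nil[OF lG]] .
  have "Nul R ?P ?Q (?b \<bullet> star ?G - ?G \<bullet> coder ?a)"
  proof (rule NulI)
    fix w assume w: "w \<in> words ?P"
    show "good ?Q (app (?b \<bullet> star ?G - ?G \<bullet> coder ?a) w)"
      by (rule mlinD(1)[OF mlin_diff[OF mlin_comp[OF m(2) mG(2)] mlin_comp[OF m(3,1)]] w])
    have "app (?b \<bullet> star ?G - ?G \<bullet> coder ?a) w = 0"
    proof (cases "length w \<le> 2")
      case False
      then have "app (?b \<bullet> star ?G) w = 0" "app (?G \<bullet> coder ?a) w = 0"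
        using star_up_to_one_length[OF opD(2)[OF op_G]] coder_up_to_two_length[OF opD(2)[OF A.op_A]]
        by (intro app_comp_vanish; fastforce simp: app_up_to)+
      then show ?thesis by simp
    qed (rule strict_small[OF w])
    then show "nul R ?Q (app (?b \<bullet> star ?G - ?G \<bullet> coder ?a) w)" by simp
  qed
  then have 1: "Null R ?P ?Q k (?b \<bullet> star ?G - ?G \<bullet> coder ?a)" ..
  have "coder A.\<alpha>A - coder ?a = sg ident * (A.\<alpha>A - ?a) * ident" by (simp add: coder_def algebra_simps)
  then have da: "Null R ?P ?P k (coder A.\<alpha>A - coder ?a)"
    using A.Nul_A_up_to by (simp only:) (intro Null_mult_left Null_mult_right mlin_sg mlin_ident gmodD[OF P]; blast)
  have dG: "Null R ?P ?Q k (star G - star ?G)"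
    using Nul_G_up_to by (intro Null_star_diff m(3) lG opD[OF op_G]) blast
  have "B.\<alpha>A \<bullet> star G - G \<bullet> coder A.\<alpha>A = (?b \<bullet> star ?G - ?G \<bullet> coder ?a) + (B.\<alpha>A - ?b) \<bullet> star G
      + ?b \<bullet> (star G - star ?G) - (G - ?G) \<bullet> coder A.\<alpha>A - ?G \<bullet> (coder A.\<alpha>A - coder ?a)"
    by simp
  then show "Null R ?P ?Q k (B.\<alpha>A \<bullet> star G - G \<bullet> coder A.\<alpha>A)"
    using Null_diff[OF Null_diff[OF Null_add[OF Null_add[OF 1 spec[OF Nul_comp_right[OF B.Nul_A_up_to mG(1)]]]
        Null_comp_left[OF m(2) dG]] spec[OF Nul_comp_right[OF Nul_G_up_to mlin_coder[OF P opD(1)[OF A.op_A]]]]]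
        Null_comp_left[OF m(3) da]] by metis
qed

lemma ainf_strict: "ainf_morphism R A.M (dga_ops A) B.M (dga_ops B) (strict_morphism B g)"
  using A.ainf_A B.ainf_A graded_maps_strict strict_morphism_eq by (simp add: ainf_morphism_iff)

lemma bd_map: "b \<in> A.bd k \<Longrightarrow> g k b \<in> B.bd k"
  using linear_mapD(1)[OF linear, of _ "k - 1"] chain[of _ "k - 1"] by (auto simp: A.bd_iff B.bd_iff)

lemma induced_map_cls:
  assumes x: "x \<in> carrier (A.M k)"
  shows "induced_map B.M B.d g k (A.cls k x) = B.cls k (g k x)"
proof -
  interpret Mk: module R "A.M k" by (rule A.modM)
  interpret Nk: module R "B.M k" by (rule B.modM)
  have gx: "g k x \<in> carrier (B.M k)" by (rule linear_mapD(1)[OF linear x])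
  show ?thesis
  proof (intro equalityI subsetI)
    fix z assume "z \<in> induced_map B.M B.d g k (A.cls k x)"
    then obtain b c where b: "b \<in> B.bd k" "c \<in> A.bd k" "z = b \<oplus>\<^bsub>B.M k\<^esub> g k (c \<oplus>\<^bsub>A.M k\<^esub> x)"
      by (auto simp: induced_map_def B.set_add_iff A.cls_iff)
    then have "z = (b \<oplus>\<^bsub>B.M k\<^esub> g k c) \<oplus>\<^bsub>B.M k\<^esub> g k x"
      using linear_mapD(2)[OF linear A.bd_carrier[OF b(2)] x] B.bd_carrier bd_map[OF b(2)] gx by (simp add: Nk.a_assoc)
    then show "z \<in> B.cls k (g k x)" using B.bd_add[OF b(1) bd_map[OF b(2)]] by (auto simp: B.cls_iff)
  next
    fix z assume "z \<in> B.cls k (g k x)"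
    moreover have "x \<in> A.cls k x" unfolding hclass_def by (rule abelian_subgroup.a_rcos_self[OF A.bd_subgroup x])
    ultimately show "z \<in> induced_map B.M B.d g k (A.cls k x)"
      by (force simp: induced_map_def B.set_add_iff B.cls_iff)
  qed
qed

end

lemma app_htpy_one: "lv \<eta> \<Longrightarrow> app \<phi> [] = 0 \<Longrightarrow> app \<gamma> [] = 0 \<Longrightarrow> app (htpy \<phi> \<eta> \<gamma>) [z] = app \<eta> [z]"
  by (simp add: htpy_def app_mult sum_cuts_Cons app_sg)

section \<open>Lifting maps of dg algebras to minimal models; uniqueness\<close>

locale dga_free_morphism = dga_morphism R A B g + A: dga_free R A + B: dga_free R B
  for R :: "('a, 'x) ring_scheme" (structure) and A :: "('a, 'n) dga" and B :: "('a, 'k) dga" and g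
begin

theorem morphism_lift:
  assumes mA: "minimal_model R A m f" and mB: "minimal_model R B m' f'"
  obtains h p q where "ainf_morphism R A.H m B.H m' h"
    "\<And>k X. X \<in> carrier (A.H k) \<Longrightarrow> h [(k, X)] = induced_map B.M B.d g k X"
    "ainf_composite R A.H m A.M (dga_ops A) B.M (dga_ops B) (strict_morphism B g) f p"
    "ainf_composite R A.H m B.H m' B.M (dga_ops B) f' h q"
    "ainf_homotopic R A.H m B.M (dga_ops B) p q"
proof -
  let ?S = "susp A.H" and ?P = "susp B.H" and ?Q = "susp B.M"
  note modA = A.minimal_modelD[OF mA] and modB = B.minimal_modelD[OF mB]
  have F: "op ?S (susp A.M) 0 (bop A.M 0 f)" and \<sigma>: "op ?S ?S 1 (bop A.H 1 m)"
    and F': "op ?P ?Q 0 (bop B.M 0 f')" and \<beta>: "op ?P ?P 1 (bop B.H 1 m')"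
    using op_bop_cases A.gM A.gH B.gM B.gH modA(4,5) modB(4,5) by blast+
  \<comment> \<open>The composite of operators is multilinear only modulo relations, whereas
    \<open>ainf_composite\<close> asks for graded maps; hence a representative \<open>p\<close>, and
    later \<open>q\<close> for the other composite.\<close>
  obtain p where p: "graded_maps R A.H B.M (0 + 1) p" "Nul R ?S ?Q (G \<bullet> star (bop A.M 0 f) - bop B.M 0 p)"
    using bop_surj[OF A.gH B.gM op_comp_star[OF op_G F]] .
  have compA: "ainf_composite R A.H m A.M (dga_ops A) B.M (dga_ops B) (strict_morphism B g) f p"
    using p by (intro ainf_compositeI modA(1) ainf_strict) simp_all
  then have p_mor: "ainf_morphism R A.H m B.M (dga_ops B) p" by (simp add: ainf_composite_def)
  let ?p = "bop B.M 0 p" and ?\<sigma> = "bop A.H 1 m"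
  have p1: "graded_maps R A.H B.M 1 p" using p(1) by simp
  note op_p = op_bop_cases(2)[OF B.gM p1]
  interpret L: lifting_problem R ?Q B.bA ?P "\<lambda>k. B.cls (k + 1)" ?S ?\<sigma> "bop B.H 1 m'" "bfam B.M 0 f'" ?p
    using A.freeP \<sigma> modA modB \<beta> op_p p_mor by unfold_locales (simp_all add: ainf_morphism_iff ainf_algebra_iff)
  obtain g0 h0 where gh: "fam ?S ?P 0 g0" "fam ?S ?Q (- 1) h0"
    "Nul R ?S ?P (L.mor_defect (fop 0 g0))" "Nul R ?S ?Q (L.htpy_defect (fop 0 g0) (fop (- 1) h0))"
    unfolding L.mor_defect_def L.htpy_defect_def by (rule L.lift_exists)
  note \<gamma>0 = op_fop[OF gh(1) gmod_susp[OF B.gH]] and \<eta>0 = op_fop[OF gh(2) gmod_susp[OF B.gM]]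
  obtain h where h: "graded_maps R A.H B.H (0 + 1) h" "Nul R ?S ?P (fop 0 g0 - bop B.H 0 h)"
    using bop_surj[OF A.gH B.gH \<gamma>0] .
  obtain t where t: "graded_maps R A.H B.M (- 1 + 1) t" "Nul R ?S ?Q (fop (- 1) h0 - bop B.M (- 1) t)"
    using bop_surj[OF A.gH B.gM \<eta>0] .
  let ?\<gamma> = "bop B.H 0 h" and ?\<eta> = "bop B.M (- 1) t"
  have h1: "graded_maps R A.H B.H 1 h" and t1: "graded_maps R A.H B.M 0 t" using h(1) t(1) by simp_all
  note \<gamma> = op_bop_cases(2)[OF B.gH h1] and \<eta> = op_bop_cases(3)[OF B.gM t1]
  have d\<gamma>: "Nul R ?S ?P (?\<gamma> - fop 0 g0)" and d\<eta>: "Nul R ?S ?Q (?\<eta> - fop (- 1) h0)"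
    using Null_uminus[OF spec[OF h(2)]] Null_uminus[OF spec[OF t(2)]] by simp_all
  have mor: "Null R ?S ?P k (L.mor_defect ?\<gamma>)" for k
    by (rule Null_cancel[OF Null_mono[OF L.mor_defect_change[OF \<gamma>0 \<gamma> spec[OF d\<gamma>, of k]]] spec[OF gh(3)]]) simp
  then have h_mor: "ainf_morphism R A.H m B.H m' h"
    using modA(1) modB(1) h1 by (simp add: ainf_morphism_iff L.mor_defect_def)
  have htp: "Null R ?S ?Q k (L.htpy_defect ?\<gamma> ?\<eta>)" for k
    by (rule Null_cancel[OF L.htpy_defect_change(2)[OF \<gamma>0 \<gamma> \<eta>0 \<eta> spec[OF d\<gamma>] spec[OF d\<eta>]] spec[OF gh(4)]])
  note T = L.op_through[OF \<gamma>]
  obtain q where q: "graded_maps R A.H B.M (0 + 1) q" "Nul R ?S ?Q (L.through ?\<gamma> - bop B.M 0 q)"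
    using bop_surj[OF A.gH B.gM T] .
  have compB: "ainf_composite R A.H m B.H m' B.M (dga_ops B) f' h q"
    using q by (intro ainf_compositeI modB(1) h_mor) simp_all
  then have q_mor: "ainf_morphism R A.H m B.M (dga_ops B) q" by (simp add: ainf_composite_def)
  let ?q = "bop B.M 0 q" and ?T = "L.through ?\<gamma>"
  have q1: "graded_maps R A.H B.M 1 q" using q(1) by simp
  note op_q = op_bop_cases(2)[OF B.gM q1]
  \<comment> \<open>The lifting theorem ends the homotopy at \<open>?T\<close>; moving its end to
    the representative \<open>?q\<close> changes the equation by null terms.\<close>
  have "ainf_homotopic R A.H m B.M (dga_ops B) p q"
  proof (rule ainf_homotopicI[OF p_mor q_mor t1], rule allI)
    fix k
    have "Null R ?S ?Q k (star ?T - star ?q)"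
      by (intro Null_star_diff opD[OF op_q] opD[OF T] spec[OF q(2)])
    then have "Null R ?S ?Q k (B.\<alpha>A \<bullet> (sg (star ?p) * ?\<eta> * (star ?T - star ?q)))"
      using mlin_star[OF opD(1)[OF op_p] lv_Nil[OF opD(2)[OF op_p]]]
      by (intro Null_comp_left[OF opD(1)[OF B.op_A]] Null_mult_left mlin_mult mlin_sg opD(1)[OF \<eta>])
    moreover have "?p - ?q - B.\<alpha>A \<bullet> htpy ?p ?\<eta> ?q - ?\<eta> \<bullet> coder ?\<sigma> =
        L.htpy_defect ?\<gamma> ?\<eta> + (?T - ?q) + B.\<alpha>A \<bullet> (sg (star ?p) * ?\<eta> * (star ?T - star ?q))"
      by (simp add: L.htpy_defect_def htpy_def right_diff_distrib)
    ultimately show "Null R ?S ?Q k (?p - ?q - B.\<alpha>A \<bullet> htpy ?p ?\<eta> ?q - ?\<eta> \<bullet> coder ?\<sigma>)"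
      using Null_add[OF Null_add[OF htp spec[OF q(2)]]] by metis
  qed
  \<comment> \<open>On a letter the homotopy equation says that \<open>g f\<^sub>1\<close> and
    \<open>f'\<^sub>1 h\<^sub>1\<close> differ by a boundary. As \<open>f\<close> and
    \<open>f'\<close> represent classes, \<open>h\<^sub>1\<close> is the map induced by
    \<open>g\<close>.\<close>
  moreover have "h [(k, X)] = induced_map B.M B.d g k X" if X: "X \<in> carrier (A.H k)" for k X
  proof -
    interpret Z: module R "B.M k" by (rule B.modM)
    have fX: "f [(k, X)] \<in> cycles A.M A.d k" "A.cls k (f [(k, X)]) = X"
      using modA(3) X by (simp_all add: A.representing_iff[OF modA(5)])
    then have fX': "f [(k, X)] \<in> carrier (A.M k)" by (simp add: cycles_def)
    have gfX: "g k (f [(k, X)]) \<in> carrier (B.M k)" by (rule linear_mapD(1)[OF linear fX'])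
    have hX: "h [(k, X)] \<in> carrier (B.H k)" using graded_mapsD(1)[OF h1, of "[(k, X)]"] X by simp
    have pX: "p [(k, X)] \<in> carrier (B.M k)" using graded_mapsD(1)[OF p1, of "[(k, X)]"] X by simp
    have tX: "t [(k, X)] \<in> carrier (B.M (k - 1))" using graded_mapsD(1)[OF t1, of "[(k, X)]"] X by simp
    have f'h: "f' [(k, h [(k, X)])] \<in> cycles B.M B.d k" "B.cls k (f' [(k, h [(k, X)])]) = h [(k, X)]"
      using modB(3) hX by (simp_all add: B.representing_iff[OF modB(5)])
    then have f'h': "f' [(k, h [(k, X)])] \<in> carrier (B.M k)" by (simp add: cycles_def)
    have dt: "B.d (k - 1) (t [(k, X)]) \<in> B.bd k" using tX by (auto simp: B.bd_iff)
    let ?w = "[(k - 1, X)]" and ?u = "f' [(k, h [(k, X)])]" and ?v = "B.d (k - 1) (t [(k, X)])"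
    have w: "?w \<in> words ?S" using X by (simp add: susp_def)
    have "nul R ?Q (app (G \<bullet> star (bop A.M 0 f) - ?p) ?w)" by (rule NulD[OF p(2) w])
    then have "nul R ?Q (frag_of [(k - 1, g k (f [(k, X)]))] - frag_of [(k - 1, p [(k, X)])])"
      by (simp add: app_comp app_star_one app_fop bfam_one)
    then have gf: "g k (f [(k, X)]) = p [(k, X)]"
      by (rule letter_eq[OF gmod_susp[OF B.gM], rotated 2]) (use gfX pX in \<open>simp_all add: susp_def\<close>)
    \<comment> \<open>This part of the homotopy equation disappears on letters because the source is
      minimal.\<close>
    have "Null R ?S ?Q (Suc 1) (?\<eta> \<bullet> coder ?\<sigma>)"
      by (rule Null_comp_coder_op[OF gmod_susp[OF A.gH] opD(1)[OF \<eta>] Null_lv[OF opD(1,2)[OF \<eta>]] \<sigma> modA(2)])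
    then have "Null R ?S ?Q (Suc 1) (?p - ?T - B.\<alpha>A \<bullet> htpy ?p ?\<eta> ?T)"
      using Null_add[OF htp] by (force simp: L.htpy_defect_def)
    then have "nul R ?Q (app (?p - ?T - B.\<alpha>A \<bullet> htpy ?p ?\<eta> ?T) ?w)" by (rule NullD(2)[OF _ w]) simp
    then have "nul R ?Q (frag_of [(k - 1, p [(k, X)])] - frag_of [(k - 1, ?u)] - frag_of [(k - 1, ?v)])"
      by (simp add: app_comp app_star_one app_htpy_one[OF lv_fop lv_Nil[OF opD(2)[OF op_p]] lv_Nil[OF opD(2)[OF T]]]
        app_fop bfam_one B.bA_one)
    from nul_diff[OF this letter_add[OF gmod_susp[OF B.gM], of ?u "k - 1" ?v]]
    have "nul R ?Q (frag_of [(k - 1, p [(k, X)])] - frag_of [(k - 1, ?u \<oplus>\<^bsub>B.M k\<^esub> ?v)])"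
      using f'h' B.bd_carrier[OF dt] by (simp add: susp_def)
    then have "p [(k, X)] = ?u \<oplus>\<^bsub>B.M k\<^esub> ?v"
      by (rule letter_eq[OF gmod_susp[OF B.gM], rotated 2]) (use pX f'h' B.bd_carrier[OF dt] in \<open>simp_all add: susp_def\<close>)
    then have "p [(k, X)] = ?v \<oplus>\<^bsub>B.M k\<^esub> ?u" using Z.a_comm[OF f'h' B.bd_carrier[OF dt]] by simp
    then have "B.cls k (p [(k, X)]) = B.cls k ?u" using B.cls_eq_iff[OF pX f'h'] dt by blast
    then show ?thesis using f'h(2) gf induced_map_cls[OF fX'] fX(2) by simp
  qed
  ultimately show ?thesis using that h_mor compA compB by blast
qed

end

context dga_free
begin

theorem minimal_model_unique:
  assumes mm: "minimal_model R A m f" "minimal_model R A m' f'"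
  obtains h where "ainf_isomorphism R H m H m' h" "\<And>k X. X \<in> carrier (H k) \<Longrightarrow> h [(k, X)] = X"
proof -
  \<comment> \<open>The identity is a map of dg algebras; its lift between the two models induces
    the identity in homology, so it is the identity on letters and hence invertible.\<close>
  interpret I: dga_free_morphism R A A "\<lambda>k x. x"
    by unfold_locales (simp add: dga_map_def linear_map_def)
  obtain h where h: "ainf_morphism R H m H m' h"
    "\<And>k X. X \<in> carrier (H k) \<Longrightarrow> h [(k, X)] = induced_map M d (\<lambda>k x. x) k X"
    using I.morphism_lift[OF mm] by metis
  have h_id: "h [(k, X)] = X" if X: "X \<in> carrier (H k)" for k X
  proof -
    obtain x where x: "x \<in> carrier (M k)" "X = cls k x" using X by (auto simp: H_simps cycles_iff)
    then show ?thesis using h(2)[OF X] I.induced_map_cls[OF x(1)] by simp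
  qed
  have h1: "graded_maps R H H 1 h" using h(1) by (simp add: ainf_morphism_iff)
  note P = gmod_susp[OF gH]
  have "Null R (susp H) (susp H) 2 (bop H 0 h - pr)"
    unfolding Null_def
  proof (intro ballI conjI impI)
    fix w assume w: "w \<in> words (susp H)"
    show "good (susp H) (app (bop H 0 h - pr) w)"
      by (rule mlinD(1)[OF mlin_diff[OF opD(1)[OF op_bop_cases(2)[OF gH h1]] mlin_pr[OF P]] w])
    assume "length w < 2"
    then consider "w = []" | k X where "w = [(k, X)]" by (cases w) auto
    then show "nul R (susp H) (app (bop H 0 h - pr) w)"
      by cases (use w h_id in \<open>simp_all add: app_fop app_pr bfam_one susp_def\<close>)
  qed
  then have "ainf_isomorphism R H m H m' h" by (rule ainf_isomorphismI[OF h(1)])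
  then show ?thesis using h_id by (rule that)
qed

end

theorem theorem11:
  fixes R :: "('r, 'x) ring_scheme" and A :: "('r, 'a) dga"
  assumes "cring R"
    and "dg_algebra R A"
    and "\<forall>i. free_module R (dga_homology A i)"
  shows
    "(\<exists>m f. minimal_model R A m f) \<and>
     (\<forall>(A' :: ('r, 'b) dga) g m f m' f'.
        dg_algebra R A' \<and> (\<forall>i. free_module R (dga_homology A' i)) \<and> dga_map R A A' g \<and>
        minimal_model R A m f \<and> minimal_model R A' m' f' \<longrightarrow>
        (\<exists>h p q.
           ainf_morphism R (dga_homology A) m (dga_homology A') m' h \<and>
           (\<forall>k. \<forall>X\<in>carrier (dga_homology A k).
              h [(k, X)] = induced_map (dg_mod A') (dg_diff A') g k X) \<and>
           ainf_composite R (dga_homology A) m (dg_mod A) (dga_ops A) (dg_mod A') (dga_ops A')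
             (strict_morphism A' g) f p \<and>
           ainf_composite R (dga_homology A) m (dga_homology A') m' (dg_mod A') (dga_ops A')
             f' h q \<and>
           ainf_homotopic R (dga_homology A) m (dg_mod A') (dga_ops A') p q)) \<and>
     (\<forall>m m'.
        (\<exists>f. minimal_model R A m f) \<and> (\<exists>f'. minimal_model R A m' f') \<longrightarrow>
        (\<exists>h. ainf_isomorphism R (dga_homology A) m (dga_homology A) m' h \<and>
           (\<forall>k. \<forall>X\<in>carrier (dga_homology A k). h [(k, X)] = X)))"
proof (intro conjI allI impI, goal_cases)
  interpret dga_free R A
    using assms by (simp add: dga_free_def dga_free_axioms_def dga_algebra_def dga_algebra_axioms_def)
  {
    case 1
    show ?case by (rule minimal_model_exists)
  next
    case (2 A' g m f m' f')
    then interpret I: dga_free_morphism R A A' g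
      using assms(1) by unfold_locales (auto simp: cring_def)
    show ?case using I.morphism_lift[of m f m' f'] 2 by metis
  next
    case (3 m m')
    then show ?case using minimal_model_unique by metis
  }
qed

end
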